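(* Let $C$ be a distributive category. Let $C_b^{\mathbb{Z}}$ be the category whose objects are maps $f:\mathbb{Z}\to \mathrm{Ob}(C)$ such that there exists $k\le 0$ with $f(n)\simeq 0$ for all $n<k$, and whose morphisms are $C_b^{\mathbb{Z}}(f,g)=\prod_{n\in\mathbb{Z}}C(f(n),g(n))$, with $$(f\oplus g)(n)=f(n)\oplus g(n),\qquad (f\otimes g)(n)=\bigoplus_{k+l=n}f(k)\otimes g(l),\qquad (-f)(n)=-f(n)$$ (the last one when $C$ has negative objects). The category $C_b^{\mathbb{Z}}$ together with the functor $P:C_b^{\mathbb{Z}}\to C_b^{\mathbb{Z}}$ given by $P(f)=f_{<0}$, where $f_{<0}(n)=0$ if $n\ge 0$ and $f_{<0}(n)=f(n)$ if $n<0$, is a Rota-Baxter category of weight $-1$. If $C$ is a categorification of a ring $R$, then $C_b^{\mathbb{Z}}$ is a categorification of the ring $R[z^{-1},z]]$ of formal Laurent series.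
   Context: A distributive category is a category $C$ with functors $\oplus,\otimes:C\times C\to C$ and objects $0,1$ such that $(C,\oplus,0)$ is symmetric monoidal with unit $0$, $(C,\otimes,1)$ is monoidal with unit $1$, and there are natural isomorphisms $x\otimes(y\oplus z)\simeq(x\otimes y)\oplus(x\otimes z)$ and $(x\oplus y)\otimes z\simeq(x\otimes z)\oplus(y\otimes z)$. It has negative objects if it comes with a functor $-:C\to C$ and natural isomorphisms $-(x\oplus y)\simeq -x\oplus -y$, $-0\simeq 0$, $-(-x)\simeq x$. A functor $P:C\to C$ is additive if there are natural isomorphisms $P(x\oplus y)\simeq P(x)\oplus P(y)$ (and $P(-x)\simeq -P(x)$ if $C$ has a negative functor). A Rota-Baxter category of weight $-1$ is a distributive category $C$ with an additive functor $P:C\to C$ and natural isomorphisms $P(x)\otimes P(y)\oplus P(x\otimes y)\simeq P(P(x)\otimes y)\oplus P(x\otimes P(y))$. A categorification of a ring $R$ is a distributive category $C$ with negative functor together with a valuation map $|\ |:\mathrm{Ob}(C)\to R$ such that $|x|=|y|$ if $x\simeq y$, $|x\oplus y|=|x|+|y|$, $|x\otimes y|=|x||y|$, $|1|=1$, $|0|=0$, $|-x|=-|x|$. $R[z^{-1},z]]$ is the ring of formal series $\sum_{n\in\mathbb{Z}}a_nz^n$, $a_n\in R$, with only finitely many nonzero coefficients of negative index. In the formula for $(f\otimes g)(n)$, the indices $k,l$ are integers; for given $n$ only finitely many pairs $(k,l)$ have both $f(k)\not\simeq 0$ and $g(l)\not\simeq 0$, and the sum is read as the sum over these pairs.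
   Formalization: Distributive categories, both C and C_b^Z, are also required to have isomorphisms 0⊗x≃0≃x⊗0 and Laplaza's coherence conditions for the distributivity isomorphisms; in C, moreover, 0 has only the identity endomorphism; without such conditions the product on C_b^Z can lack a unit. *)

theory Defs
  imports "HOL-Computational_Algebra.Formal_Laurent_Series"
begin

section \<open>Categories, functors, natural isomorphisms\<close>

record ('o, 'm) cat =
  Obj :: "'o set"
  Arr :: "'m set"
  Dom :: "'m \<Rightarrow> 'o"
  Cod :: "'m \<Rightarrow> 'o"
  Id :: "'o \<Rightarrow> 'm"
  Comp :: "'m \<Rightarrow> 'm \<Rightarrow> 'm"  (infixr \<open>\<cdot>\<index>\<close> 55)

definition hom :: "('o, 'm, 'x) cat_scheme \<Rightarrow> 'o \<Rightarrow> 'o \<Rightarrow> 'm set" where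
  "hom C x y = {f \<in> Arr C. Dom C f = x \<and> Cod C f = y}"

locale category =
  fixes C :: "('o, 'm, 'x) cat_scheme" (structure)
  assumes Dom_in_Obj: "f \<in> Arr C \<Longrightarrow> Dom C f \<in> Obj C"
    and Cod_in_Obj: "f \<in> Arr C \<Longrightarrow> Cod C f \<in> Obj C"
    and Id_in_hom: "x \<in> Obj C \<Longrightarrow> Id C x \<in> hom C x x"
    and Comp_in_hom: "f \<in> hom C x y \<Longrightarrow> g \<in> hom C y z \<Longrightarrow> g \<cdot> f \<in> hom C x z"
    and Comp_Id: "f \<in> hom C x y \<Longrightarrow> f \<cdot> Id C x = f"
    and Id_Comp: "f \<in> hom C x y \<Longrightarrow> Id C y \<cdot> f = f"
    and Comp_assoc:
      "f \<in> hom C x y \<Longrightarrow> g \<in> hom C y z \<Longrightarrow> h \<in> hom C z w \<Longrightarrow> (h \<cdot> g) \<cdot> f = h \<cdot> (g \<cdot> f)"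

definition invertible :: "('o, 'm, 'x) cat_scheme \<Rightarrow> 'm \<Rightarrow> bool" where
  "invertible C f \<longleftrightarrow>
    (\<exists>g \<in> hom C (Cod C f) (Dom C f).
      Comp C g f = Id C (Dom C f) \<and> Comp C f g = Id C (Cod C f))"

definition isomorphic :: "('o, 'm, 'x) cat_scheme \<Rightarrow> 'o \<Rightarrow> 'o \<Rightarrow> bool" where
  "isomorphic C x y \<longleftrightarrow> (\<exists>f \<in> hom C x y. invertible C f)"

definition prod_cat ::
  "('o, 'm, 'x) cat_scheme \<Rightarrow> ('p, 'n, 'y) cat_scheme \<Rightarrow> ('o \<times> 'p, 'm \<times> 'n) cat" where
  "prod_cat C D =
    \<lparr>Obj = Obj C \<times> Obj D, Arr = Arr C \<times> Arr D,
     Dom = (\<lambda>(f, g). (Dom C f, Dom D g)), Cod = (\<lambda>(f, g). (Cod C f, Cod D g)),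
     Id = (\<lambda>(x, y). (Id C x, Id D y)),
     Comp = (\<lambda>(g, g') (f, f'). (Comp C g f, Comp D g' f'))\<rparr>"

abbreviation pow2 :: "('o, 'm, 'x) cat_scheme \<Rightarrow> ('o \<times> 'o, 'm \<times> 'm) cat" where
  "pow2 C \<equiv> prod_cat C C"

abbreviation pow3 :: "('o, 'm, 'x) cat_scheme \<Rightarrow> ('o \<times> 'o \<times> 'o, 'm \<times> 'm \<times> 'm) cat" where
  "pow3 C \<equiv> prod_cat C (prod_cat C C)"

datatype ('o, 'm, 'p, 'n) ftor = Ftor (obj_map: "'o \<Rightarrow> 'p") (arr_map: "'m \<Rightarrow> 'n")

definition is_functor ::
  "('o, 'm, 'x) cat_scheme \<Rightarrow> ('p, 'n, 'y) cat_scheme \<Rightarrow> ('o, 'm, 'p, 'n) ftor \<Rightarrow> bool" where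
  "is_functor C D F \<longleftrightarrow>
    (\<forall>x \<in> Obj C. obj_map F x \<in> Obj D) \<and>
    (\<forall>f \<in> Arr C. arr_map F f \<in> hom D (obj_map F (Dom C f)) (obj_map F (Cod C f))) \<and>
    (\<forall>x \<in> Obj C. arr_map F (Id C x) = Id D (obj_map F x)) \<and>
    (\<forall>f \<in> Arr C. \<forall>g \<in> Arr C. Cod C f = Dom C g \<longrightarrow>
      arr_map F (Comp C g f) = Comp D (arr_map F g) (arr_map F f))"

definition natural_iso ::
  "('o, 'm, 'x) cat_scheme \<Rightarrow> ('p, 'n, 'y) cat_scheme \<Rightarrow>
   ('o, 'm, 'p, 'n) ftor \<Rightarrow> ('o, 'm, 'p, 'n) ftor \<Rightarrow> ('o \<Rightarrow> 'n) \<Rightarrow> bool" where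
  "natural_iso C D F G t \<longleftrightarrow>
    (\<forall>x \<in> Obj C. t x \<in> hom D (obj_map F x) (obj_map G x) \<and> invertible D (t x)) \<and>
    (\<forall>f \<in> Arr C.
      Comp D (t (Cod C f)) (arr_map F f) = Comp D (arr_map G f) (t (Dom C f)))"

definition naturally_isomorphic ::
  "('o, 'm, 'x) cat_scheme \<Rightarrow> ('p, 'n, 'y) cat_scheme \<Rightarrow>
   ('o, 'm, 'p, 'n) ftor \<Rightarrow> ('o, 'm, 'p, 'n) ftor \<Rightarrow> bool" where
  "naturally_isomorphic C D F G \<longleftrightarrow> (\<exists>t. natural_iso C D F G t)"

abbreviation id_ftor :: "('o, 'm, 'o, 'm) ftor" where
  "id_ftor \<equiv> Ftor (\<lambda>x. x) (\<lambda>f. f)"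


section \<open>Monoidal and symmetric monoidal categories\<close>

abbreviation ten ::
  "'o \<Rightarrow> ('o \<times> 'o, 'm \<times> 'm, 'o, 'm) ftor \<Rightarrow> 'o \<Rightarrow> 'o"
  (\<open>(_ \<odot>\<^bsub>_\<^esub> _)\<close> [66, 0, 66] 65) where
  "x \<odot>\<^bsub>T\<^esub> y \<equiv> obj_map T (x, y)"

abbreviation arr_ten ::
  "'m \<Rightarrow> ('o \<times> 'o, 'm \<times> 'm, 'o, 'm) ftor \<Rightarrow> 'm \<Rightarrow> 'm"
  (\<open>(_ \<boxdot>\<^bsub>_\<^esub> _)\<close> [66, 0, 66] 65) where
  "f \<boxdot>\<^bsub>T\<^esub> g \<equiv> arr_map T (f, g)"

locale monoidal = category C
  for C :: "('o, 'm, 'x) cat_scheme" (structure) +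
  fixes T :: "('o \<times> 'o, 'm \<times> 'm, 'o, 'm) ftor"
    and I :: 'o
    and a :: "'o \<times> 'o \<times> 'o \<Rightarrow> 'm"
    and l r :: "'o \<Rightarrow> 'm"
  assumes T_functor: "is_functor (pow2 C) C T"
    and I_Obj: "I \<in> Obj C"
    and a_natural: "natural_iso (pow3 C) C
        (Ftor (\<lambda>(x, y, z). (x \<odot>\<^bsub>T\<^esub> y) \<odot>\<^bsub>T\<^esub> z) (\<lambda>(f, g, h). (f \<boxdot>\<^bsub>T\<^esub> g) \<boxdot>\<^bsub>T\<^esub> h))
        (Ftor (\<lambda>(x, y, z). x \<odot>\<^bsub>T\<^esub> (y \<odot>\<^bsub>T\<^esub> z)) (\<lambda>(f, g, h). f \<boxdot>\<^bsub>T\<^esub> (g \<boxdot>\<^bsub>T\<^esub> h))) a"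
    and l_natural: "natural_iso C C
        (Ftor (\<lambda>x. I \<odot>\<^bsub>T\<^esub> x) (\<lambda>f. Id C I \<boxdot>\<^bsub>T\<^esub> f)) id_ftor l"
    and r_natural: "natural_iso C C
        (Ftor (\<lambda>x. x \<odot>\<^bsub>T\<^esub> I) (\<lambda>f. f \<boxdot>\<^bsub>T\<^esub> Id C I)) id_ftor r"
    and pentagon: "\<lbrakk>x \<in> Obj C; y \<in> Obj C; z \<in> Obj C; w \<in> Obj C\<rbrakk> \<Longrightarrow>
        a (x, y, z \<odot>\<^bsub>T\<^esub> w) \<cdot> a (x \<odot>\<^bsub>T\<^esub> y, z, w)
        = (Id C x \<boxdot>\<^bsub>T\<^esub> a (y, z, w)) \<cdot> a (x, y \<odot>\<^bsub>T\<^esub> z, w) \<cdot> (a (x, y, z) \<boxdot>\<^bsub>T\<^esub> Id C w)"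
    and triangle: "\<lbrakk>x \<in> Obj C; y \<in> Obj C\<rbrakk> \<Longrightarrow>
        (Id C x \<boxdot>\<^bsub>T\<^esub> l y) \<cdot> a (x, I, y) = r x \<boxdot>\<^bsub>T\<^esub> Id C y"

locale symmetric_monoidal = monoidal C T I a l r
  for C :: "('o, 'm, 'x) cat_scheme" (structure) and T I a l r +
  fixes s :: "'o \<times> 'o \<Rightarrow> 'm"
  assumes s_natural: "natural_iso (pow2 C) C
        (Ftor (\<lambda>(x, y). x \<odot>\<^bsub>T\<^esub> y) (\<lambda>(f, g). f \<boxdot>\<^bsub>T\<^esub> g))
        (Ftor (\<lambda>(x, y). y \<odot>\<^bsub>T\<^esub> x) (\<lambda>(f, g). g \<boxdot>\<^bsub>T\<^esub> f)) s"
    and s_involutive: "\<lbrakk>x \<in> Obj C; y \<in> Obj C\<rbrakk> \<Longrightarrow> s (y, x) \<cdot> s (x, y) = Id C (x \<odot>\<^bsub>T\<^esub> y)"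
    and hexagon: "\<lbrakk>x \<in> Obj C; y \<in> Obj C; z \<in> Obj C\<rbrakk> \<Longrightarrow>
        a (y, z, x) \<cdot> s (x, y \<odot>\<^bsub>T\<^esub> z) \<cdot> a (x, y, z)
        = (Id C y \<boxdot>\<^bsub>T\<^esub> s (x, z)) \<cdot> a (y, x, z) \<cdot> (s (x, y) \<boxdot>\<^bsub>T\<^esub> Id C z)"


section \<open>Distributive categories\<close>

record ('o, 'm) rig_cat = "('o, 'm) cat" +
  Plus :: "('o \<times> 'o, 'm \<times> 'm, 'o, 'm) ftor"
  Times :: "('o \<times> 'o, 'm \<times> 'm, 'o, 'm) ftor"
  Zero :: 'o  (\<open>\<zero>\<index>\<close>)
  One :: 'o  (\<open>\<one>\<index>\<close>)

abbreviation osum :: "('o, 'm) rig_cat \<Rightarrow> 'o \<Rightarrow> 'o \<Rightarrow> 'o"  (infixl \<open>\<oplus>\<index>\<close> 65) where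
  "osum C x y \<equiv> obj_map (Plus C) (x, y)"

abbreviation asum :: "('o, 'm) rig_cat \<Rightarrow> 'm \<Rightarrow> 'm \<Rightarrow> 'm"  (infixl \<open>\<boxplus>\<index>\<close> 65) where
  "asum C f g \<equiv> arr_map (Plus C) (f, g)"

abbreviation oprod :: "('o, 'm) rig_cat \<Rightarrow> 'o \<Rightarrow> 'o \<Rightarrow> 'o"  (infixl \<open>\<otimes>\<index>\<close> 70) where
  "oprod C x y \<equiv> obj_map (Times C) (x, y)"

abbreviation aprod :: "('o, 'm) rig_cat \<Rightarrow> 'm \<Rightarrow> 'm \<Rightarrow> 'm"  (infixl \<open>\<boxtimes>\<index>\<close> 70) where
  "aprod C f g \<equiv> arr_map (Times C) (f, g)"

locale distributive_data = category C
  for C :: "('o, 'm) rig_cat" (structure) +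
  fixes a :: "'o \<times> 'o \<times> 'o \<Rightarrow> 'm" and l r :: "'o \<Rightarrow> 'm" and s :: "'o \<times> 'o \<Rightarrow> 'm"
    and m :: "'o \<times> 'o \<times> 'o \<Rightarrow> 'm" and lm rm :: "'o \<Rightarrow> 'm"
    and dl dr :: "'o \<times> 'o \<times> 'o \<Rightarrow> 'm"
  assumes plus_symmetric_monoidal: "symmetric_monoidal C (Plus C) \<zero> a l r s"
    and times_monoidal: "monoidal C (Times C) \<one> m lm rm"
    and dl_natural: "natural_iso (pow3 C) C
        (Ftor (\<lambda>(x, y, z). x \<otimes> (y \<oplus> z)) (\<lambda>(f, g, h). f \<boxtimes> (g \<boxplus> h)))
        (Ftor (\<lambda>(x, y, z). (x \<otimes> y) \<oplus> (x \<otimes> z)) (\<lambda>(f, g, h). (f \<boxtimes> g) \<boxplus> (f \<boxtimes> h))) dl"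
    and dr_natural: "natural_iso (pow3 C) C
        (Ftor (\<lambda>(x, y, z). (x \<oplus> y) \<otimes> z) (\<lambda>(f, g, h). (f \<boxplus> g) \<boxtimes> h))
        (Ftor (\<lambda>(x, y, z). (x \<otimes> z) \<oplus> (y \<otimes> z)) (\<lambda>(f, g, h). (f \<boxtimes> h) \<boxplus> (g \<boxtimes> h))) dr"

text \<open>
  The nullary distributors \<open>0 \<otimes> x \<simeq> 0 \<simeq> x \<otimes> 0\<close> and the coherence conditions of
  M. L. Laplaza, Coherence for distributivity (Lecture Notes in Math. 281, 1972), without the
  two that involve a symmetry of \<open>\<otimes>\<close>. The roman numerals are Laplaza's.

  The absorption isomorphisms are what makes the sum in \<open>(f \<otimes> g)(n)\<close>, which is restricted to the
  pairs of nonzero objects, independent of the omitted pairs, and the coherence conditions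
  relate the two bracketings of a threefold or fourfold product of such sums. If \<open>\<oplus>\<close> and
  \<open>\<otimes>\<close> are both the join of a four-element Boolean lattice (a discrete category, with
  \<open>0 = 1\<close>), then all of \<open>distributive_data\<close> holds, but \<open>x \<otimes> 0 = x\<close>, and the product of
  \<open>C_b^Z\<close> has no unit: the coefficient of a unit in degree \<open>0\<close> would be a nonzero element below
  both atoms.

  In condition IX the middle four interchange, which exchanges the two inner summands, is
  written with the symmetry \<open>q \<oplus> (p \<oplus> t) \<rightarrow> (p \<oplus> t) \<oplus> q\<close>, which avoids inverses.
\<close>

locale laplaza = distributive_data C a l r s m lm rm dl dr
  for C :: "('o, 'm) rig_cat" (structure) and a l r s m lm rm dl dr +
  fixes nl nr :: "'o \<Rightarrow> 'm"
  assumes nl_natural: "natural_iso C C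
        (Ftor (\<lambda>x. \<zero> \<otimes> x) (\<lambda>f. Id C \<zero> \<boxtimes> f)) (Ftor (\<lambda>x. \<zero>) (\<lambda>f. Id C \<zero>)) nl"
    and nr_natural: "natural_iso C C
        (Ftor (\<lambda>x. x \<otimes> \<zero>) (\<lambda>f. f \<boxtimes> Id C \<zero>)) (Ftor (\<lambda>x. \<zero>) (\<lambda>f. Id C \<zero>)) nr"
    and I: "\<lbrakk>x \<in> Obj C; y \<in> Obj C; z \<in> Obj C\<rbrakk> \<Longrightarrow>
        s (x \<otimes> y, x \<otimes> z) \<cdot> dl (x, y, z) = dl (x, z, y) \<cdot> (Id C x \<boxtimes> s (y, z))"
    and III: "\<lbrakk>x \<in> Obj C; y \<in> Obj C; z \<in> Obj C\<rbrakk> \<Longrightarrow>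
        s (x \<otimes> z, y \<otimes> z) \<cdot> dr (x, y, z) = dr (y, x, z) \<cdot> (s (x, y) \<boxtimes> Id C z)"
    and IV: "\<lbrakk>x \<in> Obj C; y \<in> Obj C; z \<in> Obj C; w \<in> Obj C\<rbrakk> \<Longrightarrow>
        a (x \<otimes> w, y \<otimes> w, z \<otimes> w) \<cdot> (dr (x, y, w) \<boxplus> Id C (z \<otimes> w)) \<cdot> dr (x \<oplus> y, z, w)
        = (Id C (x \<otimes> w) \<boxplus> dr (y, z, w)) \<cdot> dr (x, y \<oplus> z, w) \<cdot> (a (x, y, z) \<boxtimes> Id C w)"
    and V: "\<lbrakk>x \<in> Obj C; y \<in> Obj C; z \<in> Obj C; w \<in> Obj C\<rbrakk> \<Longrightarrow>
        a (x \<otimes> y, x \<otimes> z, x \<otimes> w) \<cdot> (dl (x, y, z) \<boxplus> Id C (x \<otimes> w)) \<cdot> dl (x, y \<oplus> z, w)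
        = (Id C (x \<otimes> y) \<boxplus> dl (x, z, w)) \<cdot> dl (x, y, z \<oplus> w) \<cdot> (Id C x \<boxtimes> a (y, z, w))"
    and VI: "\<lbrakk>x \<in> Obj C; y \<in> Obj C; z \<in> Obj C; w \<in> Obj C\<rbrakk> \<Longrightarrow>
        (m (x, y, z) \<boxplus> m (x, y, w)) \<cdot> dl (x \<otimes> y, z, w)
        = dl (x, y \<otimes> z, y \<otimes> w) \<cdot> (Id C x \<boxtimes> dl (y, z, w)) \<cdot> m (x, y, z \<oplus> w)"
    and VII: "\<lbrakk>x \<in> Obj C; y \<in> Obj C; z \<in> Obj C; w \<in> Obj C\<rbrakk> \<Longrightarrow>
        dr (x, y, z \<otimes> w) \<cdot> m (x \<oplus> y, z, w)
        = (m (x, z, w) \<boxplus> m (y, z, w)) \<cdot> dr (x \<otimes> z, y \<otimes> z, w) \<cdot> (dr (x, y, z) \<boxtimes> Id C w)"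
    and VIII: "\<lbrakk>x \<in> Obj C; y \<in> Obj C; z \<in> Obj C; w \<in> Obj C\<rbrakk> \<Longrightarrow>
        dl (x, y \<otimes> w, z \<otimes> w) \<cdot> (Id C x \<boxtimes> dr (y, z, w)) \<cdot> m (x, y \<oplus> z, w)
        = (m (x, y, w) \<boxplus> m (x, z, w)) \<cdot> dr (x \<otimes> y, x \<otimes> z, w) \<cdot> (dl (x, y, z) \<boxtimes> Id C w)"
    and IX: "\<lbrakk>x \<in> Obj C; y \<in> Obj C; z \<in> Obj C; w \<in> Obj C;
          q = y \<otimes> z; p = x \<otimes> w; t = y \<otimes> w;
          swap = (Id C p \<boxplus> s (t, q)) \<cdot> a (p, t, q) \<cdot> s (q, p \<oplus> t)\<rbrakk> \<Longrightarrow>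
        (Id C (x \<otimes> z) \<boxplus> swap) \<cdot> a (x \<otimes> z, q, p \<oplus> t)
          \<cdot> (dr (x, y, z) \<boxplus> dr (x, y, w)) \<cdot> dl (x \<oplus> y, z, w)
        = a (x \<otimes> z, p, q \<oplus> t) \<cdot> (dl (x, z, w) \<boxplus> dl (y, z, w)) \<cdot> dr (x, y, z \<oplus> w)"
    and X: "nl \<zero> = nr \<zero>"
    and XI: "\<lbrakk>x \<in> Obj C; y \<in> Obj C\<rbrakk> \<Longrightarrow>
        l \<zero> \<cdot> (nl x \<boxplus> nl y) \<cdot> dl (\<zero>, x, y) = nl (x \<oplus> y)"
    and XII: "\<lbrakk>x \<in> Obj C; y \<in> Obj C\<rbrakk> \<Longrightarrow>
        l \<zero> \<cdot> (nr x \<boxplus> nr y) \<cdot> dr (x, y, \<zero>) = nr (x \<oplus> y)"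
    and XIII: "nl \<one> = rm \<zero>"
    and XIV: "nr \<one> = lm \<zero>"
    and XVI: "\<lbrakk>x \<in> Obj C; y \<in> Obj C\<rbrakk> \<Longrightarrow>
        nl (x \<otimes> y) \<cdot> m (\<zero>, x, y) = nl y \<cdot> (nl x \<boxtimes> Id C y)"
    and XVII: "\<lbrakk>x \<in> Obj C; y \<in> Obj C\<rbrakk> \<Longrightarrow>
        nr x \<cdot> (Id C x \<boxtimes> nl y) \<cdot> m (x, \<zero>, y) = nl y \<cdot> (nr x \<boxtimes> Id C y)"
    and XVIII: "\<lbrakk>x \<in> Obj C; y \<in> Obj C\<rbrakk> \<Longrightarrow>
        nr x \<cdot> (Id C x \<boxtimes> nr y) \<cdot> m (x, y, \<zero>) = nr (x \<otimes> y)"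
    and XIX: "\<lbrakk>x \<in> Obj C; y \<in> Obj C\<rbrakk> \<Longrightarrow>
        l (x \<otimes> y) \<cdot> (nr x \<boxplus> Id C (x \<otimes> y)) \<cdot> dl (x, \<zero>, y) = Id C x \<boxtimes> l y"
    and XX: "\<lbrakk>x \<in> Obj C; y \<in> Obj C\<rbrakk> \<Longrightarrow>
        l (x \<otimes> y) \<cdot> (nl y \<boxplus> Id C (x \<otimes> y)) \<cdot> dr (\<zero>, x, y) = l x \<boxtimes> Id C y"
    and XXI: "\<lbrakk>x \<in> Obj C; y \<in> Obj C\<rbrakk> \<Longrightarrow>
        r (x \<otimes> y) \<cdot> (Id C (x \<otimes> y) \<boxplus> nr x) \<cdot> dl (x, y, \<zero>) = Id C x \<boxtimes> r y"
    and XXII: "\<lbrakk>x \<in> Obj C; y \<in> Obj C\<rbrakk> \<Longrightarrow>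
        r (x \<otimes> y) \<cdot> (Id C (x \<otimes> y) \<boxplus> nl y) \<cdot> dr (x, \<zero>, y) = r x \<boxtimes> Id C y"
    and XXIII: "\<lbrakk>x \<in> Obj C; y \<in> Obj C\<rbrakk> \<Longrightarrow>
        (lm x \<boxplus> lm y) \<cdot> dl (\<one>, x, y) = lm (x \<oplus> y)"
    and XXIV: "\<lbrakk>x \<in> Obj C; y \<in> Obj C\<rbrakk> \<Longrightarrow>
        (rm x \<boxplus> rm y) \<cdot> dr (x, y, \<one>) = rm (x \<oplus> y)"

definition distributive_category :: "('o, 'm) rig_cat \<Rightarrow> bool" where
  "distributive_category C \<longleftrightarrow>
    (\<exists>a l r s m lm rm dl dr nl nr. laplaza C a l r s m lm rm dl dr nl nr)"

definition negative_functor :: "('o, 'm) rig_cat \<Rightarrow> ('o, 'm, 'o, 'm) ftor \<Rightarrow> bool" where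
  "negative_functor C N \<longleftrightarrow>
    is_functor C C N \<and>
    naturally_isomorphic (pow2 C) C
      (Ftor (\<lambda>(x, y). obj_map N (x \<oplus>\<^bsub>C\<^esub> y)) (\<lambda>(f, g). arr_map N (f \<boxplus>\<^bsub>C\<^esub> g)))
      (Ftor (\<lambda>(x, y). obj_map N x \<oplus>\<^bsub>C\<^esub> obj_map N y)
            (\<lambda>(f, g). arr_map N f \<boxplus>\<^bsub>C\<^esub> arr_map N g)) \<and>
    isomorphic C (obj_map N \<zero>\<^bsub>C\<^esub>) \<zero>\<^bsub>C\<^esub> \<and>
    naturally_isomorphic C C
      (Ftor (\<lambda>x. obj_map N (obj_map N x)) (\<lambda>f. arr_map N (arr_map N f))) id_ftor"


section \<open>Rota-Baxter categories and categorifications\<close>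

text \<open>The negative functor is optional: \<open>None\<close> if \<open>C\<close> is not equipped with one.\<close>

definition additive ::
  "('o, 'm) rig_cat \<Rightarrow> ('o, 'm, 'o, 'm) ftor option \<Rightarrow> ('o, 'm, 'o, 'm) ftor \<Rightarrow> bool" where
  "additive C N P \<longleftrightarrow>
    is_functor C C P \<and>
    naturally_isomorphic (pow2 C) C
      (Ftor (\<lambda>(x, y). obj_map P (x \<oplus>\<^bsub>C\<^esub> y)) (\<lambda>(f, g). arr_map P (f \<boxplus>\<^bsub>C\<^esub> g)))
      (Ftor (\<lambda>(x, y). obj_map P x \<oplus>\<^bsub>C\<^esub> obj_map P y)
            (\<lambda>(f, g). arr_map P f \<boxplus>\<^bsub>C\<^esub> arr_map P g)) \<and>
    (case N of None \<Rightarrow> True | Some M \<Rightarrow>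
      naturally_isomorphic C C
        (Ftor (\<lambda>x. obj_map P (obj_map M x)) (\<lambda>f. arr_map P (arr_map M f)))
        (Ftor (\<lambda>x. obj_map M (obj_map P x)) (\<lambda>f. arr_map M (arr_map P f))))"

text \<open>Weight \<open>-1\<close>: \<open>P(x) \<otimes> P(y) \<oplus> P(x \<otimes> y) \<simeq> P(P(x) \<otimes> y) \<oplus> P(x \<otimes> P(y))\<close>.\<close>

definition rota_baxter_category ::
  "('o, 'm) rig_cat \<Rightarrow> ('o, 'm, 'o, 'm) ftor option \<Rightarrow> ('o, 'm, 'o, 'm) ftor \<Rightarrow> bool" where
  "rota_baxter_category C N P \<longleftrightarrow>
    distributive_category C \<and>
    (case N of None \<Rightarrow> True | Some M \<Rightarrow> negative_functor C M) \<and>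
    additive C N P \<and>
    naturally_isomorphic (pow2 C) C
      (Ftor (\<lambda>(x, y). (obj_map P x \<otimes>\<^bsub>C\<^esub> obj_map P y) \<oplus>\<^bsub>C\<^esub> obj_map P (x \<otimes>\<^bsub>C\<^esub> y))
            (\<lambda>(f, g). (arr_map P f \<boxtimes>\<^bsub>C\<^esub> arr_map P g) \<boxplus>\<^bsub>C\<^esub> arr_map P (f \<boxtimes>\<^bsub>C\<^esub> g)))
      (Ftor (\<lambda>(x, y). obj_map P (obj_map P x \<otimes>\<^bsub>C\<^esub> y) \<oplus>\<^bsub>C\<^esub> obj_map P (x \<otimes>\<^bsub>C\<^esub> obj_map P y))
            (\<lambda>(f, g). arr_map P (arr_map P f \<boxtimes>\<^bsub>C\<^esub> g) \<boxplus>\<^bsub>C\<^esub> arr_map P (f \<boxtimes>\<^bsub>C\<^esub> arr_map P g)))"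

text \<open>
  Only operations of the target ring occur below, so the sort asks for no more than \<open>fls\<close> provides
  over an arbitrary unital ring, the zero ring included (which \<open>ring_1\<close> would exclude).
\<close>

definition categorification ::
  "('o, 'm) rig_cat \<Rightarrow> ('o, 'm, 'o, 'm) ftor \<Rightarrow> ('o \<Rightarrow> 'r::{ring, one}) \<Rightarrow> bool" where
  "categorification C N v \<longleftrightarrow>
    distributive_category C \<and> negative_functor C N \<and>
    (\<forall>x \<in> Obj C. \<forall>y \<in> Obj C. isomorphic C x y \<longrightarrow> v x = v y) \<and>
    (\<forall>x \<in> Obj C. \<forall>y \<in> Obj C. v (x \<oplus>\<^bsub>C\<^esub> y) = v x + v y) \<and>
    (\<forall>x \<in> Obj C. \<forall>y \<in> Obj C. v (x \<otimes>\<^bsub>C\<^esub> y) = v x * v y) \<and>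
    v \<one>\<^bsub>C\<^esub> = 1 \<and> v \<zero>\<^bsub>C\<^esub> = 0 \<and>
    (\<forall>x \<in> Obj C. v (obj_map N x) = - v x)"


section \<open>The category \<open>C_b^Z\<close>\<close>

definition laurent_objs :: "('o, 'm) rig_cat \<Rightarrow> (int \<Rightarrow> 'o) set" where
  "laurent_objs C =
    {f. (\<forall>n. f n \<in> Obj C) \<and> (\<exists>k \<le> 0. \<forall>n < k. isomorphic C (f n) \<zero>\<^bsub>C\<^esub>)}"

text \<open>The arrows from \<open>f\<close> to \<open>g\<close> are exactly the families in \<open>\<Prod>n. hom C (f n) (g n)\<close>.\<close>

definition laurent_arrs :: "('o, 'm) rig_cat \<Rightarrow> (int \<Rightarrow> 'm) set" where
  "laurent_arrs C =
    {\<phi>. (\<forall>n. \<phi> n \<in> Arr C) \<and>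
        (\<lambda>n. Dom C (\<phi> n)) \<in> laurent_objs C \<and> (\<lambda>n. Cod C (\<phi> n)) \<in> laurent_objs C}"

definition big_osum :: "('o, 'm) rig_cat \<Rightarrow> 'o list \<Rightarrow> 'o" where
  "big_osum C xs = foldr (osum C) xs \<zero>\<^bsub>C\<^esub>"

definition big_asum :: "('o, 'm) rig_cat \<Rightarrow> 'm list \<Rightarrow> 'm" where
  "big_asum C fs = foldr (asum C) fs (Id C \<zero>\<^bsub>C\<^esub>)"

text \<open>The first components \<open>k\<close>, in increasing order, of the pairs \<open>(k, l)\<close> with \<open>k + l = n\<close> and
  \<open>f(k) \<noteq> 0\<close>, \<open>g(l) \<noteq> 0\<close> (not isomorphic to \<open>0\<close>).\<close>

definition cauchy_indices ::
  "('o, 'm) rig_cat \<Rightarrow> (int \<Rightarrow> 'o) \<Rightarrow> (int \<Rightarrow> 'o) \<Rightarrow> int \<Rightarrow> int list" where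
  "cauchy_indices C f g n = sorted_list_of_set
    {k. \<not> isomorphic C (f k) \<zero>\<^bsub>C\<^esub> \<and> \<not> isomorphic C (g (n - k)) \<zero>\<^bsub>C\<^esub>}"

definition cauchy_prod ::
  "('o, 'm) rig_cat \<Rightarrow> (int \<Rightarrow> 'o) \<Rightarrow> (int \<Rightarrow> 'o) \<Rightarrow> int \<Rightarrow> 'o" where
  "cauchy_prod C f g n =
    big_osum C (map (\<lambda>k. f k \<otimes>\<^bsub>C\<^esub> g (n - k)) (cauchy_indices C f g n))"

text \<open>
  The arrow part \<open>T\<close> of the product of \<open>C_b^Z\<close> must be given by the sums of the arrows
  \<open>\<phi>(k) \<otimes> \<psi>(l)\<close>. This determines it literally when source and target of these arrows have
  the same nonzero pairs. In general the two sums have different index sets and a composite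
  with canonical isomorphisms \<open>0 \<oplus> x \<simeq> x\<close> is needed.

  For such a product to have a unit, \<open>0\<close> must have no endomorphism \<open>e\<close> besides the identity: in a
  degree \<open>n\<close> with \<open>f(n) = 0\<close>, the empty sum gives \<open>(1 \<otimes> \<phi>)(n) = id\<close> even if \<open>\<phi>(n) = e\<close>, and
  naturality of \<open>1 \<otimes> f \<simeq> f\<close> then yields \<open>e = id\<close>. This holds, for instance, whenever \<open>0\<close> is
  an initial object, and for finite sets with bijections.
\<close>

definition cauchy_arrow_map ::
  "('o, 'm) rig_cat \<Rightarrow> ((int \<Rightarrow> 'm) \<times> (int \<Rightarrow> 'm) \<Rightarrow> int \<Rightarrow> 'm) \<Rightarrow> bool" where
  "cauchy_arrow_map C T \<longleftrightarrow>
    (\<forall>\<phi> \<in> laurent_arrs C. \<forall>\<psi> \<in> laurent_arrs C. \<forall>n.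
      cauchy_indices C (\<lambda>k. Dom C (\<phi> k)) (\<lambda>k. Dom C (\<psi> k)) n =
      cauchy_indices C (\<lambda>k. Cod C (\<phi> k)) (\<lambda>k. Cod C (\<psi> k)) n \<longrightarrow>
      T (\<phi>, \<psi>) n =
        big_asum C (map (\<lambda>k. \<phi> k \<boxtimes>\<^bsub>C\<^esub> \<psi> (n - k))
          (cauchy_indices C (\<lambda>k. Dom C (\<phi> k)) (\<lambda>k. Dom C (\<psi> k)) n)))"

definition laurent ::
  "('o, 'm) rig_cat \<Rightarrow> ((int \<Rightarrow> 'm) \<times> (int \<Rightarrow> 'm) \<Rightarrow> int \<Rightarrow> 'm) \<Rightarrow>
   (int \<Rightarrow> 'o, int \<Rightarrow> 'm) rig_cat" where
  "laurent C T =
    \<lparr>Obj = laurent_objs C, Arr = laurent_arrs C,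
     Dom = (\<lambda>\<phi> n. Dom C (\<phi> n)), Cod = (\<lambda>\<phi> n. Cod C (\<phi> n)),
     Id = (\<lambda>f n. Id C (f n)), Comp = (\<lambda>\<psi> \<phi> n. Comp C (\<psi> n) (\<phi> n)),
     Plus = Ftor (\<lambda>(f, g) n. f n \<oplus>\<^bsub>C\<^esub> g n) (\<lambda>(\<phi>, \<psi>) n. \<phi> n \<boxplus>\<^bsub>C\<^esub> \<psi> n),
     Times = Ftor (\<lambda>(f, g). cauchy_prod C f g) T,
     Zero = (\<lambda>n. \<zero>\<^bsub>C\<^esub>),
     One = (\<lambda>n. if n = 0 then \<one>\<^bsub>C\<^esub> else \<zero>\<^bsub>C\<^esub>)\<rparr>"

definition laurent_neg ::
  "('o, 'm, 'o, 'm) ftor \<Rightarrow> (int \<Rightarrow> 'o, int \<Rightarrow> 'm, int \<Rightarrow> 'o, int \<Rightarrow> 'm) ftor" where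
  "laurent_neg N = Ftor (\<lambda>f n. obj_map N (f n)) (\<lambda>\<phi> n. arr_map N (\<phi> n))"

definition negative_part ::
  "('o, 'm) rig_cat \<Rightarrow> (int \<Rightarrow> 'o, int \<Rightarrow> 'm, int \<Rightarrow> 'o, int \<Rightarrow> 'm) ftor" where
  "negative_part C =
    Ftor (\<lambda>f n. if n \<ge> 0 then \<zero>\<^bsub>C\<^esub> else f n)
         (\<lambda>\<phi> n. if n \<ge> 0 then Id C \<zero>\<^bsub>C\<^esub> else \<phi> n)"

definition laurent_val :: "('o \<Rightarrow> 'r::zero) \<Rightarrow> (int \<Rightarrow> 'o) \<Rightarrow> 'r fls" where
  "laurent_val v f = Abs_fls (\<lambda>n. v (f n))"

end

(* A sum in C over a finite linearly ordered index set is bracketed along the order, and Laplaza's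
   coherence makes regrouping, reordering and distributing such sums canonical ("block maps").
   Rigidity of the zero object makes all maps between null objects equal, so null summands can be
   added or dropped freely. Every family built from given ones by plus and times is presented as a
   sum indexed by words, one letter for each factor; the associator, the unitors and the
   distributors of the Laurent category act diagonally on these summands, with the corresponding
   structure map of C as component. Hence Laplaza's axioms hold because they hold wordwise.
   The Rota-Baxter isomorphism follows formally from x = P x + Q x, where Q is the nonnegative part,
   from P (P x * P y) = P x * P y and from P (Q x * Q y) = 0. *)
theory Submission
  imports Defs "HOL-Library.List_Lexorder" "HOL-Library.Product_Lexorder"
begin

text \<open>Only pairs of nonnull coefficients enter the product, so its index sets depend on the
  objects, differ between source and target of an arrow, and do not match for the two bracketings of
  a threefold product. Presentations therefore may contain null summands, and
  \<open>transfer\<close> shows that being diagonal with compatible components is independent of the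
  presentations. Structure maps are defined on the presentations by supports and reach all others
  through a \<open>leaf\<close> coarser than both. Words serve as indices because concatenation is
  strictly associative: both bracketings of a threefold product get literally the same index set,
  and the associator becomes diagonal. Colours are needed since \<open>y\<close> and
  \<open>z\<close> in \<open>x \<otimes> (y \<oplus> z)\<close> can have coefficients of equal
  degree. Block maps are developed for any strong symmetric monoidal functor, because part of
  Laplaza's axioms says that \<open>x \<otimes> -\<close> and \<open>- \<otimes> z\<close> are such
  functors; expanding a product of sums is then a block map whose components are block maps.\<close>

context category
begin

section \<open>Inverses and cancellation in a category\<close>

lemma hom_iff: "f \<in> hom C x y \<longleftrightarrow> f \<in> Arr C \<and> Dom C f = x \<and> Cod C f = y"
  by (auto simp: hom_def)

lemma Dom_Cod_Obj [simp]:
  "f \<in> Arr C ==> Dom C f \<in> Obj C" "f \<in> Arr C ==> Cod C f \<in> Obj C"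
  by (simp_all add: Dom_in_Obj Cod_in_Obj)

lemma Id_Arr [simp]:
  assumes "x \<in> Obj C"
  shows "Id C x \<in> Arr C" "Dom C (Id C x) = x" "Cod C (Id C x) = x"
  using Id_in_hom[OF assms] by (simp_all add: hom_iff)

lemma comp_Arr [simp]:
  assumes "f \<in> Arr C" "g \<in> Arr C" "Dom C g = Cod C f"
  shows "g \<cdot> f \<in> Arr C" "Dom C (g \<cdot> f) = Dom C f" "Cod C (g \<cdot> f) = Cod C g"
  using Comp_in_hom[of f "Dom C f" "Cod C f" g "Cod C g"] assms by (simp_all add: hom_iff)

lemma comp_Id [simp]: "f \<in> Arr C ==> Dom C f = x ==> f \<cdot> Id C x = f"
  using Comp_Id[of f x "Cod C f"] by (simp add: hom_iff)

lemma Id_comp [simp]: "f \<in> Arr C ==> Cod C f = x ==> Id C x \<cdot> f = f"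
  using Id_Comp[of f "Dom C f" x] by (simp add: hom_iff)

lemma comp_assoc:
  "f \<in> Arr C ==> g \<in> Arr C ==> h \<in> Arr C ==> Dom C g = Cod C f ==> Dom C h = Cod C g ==>
    (h \<cdot> g) \<cdot> f = h \<cdot> (g \<cdot> f)"
  using Comp_assoc[of f "Dom C f" "Cod C f" g "Cod C g" h "Cod C h"] by (simp add: hom_iff)

text \<open>Composites are kept nested to the right, and this lets an equation be applied at the
  head of such a composite. The lemmas with suffix \<open>_tail\<close> are its instances.\<close>

lemma comp_reduce:
  "g \<cdot> f = h ==> f \<in> Arr C ==> g \<in> Arr C ==> k \<in> Arr C ==> Dom C g = Cod C f ==> Dom C f = Cod C k ==>
    g \<cdot> (f \<cdot> k) = h \<cdot> k"
  using comp_assoc[of k f g] by simp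

definition arr_inv :: "'m \<Rightarrow> 'm" where
  "arr_inv f = (SOME g. g \<in> hom C (Cod C f) (Dom C f) \<and> g \<cdot> f = Id C (Dom C f) \<and> f \<cdot> g = Id C (Cod C f))"

lemma inverse_props:
  assumes "invertible C f"
  shows "arr_inv f \<in> Arr C" "Dom C (arr_inv f) = Cod C f" "Cod C (arr_inv f) = Dom C f"
    "arr_inv f \<cdot> f = Id C (Dom C f)" "f \<cdot> arr_inv f = Id C (Cod C f)"
proof -
  have "\<exists>g. g \<in> hom C (Cod C f) (Dom C f) \<and> g \<cdot> f = Id C (Dom C f) \<and> f \<cdot> g = Id C (Cod C f)"
    using assms by (auto simp: invertible_def)
  from someI_ex[OF this] show "arr_inv f \<in> Arr C" "Dom C (arr_inv f) = Cod C f" "Cod C (arr_inv f) = Dom C f"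
    "arr_inv f \<cdot> f = Id C (Dom C f)" "f \<cdot> arr_inv f = Id C (Cod C f)"
    unfolding arr_inv_def[symmetric] by (simp_all add: hom_iff)
qed

lemmas inverse_Arr [simp] = inverse_props(1-3)
lemmas inverse_cancel [simp] = inverse_props(4,5)

lemma inverse_cancel_tail [simp]:
  assumes "invertible C f" "f \<in> Arr C" "k \<in> Arr C"
  shows "Cod C k = Dom C f ==> arr_inv f \<cdot> (f \<cdot> k) = k"
    and "Cod C k = Cod C f ==> f \<cdot> (arr_inv f \<cdot> k) = k"
  using assms comp_reduce[OF inverse_cancel(1)] comp_reduce[OF inverse_cancel(2)] by simp_all

lemma invertibleI:
  "f \<in> Arr C ==> g \<in> Arr C ==> Dom C g = Cod C f ==> Cod C g = Dom C f ==>
    g \<cdot> f = Id C (Dom C f) ==> f \<cdot> g = Id C (Cod C f) ==> invertible C f"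
  unfolding invertible_def by (auto simp: hom_iff)

lemma invertible_Id [simp]: "x \<in> Obj C ==> invertible C (Id C x)"
  by (rule invertibleI[where g="Id C x"]) auto

lemma invertible_inverse [simp]: "f \<in> Arr C ==> invertible C f ==> invertible C (arr_inv f)"
  by (rule invertibleI[where g=f]) auto

lemma invertible_comp [simp]:
  "f \<in> Arr C ==> g \<in> Arr C ==> Dom C g = Cod C f ==> invertible C f ==> invertible C g ==>
    invertible C (g \<cdot> f)"
  by (rule invertibleI[where g="arr_inv f \<cdot> arr_inv g"]) (auto simp: comp_assoc)

lemma cancel_right:
  assumes "p \<cdot> f = q \<cdot> f" "f \<in> Arr C" "invertible C f" "p \<in> Arr C" "q \<in> Arr C"
    "Dom C p = Cod C f" "Dom C q = Cod C f"
  shows "p = q"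
proof -
  have "(p \<cdot> f) \<cdot> arr_inv f = (q \<cdot> f) \<cdot> arr_inv f" using assms(1) by simp
  then show ?thesis using assms(2-) by (simp add: comp_assoc)
qed

lemma cancel_left:
  assumes "f \<cdot> p = f \<cdot> q" "f \<in> Arr C" "invertible C f" "p \<in> Arr C" "q \<in> Arr C"
    "Cod C p = Dom C f" "Cod C q = Dom C f"
  shows "p = q"
proof -
  have "arr_inv f \<cdot> (f \<cdot> p) = arr_inv f \<cdot> (f \<cdot> q)" using assms(1) by simp
  then show ?thesis using assms(2-) by simp
qed

lemma inverse_unique:
  assumes "g \<cdot> f = Id C (Dom C f)" "f \<in> Arr C" "invertible C f" "g \<in> Arr C"
    "Dom C g = Cod C f" "Cod C g = Dom C f"
  shows "arr_inv f = g"
  by (rule cancel_right[where f=f]) (use assms in auto)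

lemma inverse_natural:
  assumes "t' \<cdot> f = g \<cdot> t" "invertible C t" "invertible C t'" "t \<in> Arr C" "t' \<in> Arr C"
    "f \<in> Arr C" "g \<in> Arr C" "Dom C t' = Cod C f" "Dom C g = Cod C t" "Dom C f = Dom C t"
    "Cod C g = Cod C t'"
  shows "arr_inv t' \<cdot> g = f \<cdot> arr_inv t"
proof (rule cancel_right[where f=t])
  have "(arr_inv t' \<cdot> g) \<cdot> t = arr_inv t' \<cdot> (t' \<cdot> f)" using assms by (simp add: comp_assoc)
  also have "\<dots> = (f \<cdot> arr_inv t) \<cdot> t" using assms(2-) by (simp add: comp_assoc)
  finally show "(arr_inv t' \<cdot> g) \<cdot> t = (f \<cdot> arr_inv t) \<cdot> t" .
qed (use assms in auto)

lemma isomorphicI: "f \<in> Arr C ==> invertible C f ==> isomorphic C (Dom C f) (Cod C f)"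
  unfolding isomorphic_def by (auto simp: hom_iff)

lemma isomorphicE:
  assumes "isomorphic C x y"
  obtains f where "f \<in> Arr C" "Dom C f = x" "Cod C f = y" "invertible C f"
  using assms unfolding isomorphic_def by (auto simp: hom_iff)

lemma isomorphic_refl: "x \<in> Obj C ==> isomorphic C x x"
  using isomorphicI[of "Id C x"] by simp

lemma isomorphic_trans: "isomorphic C x y ==> isomorphic C y z ==> isomorphic C x z"
proof (elim isomorphicE)
  fix f g
  assume "f \<in> Arr C" "Dom C f = x" "Cod C f = y" "invertible C f"
    "g \<in> Arr C" "Dom C g = y" "Cod C g = z" "invertible C g"
  then show ?thesis using isomorphicI[of "g \<cdot> f"] by simp
qed

end

lemma is_functorD:
  assumes "is_functor C D F"
  shows "x \<in> Obj C ==> obj_map F x \<in> Obj D"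
    and "f \<in> Arr C ==> arr_map F f \<in> hom D (obj_map F (Dom C f)) (obj_map F (Cod C f))"
    and "x \<in> Obj C ==> arr_map F (Id C x) = Id D (obj_map F x)"
    and "f \<in> Arr C ==> g \<in> Arr C ==> Cod C f = Dom C g ==>
      arr_map F (Comp C g f) = Comp D (arr_map F g) (arr_map F f)"
  using assms by (auto simp: is_functor_def)

lemma natural_isoD:
  assumes "natural_iso C D F G t"
  shows "x \<in> Obj C ==> t x \<in> hom D (obj_map F x) (obj_map G x)"
    and "x \<in> Obj C ==> invertible D (t x)"
    and "f \<in> Arr C ==> Comp D (t (Cod C f)) (arr_map F f) = Comp D (arr_map G f) (t (Dom C f))"
  using assms by (auto simp: natural_iso_def)

lemma prod_cat_simps [simp]:
  "Obj (prod_cat C D) = Obj C \<times> Obj D" "Arr (prod_cat C D) = Arr C \<times> Arr D"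
  "Dom (prod_cat C D) (f, g) = (Dom C f, Dom D g)" "Cod (prod_cat C D) (f, g) = (Cod C f, Cod D g)"
  "Id (prod_cat C D) (x, y) = (Id C x, Id D y)"
  "Comp (prod_cat C D) (h, k) (f, g) = (Comp C h f, Comp D k g)"
  by (simp_all add: prod_cat_def)

section \<open>Coherence in monoidal categories\<close>

context monoidal
begin

abbreviation tobj :: "'o \<Rightarrow> 'o \<Rightarrow> 'o" (infixr \<open>\<uplus>\<close> 65) where "x \<uplus> y \<equiv> obj_map T (x, y)"
abbreviation tarr :: "'m \<Rightarrow> 'm \<Rightarrow> 'm" (infixr \<open>\<star>\<close> 65) where "f \<star> g \<equiv> arr_map T (f, g)"

lemma I_in [simp]: "I \<in> Obj C" by (rule I_Obj)

lemma tobj_Obj [simp]: "x \<in> Obj C ==> y \<in> Obj C ==> x \<uplus> y \<in> Obj C"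
  using is_functorD(1)[OF T_functor, of "(x, y)"] by simp

lemma tarr_Arr [simp]:
  assumes "f \<in> Arr C" "g \<in> Arr C"
  shows "f \<star> g \<in> Arr C" "Dom C (f \<star> g) = Dom C f \<uplus> Dom C g" "Cod C (f \<star> g) = Cod C f \<uplus> Cod C g"
  using is_functorD(2)[OF T_functor, of "(f, g)"] assms by (simp_all add: hom_iff)

lemma tarr_Id [simp]: "x \<in> Obj C ==> y \<in> Obj C ==> Id C x \<star> Id C y = Id C (x \<uplus> y)"
  using is_functorD(3)[OF T_functor, of "(x, y)"] by simp

lemma interchange:
  "f \<in> Arr C ==> g \<in> Arr C ==> f' \<in> Arr C ==> g' \<in> Arr C ==> Dom C g = Cod C f ==> Dom C g' = Cod C f' ==>
    (g \<star> g') \<cdot> (f \<star> f') = (g \<cdot> f) \<star> (g' \<cdot> f')"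
  using is_functorD(4)[OF T_functor, of "(f, f')" "(g, g')"] by simp

lemma interchange_tail:
  "f \<in> Arr C ==> g \<in> Arr C ==> f' \<in> Arr C ==> g' \<in> Arr C ==> Dom C g = Cod C f ==> Dom C g' = Cod C f' ==>
    k \<in> Arr C ==> Cod C k = Dom C f \<uplus> Dom C f' ==>
    (g \<star> g') \<cdot> ((f \<star> f') \<cdot> k) = ((g \<cdot> f) \<star> (g' \<cdot> f')) \<cdot> k"
  using comp_reduce[OF interchange] by simp

lemmas merge = interchange interchange_tail

lemma invertible_tarr [simp]:
  "f \<in> Arr C ==> g \<in> Arr C ==> invertible C f ==> invertible C g ==> invertible C (f \<star> g)"
  by (rule invertibleI[where g="arr_inv f \<star> arr_inv g"]) (auto simp: interchange)

lemma a_Arr [simp]: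
  assumes "x \<in> Obj C" "y \<in> Obj C" "z \<in> Obj C"
  shows "a (x, y, z) \<in> Arr C" "Dom C (a (x, y, z)) = (x \<uplus> y) \<uplus> z" "Cod C (a (x, y, z)) = x \<uplus> (y \<uplus> z)"
    "invertible C (a (x, y, z))"
proof -
  have "(x, y, z) \<in> Obj (pow3 C)" using assms by simp
  from natural_isoD(1,2)[OF a_natural this]
  show "a (x, y, z) \<in> Arr C" "Dom C (a (x, y, z)) = (x \<uplus> y) \<uplus> z" "Cod C (a (x, y, z)) = x \<uplus> (y \<uplus> z)"
    "invertible C (a (x, y, z))"
    by (simp_all add: hom_iff)
qed

lemma l_Arr [simp]:
  assumes "x \<in> Obj C"
  shows "l x \<in> Arr C" "Dom C (l x) = I \<uplus> x" "Cod C (l x) = x" "invertible C (l x)"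
  using natural_isoD(1,2)[OF l_natural, of x] assms by (auto simp: hom_iff)

lemma r_Arr [simp]:
  assumes "x \<in> Obj C"
  shows "r x \<in> Arr C" "Dom C (r x) = x \<uplus> I" "Cod C (r x) = x" "invertible C (r x)"
  using natural_isoD(1,2)[OF r_natural, of x] assms by (auto simp: hom_iff)

lemma a_nat:
  assumes "f \<in> Arr C" "g \<in> Arr C" "h \<in> Arr C" "Cod C f = x'" "Cod C g = y'" "Cod C h = z'"
  shows "a (x', y', z') \<cdot> ((f \<star> g) \<star> h) = (f \<star> (g \<star> h)) \<cdot> a (Dom C f, Dom C g, Dom C h)"
  using natural_isoD(3)[OF a_natural, of "(f, g, h)"] assms by auto

lemma a_nat_tail:
  assumes "f \<in> Arr C" "g \<in> Arr C" "h \<in> Arr C" "Cod C f = x'" "Cod C g = y'" "Cod C h = z'"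
    "k \<in> Arr C" "Cod C k = (Dom C f \<uplus> Dom C g) \<uplus> Dom C h"
  shows "a (x', y', z') \<cdot> (((f \<star> g) \<star> h) \<cdot> k) = (f \<star> (g \<star> h)) \<cdot> (a (Dom C f, Dom C g, Dom C h) \<cdot> k)"
  using comp_reduce[OF a_nat[OF assms(1-6)], of k] assms by (auto simp: comp_assoc)

lemma l_nat: "f \<in> Arr C ==> Cod C f = x' ==> l x' \<cdot> (Id C I \<star> f) = f \<cdot> l (Dom C f)"
  using natural_isoD(3)[OF l_natural, of f] by auto

lemma l_nat_tail: "f \<in> Arr C ==> Cod C f = x' ==> k \<in> Arr C ==> Cod C k = I \<uplus> Dom C f ==>
    l x' \<cdot> ((Id C I \<star> f) \<cdot> k) = f \<cdot> (l (Dom C f) \<cdot> k)"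
  using comp_reduce[OF l_nat, of f x' k] by (auto simp: comp_assoc)

lemma r_nat: "f \<in> Arr C ==> Cod C f = x' ==> r x' \<cdot> (f \<star> Id C I) = f \<cdot> r (Dom C f)"
  using natural_isoD(3)[OF r_natural, of f] by auto

lemma r_nat_tail: "f \<in> Arr C ==> Cod C f = x' ==> k \<in> Arr C ==> Cod C k = Dom C f \<uplus> I ==>
    r x' \<cdot> ((f \<star> Id C I) \<cdot> k) = f \<cdot> (r (Dom C f) \<cdot> k)"
  using comp_reduce[OF r_nat, of f x' k] by (auto simp: comp_assoc)

text \<open>\<open>l\<close> is a natural isomorphism from tensoring with \<open>I\<close> to the
  identity, so tensoring with \<open>I\<close> is faithful. Kelly's argument uses this to strip off
  an auxiliary factor \<open>I\<close>.\<close>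

lemma faithful_left:
  assumes "Id C I \<star> f = Id C I \<star> g" "f \<in> Arr C" "g \<in> Arr C" "Dom C f = Dom C g" "Cod C f = Cod C g"
  shows "f = g"
proof (rule cancel_right[where f="l (Dom C f)"])
  show "f \<cdot> l (Dom C f) = g \<cdot> l (Dom C f)"
    using l_nat[of f] l_nat[of g] assms by auto
qed (use assms in auto)

lemma faithful_right:
  assumes "f \<star> Id C I = g \<star> Id C I" "f \<in> Arr C" "g \<in> Arr C" "Dom C f = Dom C g" "Cod C f = Cod C g"
  shows "f = g"
proof (rule cancel_right[where f="r (Dom C f)"])
  show "f \<cdot> r (Dom C f) = g \<cdot> r (Dom C f)"
    using r_nat[of f] r_nat[of g] assms by auto
qed (use assms in auto)

text \<open>Kelly's argument: the two unit laws below are not among the axioms.\<close>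

lemma l_tensor:
  assumes x: "x \<in> Obj C" and y: "y \<in> Obj C"
  shows "l (x \<uplus> y) \<cdot> a (I, x, y) = l x \<star> Id C y"
proof (rule faithful_left)
  \<comment> \<open>\<open>?k\<close> consists of two sides of the pentagon for
    \<open>I, I, x, y\<close>; after precomposition with it the claim becomes this pentagon together
    with two triangles.\<close>
  let ?k = "a (I, I \<uplus> x, y) \<cdot> (a (I, I, x) \<star> Id C y)"
  show "Id C I \<star> (l (x \<uplus> y) \<cdot> a (I, x, y)) = Id C I \<star> (l x \<star> Id C y)"
  proof (rule cancel_right[where f="?k"])
    have "(Id C I \<star> (l (x \<uplus> y) \<cdot> a (I, x, y))) \<cdot> ?k
      = (Id C I \<star> l (x \<uplus> y)) \<cdot> ((Id C I \<star> a (I, x, y)) \<cdot> (a (I, I \<uplus> x, y) \<cdot> (a (I, I, x) \<star> Id C y)))"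
      using x y by (simp add: interchange_tail)
    also have "\<dots> = (Id C I \<star> l (x \<uplus> y)) \<cdot> (a (I, I, x \<uplus> y) \<cdot> a (I \<uplus> I, x, y))"
      using pentagon[of I I x y] x y by simp
    also have "\<dots> = (r I \<star> Id C (x \<uplus> y)) \<cdot> a (I \<uplus> I, x, y)"
      using comp_reduce[OF triangle[of I "x \<uplus> y"], of "a (I \<uplus> I, x, y)"] x y by simp
    also have "\<dots> = a (I, x, y) \<cdot> ((r I \<star> Id C x) \<star> Id C y)"
      using a_nat[of "r I" "Id C x" "Id C y" I x y] x y by simp
    also have "\<dots> = a (I, x, y) \<cdot> (((Id C I \<star> l x) \<cdot> a (I, I, x)) \<star> Id C y)"
      using triangle[of I x] x by simp
    also have "\<dots> = a (I, x, y) \<cdot> (((Id C I \<star> l x) \<star> Id C y) \<cdot> (a (I, I, x) \<star> Id C y))"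
      using x y by (simp add: interchange)
    also have "\<dots> = (Id C I \<star> (l x \<star> Id C y)) \<cdot> ?k"
      using x y by (simp add: a_nat_tail)
    finally show "(Id C I \<star> (l (x \<uplus> y) \<cdot> a (I, x, y))) \<cdot> ?k = (Id C I \<star> (l x \<star> Id C y)) \<cdot> ?k" .
  qed (use x y in auto)
qed (use x y in auto)

lemma r_tensor:
  assumes x: "x \<in> Obj C" and y: "y \<in> Obj C"
  shows "(Id C x \<star> r y) \<cdot> a (x, y, I) = r (x \<uplus> y)"
proof (rule faithful_right)
  show "((Id C x \<star> r y) \<cdot> a (x, y, I)) \<star> Id C I = r (x \<uplus> y) \<star> Id C I"
  proof (rule cancel_left[where f="a (x, y, I)"])
    have "a (x, y, I) \<cdot> (((Id C x \<star> r y) \<cdot> a (x, y, I)) \<star> Id C I)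
      = a (x, y, I) \<cdot> (((Id C x \<star> r y) \<star> Id C I) \<cdot> (a (x, y, I) \<star> Id C I))"
      using x y by (simp add: interchange)
    also have "\<dots> = (Id C x \<star> (r y \<star> Id C I)) \<cdot> (a (x, y \<uplus> I, I) \<cdot> (a (x, y, I) \<star> Id C I))"
      using x y by (simp add: a_nat_tail)
    also have "\<dots> = (Id C x \<star> ((Id C y \<star> l I) \<cdot> a (y, I, I))) \<cdot> (a (x, y \<uplus> I, I) \<cdot> (a (x, y, I) \<star> Id C I))"
      using triangle[of y I] y by simp
    also have "\<dots> = (Id C x \<star> (Id C y \<star> l I)) \<cdot> ((Id C x \<star> a (y, I, I)) \<cdot> (a (x, y \<uplus> I, I) \<cdot> (a (x, y, I) \<star> Id C I)))"
      using x y by (simp add: interchange_tail)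
    also have "\<dots> = (Id C x \<star> (Id C y \<star> l I)) \<cdot> (a (x, y, I \<uplus> I) \<cdot> a (x \<uplus> y, I, I))"
      using pentagon[of x y I I] x y by simp
    also have "\<dots> = a (x, y, I) \<cdot> ((Id C (x \<uplus> y) \<star> l I) \<cdot> a (x \<uplus> y, I, I))"
      using a_nat_tail[of "Id C x" "Id C y" "l I" x y I "a (x \<uplus> y, I, I)"] x y by simp
    also have "\<dots> = a (x, y, I) \<cdot> (r (x \<uplus> y) \<star> Id C I)"
      using triangle[of "x \<uplus> y" I] x y by simp
    finally show "a (x, y, I) \<cdot> (((Id C x \<star> r y) \<cdot> a (x, y, I)) \<star> Id C I) = a (x, y, I) \<cdot> (r (x \<uplus> y) \<star> Id C I)" .
  qed (use x y in auto)
qed (use x y in auto)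

end

section \<open>Exchange of adjacent summands\<close>

context symmetric_monoidal
begin

lemma s_Arr [simp]:
  assumes "x \<in> Obj C" "y \<in> Obj C"
  shows "s (x, y) \<in> Arr C" "Dom C (s (x, y)) = x \<uplus> y" "Cod C (s (x, y)) = y \<uplus> x" "invertible C (s (x, y))"
  using natural_isoD(1,2)[OF s_natural, of "(x, y)"] assms by (auto simp: hom_iff)

lemma s_nat:
  assumes "f \<in> Arr C" "g \<in> Arr C" "Cod C f = x'" "Cod C g = y'"
  shows "s (x', y') \<cdot> (f \<star> g) = (g \<star> f) \<cdot> s (Dom C f, Dom C g)"
  using natural_isoD(3)[OF s_natural, of "(f, g)"] assms by auto

lemma s_nat_tail:
  assumes "f \<in> Arr C" "g \<in> Arr C" "Cod C f = x'" "Cod C g = y'" "k \<in> Arr C" "Cod C k = Dom C f \<uplus> Dom C g"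
  shows "s (x', y') \<cdot> ((f \<star> g) \<cdot> k) = (g \<star> f) \<cdot> (s (Dom C f, Dom C g) \<cdot> k)"
  using comp_reduce[OF s_nat[OF assms(1-4)], of k] assms by (auto simp: comp_assoc)

lemma s_s [simp]: "x \<in> Obj C ==> y \<in> Obj C ==> s (y, x) \<cdot> s (x, y) = Id C (x \<uplus> y)"
  by (rule s_involutive)

text \<open>Compatibility of symmetry and unitors is not an axiom here. It comes from the hexagon
  for \<open>x, I, I\<close>, compared after tensoring with \<open>I\<close> on the right, which is
  faithful.\<close>

lemma l_s:
  assumes x: "x \<in> Obj C"
  shows "l x \<cdot> s (x, I) = r x"
proof (rule faithful_right)
  show "(l x \<cdot> s (x, I)) \<star> Id C I = r x \<star> Id C I"
  proof (rule cancel_left[where f="s (x, I)"])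
    have "s (x, I) \<cdot> ((l x \<cdot> s (x, I)) \<star> Id C I)
      = s (x, I) \<cdot> ((l x \<star> Id C I) \<cdot> (s (x, I) \<star> Id C I))"
      using x by (simp add: interchange)
    also have "\<dots> = s (x, I) \<cdot> (l (x \<uplus> I) \<cdot> (a (I, x, I) \<cdot> (s (x, I) \<star> Id C I)))"
      using x by (simp add: l_tensor[symmetric] comp_assoc)
    also have "\<dots> = l (I \<uplus> x) \<cdot> ((Id C I \<star> s (x, I)) \<cdot> (a (I, x, I) \<cdot> (s (x, I) \<star> Id C I)))"
      using x l_nat_tail[of "s (x, I)" "I \<uplus> x" "a (I, x, I) \<cdot> (s (x, I) \<star> Id C I)"] by simp
    also have "\<dots> = l (I \<uplus> x) \<cdot> (a (I, I, x) \<cdot> (s (x, I \<uplus> I) \<cdot> a (x, I, I)))"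
      using hexagon[of x I I] x by simp
    also have "\<dots> = (l I \<star> Id C x) \<cdot> (s (x, I \<uplus> I) \<cdot> a (x, I, I))"
      using comp_reduce[OF l_tensor[of I x], of "s (x, I \<uplus> I) \<cdot> a (x, I, I)"] x by simp
    also have "\<dots> = s (x, I) \<cdot> ((Id C x \<star> l I) \<cdot> a (x, I, I))"
      using s_nat_tail[of "Id C x" "l I" x I "a (x, I, I)"] x by simp
    also have "\<dots> = s (x, I) \<cdot> (r x \<star> Id C I)"
      using triangle[of x I] x by simp
    finally show "s (x, I) \<cdot> ((l x \<cdot> s (x, I)) \<star> Id C I) = s (x, I) \<cdot> (r x \<star> Id C I)" .
  qed (use x in auto)
qed (use x in auto)

lemma r_s:
  assumes x: "x \<in> Obj C"
  shows "r x \<cdot> s (I, x) = l x"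
proof -
  have "r x \<cdot> s (I, x) = (l x \<cdot> s (x, I)) \<cdot> s (I, x)" using l_s x by simp
  also have "\<dots> = l x" using x by (simp add: comp_assoc)
  finally show ?thesis .
qed

text \<open>This is the second hexagon. It follows from the axiom for \<open>y, x, w\<close> because
  \<open>s\<close> is inverse to itself.\<close>

lemma s_tensor:
  assumes x: "x \<in> Obj C" and w: "w \<in> Obj C" and y: "y \<in> Obj C"
  shows "s (x \<uplus> w, y) = a (y, x, w) \<cdot> ((s (x, y) \<star> Id C w) \<cdot> (arr_inv (a (x, y, w)) \<cdot>
    ((Id C x \<star> s (w, y)) \<cdot> a (x, w, y))))" (is "_ = ?rhs")
proof (rule cancel_left[where f="s (y, x \<uplus> w)"])
  let ?A = "a (x, w, y)"
  have "?A \<cdot> (s (y, x \<uplus> w) \<cdot> ?rhs)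
     = (?A \<cdot> (s (y, x \<uplus> w) \<cdot> a (y, x, w))) \<cdot> ((s (x, y) \<star> Id C w) \<cdot> (arr_inv (a (x, y, w)) \<cdot>
    ((Id C x \<star> s (w, y)) \<cdot> a (x, w, y))))"
    using x w y by (simp add: comp_assoc)
  also have "\<dots> = ((Id C x \<star> s (y, w)) \<cdot> (a (x, y, w) \<cdot> (s (y, x) \<star> Id C w))) \<cdot> ((s (x, y) \<star> Id C w) \<cdot> (arr_inv (a (x, y, w)) \<cdot>
    ((Id C x \<star> s (w, y)) \<cdot> a (x, w, y))))"
    using hexagon[of y x w] x w y by simp
  also have "\<dots> = ?A \<cdot> (s (y, x \<uplus> w) \<cdot> s (x \<uplus> w, y))"
    using x w y by (simp add: comp_assoc merge)
  finally have "?A \<cdot> (s (y, x \<uplus> w) \<cdot> ?rhs) = ?A \<cdot> (s (y, x \<uplus> w) \<cdot> s (x \<uplus> w, y))" .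
  then show "s (y, x \<uplus> w) \<cdot> s (x \<uplus> w, y) = s (y, x \<uplus> w) \<cdot> ?rhs"
    by (rule cancel_left[OF sym]) (use x w y in auto)
qed (use x w y in auto)

text \<open>The adjacent transposition of the first two terms of a right-bracketed sum. Sorting and
  merging of sums are composed of these maps, so coherence reduces to the relations that
  \<open>sw\<close> satisfies.\<close>

definition sw :: "'o \<Rightarrow> 'o \<Rightarrow> 'o \<Rightarrow> 'm" where
  "sw x y z = a (y, x, z) \<cdot> ((s (x, y) \<star> Id C z) \<cdot> arr_inv (a (x, y, z)))"

lemma sw_Arr [simp]:
  assumes "x \<in> Obj C" "y \<in> Obj C" "z \<in> Obj C"
  shows "sw x y z \<in> Arr C" "Dom C (sw x y z) = x \<uplus> y \<uplus> z" "Cod C (sw x y z) = y \<uplus> x \<uplus> z"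
    "invertible C (sw x y z)"
  using assms by (auto simp: sw_def)

lemma sw_sw [simp]:
  assumes "x \<in> Obj C" "y \<in> Obj C" "z \<in> Obj C"
  shows "sw y x z \<cdot> sw x y z = Id C (x \<uplus> y \<uplus> z)"
  using assms by (simp add: sw_def comp_assoc merge)

lemma sw_sw_tail [simp]:
  assumes "x \<in> Obj C" "y \<in> Obj C" "z \<in> Obj C" "k \<in> Arr C" "Cod C k = x \<uplus> y \<uplus> z"
  shows "sw y x z \<cdot> (sw x y z \<cdot> k) = k"
  using comp_reduce[OF sw_sw, of x y z k] assms by simp

lemma sw_a:
  assumes "x \<in> Obj C" "y \<in> Obj C" "z \<in> Obj C"
  shows "sw x y z \<cdot> a (x, y, z) = a (y, x, z) \<cdot> (s (x, y) \<star> Id C z)"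
  using assms by (simp add: sw_def comp_assoc)

lemma sw_nat:
  assumes "f \<in> Arr C" "g \<in> Arr C" "h \<in> Arr C" "Cod C f = x'" "Cod C g = y'" "Cod C h = z'"
  shows "sw x' y' z' \<cdot> (f \<star> g \<star> h) = (g \<star> f \<star> h) \<cdot> sw (Dom C f) (Dom C g) (Dom C h)"
proof (rule cancel_right[where f="a (Dom C f, Dom C g, Dom C h)"])
  have "(sw x' y' z' \<cdot> (f \<star> g \<star> h)) \<cdot> a (Dom C f, Dom C g, Dom C h)
    = sw x' y' z' \<cdot> (a (x', y', z') \<cdot> ((f \<star> g) \<star> h))"
    using assms by (auto simp: comp_assoc a_nat)
  also have "\<dots> = a (y', x', z') \<cdot> ((s (x', y') \<cdot> (f \<star> g)) \<star> h)"
    using assms comp_reduce[OF sw_a[of x' y' z'], of "(f \<star> g) \<star> h"] by (auto simp: comp_assoc merge)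
  also have "\<dots> = a (y', x', z') \<cdot> (((g \<star> f) \<star> h) \<cdot> (s (Dom C f, Dom C g) \<star> Id C (Dom C h)))"
    using assms by (auto simp: s_nat merge)
  also have "\<dots> = (g \<star> f \<star> h) \<cdot> (a (Dom C g, Dom C f, Dom C h) \<cdot> (s (Dom C f, Dom C g) \<star> Id C (Dom C h)))"
    using assms by (auto simp: a_nat_tail)
  also have "\<dots> = ((g \<star> f \<star> h) \<cdot> sw (Dom C f) (Dom C g) (Dom C h)) \<cdot> a (Dom C f, Dom C g, Dom C h)"
    using assms by (auto simp: comp_assoc sw_a)
  finally show "(sw x' y' z' \<cdot> (f \<star> g \<star> h)) \<cdot> a (Dom C f, Dom C g, Dom C h)
    = ((g \<star> f \<star> h) \<cdot> sw (Dom C f) (Dom C g) (Dom C h)) \<cdot> a (Dom C f, Dom C g, Dom C h)" .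
qed (use assms in auto)

lemma sw_nat_tail:
  assumes "f \<in> Arr C" "g \<in> Arr C" "h \<in> Arr C" "Cod C f = x'" "Cod C g = y'" "Cod C h = z'"
    "k \<in> Arr C" "Cod C k = Dom C f \<uplus> Dom C g \<uplus> Dom C h"
  shows "sw x' y' z' \<cdot> ((f \<star> g \<star> h) \<cdot> k) = (g \<star> f \<star> h) \<cdot> (sw (Dom C f) (Dom C g) (Dom C h) \<cdot> k)"
  using comp_reduce[OF sw_nat[OF assms(1-6)], of k] assms by (auto simp: comp_assoc)

end

context symmetric_monoidal
begin

text \<open>The second hexagon in terms of \<open>sw\<close>: an exchange with a sum splits into
  exchanges with its two terms. The pentagons for \<open>y, x, w, z\<close> and
  \<open>x, w, y, z\<close> rebracket the two ends, the one for \<open>x, y, w, z\<close> moves the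
  inverse associator that \<open>s_tensor\<close> contains.\<close>

lemma sw_tensor:
  assumes x: "x \<in> Obj C" and w: "w \<in> Obj C" and y: "y \<in> Obj C" and z: "z \<in> Obj C"
  shows "(Id C y \<star> a (x, w, z)) \<cdot> sw (x \<uplus> w) y z
    = sw x y (w \<uplus> z) \<cdot> ((Id C x \<star> sw w y z) \<cdot> a (x, w, y \<uplus> z))"
proof (rule cancel_right[where f="a (x \<uplus> w, y, z)"])
  have s1: "s (x \<uplus> w, y) \<star> Id C z = (a (y, x, w) \<star> Id C z) \<cdot> (((s (x, y) \<star> Id C w) \<star> Id C z) \<cdot>
     ((arr_inv (a (x, y, w)) \<star> Id C z) \<cdot> (((Id C x \<star> s (w, y)) \<star> Id C z) \<cdot> (a (x, w, y) \<star> Id C z))))"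
    using x w y z s_tensor[of x w y] by (simp add: merge)
  have p1: "(Id C x \<star> a (y, w, z)) \<cdot> a (x, y \<uplus> w, z) =
      a (x, y, w \<uplus> z) \<cdot> (a (x \<uplus> y, w, z) \<cdot> (arr_inv (a (x, y, w)) \<star> Id C z))"
  proof (rule cancel_right[where f="a (x, y, w) \<star> Id C z"])
    show "((Id C x \<star> a (y, w, z)) \<cdot> a (x, y \<uplus> w, z)) \<cdot> (a (x, y, w) \<star> Id C z) =
      (a (x, y, w \<uplus> z) \<cdot> (a (x \<uplus> y, w, z) \<cdot> (arr_inv (a (x, y, w)) \<star> Id C z))) \<cdot> (a (x, y, w) \<star> Id C z)"
      using pentagon[of x y w z] x w y z by (simp add: comp_assoc interchange)
  qed (use x w y z in auto)
  let ?L = "(arr_inv (a (x, y, w)) \<star> Id C z) \<cdot> (((Id C x \<star> s (w, y)) \<star> Id C z) \<cdot> (a (x, w, y) \<star> Id C z))"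
  have "((Id C y \<star> a (x, w, z)) \<cdot> sw (x \<uplus> w) y z) \<cdot> a (x \<uplus> w, y, z)
    = (Id C y \<star> a (x, w, z)) \<cdot> (a (y, x \<uplus> w, z) \<cdot> (s (x \<uplus> w, y) \<star> Id C z))"
    using x w y z by (simp add: comp_assoc sw_a)
  also have "\<dots> = ((Id C y \<star> a (x, w, z)) \<cdot> (a (y, x \<uplus> w, z) \<cdot> (a (y, x, w) \<star> Id C z))) \<cdot>
      (((s (x, y) \<star> Id C w) \<star> Id C z) \<cdot> ?L)"
    unfolding s1 using x w y z by (simp add: comp_assoc)
  also have "\<dots> = (a (y, x, w \<uplus> z) \<cdot> a (y \<uplus> x, w, z)) \<cdot> (((s (x, y) \<star> Id C w) \<star> Id C z) \<cdot> ?L)"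
    using pentagon[of y x w z] x w y z by simp
  also have "\<dots> = a (y, x, w \<uplus> z) \<cdot> ((s (x, y) \<star> Id C (w \<uplus> z)) \<cdot> (a (x \<uplus> y, w, z) \<cdot> ?L))"
    using x w y z a_nat_tail[of "s (x, y)" "Id C w" "Id C z" "y \<uplus> x" w z "?L"] by (simp add: comp_assoc)
  also have "\<dots> = sw x y (w \<uplus> z) \<cdot> (a (x, y, w \<uplus> z) \<cdot> (a (x \<uplus> y, w, z) \<cdot> ?L))"
    using x w y z comp_reduce[OF sw_a[of x y "w \<uplus> z"], of "a (x \<uplus> y, w, z) \<cdot> ?L"] by (simp add: comp_assoc)
  also have "\<dots> = sw x y (w \<uplus> z) \<cdot> ((a (x, y, w \<uplus> z) \<cdot> (a (x \<uplus> y, w, z) \<cdot> (arr_inv (a (x, y, w)) \<star> Id C z)))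
     \<cdot> (((Id C x \<star> s (w, y)) \<star> Id C z) \<cdot> (a (x, w, y) \<star> Id C z)))"
    using x w y z by (simp add: comp_assoc)
  also have "\<dots> = sw x y (w \<uplus> z) \<cdot> ((Id C x \<star> a (y, w, z)) \<cdot> (a (x, y \<uplus> w, z)
     \<cdot> (((Id C x \<star> s (w, y)) \<star> Id C z) \<cdot> (a (x, w, y) \<star> Id C z))))"
    unfolding p1[symmetric] using x w y z by (simp add: comp_assoc)
  also have "\<dots> = sw x y (w \<uplus> z) \<cdot> ((Id C x \<star> a (y, w, z)) \<cdot> ((Id C x \<star> (s (w, y) \<star> Id C z)) \<cdot>
      (a (x, w \<uplus> y, z) \<cdot> (a (x, w, y) \<star> Id C z))))"
    using x w y z by (simp add: a_nat_tail)
  also have "\<dots> = sw x y (w \<uplus> z) \<cdot> ((Id C x \<star> (a (y, w, z) \<cdot> (s (w, y) \<star> Id C z))) \<cdot>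
      (a (x, w \<uplus> y, z) \<cdot> (a (x, w, y) \<star> Id C z)))"
    using x w y z by (simp add: interchange_tail)
  also have "\<dots> = sw x y (w \<uplus> z) \<cdot> ((Id C x \<star> sw w y z) \<cdot> ((Id C x \<star> a (w, y, z)) \<cdot>
      (a (x, w \<uplus> y, z) \<cdot> (a (x, w, y) \<star> Id C z))))"
    using x w y z by (simp add: interchange_tail sw_a)
  also have "\<dots> = sw x y (w \<uplus> z) \<cdot> ((Id C x \<star> sw w y z) \<cdot> (a (x, w, y \<uplus> z) \<cdot> a (x \<uplus> w, y, z)))"
    using pentagon[of x w y z] x w y z by simp
  also have "\<dots> = (sw x y (w \<uplus> z) \<cdot> ((Id C x \<star> sw w y z) \<cdot> a (x, w, y \<uplus> z))) \<cdot> a (x \<uplus> w, y, z)"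
    using x w y z by (simp add: comp_assoc)
  finally show "((Id C y \<star> a (x, w, z)) \<cdot> sw (x \<uplus> w) y z) \<cdot> a (x \<uplus> w, y, z) = \<dots>" .
qed (use x w y z in auto)

text \<open>An exchange inside the left part of a sum agrees with the exchange in the right-nested
  sum. It is needed when an index passes the head of a list in \<open>mul_insort\<close>.\<close>

lemma sw_assoc:
  assumes x: "x \<in> Obj C" and y: "y \<in> Obj C" and z: "z \<in> Obj C" and w: "w \<in> Obj C"
  shows "(Id C y \<star> a (x, z, w)) \<cdot> (a (y, x \<uplus> z, w) \<cdot> (sw x y z \<star> Id C w))
    = sw x y (z \<uplus> w) \<cdot> ((Id C x \<star> a (y, z, w)) \<cdot> a (x, y \<uplus> z, w))"
proof (rule cancel_right[where f="a (x, y, z) \<star> Id C w"])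
  have "((Id C y \<star> a (x, z, w)) \<cdot> (a (y, x \<uplus> z, w) \<cdot> (sw x y z \<star> Id C w))) \<cdot> (a (x, y, z) \<star> Id C w)
    = (Id C y \<star> a (x, z, w)) \<cdot> (a (y, x \<uplus> z, w) \<cdot> ((sw x y z \<cdot> a (x, y, z)) \<star> Id C w))"
    using assms by (simp add: comp_assoc interchange)
  also have "\<dots> = (Id C y \<star> a (x, z, w)) \<cdot> (a (y, x \<uplus> z, w) \<cdot> ((a (y, x, z) \<star> Id C w) \<cdot> ((s (x, y) \<star> Id C z) \<star> Id C w)))"
    using assms by (simp add: sw_a interchange)
  also have "\<dots> = ((Id C y \<star> a (x, z, w)) \<cdot> (a (y, x \<uplus> z, w) \<cdot> (a (y, x, z) \<star> Id C w))) \<cdot> ((s (x, y) \<star> Id C z) \<star> Id C w)"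
    using assms by (simp add: comp_assoc)
  also have "\<dots> = a (y, x, z \<uplus> w) \<cdot> (a (y \<uplus> x, z, w) \<cdot> ((s (x, y) \<star> Id C z) \<star> Id C w))"
    unfolding pentagon[OF y x z w, symmetric] using assms by (simp add: comp_assoc)
  also have "\<dots> = a (y, x, z \<uplus> w) \<cdot> ((s (x, y) \<star> Id C (z \<uplus> w)) \<cdot> a (x \<uplus> y, z, w))"
    using assms by (simp add: a_nat)
  also have "\<dots> = sw x y (z \<uplus> w) \<cdot> (a (x, y, z \<uplus> w) \<cdot> a (x \<uplus> y, z, w))"
    using assms comp_reduce[OF sw_a[of x y "z \<uplus> w"], of "a (x \<uplus> y, z, w)"] by (simp add: comp_assoc)
  also have "\<dots> = (sw x y (z \<uplus> w) \<cdot> ((Id C x \<star> a (y, z, w)) \<cdot> a (x, y \<uplus> z, w))) \<cdot> (a (x, y, z) \<star> Id C w)"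
    using assms pentagon[of x y z w] by (simp add: comp_assoc)
  finally show "((Id C y \<star> a (x, z, w)) \<cdot> (a (y, x \<uplus> z, w) \<cdot> (sw x y z \<star> Id C w))) \<cdot> (a (x, y, z) \<star> Id C w) = \<dots>" .
qed (use assms in auto)

text \<open>The braid relation. By \<open>sw_tensor\<close> both composites move \<open>z\<close>
  past the sum of \<open>x\<close> and \<open>y\<close>, so naturality of \<open>sw\<close> in
  \<open>s (x, y)\<close> identifies them.\<close>

lemma sw_braid:
  assumes x: "x \<in> Obj C" and y: "y \<in> Obj C" and z: "z \<in> Obj C" and w: "w \<in> Obj C"
  shows "(Id C z \<star> sw x y w) \<cdot> (sw x z (y \<uplus> w) \<cdot> (Id C x \<star> sw y z w))
    = sw y z (x \<uplus> w) \<cdot> ((Id C y \<star> sw x z w) \<cdot> sw x y (z \<uplus> w))"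
proof (rule cancel_right[where f="a (x, y, z \<uplus> w)"])
  have "((Id C z \<star> sw x y w) \<cdot> (sw x z (y \<uplus> w) \<cdot> (Id C x \<star> sw y z w))) \<cdot> a (x, y, z \<uplus> w)
    = (Id C z \<star> sw x y w) \<cdot> ((Id C z \<star> a (x, y, w)) \<cdot> sw (x \<uplus> y) z w)"
    using assms by (simp add: comp_assoc sw_tensor)
  also have "\<dots> = (Id C z \<star> a (y, x, w)) \<cdot> ((Id C z \<star> (s (x, y) \<star> Id C w)) \<cdot> sw (x \<uplus> y) z w)"
    using assms by (simp add: interchange_tail sw_a)
  also have "\<dots> = (Id C z \<star> a (y, x, w)) \<cdot> (sw (y \<uplus> x) z w \<cdot> (s (x, y) \<star> Id C (z \<uplus> w)))"
    using assms sw_nat[of "s (x, y)" "Id C z" "Id C w" "y \<uplus> x" z w] by simp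
  also have "\<dots> = ((Id C z \<star> a (y, x, w)) \<cdot> sw (y \<uplus> x) z w) \<cdot> (s (x, y) \<star> Id C (z \<uplus> w))"
    using assms by (simp add: comp_assoc)
  also have "\<dots> = sw y z (x \<uplus> w) \<cdot> ((Id C y \<star> sw x z w) \<cdot> (a (y, x, z \<uplus> w) \<cdot> (s (x, y) \<star> Id C (z \<uplus> w))))"
    unfolding sw_tensor[OF y x z w] using assms by (simp add: comp_assoc)
  also have "\<dots> = (sw y z (x \<uplus> w) \<cdot> ((Id C y \<star> sw x z w) \<cdot> sw x y (z \<uplus> w))) \<cdot> a (x, y, z \<uplus> w)"
    using assms by (simp add: comp_assoc sw_a)
  finally show "((Id C z \<star> sw x y w) \<cdot> (sw x z (y \<uplus> w) \<cdot> (Id C x \<star> sw y z w))) \<cdot> a (x, y, z \<uplus> w) = \<dots>" .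
qed (use assms in auto)

lemma sw_unit:
  assumes x: "x \<in> Obj C" and y: "y \<in> Obj C"
  shows "(Id C x \<star> l y) \<cdot> sw I x y = l (x \<uplus> y)"
proof (rule cancel_right[where f="a (I, x, y)"])
  have "((Id C x \<star> l y) \<cdot> sw I x y) \<cdot> a (I, x, y) = ((Id C x \<star> l y) \<cdot> a (x, I, y)) \<cdot> (s (I, x) \<star> Id C y)"
    using assms by (simp add: comp_assoc sw_a)
  also have "\<dots> = l x \<star> Id C y"
    using assms triangle[of x y] by (simp add: interchange r_s)
  also have "\<dots> = l (x \<uplus> y) \<cdot> a (I, x, y)"
    using assms by (simp add: l_tensor)
  finally show "((Id C x \<star> l y) \<cdot> sw I x y) \<cdot> a (I, x, y) = l (x \<uplus> y) \<cdot> a (I, x, y)" .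
qed (use assms in auto)


section \<open>Sums over finite sets\<close>

text \<open>The trailing unit matches the bracketing of \<open>big_osum\<close>, so that the
  coefficients of \<open>cauchy_prod\<close> are literally such sums.\<close>

definition suml :: "('i \<Rightarrow> 'o) \<Rightarrow> 'i list \<Rightarrow> 'o" where
  "suml u ks = foldr (\<lambda>k X. u k \<uplus> X) ks I"

lemma suml_simps [simp]: "suml u [] = I" "suml u (k # ks) = u k \<uplus> suml u ks"
  by (simp_all add: suml_def)

lemma suml_Obj [simp]: "(\<And>i. u i \<in> Obj C) ==> suml u ks \<in> Obj C"
  by (induction ks) auto

definition sumo :: "('i::linorder \<Rightarrow> 'o) \<Rightarrow> 'i set \<Rightarrow> 'o" where
  "sumo u S = suml u (sorted_list_of_set S)"

lemma sumo_Obj [simp]: "(\<And>i. u i \<in> Obj C) ==> sumo u S \<in> Obj C"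
  by (simp add: sumo_def)

lemma sumo_empty [simp]: "sumo u {} = I"
  by (simp add: sumo_def)

text \<open>Insertion sort on the level of arrows: the new summand moves to its place by successive
  adjacent exchanges. The comparison is the one of \<open>insort\<close>, so the codomain is the sum
  over \<open>insort k ks\<close>.\<close>

fun insl :: "('i::linorder \<Rightarrow> 'o) \<Rightarrow> 'i \<Rightarrow> 'i list \<Rightarrow> 'm" where
  "insl u k [] = Id C (u k \<uplus> I)"
| "insl u k (m # ms) = (if k \<le> m then Id C (u k \<uplus> u m \<uplus> suml u ms)
     else (Id C (u m) \<star> insl u k ms) \<cdot> sw (u k) (u m) (suml u ms))"

definition ins :: "('i::linorder \<Rightarrow> 'o) \<Rightarrow> 'i \<Rightarrow> 'i set \<Rightarrow> 'm" where
  "ins u k S = insl u k (sorted_list_of_set S)"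

lemma insl_Arr:
  assumes "\<And>i. u i \<in> Obj C"
  shows "insl u k ks \<in> Arr C \<and> Dom C (insl u k ks) = u k \<uplus> suml u ks \<and>
    Cod C (insl u k ks) = suml u (insort k ks) \<and> invertible C (insl u k ks)"
  using assms by (induction ks) auto

lemma insl_Arr' [simp]:
  assumes "\<And>i. u i \<in> Obj C"
  shows "insl u k ks \<in> Arr C" "Dom C (insl u k ks) = u k \<uplus> suml u ks"
    "Cod C (insl u k ks) = suml u (insort k ks)" "invertible C (insl u k ks)"
  using insl_Arr[of u, OF assms] by auto

lemma ins_Arr [simp]:
  assumes "\<And>i. u i \<in> Obj C"
  shows "ins u k S \<in> Arr C" "Dom C (ins u k S) = u k \<uplus> sumo u S"
    "finite S ==> k \<notin> S ==> Cod C (ins u k S) = sumo u (insert k S)" "invertible C (ins u k S)"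
  using assms by (auto simp: ins_def sumo_def)

text \<open>If both indices have to pass the head \<open>m\<close>, this is the braid relation. If
  \<open>j\<close> stops in front of \<open>m\<close>, the two exchanges of \<open>j\<close> and
  \<open>k\<close> on the right hand side cancel.\<close>

lemma insl_commute_less:
  assumes u: "\<And>i. u i \<in> Obj C" and "j < k"
  shows "insl u j (insort k ks) \<cdot> (Id C (u j) \<star> insl u k ks)
    = insl u k (insort j ks) \<cdot> ((Id C (u k) \<star> insl u j ks) \<cdot> sw (u j) (u k) (suml u ks))"
proof (induction ks)
  case Nil
  show ?case using u assms(2) by (auto simp: comp_assoc)
next
  case (Cons m ms)
  show ?case
  proof (cases "j \<le> m")
    case True
    then show ?thesis using u assms(2) by (auto simp: comp_assoc)
  next
    case False
    then have jm: "\<not> j \<le> m" "\<not> k \<le> m" using assms(2) by auto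
    have "insl u j (insort k (m # ms)) \<cdot> (Id C (u j) \<star> insl u k (m # ms))
      = (Id C (u m) \<star> insl u j (insort k ms)) \<cdot> (sw (u j) (u m) (suml u (insort k ms)) \<cdot>
         ((Id C (u j) \<star> Id C (u m) \<star> insl u k ms) \<cdot> (Id C (u j) \<star> sw (u k) (u m) (suml u ms))))"
      using u jm by (simp add: comp_assoc interchange del: tarr_Id)
    also have "\<dots> = (Id C (u m) \<star> (insl u j (insort k ms) \<cdot> (Id C (u j) \<star> insl u k ms))) \<cdot>
        (sw (u j) (u m) (u k \<uplus> suml u ms) \<cdot> (Id C (u j) \<star> sw (u k) (u m) (suml u ms)))"
      using u by (simp add: sw_nat_tail interchange_tail del: tarr_Id)
    also have "\<dots> = (Id C (u m) \<star> (insl u k (insort j ms) \<cdot> (Id C (u k) \<star> insl u j ms))) \<cdot>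
        ((Id C (u m) \<star> sw (u j) (u k) (suml u ms)) \<cdot>
        (sw (u j) (u m) (u k \<uplus> suml u ms) \<cdot> (Id C (u j) \<star> sw (u k) (u m) (suml u ms))))"
      using u unfolding Cons.IH by (simp add: interchange_tail comp_assoc)
    also have "\<dots> = (Id C (u m) \<star> (insl u k (insort j ms) \<cdot> (Id C (u k) \<star> insl u j ms))) \<cdot>
        (sw (u k) (u m) (u j \<uplus> suml u ms) \<cdot>
          ((Id C (u k) \<star> sw (u j) (u m) (suml u ms)) \<cdot> sw (u j) (u k) (u m \<uplus> suml u ms)))"
      using u sw_braid[of "u j" "u k" "u m" "suml u ms"] by simp
    also have "\<dots> = (Id C (u m) \<star> insl u k (insort j ms)) \<cdot> ((Id C (u m) \<star> Id C (u k) \<star> insl u j ms) \<cdot>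
        (sw (u k) (u m) (u j \<uplus> suml u ms) \<cdot>
          ((Id C (u k) \<star> sw (u j) (u m) (suml u ms)) \<cdot> sw (u j) (u k) (u m \<uplus> suml u ms))))"
      using u by (simp add: interchange_tail del: tarr_Id)
    also have "\<dots> = (Id C (u m) \<star> insl u k (insort j ms)) \<cdot> (sw (u k) (u m) (suml u (insort j ms)) \<cdot>
         ((Id C (u k) \<star> Id C (u m) \<star> insl u j ms) \<cdot>
          ((Id C (u k) \<star> sw (u j) (u m) (suml u ms)) \<cdot> sw (u j) (u k) (u m \<uplus> suml u ms))))"
      using u by (simp add: sw_nat_tail del: tarr_Id)
    also have "\<dots> = insl u k (insort j (m # ms)) \<cdot> ((Id C (u k) \<star> insl u j (m # ms)) \<cdot> sw (u j) (u k) (suml u (m # ms)))"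
      using u jm by (simp add: comp_assoc interchange_tail del: tarr_Id)
    finally show ?thesis .
  qed
qed

lemma insl_commute:
  assumes u: "\<And>i. u i \<in> Obj C" and "j \<noteq> k"
  shows "insl u j (insort k ks) \<cdot> (Id C (u j) \<star> insl u k ks)
    = insl u k (insort j ks) \<cdot> ((Id C (u k) \<star> insl u j ks) \<cdot> sw (u j) (u k) (suml u ks))"
proof (cases "j < k")
  case False
  with assms have "k < j" by simp
  note * = insl_commute_less[of u, OF u this, of ks]
  have "insl u k (insort j ks) \<cdot> ((Id C (u k) \<star> insl u j ks) \<cdot> sw (u j) (u k) (suml u ks))
    = (insl u k (insort j ks) \<cdot> (Id C (u k) \<star> insl u j ks)) \<cdot> sw (u j) (u k) (suml u ks)"
    using u by (simp add: comp_assoc insort_left_comm)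
  also have "\<dots> = insl u j (insort k ks) \<cdot> (Id C (u j) \<star> insl u k ks)"
    unfolding * using u by (simp add: comp_assoc)
  finally show ?thesis ..
qed (use insl_commute_less[of u, OF u] in auto)

lemma ins_commute:
  assumes u: "\<And>i. u i \<in> Obj C" and "finite S" "j \<notin> S" "k \<notin> S" "j \<noteq> k"
  shows "ins u j (insert k S) \<cdot> (Id C (u j) \<star> ins u k S)
    = ins u k (insert j S) \<cdot> ((Id C (u k) \<star> ins u j S) \<cdot> sw (u j) (u k) (sumo u S))"
  using insl_commute[of u, OF u assms(5), of "sorted_list_of_set S"] assms
  by (simp add: ins_def sumo_def)

text \<open>\<open>mu u S T\<close> merges the sums over two disjoint index sets; like \<open>ins\<close>, it permutes the summands
  so that indices increase.\<close>

fun mul :: "('i::linorder \<Rightarrow> 'o) \<Rightarrow> 'i list \<Rightarrow> 'i set \<Rightarrow> 'm" where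
  "mul u [] T' = l (sumo u T')"
| "mul u (k # ks) T' = ins u k (set ks \<union> T') \<cdot> ((Id C (u k) \<star> mul u ks T') \<cdot> a (u k, suml u ks, sumo u T'))"

definition mu :: "('i::linorder \<Rightarrow> 'o) \<Rightarrow> 'i set \<Rightarrow> 'i set \<Rightarrow> 'm" where
  "mu u S T' = mul u (sorted_list_of_set S) T'"

lemma mul_Arr:
  assumes u: "\<And>i. u i \<in> Obj C" and "finite T'"
  shows "distinct ks ==> set ks \<inter> T' = {} ==> mul u ks T' \<in> Arr C \<and> Dom C (mul u ks T') = suml u ks \<uplus> sumo u T' \<and>
    Cod C (mul u ks T') = sumo u (set ks \<union> T') \<and> invertible C (mul u ks T')"
  using u assms(2) by (induction ks) auto

lemma mu_Arr [simp]:
  assumes u: "\<And>i. u i \<in> Obj C" and "finite S" "finite T'" "S \<inter> T' = {}"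
  shows "mu u S T' \<in> Arr C" "Dom C (mu u S T') = sumo u S \<uplus> sumo u T'"
    "Cod C (mu u S T') = sumo u (S \<union> T')" "invertible C (mu u S T')"
  using mul_Arr[of u T' "sorted_list_of_set S"] assms by (auto simp: mu_def sumo_def)

lemma mu_empty [simp]: "mu u {} T' = l (sumo u T')"
  by (simp add: mu_def)

text \<open>The recursion of \<open>mul\<close> peels off the first index only; an induction over
  finite sets has to peel off an arbitrary one. Passing the head \<open>m\<close> uses
  \<open>ins_commute\<close> for the two insertions and \<open>sw_assoc\<close> for the
  brackets.\<close>

lemma mul_insort:
  assumes u: "\<And>i. u i \<in> Obj C" and T': "finite T'" and k: "k \<notin> T'"
  shows "distinct ks ==> k \<notin> set ks ==> set ks \<inter> T' = {} ==>
    mul u (insort k ks) T' \<cdot> (insl u k ks \<star> Id C (sumo u T'))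
    = ins u k (set ks \<union> T') \<cdot> ((Id C (u k) \<star> mul u ks T') \<cdot> a (u k, suml u ks, sumo u T'))"
proof (induction ks)
  case Nil
  then show ?case using u T' k by (simp add: comp_assoc)
next
  case (Cons m ms)
  show ?case
  proof (cases "k \<le> m")
    case True
    then show ?thesis using u T' k Cons.prems mul_Arr[of u T' ms] by (simp add: comp_assoc)
  next
    case False
    have mA [simp]: "mul u ms T' \<in> Arr C" "Dom C (mul u ms T') = suml u ms \<uplus> sumo u T'"
      "Cod C (mul u ms T') = sumo u (set ms \<union> T')"
      using mul_Arr[of u T' ms] u T' Cons.prems by auto
    have mB [simp]: "mul u (insort k ms) T' \<in> Arr C" "Dom C (mul u (insort k ms) T') = suml u (insort k ms) \<uplus> sumo u T'"
      "Cod C (mul u (insort k ms) T') = sumo u (insert k (set ms \<union> T'))"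
      using mul_Arr[of u T' "insort k ms"] u T' k Cons.prems by (auto simp: distinct_insort set_insort_key)
    have f: "finite (set ms \<union> T')" "k \<notin> set ms \<union> T'" "m \<notin> set ms \<union> T'" "k \<noteq> m" using T' k Cons.prems by auto
    have IH: "mul u (insort k ms) T' \<cdot> (insl u k ms \<star> Id C (sumo u T'))
    = ins u k (set ms \<union> T') \<cdot> ((Id C (u k) \<star> mul u ms T') \<cdot> a (u k, suml u ms, sumo u T'))"
      using Cons by simp
    let ?Z = "suml u ms \<uplus> sumo u T'"
    have "mul u (insort k (m # ms)) T' \<cdot> (insl u k (m # ms) \<star> Id C (sumo u T'))
      = ins u m (insert k (set ms \<union> T')) \<cdot> ((Id C (u m) \<star> mul u (insort k ms) T') \<cdot>
         (a (u m, suml u (insort k ms), sumo u T') \<cdot> (((Id C (u m) \<star> insl u k ms) \<star> Id C (sumo u T')) \<cdot>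
            (sw (u k) (u m) (suml u ms) \<star> Id C (sumo u T')))))"
      using u f False T' Cons.prems by (simp add: comp_assoc interchange set_insort_key)
    also have "\<dots> = ins u m (insert k (set ms \<union> T')) \<cdot> ((Id C (u m) \<star> (mul u (insort k ms) T' \<cdot> (insl u k ms \<star> Id C (sumo u T')))) \<cdot>
         (a (u m, u k \<uplus> suml u ms, sumo u T') \<cdot> (sw (u k) (u m) (suml u ms) \<star> Id C (sumo u T'))))"
      using u by (simp add: a_nat_tail interchange_tail)
    also have "\<dots> = (ins u m (insert k (set ms \<union> T')) \<cdot> (Id C (u m) \<star> ins u k (set ms \<union> T'))) \<cdot> ((Id C (u m) \<star> Id C (u k) \<star> mul u ms T') \<cdot>
         ((Id C (u m) \<star> a (u k, suml u ms, sumo u T')) \<cdot> (a (u m, u k \<uplus> suml u ms, sumo u T') \<cdot> (sw (u k) (u m) (suml u ms) \<star> Id C (sumo u T')))))"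
      unfolding IH using u f by (simp add: comp_assoc interchange_tail del: tarr_Id)
    also have "\<dots> = (ins u k (insert m (set ms \<union> T')) \<cdot> ((Id C (u k) \<star> ins u m (set ms \<union> T')) \<cdot> sw (u m) (u k) (sumo u (set ms \<union> T')))) \<cdot> ((Id C (u m) \<star> Id C (u k) \<star> mul u ms T') \<cdot>
         (sw (u k) (u m) ?Z \<cdot> ((Id C (u k) \<star> a (u m, suml u ms, sumo u T')) \<cdot> a (u k, u m \<uplus> suml u ms, sumo u T'))))"
      using u sw_assoc[of "u k" "u m" "suml u ms" "sumo u T'"]
        ins_commute[of u "set ms \<union> T'" m k, OF u f(1,3,2)] f(4) by simp
    also have "\<dots> = ins u k (insert m (set ms \<union> T')) \<cdot> ((Id C (u k) \<star> ins u m (set ms \<union> T')) \<cdot> (sw (u m) (u k) (sumo u (set ms \<union> T')) \<cdot> ((Id C (u m) \<star> Id C (u k) \<star> mul u ms T') \<cdot>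
         (sw (u k) (u m) ?Z \<cdot> ((Id C (u k) \<star> a (u m, suml u ms, sumo u T')) \<cdot> a (u k, u m \<uplus> suml u ms, sumo u T'))))))"
      using u f by (simp add: comp_assoc del: tarr_Id)
    also have "\<dots> = ins u k (insert m (set ms \<union> T')) \<cdot> ((Id C (u k) \<star> ins u m (set ms \<union> T')) \<cdot> ((Id C (u k) \<star> Id C (u m) \<star> mul u ms T') \<cdot>
         ((Id C (u k) \<star> a (u m, suml u ms, sumo u T')) \<cdot> a (u k, u m \<uplus> suml u ms, sumo u T'))))"
      using u f by (simp add: sw_nat_tail del: tarr_Id)
    also have "\<dots> = ins u k (set (m # ms) \<union> T') \<cdot> ((Id C (u k) \<star> mul u (m # ms) T') \<cdot> a (u k, suml u (m # ms), sumo u T'))"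
      using u f by (simp add: interchange_tail comp_assoc del: tarr_Id)
    finally show ?thesis .
  qed
qed

lemma mu_ins:
  assumes u: "\<And>i. u i \<in> Obj C" and "finite S" "finite T'" "S \<inter> T' = {}" "k \<notin> S" "k \<notin> T'"
  shows "mu u (insert k S) T' \<cdot> (ins u k S \<star> Id C (sumo u T'))
    = ins u k (S \<union> T') \<cdot> ((Id C (u k) \<star> mu u S T') \<cdot> a (u k, sumo u S, sumo u T'))"
  using mul_insort[of u T' k "sorted_list_of_set S"] assms by (simp add: mu_def ins_def sumo_def)

end

section \<open>Unit laws, symmetry and associativity of merging\<close>

context symmetric_monoidal
begin

lemma suml_cong: "(\<And>k. k \<in> set ks ==> u k = u' k) ==> suml u ks = suml u' ks"
  by (induction ks) auto

lemma sumo_cong: "finite S ==> (\<And>k. k \<in> S ==> u k = u' k) ==> sumo u S = sumo u' S"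
  unfolding sumo_def by (rule suml_cong) simp

lemma insl_cong: "u k = u' k ==> (\<And>m. m \<in> set ks ==> u m = u' m) ==> insl u k ks = insl u' k ks"
  by (induction ks) (auto cong: suml_cong)

lemma ins_cong: "finite S ==> u k = u' k ==> (\<And>m. m \<in> S ==> u m = u' m) ==> ins u k S = ins u' k S"
  unfolding ins_def by (rule insl_cong) auto

lemma mul_cong:
  assumes "finite A" "\<And>m. m \<in> A ==> u m = u' m"
  shows "(\<And>m. m \<in> set ks ==> u m = u' m) ==> mul u ks A = mul u' ks A"
proof (induction ks)
  case Nil
  then show ?case using assms sumo_cong[of A u u'] by simp
next
  case (Cons k ks)
  have "ins u k (set ks \<union> A) = ins u' k (set ks \<union> A)"
    by (rule ins_cong) (use assms Cons.prems in auto)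
  moreover have "suml u ks = suml u' ks" by (rule suml_cong) (use Cons.prems in auto)
  moreover have "sumo u A = sumo u' A" by (rule sumo_cong) (use assms in auto)
  ultimately show ?case using Cons by simp
qed

lemma mu_cong:
  "finite A ==> finite B ==> (\<And>m. m \<in> A ==> u m = u' m) ==> (\<And>m. m \<in> B ==> u m = u' m) ==> mu u A B = mu u' A B"
  unfolding mu_def by (rule mul_cong) auto

text \<open>Since \<open>ins\<close> is invertible, arrows out of a sum over
  \<open>insert k S\<close> may be compared after \<open>ins\<close>. With \<open>mu_ins\<close>
  this gives inductions over \<open>S\<close> in which \<open>k\<close> need not be the least
  index.\<close>

lemma mu_ins_cancel:
  assumes eq: "p \<cdot> (ins u k S \<star> Id C X) = q \<cdot> (ins u k S \<star> Id C X)"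
    and "\<And>i. u i \<in> Obj C" "finite S" "k \<notin> S" "X \<in> Obj C" "p \<in> Arr C" "q \<in> Arr C"
    "Dom C p = sumo u (insert k S) \<uplus> X" "Dom C q = sumo u (insert k S) \<uplus> X"
  shows "p = q"
  by (rule cancel_right[OF eq]) (use assms(2-) in auto)

lemma mu_right_empty [simp]:
  assumes u: "\<And>i. u i \<in> Obj C" and "finite S"
  shows "mu u S {} = r (sumo u S)"
  using assms(2)
proof induction
  case empty
  \<comment> \<open>The two unitors agree at the unit; this is again a consequence of Kelly's unit
    laws and not an axiom.\<close>
  have "l I = r I"
  proof (rule faithful_right)
    have "l I \<star> Id C I = l (I \<uplus> I) \<cdot> a (I, I, I)" by (simp add: l_tensor)
    also have "l (I \<uplus> I) = Id C I \<star> l I"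
      by (rule cancel_left[where f="l I"]) (use l_nat[of "l I" I] in auto)
    also have "(Id C I \<star> l I) \<cdot> a (I, I, I) = r I \<star> Id C I" by (simp add: triangle)
    finally show "l I \<star> Id C I = r I \<star> Id C I" .
  qed auto
  then show ?case by simp
next
  case (insert k S)
  show ?case
  proof (rule mu_ins_cancel[where k=k and S=S and X=I and u=u])
    have "mu u (insert k S) {} \<cdot> (ins u k S \<star> Id C I) = ins u k S \<cdot> ((Id C (u k) \<star> r (sumo u S)) \<cdot> a (u k, sumo u S, I))"
      using mu_ins[of u S "{}" k] u insert by simp
    also have "\<dots> = r (sumo u (insert k S)) \<cdot> (ins u k S \<star> Id C I)"
      using u insert by (simp add: r_tensor r_nat)
    finally show "mu u (insert k S) {} \<cdot> (ins u k S \<star> Id C I) = r (sumo u (insert k S)) \<cdot> (ins u k S \<star> Id C I)" .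
  qed (use u insert in auto)
qed

text \<open>The counterpart of \<open>mu_ins\<close> for the second index set. There
  \<open>k\<close> has to pass the whole sum over \<open>S\<close>, and \<open>sw_tensor\<close>
  splits this exchange along the induction on \<open>S\<close>.\<close>

lemma mu_ins_mid:
  assumes u: "\<And>i. u i \<in> Obj C" and "finite S" "finite A" "S \<inter> A = {}" "k \<notin> S" "k \<notin> A"
  shows "mu u S (insert k A) \<cdot> (Id C (sumo u S) \<star> ins u k A)
    = ins u k (S \<union> A) \<cdot> ((Id C (u k) \<star> mu u S A) \<cdot> sw (sumo u S) (u k) (sumo u A))"
  using assms(2,4,5)
proof induction
  case empty
  then show ?case using u assms(3,6) by (simp add: sw_unit l_nat)
next
  case (insert j S)
  have f: "finite A" "k \<notin> S" "j \<notin> A" "k \<noteq> j" "S \<inter> A = {}" "finite (S \<union> A)" using insert assms(3,6) by auto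
  note f = f insert.hyps assms(6)
  let ?K = "sumo u A"
  show ?case
  proof (rule mu_ins_cancel[where k=j and S=S and u=u and X="u k \<uplus> ?K"])
    have "(mu u (insert j S) (insert k A) \<cdot> (Id C (sumo u (insert j S)) \<star> ins u k A)) \<cdot> (ins u j S \<star> Id C (u k \<uplus> ?K))
     = mu u (insert j S) (insert k A) \<cdot> ((ins u j S \<star> Id C (sumo u (insert k A))) \<cdot> (Id C (u j \<uplus> sumo u S) \<star> ins u k A))"
      using u f by (simp add: comp_assoc interchange)
    also have "\<dots> = ins u j (S \<union> insert k A) \<cdot> ((Id C (u j) \<star> mu u S (insert k A)) \<cdot> (a (u j, sumo u S, sumo u (insert k A)) \<cdot> (Id C (u j \<uplus> sumo u S) \<star> ins u k A)))"
      using u f comp_reduce[OF mu_ins[of u S "insert k A" j], of "Id C (u j \<uplus> sumo u S) \<star> ins u k A"] by (simp add: comp_assoc)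
    also have "\<dots> = ins u j (S \<union> insert k A) \<cdot> ((Id C (u j) \<star> (mu u S (insert k A) \<cdot> (Id C (sumo u S) \<star> ins u k A))) \<cdot> a (u j, sumo u S, u k \<uplus> ?K))"
      using u f a_nat[of "Id C (u j)" "Id C (sumo u S)" "ins u k A" "u j" "sumo u S" "sumo u (insert k A)"] by (simp add: interchange_tail)
    also have "\<dots> = ins u j (S \<union> insert k A) \<cdot> ((Id C (u j) \<star> ins u k (S \<union> A)) \<cdot> ((Id C (u j) \<star> Id C (u k) \<star> mu u S A) \<cdot> ((Id C (u j) \<star> sw (sumo u S) (u k) ?K) \<cdot> a (u j, sumo u S, u k \<uplus> ?K))))"
      using u f insert.IH by (simp add: interchange_tail del: tarr_Id)
    also have "\<dots> = (ins u j (insert k (S \<union> A)) \<cdot> (Id C (u j) \<star> ins u k (S \<union> A))) \<cdot> ((Id C (u j) \<star> Id C (u k) \<star> mu u S A) \<cdot> ((Id C (u j) \<star> sw (sumo u S) (u k) ?K) \<cdot> a (u j, sumo u S, u k \<uplus> ?K)))"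
      using u f by (simp add: comp_assoc del: tarr_Id)
    also have "ins u j (insert k (S \<union> A)) \<cdot> (Id C (u j) \<star> ins u k (S \<union> A)) =
       ins u k (insert j (S \<union> A)) \<cdot> ((Id C (u k) \<star> ins u j (S \<union> A)) \<cdot> sw (u j) (u k) (sumo u (S \<union> A)))"
      by (rule ins_commute) (use u f in auto)
    also have "(ins u k (insert j (S \<union> A)) \<cdot> ((Id C (u k) \<star> ins u j (S \<union> A)) \<cdot> sw (u j) (u k) (sumo u (S \<union> A)))) \<cdot>
       ((Id C (u j) \<star> Id C (u k) \<star> mu u S A) \<cdot> ((Id C (u j) \<star> sw (sumo u S) (u k) ?K) \<cdot> a (u j, sumo u S, u k \<uplus> ?K)))
      = ins u k (insert j (S \<union> A)) \<cdot> ((Id C (u k) \<star> ins u j (S \<union> A)) \<cdot> (sw (u j) (u k) (sumo u (S \<union> A)) \<cdot>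
       ((Id C (u j) \<star> Id C (u k) \<star> mu u S A) \<cdot> ((Id C (u j) \<star> sw (sumo u S) (u k) ?K) \<cdot> a (u j, sumo u S, u k \<uplus> ?K)))))"
      using u f by (simp add: comp_assoc del: tarr_Id)
    also have "\<dots> = ins u k (insert j (S \<union> A)) \<cdot> ((Id C (u k) \<star> ins u j (S \<union> A)) \<cdot> ((Id C (u k) \<star> Id C (u j) \<star> mu u S A) \<cdot>
       (sw (u j) (u k) (sumo u S \<uplus> ?K) \<cdot> ((Id C (u j) \<star> sw (sumo u S) (u k) ?K) \<cdot> a (u j, sumo u S, u k \<uplus> ?K)))))"
      using u f by (simp add: sw_nat_tail del: tarr_Id)
    also have "\<dots> = ins u k (insert j (S \<union> A)) \<cdot> ((Id C (u k) \<star> ins u j (S \<union> A)) \<cdot> ((Id C (u k) \<star> Id C (u j) \<star> mu u S A) \<cdot>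
       ((Id C (u k) \<star> a (u j, sumo u S, ?K)) \<cdot> sw (u j \<uplus> sumo u S) (u k) ?K)))"
      using u f sw_tensor[of "u j" "sumo u S" "u k" ?K] by simp
    also have "\<dots> = ins u k (insert j (S \<union> A)) \<cdot> ((Id C (u k) \<star> (ins u j (S \<union> A) \<cdot> ((Id C (u j) \<star> mu u S A) \<cdot> a (u j, sumo u S, ?K)))) \<cdot> sw (u j \<uplus> sumo u S) (u k) ?K)"
      using u f by (simp add: interchange_tail)
    also have "ins u j (S \<union> A) \<cdot> ((Id C (u j) \<star> mu u S A) \<cdot> a (u j, sumo u S, ?K)) = mu u (insert j S) A \<cdot> (ins u j S \<star> Id C ?K)"
      using u f by (simp add: mu_ins)
    also have "ins u k (insert j (S \<union> A)) \<cdot> ((Id C (u k) \<star> (mu u (insert j S) A \<cdot> (ins u j S \<star> Id C ?K))) \<cdot> sw (u j \<uplus> sumo u S) (u k) ?K)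
      = ins u k (insert j (S \<union> A)) \<cdot> ((Id C (u k) \<star> mu u (insert j S) A) \<cdot> ((Id C (u k) \<star> ins u j S \<star> Id C ?K) \<cdot> sw (u j \<uplus> sumo u S) (u k) ?K))"
      using u f by (simp add: interchange_tail)
    also have "\<dots> = (ins u k (insert j S \<union> A) \<cdot> ((Id C (u k) \<star> mu u (insert j S) A) \<cdot> sw (sumo u (insert j S)) (u k) ?K)) \<cdot> (ins u j S \<star> Id C (u k \<uplus> ?K))"
      using u f sw_nat[of "ins u j S" "Id C (u k)" "Id C ?K" "sumo u (insert j S)" "u k" ?K] by (simp add: comp_assoc)
    finally show "(mu u (insert j S) (insert k A) \<cdot> (Id C (sumo u (insert j S)) \<star> ins u k A)) \<cdot> (ins u j S \<star> Id C (u k \<uplus> ?K)) = \<dots>" .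
  qed (use u f in auto)
qed

text \<open>Both sides sort the same summands. In the induction step the symmetry is split by the
  second hexagon \<open>s_tensor\<close>, and \<open>mu_ins_mid\<close> absorbs the exchange of
  \<open>k\<close> with the sum over \<open>A\<close>.\<close>

lemma mu_sym:
  assumes u: "\<And>i. u i \<in> Obj C" and "finite S" "finite A" "S \<inter> A = {}"
  shows "mu u A S \<cdot> s (sumo u S, sumo u A) = mu u S A"
  using assms(2,4)
proof induction
  case empty
  then show ?case using u assms(3) by (simp add: r_s)
next
  case (insert k S)
  have f: "finite A" "k \<notin> A" "S \<inter> A = {}" "A \<inter> S = {}" "A \<inter> insert k S = {}" "A \<union> S = S \<union> A" using insert assms by auto
  note f = f insert.hyps
  show ?case
  proof (rule mu_ins_cancel[where k=k and S=S and u=u and X="sumo u A"])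
    have "(mu u A (insert k S) \<cdot> s (sumo u (insert k S), sumo u A)) \<cdot> (ins u k S \<star> Id C (sumo u A))
      = (mu u A (insert k S) \<cdot> (Id C (sumo u A) \<star> ins u k S)) \<cdot> s (u k \<uplus> sumo u S, sumo u A)"
      using u f by (simp add: comp_assoc s_nat)
    also have "\<dots> = ins u k (S \<union> A) \<cdot> ((Id C (u k) \<star> mu u A S) \<cdot> (sw (sumo u A) (u k) (sumo u S) \<cdot> s (u k \<uplus> sumo u S, sumo u A)))"
      using mu_ins_mid[of u A S k, OF u] u f by (simp add: comp_assoc)
    also have "sw (sumo u A) (u k) (sumo u S) \<cdot> s (u k \<uplus> sumo u S, sumo u A) = (Id C (u k) \<star> s (sumo u S, sumo u A)) \<cdot> a (u k, sumo u S, sumo u A)"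
      using u f by (simp add: sw_def s_tensor[of "u k" "sumo u S" "sumo u A"] comp_assoc merge)
    also have "ins u k (S \<union> A) \<cdot> ((Id C (u k) \<star> mu u A S) \<cdot> ((Id C (u k) \<star> s (sumo u S, sumo u A)) \<cdot> a (u k, sumo u S, sumo u A)))
      = mu u (insert k S) A \<cdot> (ins u k S \<star> Id C (sumo u A))"
      using u f insert.IH by (simp add: interchange_tail mu_ins)
    finally show "(mu u A (insert k S) \<cdot> s (sumo u (insert k S), sumo u A)) \<cdot> (ins u k S \<star> Id C (sumo u A)) = \<dots>" .
  qed (use u f in auto)
qed

lemma mu_assoc:
  assumes u: "\<And>i. u i \<in> Obj C" and "finite S" "finite A" "finite B" "S \<inter> A = {}" "S \<inter> B = {}" "A \<inter> B = {}"
  shows "mu u (S \<union> A) B \<cdot> (mu u S A \<star> Id C (sumo u B)) = mu u S (A \<union> B) \<cdot> ((Id C (sumo u S) \<star> mu u A B) \<cdot> a (sumo u S, sumo u A, sumo u B))"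
  using assms(2,5,6)
proof induction
  case empty
  then show ?case using u assms l_nat_tail[of "mu u A B" "sumo u (A \<union> B)" "a (I, sumo u A, sumo u B)"]
    by (simp add: l_tensor)
next
  case (insert k S)
  have f: "finite A" "finite B" "k \<notin> A" "k \<notin> B" "S \<inter> A = {}" "S \<inter> B = {}" "S \<inter> (A \<union> B) = {}"
     "insert k S \<inter> (A \<union> B) = {}" "(S \<union> A) \<inter> B = {}" "insert k (S \<union> A) \<inter> B = {}"
    using insert assms by auto
  note f = f insert.hyps assms(7)
  show ?case
  proof (rule cancel_right[where f="(ins u k S \<star> Id C (sumo u A)) \<star> Id C (sumo u B)"])
    have "(mu u (insert k S \<union> A) B \<cdot> (mu u (insert k S) A \<star> Id C (sumo u B))) \<cdot> ((ins u k S \<star> Id C (sumo u A)) \<star> Id C (sumo u B))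
      = mu u (insert k (S \<union> A)) B \<cdot> ((ins u k (S \<union> A) \<star> Id C (sumo u B)) \<cdot> (((Id C (u k) \<star> mu u S A) \<cdot> a (u k, sumo u S, sumo u A)) \<star> Id C (sumo u B)))"
      using u f by (simp add: comp_assoc interchange mu_ins)
    also have "\<dots> = ins u k (S \<union> A \<union> B) \<cdot> ((Id C (u k) \<star> mu u (S \<union> A) B) \<cdot> (a (u k, sumo u (S \<union> A), sumo u B) \<cdot>
         (((Id C (u k) \<star> mu u S A) \<cdot> a (u k, sumo u S, sumo u A)) \<star> Id C (sumo u B))))"
      using u f comp_reduce[OF mu_ins[of u "S \<union> A" B k], of "((Id C (u k) \<star> mu u S A) \<cdot> a (u k, sumo u S, sumo u A)) \<star> Id C (sumo u B)"]
      by (simp add: comp_assoc)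
    also have "\<dots> = ins u k (S \<union> A \<union> B) \<cdot> ((Id C (u k) \<star> mu u (S \<union> A) B) \<cdot> (a (u k, sumo u (S \<union> A), sumo u B) \<cdot>
         (((Id C (u k) \<star> mu u S A) \<star> Id C (sumo u B)) \<cdot> (a (u k, sumo u S, sumo u A) \<star> Id C (sumo u B)))))"
      using u f by (simp add: interchange)
    also have "\<dots> = ins u k (S \<union> A \<union> B) \<cdot> ((Id C (u k) \<star> (mu u (S \<union> A) B \<cdot> (mu u S A \<star> Id C (sumo u B)))) \<cdot> (a (u k, sumo u S \<uplus> sumo u A, sumo u B) \<cdot>
         (a (u k, sumo u S, sumo u A) \<star> Id C (sumo u B))))"
      using u f by (simp add: a_nat_tail interchange_tail)
    also have "\<dots> = ins u k (S \<union> A \<union> B) \<cdot> ((Id C (u k) \<star> (mu u S (A \<union> B) \<cdot> (Id C (sumo u S) \<star> mu u A B))) \<cdot> ((Id C (u k) \<star> a (sumo u S, sumo u A, sumo u B)) \<cdot> (a (u k, sumo u S \<uplus> sumo u A, sumo u B) \<cdot>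
         (a (u k, sumo u S, sumo u A) \<star> Id C (sumo u B)))))"
      using u f insert.IH by (simp add: interchange_tail comp_assoc)
    also have "\<dots> = ins u k (S \<union> A \<union> B) \<cdot> ((Id C (u k) \<star> (mu u S (A \<union> B) \<cdot> (Id C (sumo u S) \<star> mu u A B))) \<cdot> (a (u k, sumo u S, sumo u A \<uplus> sumo u B) \<cdot> a (u k \<uplus> sumo u S, sumo u A, sumo u B)))"
      using u f by (simp add: pentagon)
    also have "\<dots> = ins u k (S \<union> A \<union> B) \<cdot> ((Id C (u k) \<star> mu u S (A \<union> B)) \<cdot> (a (u k, sumo u S, sumo u (A \<union> B)) \<cdot> ((Id C (u k \<uplus> sumo u S) \<star> mu u A B) \<cdot> a (u k \<uplus> sumo u S, sumo u A, sumo u B))))"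
      using u f a_nat_tail[of "Id C (u k)" "Id C (sumo u S)" "mu u A B" "u k" "sumo u S" "sumo u (A \<union> B)" "a (u k \<uplus> sumo u S, sumo u A, sumo u B)"]
      by (simp add: interchange_tail)
    also have "\<dots> = (ins u k (S \<union> (A \<union> B)) \<cdot> ((Id C (u k) \<star> mu u S (A \<union> B)) \<cdot> a (u k, sumo u S, sumo u (A \<union> B)))) \<cdot> ((Id C (u k \<uplus> sumo u S) \<star> mu u A B) \<cdot> a (u k \<uplus> sumo u S, sumo u A, sumo u B))"
      using u f by (simp add: comp_assoc Un_assoc)
    also have "\<dots> = (mu u (insert k S) (A \<union> B) \<cdot> (ins u k S \<star> Id C (sumo u (A \<union> B)))) \<cdot> ((Id C (u k \<uplus> sumo u S) \<star> mu u A B) \<cdot> a (u k \<uplus> sumo u S, sumo u A, sumo u B))"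
      using mu_ins[of u S "A \<union> B" k] u f by simp
    also have "\<dots> = mu u (insert k S) (A \<union> B) \<cdot> ((ins u k S \<star> mu u A B) \<cdot> a (u k \<uplus> sumo u S, sumo u A, sumo u B))"
      using u f by (simp add: comp_assoc interchange_tail)
    also have "\<dots> = mu u (insert k S) (A \<union> B) \<cdot> ((Id C (sumo u (insert k S)) \<star> mu u A B) \<cdot> ((ins u k S \<star> Id C (sumo u A \<uplus> sumo u B)) \<cdot> a (u k \<uplus> sumo u S, sumo u A, sumo u B)))"
      using u f by (simp add: interchange_tail)
    also have "\<dots> = (mu u (insert k S) (A \<union> B) \<cdot> ((Id C (sumo u (insert k S)) \<star> mu u A B) \<cdot> a (sumo u (insert k S), sumo u A, sumo u B))) \<cdot> ((ins u k S \<star> Id C (sumo u A)) \<star> Id C (sumo u B))"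
      using u f by (simp add: comp_assoc a_nat)
    finally show "(mu u (insert k S \<union> A) B \<cdot> (mu u (insert k S) A \<star> Id C (sumo u B))) \<cdot> ((ins u k S \<star> Id C (sumo u A)) \<star> Id C (sumo u B)) = \<dots>" .
  qed (use u f in auto)
qed

lemma mu_sw:
  assumes u: "\<And>i. u i \<in> Obj C" and f: "finite S" "finite A" "finite B" "S \<inter> A = {}" "S \<inter> B = {}" "A \<inter> B = {}"
  shows "mu u A (S \<union> B) \<cdot> ((Id C (sumo u A) \<star> mu u S B) \<cdot> sw (sumo u S) (sumo u A) (sumo u B))
    = mu u S (A \<union> B) \<cdot> (Id C (sumo u S) \<star> mu u A B)"
proof -
  have g: "A \<inter> S = {}" "A \<inter> (S \<union> B) = {}" "S \<inter> (A \<union> B) = {}" "(A \<union> S) \<inter> B = {}" "(S \<union> A) \<inter> B = {}" "A \<union> S = S \<union> A" using f by auto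
  note f = f g
  have h: "mu u A (S \<union> B) \<cdot> ((Id C (sumo u A) \<star> mu u S B) \<cdot> a (sumo u A, sumo u S, sumo u B))
    = mu u (S \<union> A) B \<cdot> (mu u A S \<star> Id C (sumo u B))"
    using u f mu_assoc[of u A S B] by simp
  have "(mu u A (S \<union> B) \<cdot> ((Id C (sumo u A) \<star> mu u S B) \<cdot> sw (sumo u S) (sumo u A) (sumo u B))) \<cdot> a (sumo u S, sumo u A, sumo u B)
    = (mu u A (S \<union> B) \<cdot> ((Id C (sumo u A) \<star> mu u S B) \<cdot> a (sumo u A, sumo u S, sumo u B))) \<cdot> (s (sumo u S, sumo u A) \<star> Id C (sumo u B))"
    using u f by (simp add: comp_assoc sw_a)
  also have "\<dots> = mu u (S \<union> A) B \<cdot> ((mu u A S \<star> Id C (sumo u B)) \<cdot> (s (sumo u S, sumo u A) \<star> Id C (sumo u B)))"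
    unfolding h using u f by (simp add: comp_assoc)
  also have "\<dots> = mu u (S \<union> A) B \<cdot> (mu u S A \<star> Id C (sumo u B))"
    using u f mu_sym[of u S A] by (simp add: interchange)
  also have "\<dots> = (mu u S (A \<union> B) \<cdot> (Id C (sumo u S) \<star> mu u A B)) \<cdot> a (sumo u S, sumo u A, sumo u B)"
    using u f mu_assoc[of u S A B] by (simp add: comp_assoc)
  finally show ?thesis
    by (rule cancel_right[where f="a (sumo u S, sumo u A, sumo u B)"]) (use u f in auto)
qed

end

section \<open>Block maps of a strong symmetric monoidal functor\<close>

context symmetric_monoidal
begin

text \<open>The sum over one index is \<open>u k\<close> followed by the trailing unit of the
  bracketing, so even the passage from a summand to the sum over its index is a nontrivial
  arrow.\<close>

definition unit :: "('i::linorder \<Rightarrow> 'o) \<Rightarrow> 'i \<Rightarrow> 'm" where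
  "unit u k = arr_inv (r (u k))"

lemma sumo_single [simp]: "sumo u {k} = u k \<uplus> I"
  by (simp add: sumo_def)

lemma unit_Arr [simp]:
  assumes "\<And>i. u i \<in> Obj C"
  shows "unit u k \<in> Arr C" "Dom C (unit u k) = u k" "Cod C (unit u k) = u k \<uplus> I" "invertible C (unit u k)"
  using assms by (auto simp: unit_def)

text \<open>\<open>p0\<close> and \<open>p2\<close> stand for the comparison arrows of a monoidal
  functor. They are arguments, so that block maps of different functors can occur in one
  equation.\<close>

fun blkl :: "'m \<Rightarrow> ('o \<times> 'o \<Rightarrow> 'm) \<Rightarrow> ('i \<Rightarrow> 'o) \<Rightarrow> ('j::linorder \<Rightarrow> 'o) \<Rightarrow> ('i \<Rightarrow> 'j set) \<Rightarrow> ('i \<Rightarrow> 'm) \<Rightarrow> 'i list \<Rightarrow> 'm" where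
  "blkl p0 p2 u v G g [] = p0"
| "blkl p0 p2 u v G g (k # ks) =
    mu v (G k) (\<Union>(G ` set ks)) \<cdot> ((g k \<star> blkl p0 p2 u v G g ks) \<cdot> p2 (u k, suml u ks))"

definition blk :: "'m \<Rightarrow> ('o \<times> 'o \<Rightarrow> 'm) \<Rightarrow> ('i::linorder \<Rightarrow> 'o) \<Rightarrow> ('j::linorder \<Rightarrow> 'o) \<Rightarrow> ('i \<Rightarrow> 'j set) \<Rightarrow> ('i \<Rightarrow> 'm) \<Rightarrow> 'i set \<Rightarrow> 'm" where
  "blk p0 p2 u v G g S = blkl p0 p2 u v G g (sorted_list_of_set S)"

lemma blk_empty [simp]: "blk p0 p2 u v G g {} = p0"
  by (simp add: blk_def)

lemma blkl_cong:
  assumes "\<And>k. k \<in> set ks ==> u k = u' k" "\<And>k. k \<in> set ks ==> finite (G k)"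
    "\<And>k j. k \<in> set ks ==> j \<in> G k ==> v j = v' j"
    "\<And>k. k \<in> set ks ==> G k = G' k" "\<And>k. k \<in> set ks ==> g k = g' k"
  shows "blkl p0 p2 u v G g ks = blkl p0 p2 u' v' G' g' ks"
  using assms
proof (induction ks)
  case (Cons k ks)
  have "suml u ks = suml u' ks" by (rule suml_cong) (use Cons.prems in auto)
  moreover have "mu v (G k) (\<Union>(G ` set ks)) = mu v' (G k) (\<Union>(G ` set ks))"
    by (rule mu_cong) (use Cons.prems in auto)
  moreover have "\<Union>(G ` set ks) = \<Union>(G' ` set ks)" using Cons.prems by auto
  moreover have "blkl p0 p2 u v G g ks = blkl p0 p2 u' v' G' g' ks"
    by (rule Cons.IH) (use Cons.prems in auto)
  ultimately show ?case using Cons.prems by simp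
qed simp

lemma blk_cong:
  assumes "finite S" "\<And>k. k \<in> S ==> u k = u' k" "\<And>k. k \<in> S ==> finite (G k)"
    "\<And>k j. k \<in> S ==> j \<in> G k ==> v j = v' j"
    "\<And>k. k \<in> S ==> G k = G' k" "\<And>k. k \<in> S ==> g k = g' k"
  shows "blk p0 p2 u v G g S = blk p0 p2 u' v' G' g' S"
  unfolding blk_def by (rule blkl_cong) (use assms in auto)

text \<open>A block map sends the summand \<open>Fo (u k)\<close> to the part of the sum of \<open>v\<close> indexed by \<open>G k\<close>.\<close>

definition block :: "('o \<Rightarrow> 'o) \<Rightarrow> ('i \<Rightarrow> 'o) \<Rightarrow> ('j::linorder \<Rightarrow> 'o) \<Rightarrow> ('i \<Rightarrow> 'j set) \<Rightarrow> ('i \<Rightarrow> 'm) \<Rightarrow> 'i set \<Rightarrow> bool" where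
  "block Fo u v G g S \<longleftrightarrow> finite S \<and> (\<forall>i. u i \<in> Obj C) \<and> (\<forall>j. v j \<in> Obj C) \<and>
    (\<forall>k\<in>S. finite (G k) \<and> g k \<in> Arr C \<and> Dom C (g k) = Fo (u k) \<and> Cod C (g k) = sumo v (G k)) \<and>
    (\<forall>k\<in>S. \<forall>m\<in>S. k \<noteq> m \<longrightarrow> G k \<inter> G m = {})"

lemma blockI:
  assumes "finite S" "\<And>i. u i \<in> Obj C" "\<And>j. v j \<in> Obj C" "\<And>k. k \<in> S ==> finite (G k)" "\<And>k. k \<in> S ==> g k \<in> Arr C"
    "\<And>k. k \<in> S ==> Dom C (g k) = Fo (u k)" "\<And>k. k \<in> S ==> Cod C (g k) = sumo v (G k)"
    "\<And>k m. k \<in> S ==> m \<in> S ==> k \<noteq> m ==> G k \<inter> G m = {}"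
  shows "block Fo u v G g S"
  using assms by (auto simp: block_def)

lemma blockD:
  assumes "block Fo u v G g S"
  shows "finite S" "u i \<in> Obj C" "v j \<in> Obj C" "k \<in> S ==> finite (G k)" "k \<in> S ==> g k \<in> Arr C"
    "k \<in> S ==> Dom C (g k) = Fo (u k)" "k \<in> S ==> Cod C (g k) = sumo v (G k)"
    "k \<in> S ==> m \<in> S ==> k \<noteq> m ==> G k \<inter> G m = {}"
  using assms by (auto simp: block_def)

lemma block_subset:
  assumes "block Fo u v G g S" "S' \<subseteq> S"
  shows "block Fo u v G g S'"
  using assms unfolding block_def by (blast dest: finite_subset)

end

text \<open>A strong symmetric monoidal endofunctor. The comparison \<open>p2\<close> points from
  the image of a sum to the sum of the images, and \<open>p0\<close> from the image of the unit to
  the unit: these are the directions of the distributors and of \<open>nl\<close>,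
  \<open>nr\<close>.\<close>

locale symmetric_functor = symmetric_monoidal C T I a l r s
  for C :: "('o, 'm, 'x) cat_scheme" (structure) and T I a l r s +
  fixes Fo :: "'o \<Rightarrow> 'o" and Fa :: "'m \<Rightarrow> 'm" and p0 :: 'm and p2 :: "'o \<times> 'o \<Rightarrow> 'm"
  assumes Fo_Obj [simp]: "x \<in> Obj C ==> Fo x \<in> Obj C"
    and Fa_Arr [simp]: "f \<in> Arr C ==> Fa f \<in> Arr C" "f \<in> Arr C ==> Dom C (Fa f) = Fo (Dom C f)"
      "f \<in> Arr C ==> Cod C (Fa f) = Fo (Cod C f)"
    and Fa_Id [simp]: "x \<in> Obj C ==> Fa (Id C x) = Id C (Fo x)"
    and Fa_comp: "f \<in> Arr C ==> g \<in> Arr C ==> Dom C g = Cod C f ==> Fa (g \<cdot> f) = Fa g \<cdot> Fa f"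
    and p0_Arr [simp]: "p0 \<in> Arr C" "Dom C p0 = Fo I" "Cod C p0 = I" "invertible C p0"
    and p2_Arr [simp]: "x \<in> Obj C ==> y \<in> Obj C ==> p2 (x, y) \<in> Arr C"
      "x \<in> Obj C ==> y \<in> Obj C ==> Dom C (p2 (x, y)) = Fo (x \<odot>\<^bsub>T\<^esub> y)"
      "x \<in> Obj C ==> y \<in> Obj C ==> Cod C (p2 (x, y)) = Fo x \<odot>\<^bsub>T\<^esub> Fo y"
      "x \<in> Obj C ==> y \<in> Obj C ==> invertible C (p2 (x, y))"
    and p2_nat: "f \<in> Arr C ==> g \<in> Arr C ==> Cod C f = x' ==> Cod C g = y' ==>
      p2 (x', y') \<cdot> Fa (f \<boxdot>\<^bsub>T\<^esub> g) = (Fa f \<boxdot>\<^bsub>T\<^esub> Fa g) \<cdot> p2 (Dom C f, Dom C g)"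
    and p2_a: "x \<in> Obj C ==> y \<in> Obj C ==> z \<in> Obj C ==>
      a (Fo x, Fo y, Fo z) \<cdot> ((p2 (x, y) \<boxdot>\<^bsub>T\<^esub> Id C (Fo z)) \<cdot> p2 (x \<odot>\<^bsub>T\<^esub> y, z))
      = (Id C (Fo x) \<boxdot>\<^bsub>T\<^esub> p2 (y, z)) \<cdot> (p2 (x, y \<odot>\<^bsub>T\<^esub> z) \<cdot> Fa (a (x, y, z)))"
    and p2_s: "x \<in> Obj C ==> y \<in> Obj C ==> s (Fo x, Fo y) \<cdot> p2 (x, y) = p2 (y, x) \<cdot> Fa (s (x, y))"
    and p2_l: "y \<in> Obj C ==> l (Fo y) \<cdot> ((p0 \<boxdot>\<^bsub>T\<^esub> Id C (Fo y)) \<cdot> p2 (I, y)) = Fa (l y)"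
    and p2_r: "y \<in> Obj C ==> r (Fo y) \<cdot> ((Id C (Fo y) \<boxdot>\<^bsub>T\<^esub> p0) \<cdot> p2 (y, I)) = Fa (r y)"
begin

lemma p2_nat_tail:
  assumes "f \<in> Arr C" "g \<in> Arr C" "Cod C f = x'" "Cod C g = y'" "k \<in> Arr C" "Cod C k = Fo (Dom C f \<uplus> Dom C g)"
  shows "p2 (x', y') \<cdot> (Fa (f \<star> g) \<cdot> k) = (Fa f \<star> Fa g) \<cdot> (p2 (Dom C f, Dom C g) \<cdot> k)"
  using comp_reduce[OF p2_nat[OF assms(1-4)], of k] assms by (auto simp: comp_assoc)

lemma invertible_Fa [simp]: "f \<in> Arr C ==> invertible C f ==> invertible C (Fa f)"
  by (rule invertibleI[where g="Fa (arr_inv f)"]) (auto simp: Fa_comp[symmetric])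

lemma p2_sw:
  assumes x: "x \<in> Obj C" and y: "y \<in> Obj C" and z: "z \<in> Obj C"
  shows "(Id C (Fo y) \<star> p2 (x, z)) \<cdot> (p2 (y, x \<uplus> z) \<cdot> Fa (sw x y z))
    = sw (Fo x) (Fo y) (Fo z) \<cdot> ((Id C (Fo x) \<star> p2 (y, z)) \<cdot> p2 (x, y \<uplus> z))"
proof (rule cancel_right[where f="Fa (a (x, y, z))"])
  have "((Id C (Fo y) \<star> p2 (x, z)) \<cdot> (p2 (y, x \<uplus> z) \<cdot> Fa (sw x y z))) \<cdot> Fa (a (x, y, z))
    = (Id C (Fo y) \<star> p2 (x, z)) \<cdot> (p2 (y, x \<uplus> z) \<cdot> Fa (sw x y z \<cdot> a (x, y, z)))"
    using assms by (simp add: comp_assoc Fa_comp)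
  also have "\<dots> = ((Id C (Fo y) \<star> p2 (x, z)) \<cdot> (p2 (y, x \<uplus> z) \<cdot> Fa (a (y, x, z)))) \<cdot> Fa (s (x, y) \<star> Id C z)"
    using assms by (simp add: sw_a Fa_comp comp_assoc)
  also have "\<dots> = a (Fo y, Fo x, Fo z) \<cdot> ((p2 (y, x) \<star> Id C (Fo z)) \<cdot> (p2 (y \<uplus> x, z) \<cdot> Fa (s (x, y) \<star> Id C z)))"
    unfolding p2_a[OF y x z, symmetric] using assms by (simp add: comp_assoc)
  also have "\<dots> = a (Fo y, Fo x, Fo z) \<cdot> ((s (Fo x, Fo y) \<star> Id C (Fo z)) \<cdot> ((p2 (x, y) \<star> Id C (Fo z)) \<cdot> p2 (x \<uplus> y, z)))"
    using assms by (simp add: p2_nat p2_s merge)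
  also have "\<dots> = sw (Fo x) (Fo y) (Fo z) \<cdot> (a (Fo x, Fo y, Fo z) \<cdot> ((p2 (x, y) \<star> Id C (Fo z)) \<cdot> p2 (x \<uplus> y, z)))"
    using assms comp_reduce[OF sw_a[of "Fo x" "Fo y" "Fo z"], of "(p2 (x, y) \<star> Id C (Fo z)) \<cdot> p2 (x \<uplus> y, z)"] by (simp add: comp_assoc)
  also have "\<dots> = (sw (Fo x) (Fo y) (Fo z) \<cdot> ((Id C (Fo x) \<star> p2 (y, z)) \<cdot> p2 (x, y \<uplus> z))) \<cdot> Fa (a (x, y, z))"
    unfolding p2_a[OF x y z] using assms by (simp add: comp_assoc)
  finally show "((Id C (Fo y) \<star> p2 (x, z)) \<cdot> (p2 (y, x \<uplus> z) \<cdot> Fa (sw x y z))) \<cdot> Fa (a (x, y, z)) = \<dots>" .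
qed (use assms in auto)

abbreviation blkF where "blkF \<equiv> blk p0 p2"

lemma blkl_Arr:
  assumes b: "block Fo u v G g (set ks)" and "distinct ks"
  shows "blkl p0 p2 u v G g ks \<in> Arr C \<and> Dom C (blkl p0 p2 u v G g ks) = Fo (suml u ks) \<and>
    Cod C (blkl p0 p2 u v G g ks) = sumo v (\<Union>(G ` set ks)) \<and>
    ((\<forall>k\<in>set ks. invertible C (g k)) \<longrightarrow> invertible C (blkl p0 p2 u v G g ks))"
  using assms
proof (induction ks)
  case (Cons k ks)
  note B = blockD[OF Cons.prems(1)]
  have *: "G k \<inter> \<Union>(G ` set ks) = {}"
    using B(8)[of k] Cons.prems(2) by fastforce
  have b: "block Fo u v G g (set ks)" by (rule block_subset[OF Cons.prems(1)]) auto
  have "finite (\<Union>(G ` set ks))" using B(4) by auto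
  with * show ?case using Cons.IH[OF b] Cons.prems(2) B(2-7) by auto
qed simp

lemma blk_Arr:
  assumes b: "block Fo u v G g S"
  shows "blkF u v G g S \<in> Arr C" "Dom C (blkF u v G g S) = Fo (sumo u S)"
    "Cod C (blkF u v G g S) = sumo v (\<Union>(G ` S))"
    "(\<And>k. k \<in> S ==> invertible C (g k)) ==> invertible C (blkF u v G g S)"
  using blkl_Arr[of u v G g "sorted_list_of_set S"] b blockD(1)[OF b] by (auto simp: blk_def sumo_def)

text \<open>As for \<open>mu\<close>, the recursion is freed from the order of the indices: a block
  map may be expanded at any index. The blocks of \<open>k\<close> and of the head \<open>m\<close>
  change places by \<open>mu_sw\<close>.\<close>

lemma blkl_insort:
  assumes "block Fo u v G g (insert k (set ks))" and "distinct ks" "k \<notin> set ks"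
  shows "blkl p0 p2 u v G g (insort k ks) \<cdot> Fa (insl u k ks)
    = mu v (G k) (\<Union>(G ` set ks)) \<cdot> ((g k \<star> blkl p0 p2 u v G g ks) \<cdot> p2 (u k, suml u ks))"
  using assms
proof (induction ks)
  case Nil
  note B = blockD[OF Nil.prems(1)]
  show ?case using B by (simp add: comp_assoc)
next
  case (Cons m ms)
  note B = blockD[OF Cons.prems(1)]
  have b: "block Fo u v G g (insert k (set ms))" "block Fo u v G g (set ms)"
    by (rule block_subset[OF Cons.prems(1)]; auto)+
  let ?b = "blkl p0 p2 u v G g"
  have A [simp]: "?b ms \<in> Arr C" "Dom C (?b ms) = Fo (suml u ms)" "Cod C (?b ms) = sumo v (\<Union>(G ` set ms))"
    using blkl_Arr[OF b(2)] Cons.prems by auto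
  have A' [simp]: "?b (insort k ms) \<in> Arr C" "Dom C (?b (insort k ms)) = Fo (suml u (insort k ms))"
    "Cod C (?b (insort k ms)) = sumo v (G k \<union> \<Union>(G ` set ms))"
    using blkl_Arr[of u v G g "insort k ms"] b Cons.prems by (auto simp: set_insort_key distinct_insort)
  let ?M = "\<Union>(G ` set ms)"
  have f: "finite ?M" "finite (G k)" "finite (G m)" "G k \<inter> ?M = {}" "G m \<inter> ?M = {}" "G k \<inter> G m = {}" "G m \<inter> G k = {}"
    "G m \<inter> (G k \<union> ?M) = {}" "G k \<inter> (G m \<union> ?M) = {}"
    using B Cons.prems by (auto, (metis B(8) IntI empty_iff list.set_intros insertI1 insertI2)+)
  have g [simp]: "g k \<in> Arr C" "g m \<in> Arr C" "Dom C (g k) = Fo (u k)" "Cod C (g k) = sumo v (G k)"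
    "Dom C (g m) = Fo (u m)" "Cod C (g m) = sumo v (G m)" "\<And>i. u i \<in> Obj C" "\<And>i. v i \<in> Obj C"
    using B by auto
  show ?case
  proof (cases "k \<le> m")
    case True
    then show ?thesis using f by (simp add: comp_assoc)
  next
    case False
    have IH: "?b (insort k ms) \<cdot> Fa (insl u k ms) = mu v (G k) ?M \<cdot> ((g k \<star> ?b ms) \<cdot> p2 (u k, suml u ms))"
      using Cons b by simp
    have "?b (insort k (m # ms)) \<cdot> Fa (insl u k (m # ms))
      = mu v (G m) (G k \<union> ?M) \<cdot> ((g m \<star> ?b (insort k ms)) \<cdot> (p2 (u m, suml u (insort k ms)) \<cdot>
         (Fa (Id C (u m) \<star> insl u k ms) \<cdot> Fa (sw (u k) (u m) (suml u ms)))))"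
      using False f by (simp add: comp_assoc Fa_comp set_insort_key)
    also have "\<dots> = mu v (G m) (G k \<union> ?M) \<cdot> ((g m \<star> (?b (insort k ms) \<cdot> Fa (insl u k ms))) \<cdot> (p2 (u m, u k \<uplus> suml u ms) \<cdot>
         Fa (sw (u k) (u m) (suml u ms))))"
      using f by (simp add: p2_nat_tail interchange_tail)
    also have "\<dots> = mu v (G m) (G k \<union> ?M) \<cdot> ((Id C (sumo v (G m)) \<star> mu v (G k) ?M) \<cdot> ((g m \<star> g k \<star> ?b ms) \<cdot> ((Id C (Fo (u m)) \<star> p2 (u k, suml u ms)) \<cdot> (p2 (u m, u k \<uplus> suml u ms) \<cdot>
         Fa (sw (u k) (u m) (suml u ms))))))"
      unfolding IH using f by (simp add: interchange_tail)
    also have "\<dots> = mu v (G m) (G k \<union> ?M) \<cdot> ((Id C (sumo v (G m)) \<star> mu v (G k) ?M) \<cdot> ((g m \<star> g k \<star> ?b ms) \<cdot>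
         (sw (Fo (u k)) (Fo (u m)) (Fo (suml u ms)) \<cdot> ((Id C (Fo (u k)) \<star> p2 (u m, suml u ms)) \<cdot> p2 (u k, u m \<uplus> suml u ms)))))"
      by (simp add: p2_sw)
    also have "\<dots> = mu v (G m) (G k \<union> ?M) \<cdot> ((Id C (sumo v (G m)) \<star> mu v (G k) ?M) \<cdot> (sw (sumo v (G k)) (sumo v (G m)) (sumo v ?M) \<cdot> ((g k \<star> g m \<star> ?b ms) \<cdot>
         ((Id C (Fo (u k)) \<star> p2 (u m, suml u ms)) \<cdot> p2 (u k, u m \<uplus> suml u ms)))))"
      using f by (simp add: sw_nat_tail)
    also have "\<dots> = (mu v (G m) (G k \<union> ?M) \<cdot> ((Id C (sumo v (G m)) \<star> mu v (G k) ?M) \<cdot> sw (sumo v (G k)) (sumo v (G m)) (sumo v ?M))) \<cdot> ((g k \<star> g m \<star> ?b ms) \<cdot>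
         ((Id C (Fo (u k)) \<star> p2 (u m, suml u ms)) \<cdot> p2 (u k, u m \<uplus> suml u ms)))"
      using f by (simp add: comp_assoc)
    also have "\<dots> = (mu v (G k) (G m \<union> ?M) \<cdot> (Id C (sumo v (G k)) \<star> mu v (G m) ?M)) \<cdot> ((g k \<star> g m \<star> ?b ms) \<cdot>
         ((Id C (Fo (u k)) \<star> p2 (u m, suml u ms)) \<cdot> p2 (u k, u m \<uplus> suml u ms)))"
      using f mu_sw[of v "G k" "G m" ?M] by simp
    also have "\<dots> = mu v (G k) (\<Union>(G ` set (m # ms))) \<cdot> ((g k \<star> ?b (m # ms)) \<cdot> p2 (u k, suml u (m # ms)))"
      using f by (simp add: comp_assoc interchange_tail)
    finally show ?thesis .
  qed
qed

lemma blk_ins: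
  assumes b: "block Fo u v G g (insert k S)" and "k \<notin> S"
  shows "blkF u v G g (insert k S) \<cdot> Fa (ins u k S)
    = mu v (G k) (\<Union>(G ` S)) \<cdot> ((g k \<star> blkF u v G g S) \<cdot> p2 (u k, sumo u S))"
  using blkl_insort[of u v G g k "sorted_list_of_set S"] assms blockD(1)[OF b] by (simp add: blk_def ins_def sumo_def)

text \<open>Additivity of block maps in the index set, by induction on \<open>S\<close> with
  \<open>p2_l\<close> as base case. It supplies the hypothesis \<open>q_mu\<close> when block maps
  are composed by \<open>additive_blk\<close>.\<close>

lemma blk_mu:
  assumes "block Fo u v G g (S \<union> A)" and "S \<inter> A = {}"
  shows "blkF u v G g (S \<union> A) \<cdot> Fa (mu u S A)
    = mu v (\<Union>(G ` S)) (\<Union>(G ` A)) \<cdot> ((blkF u v G g S \<star> blkF u v G g A) \<cdot> p2 (sumo u S, sumo u A))"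
proof -
  have "finite S" "finite A" using blockD(1)[OF assms(1)] by auto
  from this(1) assms show ?thesis
  proof (induction S)
    case empty
    note B = blockD[OF empty.prems(1)]
    have b: "block Fo u v G g A" using empty.prems by simp
    note [simp] = blk_Arr[OF b] B(2,3)
    have "blkF u v G g A \<cdot> Fa (l (sumo u A)) = blkF u v G g A \<cdot> (l (Fo (sumo u A)) \<cdot> ((p0 \<star> Id C (Fo (sumo u A))) \<cdot> p2 (I, sumo u A)))"
      by (simp add: p2_l)
    also have "\<dots> = l (sumo v (\<Union>(G ` A))) \<cdot> ((Id C I \<star> blkF u v G g A) \<cdot> ((p0 \<star> Id C (Fo (sumo u A))) \<cdot> p2 (I, sumo u A)))"
      by (simp add: l_nat_tail)
    also have "\<dots> = l (sumo v (\<Union>(G ` A))) \<cdot> ((p0 \<star> blkF u v G g A) \<cdot> p2 (I, sumo u A))"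
      by (simp add: interchange_tail)
    finally show ?case by simp
  next
    case (insert k S)
    note B = blockD[OF insert.prems(1)]
    have b: "block Fo u v G g (S \<union> A)" "block Fo u v G g S" "block Fo u v G g A" "block Fo u v G g (insert k S)"
      by (rule block_subset[OF insert.prems(1)]; auto)+
    let ?b = "blkF u v G g" and ?S = "\<Union>(G ` S)" and ?A = "\<Union>(G ` A)"
    have fin: "finite A" "finite S" using B(1) by auto
    note [simp] = blk_Arr(1-3)[OF b(1)] blk_Arr(1-3)[OF b(2)] blk_Arr(1-3)[OF b(3)] blk_Arr(1-3)[OF b(4)]
      blk_Arr(1-3)[OF insert.prems(1)[unfolded Un_insert_left]] B(2,3)
    have g [simp]: "g k \<in> Arr C" "Dom C (g k) = Fo (u k)" "Cod C (g k) = sumo v (G k)" using B by auto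
    have kA: "k \<notin> A" "S \<inter> A = {}" using insert by auto
    have dis: "finite ?S" "finite ?A" "finite (G k)" "G k \<inter> ?S = {}" "G k \<inter> ?A = {}" "?S \<inter> ?A = {}" "G k \<inter> (?S \<union> ?A) = {}"
      "(G k \<union> ?S) \<inter> ?A = {}"
      using B insert.hyps insert.prems(2) kA fin
      by (auto, (metis B(8) IntI empty_iff UnI1 UnI2 insertI1 insertI2 disjoint_iff)+)
    note f = fin kA insert.hyps dis
    show ?case
    proof (rule cancel_right[where f="Fa (ins u k S \<star> Id C (sumo u A))"])
      have "(?b (insert k S \<union> A) \<cdot> Fa (mu u (insert k S) A)) \<cdot> Fa (ins u k S \<star> Id C (sumo u A))
        = ?b (insert k (S \<union> A)) \<cdot> Fa (mu u (insert k S) A \<cdot> (ins u k S \<star> Id C (sumo u A)))"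
        using f by (simp add: comp_assoc Fa_comp)
      also have "\<dots> = (?b (insert k (S \<union> A)) \<cdot> Fa (ins u k (S \<union> A))) \<cdot> (Fa (Id C (u k) \<star> mu u S A) \<cdot> Fa (a (u k, sumo u S, sumo u A)))"
        using f by (simp add: mu_ins Fa_comp comp_assoc)
      also have "?b (insert k (S \<union> A)) \<cdot> Fa (ins u k (S \<union> A)) = mu v (G k) (?S \<union> ?A) \<cdot> ((g k \<star> ?b (S \<union> A)) \<cdot> p2 (u k, sumo u (S \<union> A)))"
        using blk_ins[of u v G g k "S \<union> A"] insert.prems f by (simp add: image_Un)
      also have "\<dots> \<cdot> (Fa (Id C (u k) \<star> mu u S A) \<cdot> Fa (a (u k, sumo u S, sumo u A)))
        = mu v (G k) (?S \<union> ?A) \<cdot> ((g k \<star> ?b (S \<union> A)) \<cdot> (p2 (u k, sumo u (S \<union> A)) \<cdot> (Fa (Id C (u k) \<star> mu u S A) \<cdot> Fa (a (u k, sumo u S, sumo u A)))))"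
        using f by (simp add: comp_assoc)
      also have "\<dots> = mu v (G k) (?S \<union> ?A) \<cdot> ((g k \<star> (?b (S \<union> A) \<cdot> Fa (mu u S A))) \<cdot> (p2 (u k, sumo u S \<uplus> sumo u A) \<cdot> Fa (a (u k, sumo u S, sumo u A))))"
        using f by (simp add: p2_nat_tail interchange_tail)
      also have "?b (S \<union> A) \<cdot> Fa (mu u S A) = mu v ?S ?A \<cdot> ((?b S \<star> ?b A) \<cdot> p2 (sumo u S, sumo u A))"
        using insert.IH b(1) kA by simp
      also have "mu v (G k) (?S \<union> ?A) \<cdot> ((g k \<star> (mu v ?S ?A \<cdot> ((?b S \<star> ?b A) \<cdot> p2 (sumo u S, sumo u A)))) \<cdot> (p2 (u k, sumo u S \<uplus> sumo u A) \<cdot> Fa (a (u k, sumo u S, sumo u A))))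
        = mu v (G k) (?S \<union> ?A) \<cdot> ((Id C (sumo v (G k)) \<star> mu v ?S ?A) \<cdot> ((g k \<star> (?b S \<star> ?b A)) \<cdot>
          ((Id C (Fo (u k)) \<star> p2 (sumo u S, sumo u A)) \<cdot> (p2 (u k, sumo u S \<uplus> sumo u A) \<cdot> Fa (a (u k, sumo u S, sumo u A))))))"
        using f by (simp add: interchange_tail)
      also have "\<dots> = mu v (G k) (?S \<union> ?A) \<cdot> ((Id C (sumo v (G k)) \<star> mu v ?S ?A) \<cdot> ((g k \<star> (?b S \<star> ?b A)) \<cdot>
          (a (Fo (u k), Fo (sumo u S), Fo (sumo u A)) \<cdot> ((p2 (u k, sumo u S) \<star> Id C (Fo (sumo u A))) \<cdot> p2 (u k \<uplus> sumo u S, sumo u A)))))"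
        by (simp add: p2_a)
      also have "\<dots> = (mu v (G k) (?S \<union> ?A) \<cdot> ((Id C (sumo v (G k)) \<star> mu v ?S ?A) \<cdot> a (sumo v (G k), sumo v ?S, sumo v ?A))) \<cdot> (((g k \<star> ?b S) \<star> ?b A) \<cdot>
          ((p2 (u k, sumo u S) \<star> Id C (Fo (sumo u A))) \<cdot> p2 (u k \<uplus> sumo u S, sumo u A)))"
        using f by (simp add: comp_assoc a_nat_tail)
      also have "\<dots> = (mu v (G k \<union> ?S) ?A \<cdot> (mu v (G k) ?S \<star> Id C (sumo v ?A))) \<cdot> (((g k \<star> ?b S) \<star> ?b A) \<cdot>
          ((p2 (u k, sumo u S) \<star> Id C (Fo (sumo u A))) \<cdot> p2 (u k \<uplus> sumo u S, sumo u A)))"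
        using f mu_assoc[of v "G k" ?S ?A] by simp
      also have "\<dots> = mu v (G k \<union> ?S) ?A \<cdot> (((mu v (G k) ?S \<cdot> ((g k \<star> ?b S) \<cdot> p2 (u k, sumo u S))) \<star> ?b A) \<cdot> p2 (u k \<uplus> sumo u S, sumo u A))"
        using f by (simp add: comp_assoc interchange_tail)
      also have "mu v (G k) ?S \<cdot> ((g k \<star> ?b S) \<cdot> p2 (u k, sumo u S)) = ?b (insert k S) \<cdot> Fa (ins u k S)"
        using blk_ins[of u v G g k S] b f by simp
      also have "mu v (G k \<union> ?S) ?A \<cdot> (((?b (insert k S) \<cdot> Fa (ins u k S)) \<star> ?b A) \<cdot> p2 (u k \<uplus> sumo u S, sumo u A))
        = (mu v (\<Union>(G ` insert k S)) ?A \<cdot> ((?b (insert k S) \<star> ?b A) \<cdot> p2 (sumo u (insert k S), sumo u A))) \<cdot> Fa (ins u k S \<star> Id C (sumo u A))"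
        using f by (simp add: comp_assoc p2_nat interchange_tail)
      finally show "(?b (insert k S \<union> A) \<cdot> Fa (mu u (insert k S) A)) \<cdot> Fa (ins u k S \<star> Id C (sumo u A)) = \<dots>" .
    qed (use f in auto)
  qed
qed

lemma blk_single:
  assumes "block Fo u v G g {k}"
  shows "blkF u v G g {k} \<cdot> Fa (unit u k) = g k"
proof -
  note B = blockD[OF assms]
  note [simp] = B(2,3)
  have g [simp]: "g k \<in> Arr C" "Dom C (g k) = Fo (u k)" "Cod C (g k) = sumo v (G k)" "finite (G k)" using B by auto
  have "blkF u v G g {k} = r (sumo v (G k)) \<cdot> ((g k \<star> p0) \<cdot> p2 (u k, I))"
    by (simp add: blk_def)
  also have "\<dots> = r (sumo v (G k)) \<cdot> ((g k \<star> Id C I) \<cdot> ((Id C (Fo (u k)) \<star> p0) \<cdot> p2 (u k, I)))"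
    by (simp add: interchange_tail)
  also have "\<dots> = g k \<cdot> Fa (r (u k))"
    by (simp add: r_nat_tail p2_r)
  finally show ?thesis
    by (simp add: comp_assoc unit_def Fa_comp[symmetric])
qed

end

context symmetric_monoidal
begin

lemma blkl_cong_functor:
  assumes "\<And>i. u i \<in> Obj C" "p0 = q0" "\<And>x y. x \<in> Obj C ==> y \<in> Obj C ==> p2 (x, y) = q2 (x, y)"
  shows "blkl p0 p2 u v G g ks = blkl q0 q2 u v G g ks"
  using assms by (induction ks) auto

lemma blk_cong_functor:
  assumes "\<And>i. u i \<in> Obj C" "p0 = q0" "\<And>x y. x \<in> Obj C ==> y \<in> Obj C ==> p2 (x, y) = q2 (x, y)"
  shows "blk p0 p2 u v G g S = blk q0 q2 u v G g S"
  unfolding blk_def by (rule blkl_cong_functor) (use assms in auto)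

lemma identity_functor:
  "symmetric_functor C T I a l r s (\<lambda>x. x) (\<lambda>f. f) (Id C I) (\<lambda>a. Id C (obj_map T a))"
  by unfold_locales auto

abbreviation phi where "phi \<equiv> blk (Id C I) (\<lambda>a. Id C (obj_map T a))"
abbreviation sblock where "sblock \<equiv> block (\<lambda>x. x)"

lemmas phi_Arr = symmetric_functor.blk_Arr[OF identity_functor]
lemmas phi_single = symmetric_functor.blk_single[OF identity_functor]

lemma phi_mu:
  assumes "sblock u v G g (S \<union> A)" and "S \<inter> A = {}"
  shows "phi u v G g (S \<union> A) \<cdot> mu u S A
    = mu v (\<Union>(G ` S)) (\<Union>(G ` A)) \<cdot> (phi u v G g S \<star> phi u v G g A)"
proof -
  have b: "sblock u v G g S" "sblock u v G g A" by (rule block_subset[OF assms(1)]; auto)+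
  show ?thesis
    using symmetric_functor.blk_mu[OF identity_functor assms] phi_Arr(1-3)[OF b(1)] phi_Arr(1-3)[OF b(2)] blockD(2)[OF assms(1)]
    by simp
qed

lemma mu_unit:
  assumes u: "\<And>i. u i \<in> Obj C" and "finite A" "k \<notin> A"
  shows "mu u {k} A \<cdot> (unit u k \<star> Id C (sumo u A)) = ins u k A"
proof -
  have "ins u k {} = Id C (u k \<uplus> I)" by (simp add: ins_def)
  then have "mu u {k} A = ins u k A \<cdot> (r (u k) \<star> Id C (sumo u A))"
    using mu_ins[of u "{}" A k] triangle[of "u k" "sumo u A"] u assms by simp
  then show ?thesis using assms by (simp add: comp_assoc interchange unit_def)
qed

lemma insl_first: "(\<And>m. m \<in> set ks ==> k \<le> m) ==> insl u k ks = Id C (u k \<uplus> suml u ks)"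
  by (cases ks) auto

text \<open>If every block is a single index, nothing is reordered and all merging steps become
  identities. So diagonal block maps are the plain iterated sums of arrows that
  \<open>cauchy_arrow_map\<close> asks for.\<close>

lemma phi_diagonal:
  assumes u: "\<And>i. u i \<in> Obj C" and v: "\<And>i. v i \<in> Obj C" and S: "finite S"
    and g: "\<And>k. k \<in> S ==> g k \<in> Arr C" "\<And>k. k \<in> S ==> Dom C (g k) = u k" "\<And>k. k \<in> S ==> Cod C (g k) = v k"
  shows "phi u v (\<lambda>k. {k}) (\<lambda>k. unit v k \<cdot> g k) S = foldr (\<lambda>k X. g k \<star> X) (sorted_list_of_set S) (Id C I)"
proof -
  have "sorted ks ==> distinct ks ==> set ks \<subseteq> S ==>
     blkl (Id C I) (\<lambda>a. Id C (obj_map T a)) u v (\<lambda>k. {k}) (\<lambda>k. unit v k \<cdot> g k) ks = foldr (\<lambda>k X. g k \<star> X) ks (Id C I)" for ks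
  proof (induction ks)
    case (Cons k ks)
    let ?b = "blkl (Id C I) (\<lambda>a. Id C (obj_map T a)) u v (\<lambda>k. {k}) (\<lambda>k. unit v k \<cdot> g k) ks"
    have b: "sblock u v (\<lambda>k. {k}) (\<lambda>k. unit v k \<cdot> g k) (set ks)"
      by (rule blockI) (use u v g Cons.prems in auto)
    have A: "?b \<in> Arr C" "Dom C ?b = suml u ks" "Cod C ?b = sumo v (set ks)"
      using symmetric_functor.blkl_Arr[OF identity_functor b] Cons.prems by auto
    have "sorted_list_of_set (set ks) = ks"
      using Cons.prems by (simp add: sorted_list_of_set.idem_if_sorted_distinct)
    then have ins: "ins v k (set ks) = Id C (v k \<uplus> sumo v (set ks))"
      unfolding ins_def sumo_def using Cons.prems by (subst insl_first) auto
    have gk: "g k \<in> Arr C" "Dom C (g k) = u k" "Cod C (g k) = v k" using g Cons.prems by auto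
    have "blkl (Id C I) (\<lambda>a. Id C (obj_map T a)) u v (\<lambda>k. {k}) (\<lambda>k. unit v k \<cdot> g k) (k # ks)
      = mu v {k} (set ks) \<cdot> ((unit v k \<cdot> g k) \<star> ?b)"
      using u v A gk Cons.prems by simp
    also have "\<dots> = (mu v {k} (set ks) \<cdot> (unit v k \<star> Id C (sumo v (set ks)))) \<cdot> (g k \<star> ?b)"
      using u v A gk Cons.prems by (simp add: comp_assoc interchange)
    also have "\<dots> = g k \<star> ?b"
      using mu_unit[of v "set ks" k] ins u v A gk Cons.prems by simp
    finally show ?case using Cons by simp
  qed simp
  then show ?thesis using S by (simp add: blk_def)
qed

lemma phi_id:
  assumes u: "\<And>i. u i \<in> Obj C" and S: "finite S"
  shows "phi u u (\<lambda>k. {k}) (unit u) S = Id C (sumo u S)"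
proof -
  have "phi u u (\<lambda>k. {k}) (unit u) S = phi u u (\<lambda>k. {k}) (\<lambda>k. unit u k \<cdot> Id C (u k)) S"
    by (rule blk_cong) (use u S in auto)
  also have "\<dots> = foldr (\<lambda>k X. Id C (u k) \<star> X) (sorted_list_of_set S) (Id C I)"
    by (rule phi_diagonal) (use u S in auto)
  also have "foldr (\<lambda>k X. Id C (u k) \<star> X) ks (Id C I) = Id C (suml u ks)" for ks
    using u by (induction ks) auto
  finally show ?thesis by (simp add: sumo_def)
qed

end

section \<open>Composition and naturality of block maps\<close>

context symmetric_functor
begin

text \<open>The fusion law behind all compositions of block maps. The outer map enters only as a
  family \<open>q\<close> indexed by sets and additive in the sense of \<open>q_mu\<close>, so it
  may be a block map or the distribution \<open>nu\<close> in its second argument. The result is a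
  block map for the composite functor.\<close>

lemma additive_blk:
  assumes F': "symmetric_functor C T I a l r s Fo' Fa' q0 q2"
    and b: "block Fo' u v G g S"
    and w: "\<And>i. w i \<in> Obj C"
    and H: "\<And>j. j \<in> \<Union>(G ` S) ==> finite (H j)"
      "\<And>j j'. j \<in> \<Union>(G ` S) ==> j' \<in> \<Union>(G ` S) ==> j \<noteq> j' ==> H j \<inter> H j' = {}"
    and q: "\<And>A. A \<subseteq> \<Union>(G ` S) ==> q A \<in> Arr C" "\<And>A. A \<subseteq> \<Union>(G ` S) ==> Dom C (q A) = Fo (sumo v A)"
      "\<And>A. A \<subseteq> \<Union>(G ` S) ==> Cod C (q A) = sumo w (\<Union>(H ` A))"
    and q0: "q {} = p0"
    and q_mu: "\<And>A B. A \<subseteq> \<Union>(G ` S) ==> B \<subseteq> \<Union>(G ` S) ==> A \<inter> B = {} ==>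
      q (A \<union> B) \<cdot> Fa (mu v A B) = mu w (\<Union>(H ` A)) (\<Union>(H ` B)) \<cdot> ((q A \<star> q B) \<cdot> p2 (sumo v A, sumo v B))"
  shows "q (\<Union>(G ` S)) \<cdot> Fa (blk q0 q2 u v G g S)
    = blk (p0 \<cdot> Fa q0) (\<lambda>(x, y). p2 (Fo' x, Fo' y) \<cdot> Fa (q2 (x, y))) u w (\<lambda>k. \<Union>(H ` G k)) (\<lambda>k. q (G k) \<cdot> Fa (g k)) S"
proof -
  interpret F': symmetric_functor C T I a l r s Fo' Fa' q0 q2 by fact
  note B = blockD[OF b]
  have "distinct ks ==> set ks \<subseteq> S ==> q (\<Union>(G ` set ks)) \<cdot> Fa (blkl q0 q2 u v G g ks)
    = blkl (p0 \<cdot> Fa q0) (\<lambda>(x, y). p2 (Fo' x, Fo' y) \<cdot> Fa (q2 (x, y))) u w (\<lambda>k. \<Union>(H ` G k)) (\<lambda>k. q (G k) \<cdot> Fa (g k)) ks" for ks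
  proof (induction ks)
    case Nil
    then show ?case using q0 by simp
  next
    case (Cons k ks)
    have bk: "block Fo' u v G g (set ks)" by (rule block_subset[OF b]) (use Cons.prems in auto)
    let ?b = "blkl q0 q2 u v G g ks" and ?K = "\<Union>(G ` set ks)"
    have A [simp]: "?b \<in> Arr C" "Dom C ?b = Fo' (suml u ks)" "Cod C ?b = sumo v ?K"
      using F'.blkl_Arr[OF bk] Cons.prems by auto
    have k: "k \<in> S" "set ks \<subseteq> S" "k \<notin> set ks" using Cons.prems by auto
    have dis: "G k \<inter> ?K = {}" using B(8) k by blast
    have sub: "G k \<subseteq> \<Union>(G ` S)" "?K \<subseteq> \<Union>(G ` S)" "G k \<union> ?K \<subseteq> \<Union>(G ` S)" using k by auto
    have finH: "finite (\<Union>(H ` A))" if "A \<subseteq> \<Union>(G ` S)" "finite A" for A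
      by (intro finite_UN_I) (use that H(1) in blast)+
    have "finite (G k)" "finite ?K" using B(4) k by auto
    note fin = this finH[OF sub(1)] finH[OF sub(2)]
    have disH: "\<Union>(H ` G k) \<inter> \<Union>(H ` ?K) = {}"
    proof -
      have "H j \<inter> H j' = {}" if "j \<in> G k" "j' \<in> ?K" for j j'
        using H(2)[of j j'] sub that dis by blast
      then show ?thesis by blast
    qed
    note [simp] = B(2,3) w q(1-3)[OF sub(1)] q(1-3)[OF sub(2)] q(1-3)[OF sub(3)]
    have g [simp]: "g k \<in> Arr C" "Dom C (g k) = Fo' (u k)" "Cod C (g k) = sumo v (G k)" using B k by auto
    have "q (\<Union>(G ` set (k # ks))) \<cdot> Fa (blkl q0 q2 u v G g (k # ks))
      = (q (G k \<union> ?K) \<cdot> Fa (mu v (G k) ?K)) \<cdot> (Fa (g k \<star> ?b) \<cdot> Fa (q2 (u k, suml u ks)))"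
      using fin dis by (simp add: Fa_comp comp_assoc)
    also have "\<dots> = (mu w (\<Union>(H ` G k)) (\<Union>(H ` ?K)) \<cdot> ((q (G k) \<star> q ?K) \<cdot> p2 (sumo v (G k), sumo v ?K))) \<cdot> (Fa (g k \<star> ?b) \<cdot> Fa (q2 (u k, suml u ks)))"
      using q_mu[OF sub(1,2) dis] by simp
    also have "\<dots> = mu w (\<Union>(H ` G k)) (\<Union>(H ` ?K)) \<cdot> (((q (G k) \<cdot> Fa (g k)) \<star> (q ?K \<cdot> Fa ?b)) \<cdot> (p2 (Fo' (u k), Fo' (suml u ks)) \<cdot> Fa (q2 (u k, suml u ks))))"
      using fin dis disH by (simp add: comp_assoc p2_nat_tail interchange_tail)
    also have "\<Union>(H ` ?K) = \<Union>((\<lambda>k. \<Union>(H ` G k)) ` set ks)" by auto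
    finally show ?case using Cons by simp
  qed
  from this[of "sorted_list_of_set S"] show ?thesis using B(1) by (simp add: blk_def)
qed

lemma phi_blk:
  assumes b: "block Fo u v G g S" and c: "sblock v w H h (\<Union>(G ` S))"
  shows "phi v w H h (\<Union>(G ` S)) \<cdot> blkF u v G g S
    = blkF u w (\<lambda>k. \<Union>(H ` G k)) (\<lambda>k. phi v w H h (G k) \<cdot> g k) S"
proof -
  note c' = blockD[OF c]
  have cs: "sblock v w H h A" if "A \<subseteq> \<Union>(G ` S)" for A by (rule block_subset[OF c that])
  have "phi v w H h (\<Union>(G ` S)) \<cdot> blkF u v G g S
     = blk (Id C I \<cdot> p0) (\<lambda>(x, y). (\<lambda>a. Id C (obj_map T a)) (Fo x, Fo y) \<cdot> p2 (x, y)) u w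
        (\<lambda>k. \<Union>(H ` G k)) (\<lambda>k. phi v w H h (G k) \<cdot> g k) S"
  proof (rule symmetric_functor.additive_blk[OF identity_functor symmetric_functor_axioms b])
    fix A B assume "A \<subseteq> \<Union>(G ` S)" "B \<subseteq> \<Union>(G ` S)" "A \<inter> B = {}"
    then show "phi v w H h (A \<union> B) \<cdot> mu v A B = mu w (\<Union>(H ` A)) (\<Union>(H ` B)) \<cdot> ((phi v w H h A \<star> phi v w H h B) \<cdot>
      (\<lambda>a. Id C (obj_map T a)) (sumo v A, sumo v B))"
      using phi_mu[OF cs[of "A \<union> B"]] phi_Arr(1-3)[OF cs[of A]] phi_Arr(1-3)[OF cs[of B]] c'(2) by simp
  qed (use c' phi_Arr(1-3)[OF cs] in auto)
  also have "\<dots> = blkF u w (\<lambda>k. \<Union>(H ` G k)) (\<lambda>k. phi v w H h (G k) \<cdot> g k) S"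
    by (rule blk_cong_functor) (use blockD[OF b] in auto)
  finally show ?thesis .
qed

lemma additive_phi:
  assumes b: "sblock u v G g S"
    and w: "\<And>i. w i \<in> Obj C"
    and H: "\<And>j. j \<in> \<Union>(G ` S) ==> finite (H j)"
      "\<And>j j'. j \<in> \<Union>(G ` S) ==> j' \<in> \<Union>(G ` S) ==> j \<noteq> j' ==> H j \<inter> H j' = {}"
    and q: "\<And>A. A \<subseteq> \<Union>(G ` S) ==> q A \<in> Arr C" "\<And>A. A \<subseteq> \<Union>(G ` S) ==> Dom C (q A) = Fo (sumo v A)"
      "\<And>A. A \<subseteq> \<Union>(G ` S) ==> Cod C (q A) = sumo w (\<Union>(H ` A))"
    and q0: "q {} = p0"
    and q_mu: "\<And>A B. A \<subseteq> \<Union>(G ` S) ==> B \<subseteq> \<Union>(G ` S) ==> A \<inter> B = {} ==>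
      q (A \<union> B) \<cdot> Fa (mu v A B) = mu w (\<Union>(H ` A)) (\<Union>(H ` B)) \<cdot> ((q A \<star> q B) \<cdot> p2 (sumo v A, sumo v B))"
  shows "q (\<Union>(G ` S)) \<cdot> Fa (phi u v G g S)
    = blkF u w (\<lambda>k. \<Union>(H ` G k)) (\<lambda>k. q (G k) \<cdot> Fa (g k)) S"
proof -
  have "q (\<Union>(G ` S)) \<cdot> Fa (phi u v G g S) = blk (p0 \<cdot> Fa (Id C I)) (\<lambda>(x, y). p2 (x, y) \<cdot> Fa ((\<lambda>a. Id C (obj_map T a)) (x, y)))
     u w (\<lambda>k. \<Union>(H ` G k)) (\<lambda>k. q (G k) \<cdot> Fa (g k)) S"
    by (rule additive_blk[OF identity_functor b]) (use assms in auto)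
  also have "\<dots> = blkF u w (\<lambda>k. \<Union>(H ` G k)) (\<lambda>k. q (G k) \<cdot> Fa (g k)) S"
    by (rule blk_cong_functor) (use blockD[OF b] in auto)
  finally show ?thesis .
qed

lemma blk_phi:
  assumes b: "sblock u v G g S" and c: "block Fo v w H h (\<Union>(G ` S))"
  shows "blkF v w H h (\<Union>(G ` S)) \<cdot> Fa (phi u v G g S)
    = blkF u w (\<lambda>k. \<Union>(H ` G k)) (\<lambda>k. blkF v w H h (G k) \<cdot> Fa (g k)) S"
proof -
  note c' = blockD[OF c]
  have cs: "block Fo v w H h A" if "A \<subseteq> \<Union>(G ` S)" for A by (rule block_subset[OF c that])
  show ?thesis
    by (rule additive_phi[OF b]) (use c' blk_Arr(1-3)[OF cs] blk_mu[OF cs] in auto)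
qed

text \<open>A monoidal transformation \<open>t\<close> replaces the functor of a block map:
  \<open>t0\<close> and \<open>t2\<close> say that \<open>t\<close> respects the comparison arrows.
  The associator and the unitors of \<open>\<otimes>\<close> are used below as such
  transformations.\<close>

lemma blk_natural:
  assumes b: "block Fo u v G g S"
    and t: "\<And>x. x \<in> Obj C ==> t x \<in> Arr C" "\<And>x. x \<in> Obj C ==> Dom C (t x) = Ko x" "\<And>x. x \<in> Obj C ==> Cod C (t x) = Fo x"
    and q2: "\<And>x y. x \<in> Obj C ==> y \<in> Obj C ==> q2 (x, y) \<in> Arr C"
      "\<And>x y. x \<in> Obj C ==> y \<in> Obj C ==> Cod C (q2 (x, y)) = Ko x \<uplus> Ko y"
    and t0: "p0 \<cdot> t I = q0"
    and t2: "\<And>x y. x \<in> Obj C ==> y \<in> Obj C ==> p2 (x, y) \<cdot> t (x \<uplus> y) = (t x \<star> t y) \<cdot> q2 (x, y)"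
  shows "blkF u v G g S \<cdot> t (sumo u S) = blk q0 q2 u v G (\<lambda>k. g k \<cdot> t (u k)) S"
proof -
  note B = blockD[OF b]
  have "distinct ks ==> set ks \<subseteq> S ==> blkl p0 p2 u v G g ks \<cdot> t (suml u ks)
    = blkl q0 q2 u v G (\<lambda>k. g k \<cdot> t (u k)) ks" for ks
  proof (induction ks)
    case Nil
    then show ?case using t0 by simp
  next
    case (Cons k ks)
    have bk: "block Fo u v G g (set ks)" by (rule block_subset[OF b]) (use Cons.prems in auto)
    let ?b = "blkl p0 p2 u v G g ks" and ?K = "\<Union>(G ` set ks)"
    have A [simp]: "?b \<in> Arr C" "Dom C ?b = Fo (suml u ks)" "Cod C ?b = sumo v ?K"
      using blkl_Arr[OF bk] Cons.prems by auto
    have k: "k \<in> S" "set ks \<subseteq> S" "k \<notin> set ks" using Cons.prems by auto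
    have dis: "G k \<inter> ?K = {}" using B(8) k by blast
    have fin: "finite (G k)" "finite ?K" using B(4) k by auto
    note [simp] = B(2,3) t q2
    have g [simp]: "g k \<in> Arr C" "Dom C (g k) = Fo (u k)" "Cod C (g k) = sumo v (G k)" using B k by auto
    have "blkl p0 p2 u v G g (k # ks) \<cdot> t (suml u (k # ks))
      = mu v (G k) ?K \<cdot> ((g k \<star> ?b) \<cdot> (p2 (u k, suml u ks) \<cdot> t (u k \<uplus> suml u ks)))"
      using fin dis by (simp add: comp_assoc)
    also have "\<dots> = mu v (G k) ?K \<cdot> (((g k \<cdot> t (u k)) \<star> (?b \<cdot> t (suml u ks))) \<cdot> q2 (u k, suml u ks))"
      using fin dis by (simp add: t2 interchange_tail)
    finally show ?case using Cons by simp
  qed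
  then show ?thesis using B(1) by (simp add: blk_def sumo_def)
qed

end

context symmetric_monoidal
begin

lemmas phi_phi = symmetric_functor.phi_blk[OF identity_functor]

lemma phi_unit_comp:
  assumes "sblock u v G g {k}" and "f \<in> Arr C" "Cod C f = u k"
  shows "phi u v G g {k} \<cdot> (unit u k \<cdot> f) = g k \<cdot> f"
  using comp_reduce[OF phi_single[OF assms(1)], of f] blockD(2)[OF assms(1)] phi_Arr(1,2)[OF assms(1)] assms(2,3) by simp

end

context symmetric_functor
begin

lemma blk_blk:
  assumes F': "symmetric_functor C T I a l r s Fo' Fa' q0 q2"
    and b: "block Fo' u v G g S" and c: "block Fo v w H h (\<Union>(G ` S))"
  shows "blkF v w H h (\<Union>(G ` S)) \<cdot> Fa (blk q0 q2 u v G g S)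
    = blk (p0 \<cdot> Fa q0) (\<lambda>(x, y). p2 (Fo' x, Fo' y) \<cdot> Fa (q2 (x, y))) u w
        (\<lambda>k. \<Union>(H ` G k)) (\<lambda>k. blkF v w H h (G k) \<cdot> Fa (g k)) S"
proof -
  note c' = blockD[OF c]
  have cs: "block Fo v w H h A" if "A \<subseteq> \<Union>(G ` S)" for A by (rule block_subset[OF c that])
  show ?thesis
    by (rule additive_blk[OF F' b]) (use c' blk_Arr(1-3)[OF cs] blk_mu[OF cs] in auto)
qed

text \<open>A threefold product applies two multiplication functors in succession, and its expansion
  is a block map for their composite.\<close>

lemma composite_functor:
  assumes F': "symmetric_functor C T I a l r s Fo' Fa' q0 q2"
  shows "symmetric_functor C T I a l r s (\<lambda>x. Fo (Fo' x)) (\<lambda>f. Fa (Fa' f)) (p0 \<cdot> Fa q0)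
    (\<lambda>(x, y). p2 (Fo' x, Fo' y) \<cdot> Fa (q2 (x, y)))"
proof -
  interpret F': symmetric_functor C T I a l r s Fo' Fa' q0 q2 by fact
  show ?thesis
  proof unfold_locales
    fix f g x' y' assume fg: "f \<in> Arr C" "g \<in> Arr C" "Cod C f = x'" "Cod C g = y'"
    have "p2 (Fo' x', Fo' y') \<cdot> (Fa (q2 (x', y')) \<cdot> Fa (Fa' (f \<star> g)))
      = p2 (Fo' x', Fo' y') \<cdot> (Fa (Fa' f \<star> Fa' g) \<cdot> Fa (q2 (Dom C f, Dom C g)))"
      using fg by (auto simp: Fa_comp[symmetric] F'.p2_nat)
    also have "\<dots> = (Fa (Fa' f) \<star> Fa (Fa' g)) \<cdot> (p2 (Fo' (Dom C f), Fo' (Dom C g)) \<cdot> Fa (q2 (Dom C f, Dom C g)))"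
      using fg by (auto simp: p2_nat_tail)
    finally show "(case (x', y') of (x, y) \<Rightarrow> p2 (Fo' x, Fo' y) \<cdot> Fa (q2 (x, y))) \<cdot> Fa (Fa' (f \<star> g)) =
       Fa (Fa' f) \<star> Fa (Fa' g) \<cdot> (case (Dom C f, Dom C g) of (x, y) \<Rightarrow> p2 (Fo' x, Fo' y) \<cdot> Fa (q2 (x, y)))"
      using fg by (auto simp: comp_assoc)
  next
    fix x y z assume X: "x \<in> Obj C" "y \<in> Obj C" "z \<in> Obj C"
    let ?G = "Fo'"
    have "a (Fo (?G x), Fo (?G y), Fo (?G z)) \<cdot> (((p2 (?G x, ?G y) \<cdot> Fa (q2 (x, y))) \<star> Id C (Fo (?G z))) \<cdot> (p2 (?G (x \<uplus> y), ?G z) \<cdot> Fa (q2 (x \<uplus> y, z))))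
      = a (Fo (?G x), Fo (?G y), Fo (?G z)) \<cdot> ((p2 (?G x, ?G y) \<star> Id C (Fo (?G z))) \<cdot> ((Fa (q2 (x, y)) \<star> Fa (Id C (?G z))) \<cdot> (p2 (?G (x \<uplus> y), ?G z) \<cdot> Fa (q2 (x \<uplus> y, z)))))"
      using X by (simp add: interchange_tail)
    also have "\<dots> = a (Fo (?G x), Fo (?G y), Fo (?G z)) \<cdot> ((p2 (?G x, ?G y) \<star> Id C (Fo (?G z))) \<cdot> (p2 (?G x \<uplus> ?G y, ?G z) \<cdot> (Fa (q2 (x, y) \<star> Id C (?G z)) \<cdot> Fa (q2 (x \<uplus> y, z)))))"
      using X p2_nat_tail[of "q2 (x, y)" "Id C (?G z)" "?G x \<uplus> ?G y" "?G z" "Fa (q2 (x \<uplus> y, z))"] by simp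
    also have "\<dots> = (a (Fo (?G x), Fo (?G y), Fo (?G z)) \<cdot> ((p2 (?G x, ?G y) \<star> Id C (Fo (?G z))) \<cdot> p2 (?G x \<uplus> ?G y, ?G z))) \<cdot> Fa ((q2 (x, y) \<star> Id C (?G z)) \<cdot> q2 (x \<uplus> y, z))"
      using X by (simp add: comp_assoc Fa_comp)
    also have "\<dots> = (Id C (Fo (?G x)) \<star> p2 (?G y, ?G z)) \<cdot> (p2 (?G x, ?G y \<uplus> ?G z) \<cdot> Fa (a (?G x, ?G y, ?G z) \<cdot> ((q2 (x, y) \<star> Id C (?G z)) \<cdot> q2 (x \<uplus> y, z))))"
      using X by (simp add: p2_a comp_assoc Fa_comp)
    also have "\<dots> = (Id C (Fo (?G x)) \<star> p2 (?G y, ?G z)) \<cdot> (p2 (?G x, ?G y \<uplus> ?G z) \<cdot> (Fa (Id C (?G x) \<star> q2 (y, z)) \<cdot> (Fa (q2 (x, y \<uplus> z)) \<cdot> Fa (Fa' (a (x, y, z))))))"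
      using X by (simp add: F'.p2_a Fa_comp)
    also have "\<dots> = (Id C (Fo (?G x)) \<star> (p2 (?G y, ?G z) \<cdot> Fa (q2 (y, z)))) \<cdot> ((p2 (?G x, ?G (y \<uplus> z)) \<cdot> Fa (q2 (x, y \<uplus> z))) \<cdot> Fa (Fa' (a (x, y, z))))"
      using X by (simp add: p2_nat_tail interchange_tail comp_assoc)
    finally show "a (Fo (?G x), Fo (?G y), Fo (?G z)) \<cdot> ((case (x, y) of (x, y) \<Rightarrow> p2 (?G x, ?G y) \<cdot> Fa (q2 (x, y))) \<star> Id C (Fo (?G z)) \<cdot>
          (case (x \<uplus> y, z) of (x, y) \<Rightarrow> p2 (?G x, ?G y) \<cdot> Fa (q2 (x, y)))) =
       Id C (Fo (?G x)) \<star> (case (y, z) of (x, y) \<Rightarrow> p2 (?G x, ?G y) \<cdot> Fa (q2 (x, y))) \<cdot>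
       (case (x, y \<uplus> z) of (x, y) \<Rightarrow> p2 (?G x, ?G y) \<cdot> Fa (q2 (x, y))) \<cdot> Fa (Fa' (a (x, y, z)))"
      by simp
  next
    fix x y assume X: "x \<in> Obj C" "y \<in> Obj C"
    have "s (Fo (Fo' x), Fo (Fo' y)) \<cdot> (p2 (Fo' x, Fo' y) \<cdot> Fa (q2 (x, y))) = p2 (Fo' y, Fo' x) \<cdot> (Fa (s (Fo' x, Fo' y)) \<cdot> Fa (q2 (x, y)))"
      using X comp_reduce[OF p2_s[of "Fo' x" "Fo' y"], of "Fa (q2 (x, y))"] by (simp add: comp_assoc)
    then show "s (Fo (Fo' x), Fo (Fo' y)) \<cdot> (case (x, y) of (x, y) \<Rightarrow> p2 (Fo' x, Fo' y) \<cdot> Fa (q2 (x, y))) =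
       (case (y, x) of (x, y) \<Rightarrow> p2 (Fo' x, Fo' y) \<cdot> Fa (q2 (x, y))) \<cdot> Fa (Fa' (s (x, y)))"
      using X by (simp add: Fa_comp[symmetric] F'.p2_s comp_assoc)
  next
    fix y assume X: "y \<in> Obj C"
    have "l (Fo (Fo' y)) \<cdot> (((p0 \<cdot> Fa q0) \<star> Id C (Fo (Fo' y))) \<cdot> (p2 (Fo' I, Fo' y) \<cdot> Fa (q2 (I, y))))
      = l (Fo (Fo' y)) \<cdot> ((p0 \<star> Id C (Fo (Fo' y))) \<cdot> ((Fa q0 \<star> Fa (Id C (Fo' y))) \<cdot> (p2 (Fo' I, Fo' y) \<cdot> Fa (q2 (I, y)))))"
      using X by (simp add: interchange_tail)
    also have "\<dots> = l (Fo (Fo' y)) \<cdot> ((p0 \<star> Id C (Fo (Fo' y))) \<cdot> (p2 (I, Fo' y) \<cdot> Fa ((q0 \<star> Id C (Fo' y)) \<cdot> q2 (I, y))))"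
      using X p2_nat_tail[of q0 "Id C (Fo' y)" I "Fo' y" "Fa (q2 (I, y))"] by (simp add: Fa_comp)
    also have "\<dots> = Fa (l (Fo' y) \<cdot> ((q0 \<star> Id C (Fo' y)) \<cdot> q2 (I, y)))"
      using X by (simp add: Fa_comp p2_l[symmetric] comp_assoc)
    finally show "l (Fo (Fo' y)) \<cdot> (p0 \<cdot> Fa q0) \<star> Id C (Fo (Fo' y)) \<cdot> (case (I, y) of (x, y) \<Rightarrow> p2 (Fo' x, Fo' y) \<cdot> Fa (q2 (x, y))) = Fa (Fa' (l y))"
      using X by (simp add: F'.p2_l)
  next
    fix y assume X: "y \<in> Obj C"
    have "r (Fo (Fo' y)) \<cdot> ((Id C (Fo (Fo' y)) \<star> (p0 \<cdot> Fa q0)) \<cdot> (p2 (Fo' y, Fo' I) \<cdot> Fa (q2 (y, I))))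
      = r (Fo (Fo' y)) \<cdot> ((Id C (Fo (Fo' y)) \<star> p0) \<cdot> ((Fa (Id C (Fo' y)) \<star> Fa q0) \<cdot> (p2 (Fo' y, Fo' I) \<cdot> Fa (q2 (y, I)))))"
      using X by (simp add: interchange_tail)
    also have "\<dots> = r (Fo (Fo' y)) \<cdot> ((Id C (Fo (Fo' y)) \<star> p0) \<cdot> (p2 (Fo' y, I) \<cdot> Fa ((Id C (Fo' y) \<star> q0) \<cdot> q2 (y, I))))"
      using X p2_nat_tail[of "Id C (Fo' y)" q0 "Fo' y" I "Fa (q2 (y, I))"] by (simp add: Fa_comp)
    also have "\<dots> = Fa (r (Fo' y) \<cdot> ((Id C (Fo' y) \<star> q0) \<cdot> q2 (y, I)))"
      using X by (simp add: Fa_comp p2_r[symmetric] comp_assoc)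
    finally show "r (Fo (Fo' y)) \<cdot> Id C (Fo (Fo' y)) \<star> (p0 \<cdot> Fa q0) \<cdot> (case (y, I) of (x, y) \<Rightarrow> p2 (Fo' x, Fo' y) \<cdot> Fa (q2 (x, y))) = Fa (Fa' (r y))"
      using X by (simp add: F'.p2_r)
  qed (auto simp: Fa_comp F'.Fa_comp)
qed

end

context symmetric_monoidal
begin

text \<open>Translates the exchange of condition IX, which is written without inverses, into
  \<open>sw\<close>.\<close>

lemma sw_eq:
  assumes q: "q \<in> Obj C" and p: "p \<in> Obj C" and t: "t \<in> Obj C"
  shows "(Id C p \<star> s (t, q)) \<cdot> (a (p, t, q) \<cdot> s (q, p \<uplus> t)) = sw q p t"
proof (rule cancel_right[where f="a (q, p, t)"])
  have "((Id C p \<star> s (t, q)) \<cdot> (a (p, t, q) \<cdot> s (q, p \<uplus> t))) \<cdot> a (q, p, t)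
    = (Id C p \<star> s (t, q)) \<cdot> ((Id C p \<star> s (q, t)) \<cdot> (a (p, q, t) \<cdot> (s (q, p) \<star> Id C t)))"
    using assms hexagon[of q p t] by (simp add: comp_assoc)
  also have "\<dots> = sw q p t \<cdot> a (q, p, t)"
    using assms by (simp add: interchange_tail sw_a)
  finally show "((Id C p \<star> s (t, q)) \<cdot> (a (p, t, q) \<cdot> s (q, p \<uplus> t))) \<cdot> a (q, p, t) = sw q p t \<cdot> a (q, p, t)" .
qed (use assms in auto)

text \<open>Four sums are merged in two pairs, by rows or by columns. Hypothesis \<open>eq\<close>
  is the middle four interchange of the domains, in the shape in which condition IX provides it for
  the distributors.\<close>

lemma mu_middle:
  assumes u: "\<And>i. u i \<in> Obj C" and f: "finite X" "finite P" "finite Q" "finite R"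
    and d: "X \<inter> P = {}" "X \<inter> Q = {}" "X \<inter> R = {}" "P \<inter> Q = {}" "P \<inter> R = {}" "Q \<inter> R = {}"
    and g: "g1 \<in> Arr C" "g2 \<in> Arr C" "g3 \<in> Arr C" "g4 \<in> Arr C"
      "Cod C g1 = sumo u X" "Cod C g2 = sumo u P" "Cod C g3 = sumo u Q" "Cod C g4 = sumo u R"
    and k: "k \<in> Arr C" "k' \<in> Arr C" "Cod C k = (Dom C g1 \<uplus> Dom C g2) \<uplus> (Dom C g3 \<uplus> Dom C g4)"
      "Cod C k' = (Dom C g1 \<uplus> Dom C g3) \<uplus> (Dom C g2 \<uplus> Dom C g4)"
    and eq: "(Id C (Dom C g1) \<star> sw (Dom C g3) (Dom C g2) (Dom C g4)) \<cdot> (a (Dom C g1, Dom C g3, Dom C g2 \<uplus> Dom C g4) \<cdot> k')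
       = a (Dom C g1, Dom C g2, Dom C g3 \<uplus> Dom C g4) \<cdot> k"
  shows "mu u (X \<union> P) (Q \<union> R) \<cdot> (((mu u X P \<cdot> (g1 \<star> g2)) \<star> (mu u Q R \<cdot> (g3 \<star> g4))) \<cdot> k)
    = mu u (X \<union> Q) (P \<union> R) \<cdot> (((mu u X Q \<cdot> (g1 \<star> g3)) \<star> (mu u P R \<cdot> (g2 \<star> g4))) \<cdot> k')"
proof -
  have d': "X \<inter> (P \<union> (Q \<union> R)) = {}" "P \<inter> (Q \<union> R) = {}" "(X \<union> P) \<inter> (Q \<union> R) = {}" "X \<inter> (Q \<union> R) = {}"
    "X \<inter> (Q \<union> (P \<union> R)) = {}" "Q \<inter> (P \<union> R) = {}" "(X \<union> Q) \<inter> (P \<union> R) = {}" "X \<inter> (P \<union> R) = {}" "Q \<inter> P = {}"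
    "Q \<union> (P \<union> R) = P \<union> (Q \<union> R)"
    using d by auto
  \<comment> \<open>The fully right-nested form of a grouping. It is stated for all arguments
    because it is applied a second time with the two middle sums interchanged.\<close>
  have four: "mu u (X \<union> P) (Q \<union> R) \<cdot> (((mu u X P \<cdot> (g1 \<star> g2)) \<star> (mu u Q R \<cdot> (g3 \<star> g4))) \<cdot> k)
    = mu u X (P \<union> (Q \<union> R)) \<cdot> ((g1 \<star> (mu u P (Q \<union> R) \<cdot> ((Id C (sumo u P) \<star> mu u Q R) \<cdot> (g2 \<star> (g3 \<star> g4))))) \<cdot>
       (a (Dom C g1, Dom C g2, Dom C g3 \<uplus> Dom C g4) \<cdot> k))"
    if "finite X" "finite P" "finite Q" "finite R" "X \<inter> (P \<union> (Q \<union> R)) = {}" "P \<inter> (Q \<union> R) = {}" "X \<inter> P = {}"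
      "(X \<union> P) \<inter> (Q \<union> R) = {}" "X \<inter> (Q \<union> R) = {}" "Q \<inter> R = {}"
      "g1 \<in> Arr C" "g2 \<in> Arr C" "g3 \<in> Arr C" "g4 \<in> Arr C"
      "Cod C g1 = sumo u X" "Cod C g2 = sumo u P" "Cod C g3 = sumo u Q" "Cod C g4 = sumo u R"
      "k \<in> Arr C" "Cod C k = (Dom C g1 \<uplus> Dom C g2) \<uplus> (Dom C g3 \<uplus> Dom C g4)" for X P Q R g1 g2 g3 g4 k
  proof -
    have "mu u (X \<union> P) (Q \<union> R) \<cdot> (((mu u X P \<cdot> (g1 \<star> g2)) \<star> (mu u Q R \<cdot> (g3 \<star> g4))) \<cdot> k)
      = (mu u (X \<union> P) (Q \<union> R) \<cdot> (mu u X P \<star> Id C (sumo u (Q \<union> R)))) \<cdot> (((g1 \<star> g2) \<star> (mu u Q R \<cdot> (g3 \<star> g4))) \<cdot> k)"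
      using that u by (simp add: comp_assoc interchange_tail)
    also have "\<dots> = mu u X (P \<union> (Q \<union> R)) \<cdot> ((Id C (sumo u X) \<star> mu u P (Q \<union> R)) \<cdot> (a (sumo u X, sumo u P, sumo u (Q \<union> R)) \<cdot> (((g1 \<star> g2) \<star> (mu u Q R \<cdot> (g3 \<star> g4))) \<cdot> k)))"
      using that u mu_assoc[of u X P "Q \<union> R"] by (simp add: comp_assoc)
    also have "\<dots> = mu u X (P \<union> (Q \<union> R)) \<cdot> ((g1 \<star> (mu u P (Q \<union> R) \<cdot> (g2 \<star> (mu u Q R \<cdot> (g3 \<star> g4))))) \<cdot> (a (Dom C g1, Dom C g2, Dom C g3 \<uplus> Dom C g4) \<cdot> k))"
      using that u by (simp add: a_nat_tail interchange_tail)
    also have "g2 \<star> (mu u Q R \<cdot> (g3 \<star> g4)) = (Id C (sumo u P) \<star> mu u Q R) \<cdot> (g2 \<star> (g3 \<star> g4))"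
      using that u by (simp add: interchange)
    finally show ?thesis .
  qed
  have "mu u (X \<union> P) (Q \<union> R) \<cdot> (((mu u X P \<cdot> (g1 \<star> g2)) \<star> (mu u Q R \<cdot> (g3 \<star> g4))) \<cdot> k)
    = mu u X (P \<union> (Q \<union> R)) \<cdot> ((g1 \<star> (mu u P (Q \<union> R) \<cdot> ((Id C (sumo u P) \<star> mu u Q R) \<cdot> (g2 \<star> (g3 \<star> g4))))) \<cdot>
       ((Id C (Dom C g1) \<star> sw (Dom C g3) (Dom C g2) (Dom C g4)) \<cdot> (a (Dom C g1, Dom C g3, Dom C g2 \<uplus> Dom C g4) \<cdot> k')))"
    unfolding eq by (rule four) (use f d d' g k in auto)
  also have "\<dots> = mu u X (P \<union> (Q \<union> R)) \<cdot> ((g1 \<star> (mu u P (Q \<union> R) \<cdot> ((Id C (sumo u P) \<star> mu u Q R) \<cdot> ((g2 \<star> (g3 \<star> g4)) \<cdot> sw (Dom C g3) (Dom C g2) (Dom C g4))))) \<cdot>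
       (a (Dom C g1, Dom C g3, Dom C g2 \<uplus> Dom C g4) \<cdot> k'))"
    using u f d d' g k by (simp add: interchange_tail comp_assoc)
  also have "(g2 \<star> (g3 \<star> g4)) \<cdot> sw (Dom C g3) (Dom C g2) (Dom C g4) = sw (sumo u Q) (sumo u P) (sumo u R) \<cdot> (g3 \<star> (g2 \<star> g4))"
    using u f d d' g k by (simp add: sw_nat)
  also have "mu u P (Q \<union> R) \<cdot> ((Id C (sumo u P) \<star> mu u Q R) \<cdot> (sw (sumo u Q) (sumo u P) (sumo u R) \<cdot> (g3 \<star> (g2 \<star> g4))))
    = (mu u P (Q \<union> R) \<cdot> ((Id C (sumo u P) \<star> mu u Q R) \<cdot> sw (sumo u Q) (sumo u P) (sumo u R))) \<cdot> (g3 \<star> (g2 \<star> g4))"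
    using u f d d' g k by (simp add: comp_assoc)
  also have "\<dots> = mu u Q (P \<union> R) \<cdot> ((Id C (sumo u Q) \<star> mu u P R) \<cdot> (g3 \<star> (g2 \<star> g4)))"
    using u f d d' g k mu_sw[of u Q P R] by (simp add: comp_assoc)
  also have "mu u X (P \<union> (Q \<union> R)) \<cdot> ((g1 \<star> (mu u Q (P \<union> R) \<cdot> ((Id C (sumo u Q) \<star> mu u P R) \<cdot> (g3 \<star> (g2 \<star> g4))))) \<cdot> (a (Dom C g1, Dom C g3, Dom C g2 \<uplus> Dom C g4) \<cdot> k'))
    = mu u (X \<union> Q) (P \<union> R) \<cdot> (((mu u X Q \<cdot> (g1 \<star> g3)) \<star> (mu u P R \<cdot> (g2 \<star> g4))) \<cdot> k')"
    unfolding d'(10)[symmetric] by (rule four[symmetric]) (use f d d' g k in auto)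
  finally show ?thesis .
qed

end

section \<open>Products of sums\<close>

sublocale distributive_data \<subseteq> symmetric_monoidal C "Plus C" "\<zero>" a l r s
  by (rule plus_symmetric_monoidal)

sublocale distributive_data \<subseteq> times: monoidal C "Times C" "\<one>" m lm rm
  by (rule times_monoidal)

context laplaza
begin

lemma dl_Arr [simp]:
  assumes "x \<in> Obj C" "y \<in> Obj C" "z \<in> Obj C"
  shows "dl (x, y, z) \<in> Arr C" "Dom C (dl (x, y, z)) = x \<otimes> (y \<oplus> z)"
    "Cod C (dl (x, y, z)) = (x \<otimes> y) \<oplus> (x \<otimes> z)" "invertible C (dl (x, y, z))"
proof -
  have "(x, y, z) \<in> Obj (pow3 C)" using assms by simp
  from natural_isoD(1,2)[OF dl_natural this]
  show "dl (x, y, z) \<in> Arr C" "Dom C (dl (x, y, z)) = x \<otimes> (y \<oplus> z)"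
    "Cod C (dl (x, y, z)) = (x \<otimes> y) \<oplus> (x \<otimes> z)" "invertible C (dl (x, y, z))"
    by (simp_all add: hom_iff)
qed

lemma dr_Arr [simp]:
  assumes "x \<in> Obj C" "y \<in> Obj C" "z \<in> Obj C"
  shows "dr (x, y, z) \<in> Arr C" "Dom C (dr (x, y, z)) = (x \<oplus> y) \<otimes> z"
    "Cod C (dr (x, y, z)) = (x \<otimes> z) \<oplus> (y \<otimes> z)" "invertible C (dr (x, y, z))"
proof -
  have "(x, y, z) \<in> Obj (pow3 C)" using assms by simp
  from natural_isoD(1,2)[OF dr_natural this]
  show "dr (x, y, z) \<in> Arr C" "Dom C (dr (x, y, z)) = (x \<oplus> y) \<otimes> z"
    "Cod C (dr (x, y, z)) = (x \<otimes> z) \<oplus> (y \<otimes> z)" "invertible C (dr (x, y, z))"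
    by (simp_all add: hom_iff)
qed

lemma nl_Arr [simp]:
  assumes "x \<in> Obj C"
  shows "nl x \<in> Arr C" "Dom C (nl x) = \<zero> \<otimes> x" "Cod C (nl x) = \<zero>" "invertible C (nl x)"
  using natural_isoD(1,2)[OF nl_natural assms] by (simp_all add: hom_iff)

lemma nr_Arr [simp]:
  assumes "x \<in> Obj C"
  shows "nr x \<in> Arr C" "Dom C (nr x) = x \<otimes> \<zero>" "Cod C (nr x) = \<zero>" "invertible C (nr x)"
  using natural_isoD(1,2)[OF nr_natural assms] by (simp_all add: hom_iff)

lemma dl_nat:
  assumes "f \<in> Arr C" "g \<in> Arr C" "h \<in> Arr C" "Cod C f = x'" "Cod C g = y'" "Cod C h = z'"
  shows "dl (x', y', z') \<cdot> (f \<boxtimes> (g \<boxplus> h)) = ((f \<boxtimes> g) \<boxplus> (f \<boxtimes> h)) \<cdot> dl (Dom C f, Dom C g, Dom C h)"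
  using natural_isoD(3)[OF dl_natural, of "(f, g, h)"] assms by auto

lemma dr_nat:
  assumes "f \<in> Arr C" "g \<in> Arr C" "h \<in> Arr C" "Cod C f = x'" "Cod C g = y'" "Cod C h = z'"
  shows "dr (x', y', z') \<cdot> ((f \<boxplus> g) \<boxtimes> h) = ((f \<boxtimes> h) \<boxplus> (g \<boxtimes> h)) \<cdot> dr (Dom C f, Dom C g, Dom C h)"
  using natural_isoD(3)[OF dr_natural, of "(f, g, h)"] assms by auto

lemma dr_nat_tail:
  assumes "f \<in> Arr C" "g \<in> Arr C" "h \<in> Arr C" "Cod C f = x'" "Cod C g = y'" "Cod C h = z'"
    "k \<in> Arr C" "Cod C k = (Dom C f \<oplus> Dom C g) \<otimes> Dom C h"
  shows "dr (x', y', z') \<cdot> (((f \<boxplus> g) \<boxtimes> h) \<cdot> k) = ((f \<boxtimes> h) \<boxplus> (g \<boxtimes> h)) \<cdot> (dr (Dom C f, Dom C g, Dom C h) \<cdot> k)"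
  using comp_reduce[OF dr_nat[OF assms(1-6)], of k] assms by (auto simp: comp_assoc)

lemma nl_nat: "f \<in> Arr C ==> Cod C f = x ==> nl x \<cdot> (Id C \<zero> \<boxtimes> f) = nl (Dom C f)"
  using natural_isoD(3)[OF nl_natural, of f] by auto

lemma nr_nat: "f \<in> Arr C ==> Cod C f = x ==> nr x \<cdot> (f \<boxtimes> Id C \<zero>) = nr (Dom C f)"
  using natural_isoD(3)[OF nr_natural, of f] by auto

lemma nl_nat_tail: "f \<in> Arr C ==> Cod C f = x ==> k \<in> Arr C ==> Cod C k = \<zero> \<otimes> Dom C f ==>
    nl x \<cdot> ((Id C \<zero> \<boxtimes> f) \<cdot> k) = nl (Dom C f) \<cdot> k"
  using comp_reduce[OF nl_nat, of f x k] by auto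

text \<open>Conditions V and I make \<open>dl\<close> compatible with \<open>a\<close> and
  \<open>s\<close>, while XIX and XXI say that \<open>nr\<close> removes a zero summand correctly.
  For the right multiplication below, IV, III, XX and XXII do the same.\<close>

lemma left_functor:
  assumes x: "x \<in> Obj C"
  shows "symmetric_functor C (Plus C) \<zero> a l r s (\<lambda>y. x \<otimes> y) (\<lambda>f. Id C x \<boxtimes> f) (nr x) (\<lambda>p. dl (x, p))"
  by unfold_locales
    (use x in \<open>auto simp: times.interchange dl_nat V I XIX XXI\<close>)

lemma right_functor:
  assumes z: "z \<in> Obj C"
  shows "symmetric_functor C (Plus C) \<zero> a l r s (\<lambda>y. y \<otimes> z) (\<lambda>f. f \<boxtimes> Id C z) (nl z) (\<lambda>(x, y). dr (x, y, z))"
  by unfold_locales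
    (use z in \<open>auto simp: times.interchange dr_nat IV III XX XXII\<close>)

text \<open>The words of a factor have one common length \<open>p\<close>, so a concatenated word
  can be cut again. Iterated products thereby keep a single index type, which nested pairs would
  not.\<close>

definition tens :: "nat \<Rightarrow> ('k list \<Rightarrow> 'o) \<Rightarrow> ('k list \<Rightarrow> 'o) \<Rightarrow> 'k list \<Rightarrow> 'o" where
  "tens p u v w = u (take p w) \<otimes> v (drop p w)"

lemma tens_append [simp]: "length s' = p ==> tens p u v (s' @ t) = u s' \<otimes> v t"
  by (simp add: tens_def)

lemma tens_Obj [simp]: "(\<And>i. u i \<in> Obj C) ==> (\<And>i. v i \<in> Obj C) ==> tens p u v w \<in> Obj C"
  by (simp add: tens_def)

definition wprod :: "'k list set \<Rightarrow> 'k list set \<Rightarrow> 'k list set" where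
  "wprod S T = (\<Union>s\<in>S. (@) s ` T)"

definition words :: "nat \<Rightarrow> 'k list set \<Rightarrow> bool" where
  "words p S \<longleftrightarrow> finite S \<and> (\<forall>s\<in>S. length s = p)"

lemma wprod_simps [simp]:
  "wprod {} T = {}" "wprod (insert s' S) T = (@) s' ` T \<union> wprod S T" "wprod S {} = {}"
  by (auto simp: wprod_def)

lemma finite_wprod [simp]: "finite S ==> finite T ==> finite (wprod S T)"
  by (auto simp: wprod_def)

lemma words_wprod: "words p S ==> words q T ==> words (p + q) (wprod S T)"
  by (auto simp: words_def wprod_def)

lemma wprod_assoc: "wprod (wprod S T) R = wprod S (wprod T R)"
  by (force simp: wprod_def)

text \<open>A word has only one prefix of length \<open>p\<close>, so both parts can be recovered
  from a concatenation.\<close>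

lemma wprod_disjoint:
  assumes "\<And>s'. s' \<in> S \<union> S' ==> length s' = p" "S \<inter> S' = {} \<or> T \<inter> T' = {}"
  shows "wprod S T \<inter> wprod S' T' = {}"
proof (rule equals0I)
  fix w assume "w \<in> wprod S T \<inter> wprod S' T'"
  then obtain b t b' t' where "w = b @ t" "w = b' @ t'" "b \<in> S" "b' \<in> S'" "t \<in> T" "t' \<in> T'"
    unfolding wprod_def by blast
  moreover then have "b = b' \<and> t = t'" using assms(1)[of b] assms(1)[of b'] by simp
  ultimately show False using assms(2) by auto
qed

lemma wprod_single: "wprod {k} T = (@) k ` T"
  by simp

text \<open>Distribution of one object \<open>x\<close> over a sum by \<open>dl\<close>. The prefix
  \<open>s'\<close> labels the resulting terms, and the family \<open>w\<close> of target objects is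
  left free because the same expansion occurs with differently bracketed targets.\<close>

definition lam :: "'o \<Rightarrow> ('k list \<Rightarrow> 'o) \<Rightarrow> ('k list \<Rightarrow> 'o) \<Rightarrow> 'k list \<Rightarrow> ('k::linorder) list set \<Rightarrow> 'm" where
  "lam x v w s' T = blk (nr x) (\<lambda>p. dl (x, p)) v w (\<lambda>t. {s' @ t}) (\<lambda>t. unit w (s' @ t)) T"

text \<open>Distribution of a product of two sums: \<open>dr\<close> splits the left factor, and
  each of its terms is distributed over the right factor. That the order of the two splittings does
  not matter is the content of \<open>nu_mu_right\<close>.\<close>

definition nu :: "nat \<Rightarrow> ('k list \<Rightarrow> 'o) \<Rightarrow> ('k list \<Rightarrow> 'o) \<Rightarrow> ('k::linorder) list set \<Rightarrow> 'k list set \<Rightarrow> 'm" where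
  "nu p u v S T = blk (nl (sumo v T)) (\<lambda>(x, y). dr (x, y, sumo v T)) u (tens p u v)
     (\<lambda>s. (@) s ` T) (\<lambda>s. lam (u s) v (tens p u v) s T) S"

lemma lam_block:
  assumes "\<And>i. v i \<in> Obj C" "\<And>i. w i \<in> Obj C" "finite T" "\<And>t. t \<in> T ==> w (s' @ t) = x \<otimes> v t"
  shows "block (\<lambda>y. x \<otimes> y) v w (\<lambda>t. {s' @ t}) (\<lambda>t. unit w (s' @ t)) T"
  by (rule blockI) (use assms in auto)

lemma lam_Arr [simp]:
  assumes "x \<in> Obj C" "\<And>i. v i \<in> Obj C" "\<And>i. w i \<in> Obj C" "finite T" "\<And>t. t \<in> T ==> w (s' @ t) = x \<otimes> v t"
  shows "lam x v w s' T \<in> Arr C" "Dom C (lam x v w s' T) = x \<otimes> sumo v T"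
    "Cod C (lam x v w s' T) = sumo w ((@) s' ` T)" "invertible C (lam x v w s' T)"
proof -
  note b = lam_block[of v w T s' x, OF assms(2-5)]
  have "\<Union>((\<lambda>t. {s' @ t}) ` T) = (@) s' ` T" by auto
  then show "lam x v w s' T \<in> Arr C" "Dom C (lam x v w s' T) = x \<otimes> sumo v T"
    "Cod C (lam x v w s' T) = sumo w ((@) s' ` T)" "invertible C (lam x v w s' T)"
    using symmetric_functor.blk_Arr[OF left_functor b] assms by (simp_all add: lam_def)
qed

lemma lam_single:
  assumes "x \<in> Obj C" "\<And>i. v i \<in> Obj C" "\<And>i. w i \<in> Obj C" "w (s' @ t) = x \<otimes> v t"
  shows "lam x v w s' {t} \<cdot> (Id C x \<boxtimes> unit v t) = unit w (s' @ t)"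
  unfolding lam_def
  by (rule symmetric_functor.blk_single[OF left_functor lam_block]) (use assms in auto)

lemma lam_mu:
  assumes "x \<in> Obj C" "\<And>i. v i \<in> Obj C" "\<And>i. w i \<in> Obj C" "finite T" "finite A" "T \<inter> A = {}"
    "\<And>t. t \<in> T \<union> A ==> w (s' @ t) = x \<otimes> v t"
  shows "lam x v w s' (T \<union> A) \<cdot> (Id C x \<boxtimes> mu v T A)
    = mu w ((@) s' ` T) ((@) s' ` A) \<cdot> ((lam x v w s' T \<boxplus> lam x v w s' A) \<cdot> dl (x, sumo v T, sumo v A))"
proof -
  have b: "block (\<lambda>y. x \<otimes> y) v w (\<lambda>t. {s' @ t}) (\<lambda>t. unit w (s' @ t)) (T \<union> A)"
    by (rule lam_block) (use assms in auto)
  have "\<Union>((\<lambda>t. {s' @ t}) ` T) = (@) s' ` T" for T by auto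
  then show ?thesis
    using symmetric_functor.blk_mu[OF left_functor[OF assms(1)] b assms(6)] by (simp add: lam_def)
qed

lemma nu_block:
  assumes "\<And>i. u i \<in> Obj C" "\<And>i. v i \<in> Obj C" "words p S" "finite T"
  shows "block (\<lambda>y. y \<otimes> sumo v T) u (tens p u v) (\<lambda>s. (@) s ` T) (\<lambda>s. lam (u s) v (tens p u v) s T) S"
  by (rule blockI) (use assms in \<open>auto simp: words_def\<close>)

lemma nu_Arr [simp]:
  assumes "\<And>i. u i \<in> Obj C" "\<And>i. v i \<in> Obj C" "words p S" "finite T"
  shows "nu p u v S T \<in> Arr C" "Dom C (nu p u v S T) = sumo u S \<otimes> sumo v T"
    "Cod C (nu p u v S T) = sumo (tens p u v) (wprod S T)" "invertible C (nu p u v S T)"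
  using symmetric_functor.blk_Arr[OF right_functor nu_block[of u v p S T, OF assms]] assms
  by (auto simp: nu_def wprod_def words_def)

lemma words_simps [simp]:
  "words p {}" "words p (insert s' S) \<longleftrightarrow> length s' = p \<and> words p S" "words p (S \<union> A) \<longleftrightarrow> words p S \<and> words p A"
  by (auto simp: words_def)

lemma words_finite: "words p S ==> finite S"
  by (simp add: words_def)

lemma nu_ins:
  assumes "\<And>i. u i \<in> Obj C" "\<And>i. v i \<in> Obj C" "words p S" "length k = p" "finite T" "k \<notin> S"
  shows "nu p u v (insert k S) T \<cdot> (ins u k S \<boxtimes> Id C (sumo v T))
    = mu (tens p u v) ((@) k ` T) (wprod S T) \<cdot> ((lam (u k) v (tens p u v) k T \<boxplus> nu p u v S T) \<cdot> dr (u k, sumo u S, sumo v T))"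
  using symmetric_functor.blk_ins[OF right_functor nu_block[of u v p "insert k S" T] assms(6)] assms
  by (simp add: nu_def wprod_def)

lemma nu_single:
  assumes "\<And>i. u i \<in> Obj C" "\<And>i. v i \<in> Obj C" "length k = p" "finite T"
  shows "nu p u v {k} T \<cdot> (unit u k \<boxtimes> Id C (sumo v T)) = lam (u k) v (tens p u v) k T"
  using symmetric_functor.blk_single[OF right_functor nu_block[of u v p "{k}" T]] assms
  by (simp add: nu_def)

lemma nu_single_single:
  assumes u: "\<And>i. u i \<in> Obj C" and v: "\<And>i. v i \<in> Obj C" and k: "length k = p"
  shows "nu p u v {k} {t} \<cdot> (unit u k \<boxtimes> unit v t) = unit (tens p u v) (k @ t)"
proof -
  have "nu p u v {k} {t} \<cdot> (unit u k \<boxtimes> unit v t)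
    = (nu p u v {k} {t} \<cdot> (unit u k \<boxtimes> Id C (sumo v {t}))) \<cdot> (Id C (u k) \<boxtimes> unit v t)"
    using assms by (simp add: comp_assoc times.interchange)
  also have "\<dots> = lam (u k) v (tens p u v) k {t} \<cdot> (Id C (u k) \<boxtimes> unit v t)"
    using nu_single[of u v k p "{t}"] assms by simp
  also have "\<dots> = unit (tens p u v) (k @ t)"
    by (rule lam_single) (use assms in auto)
  finally show ?thesis .
qed

lemma nu_empty_left [simp]: "nu p u v {} T = nl (sumo v T)"
  by (simp add: nu_def)

text \<open>The recursion runs over the left factor, so an empty right factor needs an induction:
  XII adds one summand, and at the empty left sum the two absorptions have to agree, which is
  X.\<close>

lemma nu_empty_right:
  assumes u: "\<And>i. u i \<in> Obj C" and v: "\<And>i. v i \<in> Obj C" and S: "words p S"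
  shows "nu p u v S {} = nr (sumo u S)"
  using words_finite[OF S] S
proof induction
  case empty
  then show ?case using X by simp
next
  case (insert k S)
  have k: "length k = p" "words p S" using insert.prems by auto
  show ?case
  proof (rule cancel_right[where f="ins u k S \<boxtimes> Id C \<zero>"])
    have "nu p u v (insert k S) {} \<cdot> (ins u k S \<boxtimes> Id C \<zero>) = l \<zero> \<cdot> ((nr (u k) \<boxplus> nr (sumo u S)) \<cdot> dr (u k, sumo u S, \<zero>))"
      using nu_ins[of u v p S k "{}"] insert k u v by (simp add: lam_def)
    also have "\<dots> = nr (sumo u (insert k S)) \<cdot> (ins u k S \<boxtimes> Id C \<zero>)"
      using u insert XII[of "u k" "sumo u S"] by (simp add: nr_nat)
    finally show "nu p u v (insert k S) {} \<cdot> (ins u k S \<boxtimes> Id C \<zero>) = nr (sumo u (insert k S)) \<cdot> (ins u k S \<boxtimes> Id C \<zero>)" .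
  qed (use u v insert k in auto)
qed

text \<open>\<open>nu\<close> splits the left factor first, hence additivity in the right one must
  be proved. Adding a summand \<open>k\<close> on the left interchanges the two distributions, which
  is condition IX used through \<open>mu_middle\<close>; for the empty left sum the claim is
  XI.\<close>

lemma nu_mu_right:
  assumes u: "\<And>i. u i \<in> Obj C" and v: "\<And>i. v i \<in> Obj C" and S: "words p S" and TA: "finite T" "finite A" "T \<inter> A = {}"
  shows "nu p u v S (T \<union> A) \<cdot> (Id C (sumo u S) \<boxtimes> mu v T A)
    = mu (tens p u v) (wprod S T) (wprod S A) \<cdot> ((nu p u v S T \<boxplus> nu p u v S A) \<cdot> dl (sumo u S, sumo v T, sumo v A))"
  using words_finite[OF S] S
proof induction
  case empty
  then show ?case using v TA XI[of "sumo v T" "sumo v A"] by (simp add: nl_nat)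
next
  case (insert k S)
  have k: "length k = p" "words p S" "finite S" using insert.prems insert.hyps by auto
  let ?w = "tens p u v"
  have w: "\<And>i. ?w i \<in> Obj C" using u v by simp
  have fT: "finite (T \<union> A)" using TA by simp
  have len: "\<And>s'. s' \<in> S ==> length s' = p" using k by (auto simp: words_def)
  have dis0: "(@) k ` T \<inter> (@) k ` A = {}" "(@) k ` T \<inter> wprod S T = {}" "(@) k ` T \<inter> wprod S A = {}"
    "(@) k ` A \<inter> wprod S T = {}" "(@) k ` A \<inter> wprod S A = {}" "wprod S T \<inter> wprod S A = {}"
    unfolding wprod_single[symmetric]
    by (rule wprod_disjoint[where p=p]; use TA insert.hyps k len in auto)+
  have dis1: "wprod S T \<inter> (@) k ` A = {}" "wprod S A \<inter> (@) k ` T = {}"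
    using dis0(3,4) by (simp_all only: Int_commute)
  have "((@) k ` T \<union> (@) k ` A) \<inter> (wprod S T \<union> wprod S A) = {}"
    "((@) k ` T \<union> wprod S T) \<inter> ((@) k ` A \<union> wprod S A) = {}"
    by (simp_all only: Int_Un_distrib Int_Un_distrib2 dis0 dis1 Un_empty simp_thms)
  note dis = dis0 dis1 this
  have wU: "wprod S (T \<union> A) = wprod S T \<union> wprod S A" "(@) k ` (T \<union> A) = (@) k ` T \<union> (@) k ` A" by (auto simp: wprod_def)
  note f = k w TA fT dis insert.hyps
  let ?la = "\<lambda>T. lam (u k) v ?w k T" and ?nu = "\<lambda>T. nu p u v S T" and ?x = "u k" and ?y = "sumo u S" and ?z = "sumo v T" and ?t = "sumo v A"
  have lamA [simp]: "?la Z \<in> Arr C" "Dom C (?la Z) = u k \<otimes> sumo v Z" "Cod C (?la Z) = sumo ?w ((@) k ` Z)"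
    if "finite Z" for Z
    using lam_Arr[of "u k" v ?w Z k] u v k that by auto
  show ?case
  proof (rule cancel_right[where f="ins u k S \<boxtimes> Id C (?z \<oplus> ?t)"])
    have "(nu p u v (insert k S) (T \<union> A) \<cdot> (Id C (sumo u (insert k S)) \<boxtimes> mu v T A)) \<cdot> (ins u k S \<boxtimes> Id C (?z \<oplus> ?t))
      = (nu p u v (insert k S) (T \<union> A) \<cdot> (ins u k S \<boxtimes> Id C (sumo v (T \<union> A)))) \<cdot> (Id C (?x \<oplus> ?y) \<boxtimes> mu v T A)"
      using u v f by (simp add: comp_assoc times.interchange)
    also have "\<dots> = mu ?w ((@) k ` (T \<union> A)) (wprod S (T \<union> A)) \<cdot> ((?la (T \<union> A) \<boxplus> ?nu (T \<union> A)) \<cdot> (dr (?x, ?y, sumo v (T \<union> A)) \<cdot> (Id C (?x \<oplus> ?y) \<boxtimes> mu v T A)))"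
      using u v f nu_ins[of u v p S k "T \<union> A"] by (simp add: comp_assoc wU)
    also have "dr (?x, ?y, sumo v (T \<union> A)) \<cdot> (Id C (?x \<oplus> ?y) \<boxtimes> mu v T A) = ((Id C ?x \<boxtimes> mu v T A) \<boxplus> (Id C ?y \<boxtimes> mu v T A)) \<cdot> dr (?x, ?y, ?z \<oplus> ?t)"
      using u v f dr_nat[of "Id C ?x" "Id C ?y" "mu v T A" ?x ?y "sumo v (T \<union> A)"] by simp
    also have "mu ?w ((@) k ` (T \<union> A)) (wprod S (T \<union> A)) \<cdot> ((?la (T \<union> A) \<boxplus> ?nu (T \<union> A)) \<cdot> (((Id C ?x \<boxtimes> mu v T A) \<boxplus> (Id C ?y \<boxtimes> mu v T A)) \<cdot> dr (?x, ?y, ?z \<oplus> ?t)))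
      = mu ?w ((@) k ` (T \<union> A)) (wprod S (T \<union> A)) \<cdot> (((?la (T \<union> A) \<cdot> (Id C ?x \<boxtimes> mu v T A)) \<boxplus> (?nu (T \<union> A) \<cdot> (Id C ?y \<boxtimes> mu v T A))) \<cdot> dr (?x, ?y, ?z \<oplus> ?t))"
      using u v f by (simp add: interchange_tail wU)
    also have "?la (T \<union> A) \<cdot> (Id C ?x \<boxtimes> mu v T A) = mu ?w ((@) k ` T) ((@) k ` A) \<cdot> ((?la T \<boxplus> ?la A) \<cdot> dl (?x, ?z, ?t))"
      by (rule lam_mu) (use u v f in auto)
    also have "?nu (T \<union> A) \<cdot> (Id C ?y \<boxtimes> mu v T A) = mu ?w (wprod S T) (wprod S A) \<cdot> ((?nu T \<boxplus> ?nu A) \<cdot> dl (?y, ?z, ?t))"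
      using insert.IH k by simp
    also have "mu ?w ((@) k ` (T \<union> A)) (wprod S (T \<union> A)) \<cdot> (((mu ?w ((@) k ` T) ((@) k ` A) \<cdot> ((?la T \<boxplus> ?la A) \<cdot> dl (?x, ?z, ?t))) \<boxplus> (mu ?w (wprod S T) (wprod S A) \<cdot> ((?nu T \<boxplus> ?nu A) \<cdot> dl (?y, ?z, ?t)))) \<cdot> dr (?x, ?y, ?z \<oplus> ?t))
      = mu ?w ((@) k ` T \<union> (@) k ` A) (wprod S T \<union> wprod S A) \<cdot> (((mu ?w ((@) k ` T) ((@) k ` A) \<cdot> (?la T \<boxplus> ?la A)) \<boxplus> (mu ?w (wprod S T) (wprod S A) \<cdot> (?nu T \<boxplus> ?nu A))) \<cdot> ((dl (?x, ?z, ?t) \<boxplus> dl (?y, ?z, ?t)) \<cdot> dr (?x, ?y, ?z \<oplus> ?t)))"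
      using u v f by (simp add: interchange_tail comp_assoc wU)
    also have "\<dots> = mu ?w ((@) k ` T \<union> wprod S T) ((@) k ` A \<union> wprod S A) \<cdot> (((mu ?w ((@) k ` T) (wprod S T) \<cdot> (?la T \<boxplus> ?nu T)) \<boxplus> (mu ?w ((@) k ` A) (wprod S A) \<cdot> (?la A \<boxplus> ?nu A))) \<cdot> ((dr (?x, ?y, ?z) \<boxplus> dr (?x, ?y, ?t)) \<cdot> dl (?x \<oplus> ?y, ?z, ?t)))"
    proof (rule mu_middle)
      have "(Id C (?x \<otimes> ?z) \<boxplus> sw (?y \<otimes> ?z) (?x \<otimes> ?t) (?y \<otimes> ?t)) \<cdot> (a (?x \<otimes> ?z, ?y \<otimes> ?z, ?x \<otimes> ?t \<oplus> ?y \<otimes> ?t) \<cdot> ((dr (?x, ?y, ?z) \<boxplus> dr (?x, ?y, ?t)) \<cdot> dl (?x \<oplus> ?y, ?z, ?t)))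
        = a (?x \<otimes> ?z, ?x \<otimes> ?t, ?y \<otimes> ?z \<oplus> ?y \<otimes> ?t) \<cdot> ((dl (?x, ?z, ?t) \<boxplus> dl (?y, ?z, ?t)) \<cdot> dr (?x, ?y, ?z \<oplus> ?t))"
        using u v IX[of ?x ?y ?z ?t "?y \<otimes> ?z" "?x \<otimes> ?t" "?y \<otimes> ?t", OF _ _ _ _ refl refl refl refl] by (simp add: sw_eq)
      then show "(Id C (Dom C (?la T)) \<boxplus> sw (Dom C (?nu T)) (Dom C (?la A)) (Dom C (?nu A))) \<cdot>
          (a (Dom C (?la T), Dom C (?nu T), Dom C (?la A) \<oplus> Dom C (?nu A)) \<cdot> ((dr (?x, ?y, ?z) \<boxplus> dr (?x, ?y, ?t)) \<cdot> dl (?x \<oplus> ?y, ?z, ?t))) =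
        a (Dom C (?la T), Dom C (?la A), Dom C (?nu T) \<oplus> Dom C (?nu A)) \<cdot> ((dl (?x, ?z, ?t) \<boxplus> dl (?y, ?z, ?t)) \<cdot> dr (?x, ?y, ?z \<oplus> ?t))"
        using u v f by simp
    qed (use u v f in auto)
    also have "\<dots> = mu ?w (wprod (insert k S) T) (wprod (insert k S) A) \<cdot> (((mu ?w ((@) k ` T) (wprod S T) \<cdot> ((?la T \<boxplus> ?nu T) \<cdot> dr (?x, ?y, ?z))) \<boxplus> (mu ?w ((@) k ` A) (wprod S A) \<cdot> ((?la A \<boxplus> ?nu A) \<cdot> dr (?x, ?y, ?t)))) \<cdot> dl (?x \<oplus> ?y, ?z, ?t))"
      using u v f by (simp add: interchange_tail comp_assoc)
    also have "\<dots> = mu ?w (wprod (insert k S) T) (wprod (insert k S) A) \<cdot> (((nu p u v (insert k S) T \<cdot> (ins u k S \<boxtimes> Id C ?z)) \<boxplus> (nu p u v (insert k S) A \<cdot> (ins u k S \<boxtimes> Id C ?t))) \<cdot> dl (?x \<oplus> ?y, ?z, ?t))"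
      using u v f by (simp add: nu_ins)
    also have "\<dots> = mu ?w (wprod (insert k S) T) (wprod (insert k S) A) \<cdot> ((nu p u v (insert k S) T \<boxplus> nu p u v (insert k S) A) \<cdot> (((ins u k S \<boxtimes> Id C ?z) \<boxplus> (ins u k S \<boxtimes> Id C ?t)) \<cdot> dl (?x \<oplus> ?y, ?z, ?t)))"
      using u v f by (simp add: interchange_tail)
    also have "((ins u k S \<boxtimes> Id C ?z) \<boxplus> (ins u k S \<boxtimes> Id C ?t)) \<cdot> dl (?x \<oplus> ?y, ?z, ?t) = dl (sumo u (insert k S), ?z, ?t) \<cdot> (ins u k S \<boxtimes> Id C (?z \<oplus> ?t))"
      using u v f dl_nat[of "ins u k S" "Id C ?z" "Id C ?t" "sumo u (insert k S)" ?z ?t] by simp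
    finally show "(nu p u v (insert k S) (T \<union> A) \<cdot> (Id C (sumo u (insert k S)) \<boxtimes> mu v T A)) \<cdot> (ins u k S \<boxtimes> Id C (?z \<oplus> ?t))
      = (mu ?w (wprod (insert k S) T) (wprod (insert k S) A) \<cdot> ((nu p u v (insert k S) T \<boxplus> nu p u v (insert k S) A) \<cdot> dl (sumo u (insert k S), ?z, ?t))) \<cdot> (ins u k S \<boxtimes> Id C (?z \<oplus> ?t))"
      using u v f by (simp add: comp_assoc)
  qed (use u v f in \<open>auto simp: wU\<close>)
qed

end

section \<open>Associativity of the distribution of products over sums\<close>

context laplaza
begin

lemma UN_append: "(\<Union>t\<in>T. {s' @ t}) = (@) s' ` T"
  by auto

lemma UN_single: "(\<Union>t\<in>T. {t}) = T"
  by auto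

text \<open>Each of the three associativity laws extends the previous one by additivity in one more factor.\<close>

lemma lam_lam:
  assumes x: "x \<in> Obj C" and y: "y \<in> Obj C" and v: "\<And>i. v i \<in> Obj C" and ws: "\<And>i. w i \<in> Obj C" "\<And>i. w1 i \<in> Obj C" "\<And>i. w2 i \<in> Obj C"
    and R: "finite R"
    and eq: "\<And>r. r \<in> R ==> w1 (t @ r) = y \<otimes> v r" "\<And>r. r \<in> R ==> w (s' @ t @ r) = x \<otimes> (y \<otimes> v r)"
      "\<And>r. r \<in> R ==> w2 (s' @ t @ r) = (x \<otimes> y) \<otimes> v r"
    and g: "\<And>r. r \<in> R ==> g (s' @ t @ r) = unit w (s' @ t @ r) \<cdot> m (x, y, v r)"
  shows "lam x w1 w s' ((@) t ` R) \<cdot> ((Id C x \<boxtimes> lam y v w1 t R) \<cdot> m (x, y, sumo v R))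
    = phi w2 w (\<lambda>q. {q}) g ((@) (s' @ t) ` R) \<cdot> lam (x \<otimes> y) v w2 (s' @ t) R"
proof -
  note O [simp] = x y v ws eq
  interpret X: symmetric_functor C "Plus C" "\<zero>" a l r s "\<lambda>y. x \<otimes> y" "\<lambda>f. Id C x \<boxtimes> f" "nr x" "\<lambda>p. dl (x, p)"
    by (rule left_functor[OF x])
  interpret Y: symmetric_functor C "Plus C" "\<zero>" a l r s "\<lambda>z. y \<otimes> z" "\<lambda>f. Id C y \<boxtimes> f" "nr y" "\<lambda>p. dl (y, p)"
    by (rule left_functor[OF y])
  interpret XY: symmetric_functor C "Plus C" "\<zero>" a l r s "\<lambda>z. (x \<otimes> y) \<otimes> z" "\<lambda>f. Id C (x \<otimes> y) \<boxtimes> f" "nr (x \<otimes> y)" "\<lambda>p. dl (x \<otimes> y, p)"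
    by (rule left_functor) simp
  let ?q0 = "nr x \<cdot> (Id C x \<boxtimes> nr y)" and ?q2 = "\<lambda>(z, z'). dl (x, y \<otimes> z, y \<otimes> z') \<cdot> (Id C x \<boxtimes> dl (y, z, z'))"
  interpret XoY: symmetric_functor C "Plus C" "\<zero>" a l r s "\<lambda>z. x \<otimes> (y \<otimes> z)" "\<lambda>f. Id C x \<boxtimes> (Id C y \<boxtimes> f)" ?q0 ?q2
    by (rule X.composite_functor[OF Y.symmetric_functor_axioms])
  have b: "block (\<lambda>z. y \<otimes> z) v w1 (\<lambda>r. {t @ r}) (\<lambda>r. unit w1 (t @ r)) R"
    by (rule lam_block) (use R in auto)
  have c: "block (\<lambda>z. x \<otimes> z) w1 w (\<lambda>t. {s' @ t}) (\<lambda>t. unit w (s' @ t)) ((@) t ` R)"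
    by (rule lam_block) (use R in auto)
  let ?h = "\<lambda>r. lam x w1 w s' {t @ r} \<cdot> (Id C x \<boxtimes> unit w1 (t @ r))"
  have h: "?h r = unit w (s' @ t @ r)" if "r \<in> R" for r
    using lam_single[of x w1 w s' "t @ r"] that by simp
  have l1: "lam x w1 w s' ((@) t ` R) \<in> Arr C" "Dom C (lam x w1 w s' ((@) t ` R)) = x \<otimes> sumo w1 ((@) t ` R)"
    by (rule lam_Arr; use R in auto)+
  have e: "lam x w1 w s' ((@) t ` R) \<cdot> (Id C x \<boxtimes> lam y v w1 t R) = blk ?q0 ?q2 v w (\<lambda>r. {s' @ t @ r}) ?h R"
    using X.blk_blk[OF Y.symmetric_functor_axioms b] c by (simp add: lam_def UN_append)
  have "lam x w1 w s' ((@) t ` R) \<cdot> ((Id C x \<boxtimes> lam y v w1 t R) \<cdot> m (x, y, sumo v R))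
    = (lam x w1 w s' ((@) t ` R) \<cdot> (Id C x \<boxtimes> lam y v w1 t R)) \<cdot> m (x, y, sumo v R)"
    by (subst comp_assoc) (use R l1 in auto)
  also have "\<dots> = blk ?q0 ?q2 v w (\<lambda>r. {s' @ t @ r}) ?h R \<cdot> m (x, y, sumo v R)"
    unfolding e ..
  \<comment> \<open>The associator in its third argument is a monoidal transformation from
    \<open>(x \<otimes> y) \<otimes> -\<close> to \<open>x \<otimes> (y \<otimes> -)\<close>: VI
    treats binary sums, XVIII the empty one.\<close>
  also have "\<dots> = blk (nr (x \<otimes> y)) (\<lambda>p. dl (x \<otimes> y, p)) v w (\<lambda>r. {s' @ t @ r}) (\<lambda>r. ?h r \<cdot> m (x, y, v r)) R"
  proof (rule XoY.blk_natural[where Ko="\<lambda>z. (x \<otimes> y) \<otimes> z" and t="\<lambda>z. m (x, y, z)"])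
    show "block (\<lambda>z. x \<otimes> (y \<otimes> z)) v w (\<lambda>r. {s' @ t @ r}) ?h R"
      by (rule blockI) (use R h in auto)
    show "?q0 \<cdot> m (x, y, \<zero>) = nr (x \<otimes> y)"
      using XVIII[OF x y] by (simp add: comp_assoc)
    show "?q2 (z, z') \<cdot> m (x, y, z \<oplus> z') = (m (x, y, z) \<boxplus> m (x, y, z')) \<cdot> dl (x \<otimes> y, z, z')" if "z \<in> Obj C" "z' \<in> Obj C" for z z'
      using VI[OF x y that] that by (simp add: comp_assoc)
  qed auto
  also have "\<dots> = blk (nr (x \<otimes> y)) (\<lambda>p. dl (x \<otimes> y, p)) v w (\<lambda>r. {s' @ t @ r}) (\<lambda>r. phi w2 w (\<lambda>q. {q}) g {s' @ t @ r} \<cdot> unit w2 (s' @ t @ r)) R"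
  proof (rule blk_cong)
    fix k assume k: "k \<in> R"
    have "sblock w2 w (\<lambda>q. {q}) g {s' @ t @ k}"
      by (rule blockI) (use k g in auto)
    then show "?h k \<cdot> m (x, y, v k) = phi w2 w (\<lambda>q. {q}) g {s' @ t @ k} \<cdot> unit w2 (s' @ t @ k)"
      using h k g phi_single[of w2 w "\<lambda>q. {q}" g "s' @ t @ k"] by simp
  qed (use R in auto)
  also have "\<dots> = phi w2 w (\<lambda>q. {q}) g ((@) (s' @ t) ` R) \<cdot> lam (x \<otimes> y) v w2 (s' @ t) R"
  proof -
    have b: "block (\<lambda>z. (x \<otimes> y) \<otimes> z) v w2 (\<lambda>r. {(s' @ t) @ r}) (\<lambda>r. unit w2 ((s' @ t) @ r)) R"
      by (rule lam_block) (use R in auto)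
    have "sblock w2 w (\<lambda>q. {q}) g ((@) (s' @ t) ` R)"
      by (rule blockI) (use R g in auto)
    then show ?thesis using XY.phi_blk[OF b, where w=w and H="\<lambda>q. {q}" and h=g] by (simp add: lam_def UN_append[of "s' @ t", simplified] UN_append)
  qed
  finally show ?thesis .
qed

lemma lam_nu:
  assumes x: "x \<in> Obj C" and v: "\<And>i. v i \<in> Obj C" and z: "\<And>i. z i \<in> Obj C" and ws: "\<And>i. w i \<in> Obj C" "\<And>i. y i \<in> Obj C"
    and T: "words q T" and R: "finite R" and p: "length s' = p"
    and eq: "\<And>t. t \<in> T ==> y (s' @ t) = x \<otimes> v t"
      "\<And>t r. t \<in> T ==> r \<in> R ==> w (s' @ t @ r) = x \<otimes> (v t \<otimes> z r)"
    and g: "\<And>t r. t \<in> T ==> r \<in> R ==> g (s' @ t @ r) = unit w (s' @ t @ r) \<cdot> m (x, v t, z r)"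
  shows "lam x (tens q v z) w s' (wprod T R) \<cdot> ((Id C x \<boxtimes> nu q v z T R) \<cdot> m (x, sumo v T, sumo z R))
    = phi (tens (p + q) y z) w (\<lambda>q. {q}) g (wprod ((@) s' ` T) R) \<cdot>
      (nu (p + q) y z ((@) s' ` T) R \<cdot> (lam x v y s' T \<boxtimes> Id C (sumo z R)))"
proof -
  note O [simp] = x v z ws eq(1)
  let ?Z = "sumo z R" and ?w1 = "tens q v z" and ?w2 = "tens (p + q) y z"
  interpret X: symmetric_functor C "Plus C" "\<zero>" a l r s "\<lambda>y. x \<otimes> y" "\<lambda>f. Id C x \<boxtimes> f" "nr x" "\<lambda>p. dl (x, p)"
    by (rule left_functor[OF x])
  interpret Z: symmetric_functor C "Plus C" "\<zero>" a l r s "\<lambda>y. y \<otimes> ?Z" "\<lambda>f. f \<boxtimes> Id C ?Z" "nl ?Z" "\<lambda>(x, y). dr (x, y, ?Z)"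
    by (rule right_functor) simp
  let ?q0 = "nr x \<cdot> (Id C x \<boxtimes> nl ?Z)" and ?q2 = "\<lambda>(y, y'). dl (x, y \<otimes> ?Z, y' \<otimes> ?Z) \<cdot> (Id C x \<boxtimes> (case (y, y') of (y, y') \<Rightarrow> dr (y, y', ?Z)))"
  interpret XZ: symmetric_functor C "Plus C" "\<zero>" a l r s "\<lambda>y. x \<otimes> (y \<otimes> ?Z)" "\<lambda>f. Id C x \<boxtimes> (f \<boxtimes> Id C ?Z)" ?q0 ?q2
    by (rule X.composite_functor[OF Z.symmetric_functor_axioms])
  let ?r0 = "nl ?Z \<cdot> (nr x \<boxtimes> Id C ?Z)" and ?r2 = "\<lambda>(y, y'). (case (x \<otimes> y, x \<otimes> y') of (x, y) \<Rightarrow> dr (x, y, ?Z)) \<cdot> (dl (x, y, y') \<boxtimes> Id C ?Z)"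
  interpret ZX: symmetric_functor C "Plus C" "\<zero>" a l r s "\<lambda>y. (x \<otimes> y) \<otimes> ?Z" "\<lambda>f. (Id C x \<boxtimes> f) \<boxtimes> Id C ?Z" ?r0 ?r2
    by (rule Z.composite_functor[OF X.symmetric_functor_axioms])
  have fT: "finite T" and len: "\<And>t. t \<in> T ==> length t = q" using T by (auto simp: words_def)
  have w2: "?w2 (s' @ t @ r) = (x \<otimes> v t) \<otimes> z r" if "t \<in> T" "r \<in> R" for t r
    using tens_append[of "s' @ t" "p + q" y z r] that len p by simp
  have sT: "words (p + q) ((@) s' ` T)" using fT len p by (auto simp: words_def)
  have w: "w (s' @ t) = x \<otimes> ?w1 t" if "t \<in> wprod T R" for t
    using that eq(2) len by (auto simp: wprod_def)
  have b: "block (\<lambda>y. y \<otimes> ?Z) v ?w1 (\<lambda>t. (@) t ` R) (\<lambda>t. lam (v t) z ?w1 t R) T"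
    by (rule nu_block) (use T R in auto)
  have c: "block (\<lambda>y. x \<otimes> y) ?w1 w (\<lambda>t. {s' @ t}) (\<lambda>t. unit w (s' @ t)) (wprod T R)"
    by (rule lam_block) (use fT R w in auto)
  let ?h = "\<lambda>t. lam x ?w1 w s' ((@) t ` R) \<cdot> (Id C x \<boxtimes> lam (v t) z ?w1 t R)"
  have hA0: "lam (v t) z ?w1 t R \<in> Arr C" "Dom C (lam (v t) z ?w1 t R) = v t \<otimes> ?Z" "Cod C (lam (v t) z ?w1 t R) = sumo ?w1 ((@) t ` R)"
    "lam x ?w1 w s' ((@) t ` R) \<in> Arr C" "Dom C (lam x ?w1 w s' ((@) t ` R)) = x \<otimes> sumo ?w1 ((@) t ` R)"
    "Cod C (lam x ?w1 w s' ((@) t ` R)) = sumo w ((@) s' ` (@) t ` R)" if "t \<in> T" for t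
    by (rule lam_Arr; use that R len eq(2) in auto)+
  have hA: "?h t \<in> Arr C" "Dom C (?h t) = x \<otimes> (v t \<otimes> ?Z)" "Cod C (?h t) = sumo w ((\<lambda>r. s' @ t @ r) ` R)" if "t \<in> T" for t
    using hA0[OF that] that by (simp_all add: image_image)
  have e: "lam x ?w1 w s' (wprod T R) \<cdot> (Id C x \<boxtimes> nu q v z T R) = blk ?q0 ?q2 v w (\<lambda>t. \<Union>r\<in>(@) t ` R. {s' @ r}) ?h T"
    using X.blk_blk[OF Z.symmetric_functor_axioms b, where w=w and H="\<lambda>t. {s' @ t}" and h="\<lambda>t. unit w (s' @ t)"] c
    by (simp add: lam_def[of x ?w1 w s'] nu_def wprod_def)
  have e': "blk ?q0 ?q2 v w (\<lambda>t. \<Union>r\<in>(@) t ` R. {s' @ r}) ?h T = blk ?q0 ?q2 v w (\<lambda>t. (\<lambda>r. s' @ t @ r) ` R) ?h T"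
    by (rule blk_cong) (use fT R in auto)
  have "lam x ?w1 w s' (wprod T R) \<cdot> ((Id C x \<boxtimes> nu q v z T R) \<cdot> m (x, sumo v T, ?Z))
    = (lam x ?w1 w s' (wprod T R) \<cdot> (Id C x \<boxtimes> nu q v z T R)) \<cdot> m (x, sumo v T, ?Z)"
    by (subst comp_assoc) (use T R fT w in auto)
  also have "\<dots> = blk ?q0 ?q2 v w (\<lambda>t. (\<lambda>r. s' @ t @ r) ` R) ?h T \<cdot> m (x, sumo v T, ?Z)"
    unfolding e e' ..
  \<comment> \<open>The same for the associator in its middle argument, which is monoidal by VIII
    and XVII.\<close>
  also have "\<dots> = blk ?r0 ?r2 v w (\<lambda>t. (\<lambda>r. s' @ t @ r) ` R) (\<lambda>t. ?h t \<cdot> m (x, v t, ?Z)) T"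
  proof (rule XZ.blk_natural[where Ko="\<lambda>y. (x \<otimes> y) \<otimes> ?Z" and t="\<lambda>y. m (x, y, ?Z)"])
    show "block (\<lambda>y. x \<otimes> (y \<otimes> ?Z)) v w (\<lambda>t. (\<lambda>r. s' @ t @ r) ` R) ?h T"
      by (rule blockI) (use fT R hA len in auto)
    show "?q0 \<cdot> m (x, \<zero>, ?Z) = ?r0"
      using XVII[OF x, of ?Z] by (simp add: comp_assoc)
    show "?q2 (y, y') \<cdot> m (x, y \<oplus> y', ?Z) = (m (x, y, ?Z) \<boxplus> m (x, y', ?Z)) \<cdot> ?r2 (y, y')" if "y \<in> Obj C" "y' \<in> Obj C" for y y'
      using VIII[OF x that, of ?Z] that by (simp add: comp_assoc)
  qed auto
  also have "\<dots> = blk ?r0 ?r2 v w (\<lambda>t. (\<lambda>r. s' @ t @ r) ` R) (\<lambda>t. phi ?w2 w (\<lambda>q. {q}) g ((\<lambda>r. s' @ t @ r) ` R) \<cdot>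
        (nu (p + q) y z {s' @ t} R \<cdot> (unit y (s' @ t) \<boxtimes> Id C ?Z))) T"
  proof (rule blk_cong)
    fix t assume t: "t \<in> T"
    have "nu (p + q) y z {s' @ t} R \<cdot> (unit y (s' @ t) \<boxtimes> Id C ?Z) = lam (x \<otimes> v t) z ?w2 (s' @ t) R"
      using nu_single[of y z "s' @ t" "p + q" R] t R len p by simp
    moreover have "lam x ?w1 w s' ((@) t ` R) \<cdot> ((Id C x \<boxtimes> lam (v t) z ?w1 t R) \<cdot> m (x, v t, ?Z))
        = phi ?w2 w (\<lambda>q. {q}) g ((@) (s' @ t) ` R) \<cdot> lam (x \<otimes> v t) z ?w2 (s' @ t) R"
      by (rule lam_lam) (use t R eq(2) g w2 len in auto)
    moreover have "?h t \<cdot> m (x, v t, ?Z) = lam x ?w1 w s' ((@) t ` R) \<cdot> ((Id C x \<boxtimes> lam (v t) z ?w1 t R) \<cdot> m (x, v t, ?Z))"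
      by (rule comp_assoc) (use t R hA0 in auto)
    ultimately show "?h t \<cdot> m (x, v t, ?Z) = phi ?w2 w (\<lambda>q. {q}) g ((\<lambda>r. s' @ t @ r) ` R) \<cdot>
        (nu (p + q) y z {s' @ t} R \<cdot> (unit y (s' @ t) \<boxtimes> Id C ?Z))"
      by (simp add: image_image)
  qed (use fT R in auto)
  also have "\<dots> = phi ?w2 w (\<lambda>q. {q}) g (wprod ((@) s' ` T) R) \<cdot> (nu (p + q) y z ((@) s' ` T) R \<cdot> (lam x v y s' T \<boxtimes> Id C ?Z))"
  proof -
    have b1: "block (\<lambda>y. x \<otimes> y) v y (\<lambda>t. {s' @ t}) (\<lambda>t. unit y (s' @ t)) T"
      by (rule lam_block) (use fT in auto)
    have b2: "block (\<lambda>y. y \<otimes> ?Z) y ?w2 (\<lambda>t. (@) t ` R) (\<lambda>t. lam (y t) z ?w2 t R) ((@) s' ` T)"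
      by (rule nu_block) (use sT R in auto)
    let ?k = "\<lambda>t. nu (p + q) y z {s' @ t} R \<cdot> (unit y (s' @ t) \<boxtimes> Id C ?Z)"
    have e: "nu (p + q) y z ((@) s' ` T) R \<cdot> (lam x v y s' T \<boxtimes> Id C ?Z) = blk ?r0 ?r2 v ?w2 (\<lambda>t. (@) (s' @ t) ` R) ?k T"
      using Z.blk_blk[OF X.symmetric_functor_axioms b1, where w="?w2" and H="\<lambda>t. (@) t ` R" and h="\<lambda>t. lam (y t) z ?w2 t R"] b2
      by (simp add: lam_def[of x v y s'] nu_def[of "p + q"] UN_append)
    have kA: "?k t \<in> Arr C" "Dom C (?k t) = (x \<otimes> v t) \<otimes> ?Z" "Cod C (?k t) = sumo ?w2 ((@) (s' @ t) ` R)" if "t \<in> T" for t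
      using that R len p by auto
    have b3: "block (\<lambda>y. (x \<otimes> y) \<otimes> ?Z) v ?w2 (\<lambda>t. (@) (s' @ t) ` R) ?k T"
      by (rule blockI) (use fT R kA len in auto)
    have gg: "g k \<in> Arr C" "Dom C (g k) = ?w2 k" "Cod C (g k) = sumo w {k}" if "k \<in> wprod ((@) s' ` T) R" for k
      using that g eq(2) w2 by (auto simp: wprod_def)
    have U: "(\<Union>t\<in>T. (@) (s' @ t) ` R) = wprod ((@) s' ` T) R" by (auto simp: wprod_def)
    have "sblock ?w2 w (\<lambda>q. {q}) g (wprod ((@) s' ` T) R)"
      by (rule blockI) (use fT R gg in auto)
    then have "phi ?w2 w (\<lambda>q. {q}) g (wprod ((@) s' ` T) R) \<cdot> blk ?r0 ?r2 v ?w2 (\<lambda>t. (@) (s' @ t) ` R) ?k T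
      = blk ?r0 ?r2 v w (\<lambda>t. \<Union>q\<in>(@) (s' @ t) ` R. {q}) (\<lambda>t. phi ?w2 w (\<lambda>q. {q}) g ((@) (s' @ t) ` R) \<cdot> ?k t) T"
      using ZX.phi_blk[OF b3, where w=w and H="\<lambda>q. {q}" and h=g] by (simp only: U)
    also have "\<dots> = blk ?r0 ?r2 v w (\<lambda>t. (\<lambda>r. s' @ t @ r) ` R) (\<lambda>t. phi ?w2 w (\<lambda>q. {q}) g ((\<lambda>r. s' @ t @ r) ` R) \<cdot> ?k t) T"
      by (rule blk_cong) (use fT R in \<open>auto simp: image_image\<close>)
    finally show ?thesis using e by simp
  qed
  finally show ?thesis .
qed

lemma nu_assoc:
  assumes u: "\<And>i. u i \<in> Obj C" and v: "\<And>i. v i \<in> Obj C" and z: "\<And>i. z i \<in> Obj C"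
    and S: "words p S" and T: "words q T" and R: "finite R"
    and g: "\<And>s t r. s \<in> S ==> t \<in> T ==> r \<in> R ==> g (s @ t @ r) = unit (tens p u (tens q v z)) (s @ t @ r) \<cdot> m (u s, v t, z r)"
  shows "nu p u (tens q v z) S (wprod T R) \<cdot> ((Id C (sumo u S) \<boxtimes> nu q v z T R) \<cdot> m (sumo u S, sumo v T, sumo z R))
    = phi (tens (p + q) (tens p u v) z) (tens p u (tens q v z)) (\<lambda>q. {q}) g (wprod (wprod S T) R) \<cdot>
      (nu (p + q) (tens p u v) z (wprod S T) R \<cdot> (nu p u v S T \<boxtimes> Id C (sumo z R)))"
proof -
  note O [simp] = u v z
  let ?T = "sumo v T" and ?R = "sumo z R" and ?V = "tens q v z" and ?w = "tens p u (tens q v z)" and ?y = "tens p u v"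
    and ?w2 = "tens (p + q) (tens p u v) z"
  let ?W = "sumo ?V (wprod T R)"
  have fS: "finite S" "finite T" and len: "\<And>t. t \<in> S ==> length t = p" "\<And>t. t \<in> T ==> length t = q"
    using S T by (auto simp: words_def)
  have w: "?w (s' @ t @ r) = u s' \<otimes> (v t \<otimes> z r)" if "s' \<in> S" "t \<in> T" "r \<in> R" for s' t r
    using that len by simp
  have w2: "?w2 (s' @ t @ r) = (u s' \<otimes> v t) \<otimes> z r" if "s' \<in> S" "t \<in> T" "r \<in> R" for s' t r
    using tens_append[of "s' @ t" "p + q" ?y z r] that len by simp
  have ST: "words (p + q) (wprod S T)" by (rule words_wprod[OF S T])
  have TR: "finite (wprod T R)" using fS R by simp
  interpret W: symmetric_functor C "Plus C" "\<zero>" a l r s "\<lambda>y. y \<otimes> ?W" "\<lambda>f. f \<boxtimes> Id C ?W" "nl ?W" "\<lambda>(x, y). dr (x, y, ?W)"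
    by (rule right_functor) simp
  interpret T: symmetric_functor C "Plus C" "\<zero>" a l r s "\<lambda>y. y \<otimes> ?T" "\<lambda>f. f \<boxtimes> Id C ?T" "nl ?T" "\<lambda>(x, y). dr (x, y, ?T)"
    by (rule right_functor) simp
  interpret R: symmetric_functor C "Plus C" "\<zero>" a l r s "\<lambda>y. y \<otimes> ?R" "\<lambda>f. f \<boxtimes> Id C ?R" "nl ?R" "\<lambda>(x, y). dr (x, y, ?R)"
    by (rule right_functor) simp
  let ?r0 = "nl ?R \<cdot> (nl ?T \<boxtimes> Id C ?R)" and ?r2 = "\<lambda>(x, y). (case (x \<otimes> ?T, y \<otimes> ?T) of (x, y) \<Rightarrow> dr (x, y, ?R)) \<cdot> ((case (x, y) of (x, y) \<Rightarrow> dr (x, y, ?T)) \<boxtimes> Id C ?R)"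
  interpret RT: symmetric_functor C "Plus C" "\<zero>" a l r s "\<lambda>y. (y \<otimes> ?T) \<otimes> ?R" "\<lambda>f. (f \<boxtimes> Id C ?T) \<boxtimes> Id C ?R" ?r0 ?r2
    by (rule R.composite_functor[OF T.symmetric_functor_axioms])
  let ?t = "\<lambda>x. (Id C x \<boxtimes> nu q v z T R) \<cdot> m (x, ?T, ?R)"
  have b: "block (\<lambda>y. y \<otimes> ?W) u ?w (\<lambda>s. (@) s ` wprod T R) (\<lambda>s. lam (u s) ?V ?w s (wprod T R)) S"
    using nu_block[of u ?V p S "wprod T R"] S TR by simp
  \<comment> \<open>The transformation is now \<open>?t\<close>, the associator followed by the
    expansion of the inner product. It is monoidal in the first factor by VII and XVI and the
    naturality of \<open>dr\<close> and \<open>nl\<close>.\<close>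
  have "nu p u ?V S (wprod T R) \<cdot> ?t (sumo u S) = blk ?r0 ?r2 u ?w (\<lambda>s. (@) s ` wprod T R) (\<lambda>s. lam (u s) ?V ?w s (wprod T R) \<cdot> ?t (u s)) S"
    unfolding nu_def[of p u ?V]
  proof (rule W.blk_natural[where Ko="\<lambda>y. (y \<otimes> ?T) \<otimes> ?R" and t="?t"])
    show "block (\<lambda>y. y \<otimes> ?W) u ?w (\<lambda>s. (@) s ` wprod T R) (\<lambda>s. lam (u s) ?V ?w s (wprod T R)) S" by (rule b)
    have "nl ?W \<cdot> ?t \<zero> = nl (?T \<otimes> ?R) \<cdot> m (\<zero>, ?T, ?R)"
      using T R by (simp add: nl_nat_tail)
    then show "nl ?W \<cdot> ?t \<zero> = ?r0" using XVI[of ?T ?R] by simp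
    fix x y assume X: "x \<in> Obj C" "y \<in> Obj C"
    have "dr (x, y, ?W) \<cdot> ?t (x \<oplus> y) = dr (x, y, ?W) \<cdot> (((Id C x \<boxplus> Id C y) \<boxtimes> nu q v z T R) \<cdot> m (x \<oplus> y, ?T, ?R))"
      using X by simp
    also have "\<dots> = ((Id C x \<boxtimes> nu q v z T R) \<boxplus> (Id C y \<boxtimes> nu q v z T R)) \<cdot> (dr (x, y, ?T \<otimes> ?R) \<cdot> m (x \<oplus> y, ?T, ?R))"
      using X T R by (simp add: dr_nat_tail del: tarr_Id)
    also have "\<dots> = (?t x \<boxplus> ?t y) \<cdot> ?r2 (x, y)"
      using X T R VII[OF X, of ?T ?R] by (simp add: interchange_tail)
    finally show "(case (x, y) of (x, y) \<Rightarrow> dr (x, y, ?W)) \<cdot> ?t (x \<oplus> y) = (?t x \<boxplus> ?t y) \<cdot> ?r2 (x, y)" by simp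
  qed (use T R X in auto)
  also have "\<dots> = blk ?r0 ?r2 u ?w (\<lambda>s. (@) s ` wprod T R) (\<lambda>s. phi ?w2 ?w (\<lambda>q. {q}) g (wprod ((@) s ` T) R) \<cdot>
       (nu (p + q) ?y z ((@) s ` T) R \<cdot> (lam (u s) v ?y s T \<boxtimes> Id C ?R))) S"
  proof (rule blk_cong)
    fix s' assume s': "s' \<in> S"
    show "lam (u s') ?V ?w s' (wprod T R) \<cdot> ?t (u s') = phi ?w2 ?w (\<lambda>q. {q}) g (wprod ((@) s' ` T) R) \<cdot>
       (nu (p + q) ?y z ((@) s' ` T) R \<cdot> (lam (u s') v ?y s' T \<boxtimes> Id C ?R))"
      by (rule lam_nu) (use s' T R len w g in auto)
  qed (use fS R TR in auto)
  also have "\<dots> = phi ?w2 ?w (\<lambda>q. {q}) g (wprod (wprod S T) R) \<cdot> (nu (p + q) ?y z (wprod S T) R \<cdot> (nu p u v S T \<boxtimes> Id C ?R))"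
  proof -
    have b1: "block (\<lambda>y. y \<otimes> ?T) u ?y (\<lambda>s. (@) s ` T) (\<lambda>s. lam (u s) v ?y s T) S"
      by (rule nu_block) (use S fS in auto)
    have b2: "block (\<lambda>y. y \<otimes> ?R) ?y ?w2 (\<lambda>t. (@) t ` R) (\<lambda>t. lam (?y t) z ?w2 t R) (wprod S T)"
      by (rule nu_block) (use ST R in auto)
    let ?k = "\<lambda>s. nu (p + q) ?y z ((@) s ` T) R \<cdot> (lam (u s) v ?y s T \<boxtimes> Id C ?R)"
    have U: "(\<Union>s\<in>S. (@) s ` T) = wprod S T" "\<And>A. (\<Union>t\<in>A. (@) t ` R) = wprod A R" by (auto simp: wprod_def)
    have e: "nu (p + q) ?y z (wprod S T) R \<cdot> (nu p u v S T \<boxtimes> Id C ?R) = blk ?r0 ?r2 u ?w2 (\<lambda>s. wprod ((@) s ` T) R) ?k S"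
      using R.blk_blk[OF T.symmetric_functor_axioms b1, where w="?w2" and H="\<lambda>t. (@) t ` R" and h="\<lambda>t. lam (?y t) z ?w2 t R"] b2
      by (simp only: nu_def U)
    have sT: "words (p + q) ((@) s' ` T)" if "s' \<in> S" for s'
      using T that len by (auto simp: words_def)
    have kA: "?k s' \<in> Arr C" "Dom C (?k s') = (u s' \<otimes> ?T) \<otimes> ?R" "Cod C (?k s') = sumo ?w2 (wprod ((@) s' ` T) R)" if "s' \<in> S" for s'
      using that R sT len fS lam_Arr[of "u s'" v ?y T s'] by auto
    have dis: "wprod ((@) k ` T) R \<inter> wprod ((@) j ` T) R = {}" if "k \<in> S" "j \<in> S" "k \<noteq> j" for k j
      by (rule wprod_disjoint[where p="p + q"]) (use that len in auto)
    have b3: "block (\<lambda>y. (y \<otimes> ?T) \<otimes> ?R) u ?w2 (\<lambda>s. wprod ((@) s ` T) R) ?k S"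
      by (rule blockI) (use fS R kA dis in auto)
    have gg: "g k \<in> Arr C" "Dom C (g k) = ?w2 k" "Cod C (g k) = sumo ?w {k}" if "k \<in> wprod (wprod S T) R" for k
      using that g w w2 by (auto simp: wprod_def)
    have U2: "(\<Union>s\<in>S. wprod ((@) s ` T) R) = wprod (wprod S T) R" by (auto simp: wprod_def)
    have "sblock ?w2 ?w (\<lambda>q. {q}) g (wprod (wprod S T) R)"
      by (rule blockI) (use fS R gg in auto)
    then have "phi ?w2 ?w (\<lambda>q. {q}) g (wprod (wprod S T) R) \<cdot> blk ?r0 ?r2 u ?w2 (\<lambda>s. wprod ((@) s ` T) R) ?k S
      = blk ?r0 ?r2 u ?w (\<lambda>s. \<Union>q\<in>wprod ((@) s ` T) R. {q}) (\<lambda>s. phi ?w2 ?w (\<lambda>q. {q}) g (wprod ((@) s ` T) R) \<cdot> ?k s) S"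
      using RT.phi_blk[OF b3, where w="?w" and H="\<lambda>q. {q}" and h=g] by (simp only: U2)
    also have "\<dots> = blk ?r0 ?r2 u ?w (\<lambda>s. (@) s ` wprod T R) (\<lambda>s. phi ?w2 ?w (\<lambda>q. {q}) g (wprod ((@) s ` T) R) \<cdot> ?k s) S"
      by (rule blk_cong) (use fS R in \<open>auto simp: wprod_def\<close>)
    finally show ?thesis using e by simp
  qed
  finally show ?thesis .
qed

end

section \<open>Unit laws and naturality of the distribution\<close>

context laplaza
begin

text \<open>By XIV and XXIII, \<open>lm\<close> is a monoidal transformation from
  \<open>\<one> \<otimes> -\<close> to the identity, so taking \<open>lm\<close> termwise after the
  expansion amounts to taking it once.\<close>

lemma lam_unit:
  assumes v: "\<And>i. v i \<in> Obj C" and w: "\<And>i. w i \<in> Obj C" and T: "finite T"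
    and eq: "\<And>t. t \<in> T ==> w t = \<one> \<otimes> v t" and g: "\<And>t. t \<in> T ==> g t = unit v t \<cdot> lm (v t)"
  shows "phi w v (\<lambda>q. {q}) g T \<cdot> lam \<one> v w [] T = lm (sumo v T)"
proof -
  note O [simp] = v w
  interpret U: symmetric_functor C "Plus C" "\<zero>" a l r s "\<lambda>y. \<one> \<otimes> y" "\<lambda>f. Id C \<one> \<boxtimes> f" "nr \<one>" "\<lambda>p. dl (\<one>, p)"
    by (rule left_functor) simp
  have b: "block (\<lambda>y. \<one> \<otimes> y) v w (\<lambda>t. {[] @ t}) (\<lambda>t. unit w ([] @ t)) T"
    by (rule lam_block) (use T eq in auto)
  have c: "sblock w v (\<lambda>q. {q}) g T"
    by (rule blockI) (use T eq g in auto)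
  have "phi w v (\<lambda>q. {q}) g T \<cdot> lam \<one> v w [] T = blk (nr \<one>) (\<lambda>p. dl (\<one>, p)) v v (\<lambda>t. {t}) (\<lambda>t. phi w v (\<lambda>q. {q}) g {t} \<cdot> unit w t) T"
    using U.phi_blk[OF b, where w=v and H="\<lambda>q. {q}" and h=g] c by (simp add: lam_def)
  also have "\<dots> = blk (nr \<one>) (\<lambda>p. dl (\<one>, p)) v v (\<lambda>t. {t}) (\<lambda>t. unit v t \<cdot> lm (v t)) T"
  proof (rule blk_cong)
    fix t assume t: "t \<in> T"
    have "sblock w v (\<lambda>q. {q}) g {t}" by (rule block_subset[OF c]) (use t in auto)
    then show "phi w v (\<lambda>q. {q}) g {t} \<cdot> unit w t = unit v t \<cdot> lm (v t)"
      using phi_single[of w v "\<lambda>q. {q}" g t] g[OF t] by simp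
  qed (use T in auto)
  also have "\<dots> = phi v v (\<lambda>t. {t}) (unit v) T \<cdot> lm (sumo v T)"
    by (rule symmetric_functor.blk_natural[OF identity_functor, symmetric, where Ko="\<lambda>y. \<one> \<otimes> y"])
      (use T XIV XXIII in \<open>auto intro!: blockI\<close>)
  also have "\<dots> = lm (sumo v T)"
    using phi_id[of v T] T by simp
  finally show ?thesis .
qed

lemma nu_unit_left:
  assumes u: "\<And>i. u i \<in> Obj C" "u [] = \<one>" and v: "\<And>i. v i \<in> Obj C" and T: "finite T"
    and g: "\<And>t. t \<in> T ==> g t = unit v t \<cdot> lm (v t)"
  shows "phi (tens 0 u v) v (\<lambda>q. {q}) g T \<cdot> (nu 0 u v {[]} T \<cdot> (unit u [] \<boxtimes> Id C (sumo v T))) = lm (sumo v T)"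
  using lam_unit[of v "tens 0 u v" T g] nu_single[of u v "[]" 0 T] assms by (simp add: tens_def)

text \<open>The mirror image rests on XIII and XXIV. Here every summand carries its own expansion
  over the single word \<open>[]\<close>, which is removed by \<open>lam_single\<close> before
  \<open>rm\<close> can act.\<close>

lemma nu_unit_right:
  assumes z: "\<And>i. z i \<in> Obj C" "z [] = \<one>" and u: "\<And>i. u i \<in> Obj C" and S: "words p S"
    and g: "\<And>k. k \<in> S ==> g k = unit u k \<cdot> rm (u k)"
  shows "phi (tens p u z) u (\<lambda>q. {q}) g S \<cdot> (nu p u z S {[]} \<cdot> (Id C (sumo u S) \<boxtimes> unit z [])) = rm (sumo u S)"
proof -
  note O [simp] = u z
  let ?Z = "sumo z {[]}" and ?w = "tens p u z"
  interpret Z: symmetric_functor C "Plus C" "\<zero>" a l r s "\<lambda>y. y \<otimes> ?Z" "\<lambda>f. f \<boxtimes> Id C ?Z" "nl ?Z" "\<lambda>(x, y). dr (x, y, ?Z)"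
    by (rule right_functor) simp
  interpret U: symmetric_functor C "Plus C" "\<zero>" a l r s "\<lambda>y. y \<otimes> \<one>" "\<lambda>f. f \<boxtimes> Id C \<one>" "nl \<one>" "\<lambda>(x, y). dr (x, y, \<one>)"
    by (rule right_functor) simp
  have fS: "finite S" and len: "\<And>k. k \<in> S ==> length k = p" using S by (auto simp: words_def)
  have w: "?w k = u k \<otimes> \<one>" if "k \<in> S" for k
    using tens_append[of k p u z "[]"] len[OF that] by simp
  have c: "sblock ?w u (\<lambda>q. {q}) g S"
    by (rule blockI) (use fS w g in auto)
  have b: "block (\<lambda>y. y \<otimes> ?Z) u ?w (\<lambda>k. (@) k ` {[]}) (\<lambda>k. lam (u k) z ?w k {[]}) S"
    by (rule nu_block) (use S in auto)
  have lA: "lam (u k) z ?w k {[]} \<in> Arr C" "Dom C (lam (u k) z ?w k {[]}) = u k \<otimes> ?Z" "Cod C (lam (u k) z ?w k {[]}) = sumo ?w {k}" if "k \<in> S" for k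
    using lam_Arr[of "u k" z ?w "{[]}" k] len[OF that] tens_append[of k p u z "[]"] by auto
  have "nu p u z S {[]} \<cdot> (Id C (sumo u S) \<boxtimes> unit z []) = blk (nl \<one>) (\<lambda>(x, y). dr (x, y, \<one>)) u ?w (\<lambda>k. {k}) (\<lambda>k. lam (u k) z ?w k {[]} \<cdot> (Id C (u k) \<boxtimes> unit z [])) S"
  proof -
    have e: "nu p u z S {[]} = blk (nl ?Z) (\<lambda>(x, y). dr (x, y, ?Z)) u ?w (\<lambda>k. {k}) (\<lambda>k. lam (u k) z ?w k {[]}) S"
      unfolding nu_def by (rule blk_cong) (use fS in auto)
    show ?thesis unfolding e
    proof (rule Z.blk_natural[where Ko="\<lambda>y. y \<otimes> \<one>" and t="\<lambda>x. Id C x \<boxtimes> unit z []"])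
      show "block (\<lambda>y. y \<otimes> ?Z) u ?w (\<lambda>k. {k}) (\<lambda>k. lam (u k) z ?w k {[]}) S"
        by (rule blockI) (use fS lA in auto)
      show "nl ?Z \<cdot> (Id C \<zero> \<boxtimes> unit z []) = nl \<one>" by (simp add: nl_nat)
      fix x y assume "x \<in> Obj C" "y \<in> Obj C"
      then show "(case (x, y) of (x, y) \<Rightarrow> dr (x, y, ?Z)) \<cdot> (Id C (x \<oplus> y) \<boxtimes> unit z []) =
        ((Id C x \<boxtimes> unit z []) \<boxplus> (Id C y \<boxtimes> unit z [])) \<cdot> (case (x, y) of (x, y) \<Rightarrow> dr (x, y, \<one>))"
        using dr_nat[of "Id C x" "Id C y" "unit z []" x y ?Z] by simp
    qed auto
  qed
  also have "\<dots> = blk (nl \<one>) (\<lambda>(x, y). dr (x, y, \<one>)) u ?w (\<lambda>k. {k}) (unit ?w) S"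
    by (rule blk_cong) (use fS lam_single[of _ z ?w _ "[]"] tens_append[of _ p u z "[]"] len in auto)
  finally have e: "nu p u z S {[]} \<cdot> (Id C (sumo u S) \<boxtimes> unit z []) = \<dots>" .
  have b: "block (\<lambda>y. y \<otimes> \<one>) u ?w (\<lambda>k. {k}) (unit ?w) S"
    by (rule blockI) (use fS w in auto)
  have "phi ?w u (\<lambda>q. {q}) g S \<cdot> (nu p u z S {[]} \<cdot> (Id C (sumo u S) \<boxtimes> unit z []))
     = blk (nl \<one>) (\<lambda>(x, y). dr (x, y, \<one>)) u u (\<lambda>t. {t}) (\<lambda>t. phi ?w u (\<lambda>q. {q}) g {t} \<cdot> unit ?w t) S"
    unfolding e using U.phi_blk[OF b, where w=u and H="\<lambda>q. {q}" and h=g] c by simp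
  also have "\<dots> = blk (nl \<one>) (\<lambda>(x, y). dr (x, y, \<one>)) u u (\<lambda>t. {t}) (\<lambda>t. unit u t \<cdot> rm (u t)) S"
  proof (rule blk_cong)
    fix t assume t: "t \<in> S"
    have "sblock ?w u (\<lambda>q. {q}) g {t}" by (rule block_subset[OF c]) (use t in auto)
    then show "phi ?w u (\<lambda>q. {q}) g {t} \<cdot> unit ?w t = unit u t \<cdot> rm (u t)"
      using phi_single[of ?w u "\<lambda>q. {q}" g t] g[OF t] by simp
  qed (use fS in auto)
  also have "\<dots> = phi u u (\<lambda>t. {t}) (unit u) S \<cdot> rm (sumo u S)"
    by (rule symmetric_functor.blk_natural[OF identity_functor, symmetric, where Ko="\<lambda>y. y \<otimes> \<one>"])
      (use fS XIII XXIV in \<open>auto intro!: blockI\<close>)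
  also have "\<dots> = rm (sumo u S)"
    using phi_id[of u S] fS by simp
  finally show ?thesis .
qed

text \<open>With its first argument fixed, \<open>nu\<close> is additive in the second one by
  \<open>nu_mu_right\<close>, so \<open>additive_phi\<close> pushes a block map through it;
  \<open>g\<close> is then absorbed as a monoidal transformation between two left
  multiplications.\<close>

lemma nu_phi_single:
  assumes x: "x \<in> Obj C" and u': "\<And>i. u' i \<in> Obj C" and w: "\<And>i. w i \<in> Obj C"
    and T: "finite T" and c: "sblock v v' H h T" and A: "words q A"
    and g: "g \<in> Arr C" "Dom C g = x" "Cod C g = sumo u' A"
    and eq: "\<And>t. t \<in> T ==> w (s' @ t) = x \<otimes> v t"
    and G: "\<And>t. t \<in> T ==> G (s' @ t) = wprod A (H t)"
    and k: "\<And>t. t \<in> T ==> k (s' @ t) = nu q u' v' A (H t) \<cdot> (g \<boxtimes> h t)"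
  shows "nu q u' v' A (\<Union>(H ` T)) \<cdot> (g \<boxtimes> phi v v' H h T) = phi w (tens q u' v') G k ((@) s' ` T) \<cdot> lam x v w s' T"
proof -
  note c' = blockD[OF c]
  note O [simp] = x u' w c'(2,3) A g
  let ?X = "sumo u' A" and ?w = "tens q u' v'"
  interpret L: symmetric_functor C "Plus C" "\<zero>" a l r s "\<lambda>y. x \<otimes> y" "\<lambda>f. Id C x \<boxtimes> f" "nr x" "\<lambda>p. dl (x, p)"
    by (rule left_functor) simp
  interpret X: symmetric_functor C "Plus C" "\<zero>" a l r s "\<lambda>y. ?X \<otimes> y" "\<lambda>f. Id C ?X \<boxtimes> f" "nr ?X" "\<lambda>p. dl (?X, p)"
    by (rule left_functor) simp
  note phiT [simp] = phi_Arr(1-3)[OF c]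
  have fH: "finite (\<Union>(H ` T))" using T c'(4) by auto
  have len: "\<And>b. b \<in> A ==> length b = q" and fA: "finite A" using A by (auto simp: words_def)
  have U: "\<Union>((\<lambda>j. wprod A {j}) ` B) = wprod A B" for B by (auto simp: wprod_def)
  have dis: "wprod A B \<inter> wprod A B' = {}" if "B \<inter> B' = {}" for B B'
    by (rule wprod_disjoint[where p=q]) (use len that in auto)
  have "nu q u' v' A (\<Union>(H ` T)) \<cdot> (g \<boxtimes> phi v v' H h T)
    = (nu q u' v' A (\<Union>(H ` T)) \<cdot> (Id C ?X \<boxtimes> phi v v' H h T)) \<cdot> (g \<boxtimes> Id C (sumo v T))"
    using fH by (simp add: comp_assoc times.interchange)
  also have e: "nu q u' v' A (\<Union>(H ` T)) \<cdot> (Id C ?X \<boxtimes> phi v v' H h T)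
    = blk (nr ?X) (\<lambda>p. dl (?X, p)) v ?w (\<lambda>t. \<Union>((\<lambda>j. wprod A {j}) ` H t)) (\<lambda>t. nu q u' v' A (H t) \<cdot> (Id C ?X \<boxtimes> h t)) T"
  proof (rule X.additive_phi[OF c])
    fix B assume "B \<subseteq> \<Union>(H ` T)"
    then have "finite B" using fH finite_subset by blast
    then show "nu q u' v' A B \<in> Arr C" "Dom C (nu q u' v' A B) = ?X \<otimes> sumo v' B"
      "Cod C (nu q u' v' A B) = sumo ?w (\<Union>((\<lambda>j. wprod A {j}) ` B))" by (auto simp: U)
  next
    fix B B' assume B: "B \<subseteq> \<Union>(H ` T)" "B' \<subseteq> \<Union>(H ` T)" "B \<inter> B' = {}"
    then have "finite B" "finite B'" using fH finite_subset by blast+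
    then show "nu q u' v' A (B \<union> B') \<cdot> (Id C ?X \<boxtimes> mu v' B B') = mu ?w (\<Union>((\<lambda>j. wprod A {j}) ` B)) (\<Union>((\<lambda>j. wprod A {j}) ` B')) \<cdot>
        ((nu q u' v' A B \<boxplus> nu q u' v' A B') \<cdot> dl (?X, sumo v' B, sumo v' B'))"
      using nu_mu_right[of u' v' q A B B'] B by (simp add: U)
  qed (use fA dis nu_empty_right[of u' v' q A] in auto)
  also have "blk (nr ?X) (\<lambda>p. dl (?X, p)) v ?w (\<lambda>t. \<Union>((\<lambda>j. wprod A {j}) ` H t)) (\<lambda>t. nu q u' v' A (H t) \<cdot> (Id C ?X \<boxtimes> h t)) T \<cdot> (g \<boxtimes> Id C (sumo v T))
    = blk (nr x) (\<lambda>p. dl (x, p)) v ?w (\<lambda>t. \<Union>((\<lambda>j. wprod A {j}) ` H t)) (\<lambda>t. (nu q u' v' A (H t) \<cdot> (Id C ?X \<boxtimes> h t)) \<cdot> (g \<boxtimes> Id C (v t))) T"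
  proof (rule X.blk_natural[where Ko="\<lambda>y. x \<otimes> y" and t="\<lambda>y. g \<boxtimes> Id C y"])
    show "block (\<lambda>y. ?X \<otimes> y) v ?w (\<lambda>t. \<Union>((\<lambda>j. wprod A {j}) ` H t)) (\<lambda>t. nu q u' v' A (H t) \<cdot> (Id C ?X \<boxtimes> h t)) T"
      unfolding U by (rule blockI) (use T fA c' dis in auto)
    show "nr ?X \<cdot> (g \<boxtimes> Id C \<zero>) = nr x" by (simp add: nr_nat)
    fix y z assume "y \<in> Obj C" "z \<in> Obj C"
    then show "dl (?X, y, z) \<cdot> (g \<boxtimes> Id C (y \<oplus> z)) = ((g \<boxtimes> Id C y) \<boxplus> (g \<boxtimes> Id C z)) \<cdot> dl (x, y, z)"
      using dl_nat[of g "Id C y" "Id C z" ?X y z] by simp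
  qed auto
  also have "\<dots> = blk (nr x) (\<lambda>p. dl (x, p)) v ?w (\<lambda>t. \<Union>(G ` {s' @ t})) (\<lambda>t. phi w ?w G k {s' @ t} \<cdot> unit w (s' @ t)) T"
  proof (rule blk_cong)
    fix t assume t: "t \<in> T"
    show "\<Union>((\<lambda>j. wprod A {j}) ` H t) = \<Union>(G ` {s' @ t})" using G t by (simp add: U)
    have "sblock w ?w G k {s' @ t}"
      by (rule blockI) (use t G k eq fA c' in auto)
    then show "(nu q u' v' A (H t) \<cdot> (Id C ?X \<boxtimes> h t)) \<cdot> (g \<boxtimes> Id C (v t)) = phi w ?w G k {s' @ t} \<cdot> unit w (s' @ t)"
      using phi_single[of w ?w G k "s' @ t"] k t c' by (simp add: comp_assoc times.interchange)
  qed (use T fA c' U in auto)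
  also have "\<dots> = phi w ?w G k ((@) s' ` T) \<cdot> lam x v w s' T"
  proof -
    have b: "block (\<lambda>y. x \<otimes> y) v w (\<lambda>t. {s' @ t}) (\<lambda>t. unit w (s' @ t)) T"
      by (rule lam_block) (use T eq in auto)
    have "sblock w ?w G k ((@) s' ` T)"
    proof (rule blockI)
      fix i j assume "i \<in> (@) s' ` T" "j \<in> (@) s' ` T" "i \<noteq> j"
      then obtain t t' where t: "i = s' @ t" "j = s' @ t'" "t \<in> T" "t' \<in> T" "t \<noteq> t'" by auto
      then show "G i \<inter> G j = {}" using G dis[OF c'(8)[OF t(3-5)]] by simp
    qed (use T G k eq fA c' in auto)
    then show ?thesis
      using L.phi_blk[OF b, where w="?w" and H=G and h=k] by (simp add: lam_def UN_append)
  qed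
  finally show ?thesis .
qed

text \<open>Naturality of the distribution for block maps in both factors. It allows products of
  arrows to be computed summand by summand.\<close>

lemma nu_phi:
  assumes S: "words p S" and T: "finite T" and b: "sblock u u' G g S" and c: "sblock v v' H h T"
    and G: "\<And>k. k \<in> S ==> words q (G k)"
  shows "nu q u' v' (\<Union>(G ` S)) (\<Union>(H ` T)) \<cdot> (phi u u' G g S \<boxtimes> phi v v' H h T)
    = phi (tens p u v) (tens q u' v') (\<lambda>w. wprod (G (take p w)) (H (drop p w)))
       (\<lambda>w. nu q u' v' (G (take p w)) (H (drop p w)) \<cdot> (g (take p w) \<boxtimes> h (drop p w))) (wprod S T) \<cdot> nu p u v S T"
    (is "_ = phi ?w ?w' ?G ?g _ \<cdot> _")
proof -
  note b' = blockD[OF b] and c' = blockD[OF c]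
  note O [simp] = b'(2,3) c'(2,3)
  let ?K = "\<Union>(H ` T)" and ?A = "\<Union>(G ` S)"
  let ?Y = "sumo v T" and ?Y' = "sumo v' ?K"
  interpret Y: symmetric_functor C "Plus C" "\<zero>" a l r s "\<lambda>y. y \<otimes> ?Y" "\<lambda>f. f \<boxtimes> Id C ?Y" "nl ?Y" "\<lambda>(x, y). dr (x, y, ?Y)"
    by (rule right_functor) simp
  interpret Y': symmetric_functor C "Plus C" "\<zero>" a l r s "\<lambda>y. y \<otimes> ?Y'" "\<lambda>f. f \<boxtimes> Id C ?Y'" "nl ?Y'" "\<lambda>(x, y). dr (x, y, ?Y')"
    by (rule right_functor) simp
  note phiT [simp] = phi_Arr(1-3)[OF c] phi_Arr(1-3)[OF b]
  have fS: "finite S" and len: "\<And>k. k \<in> S ==> length k = p" using S by (auto simp: words_def)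
  have fK: "finite ?K" using T c'(4) by auto
  have A: "words q ?A" using G fS by (auto simp: words_def)
  have lenG: "length i = q" if "k \<in> S" "i \<in> G k" for i k using G that by (auto simp: words_def)
  have bA: "block (\<lambda>y. y \<otimes> ?Y') u' ?w' (\<lambda>s. (@) s ` ?K) (\<lambda>s. lam (u' s) v' ?w' s ?K) ?A"
    by (rule nu_block) (use A fK in auto)
  have U: "(\<Union>j\<in>B. (@) j ` ?K) = wprod B ?K" for B by (auto simp: wprod_def)
  let ?f = "\<lambda>s. nu q u' v' (G s) ?K \<cdot> (g s \<boxtimes> Id C ?Y')"
  have fA: "?f k \<in> Arr C" "Dom C (?f k) = u k \<otimes> ?Y'" "Cod C (?f k) = sumo ?w' (wprod (G k) ?K)" if "k \<in> S" for k
    using that b' G fK by auto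
  have disG: "wprod (G i) B \<inter> wprod (G j) B' = {}" if "i \<in> S" "j \<in> S" "i \<noteq> j" for i j B B'
    by (rule wprod_disjoint[where p=q]) (use lenG that b'(8) in auto)
  have "nu q u' v' ?A ?K \<cdot> (phi u u' G g S \<boxtimes> phi v v' H h T)
    = (nu q u' v' ?A ?K \<cdot> (phi u u' G g S \<boxtimes> Id C ?Y')) \<cdot> (Id C (sumo u S) \<boxtimes> phi v v' H h T)"
    using A fK by (simp add: comp_assoc times.interchange)
  \<comment> \<open>The block map of the left factor fuses with the outer expansion by
    \<open>blk_phi\<close>; the one of the right factor is afterwards absorbed in each summand by
    \<open>nu_phi_single\<close>.\<close>
  also have "nu q u' v' ?A ?K \<cdot> (phi u u' G g S \<boxtimes> Id C ?Y') = blk (nl ?Y') (\<lambda>(x, y). dr (x, y, ?Y')) u ?w' (\<lambda>s. wprod (G s) ?K) ?f S"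
    using Y'.blk_phi[OF b bA] by (simp add: nu_def U)
  also have "blk (nl ?Y') (\<lambda>(x, y). dr (x, y, ?Y')) u ?w' (\<lambda>s. wprod (G s) ?K) ?f S \<cdot> (Id C (sumo u S) \<boxtimes> phi v v' H h T)
    = blk (nl ?Y) (\<lambda>(x, y). dr (x, y, ?Y)) u ?w' (\<lambda>s. wprod (G s) ?K) (\<lambda>s. ?f s \<cdot> (Id C (u s) \<boxtimes> phi v v' H h T)) S"
  proof (rule Y'.blk_natural[where Ko="\<lambda>y. y \<otimes> ?Y" and t="\<lambda>x. Id C x \<boxtimes> phi v v' H h T"])
    show "block (\<lambda>y. y \<otimes> ?Y') u ?w' (\<lambda>s. wprod (G s) ?K) ?f S"
      by (rule blockI) (use fS fK fA b' disG in auto)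
    show "nl ?Y' \<cdot> (Id C \<zero> \<boxtimes> phi v v' H h T) = nl ?Y" by (simp add: nl_nat)
    fix x y assume "x \<in> Obj C" "y \<in> Obj C"
    then show "(case (x, y) of (x, y) \<Rightarrow> dr (x, y, ?Y')) \<cdot> (Id C (x \<oplus> y) \<boxtimes> phi v v' H h T)
      = ((Id C x \<boxtimes> phi v v' H h T) \<boxplus> (Id C y \<boxtimes> phi v v' H h T)) \<cdot> (case (x, y) of (x, y) \<Rightarrow> dr (x, y, ?Y))"
      using dr_nat[of "Id C x" "Id C y" "phi v v' H h T" x y ?Y'] by simp
  qed auto
  also have "\<dots> = blk (nl ?Y) (\<lambda>(x, y). dr (x, y, ?Y)) u ?w' (\<lambda>s. \<Union>(?G ` (@) s ` T)) (\<lambda>s. phi ?w ?w' ?G ?g ((@) s ` T) \<cdot> lam (u s) v ?w s T) S"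
  proof (rule blk_cong)
    fix k assume k: "k \<in> S"
    show "wprod (G k) ?K = \<Union>(?G ` (@) k ` T)" using len[OF k] by (auto simp: wprod_def)
    show "finite (wprod (G k) ?K)" using k b' fK by auto
    have "?f k \<cdot> (Id C (u k) \<boxtimes> phi v v' H h T) = nu q u' v' (G k) ?K \<cdot> (g k \<boxtimes> phi v v' H h T)"
      using k b' G fK by (simp add: comp_assoc times.interchange)
    also have "\<dots> = phi ?w ?w' ?G ?g ((@) k ` T) \<cdot> lam (u k) v ?w k T"
      by (rule nu_phi_single[OF _ _ _ T c]) (use k b' G len in auto)
    finally show "?f k \<cdot> (Id C (u k) \<boxtimes> phi v v' H h T) = phi ?w ?w' ?G ?g ((@) k ` T) \<cdot> lam (u k) v ?w k T" .
  qed (use fS in auto)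
  also have "\<dots> = phi ?w ?w' ?G ?g (wprod S T) \<cdot> nu p u v S T"
  proof -
    have bn: "block (\<lambda>y. y \<otimes> ?Y) u ?w (\<lambda>s. (@) s ` T) (\<lambda>s. lam (u s) v ?w s T) S"
      by (rule nu_block) (use S T in auto)
    have U: "(\<Union>s\<in>S. (@) s ` T) = wprod S T" by (auto simp: wprod_def)
    have "sblock ?w ?w' ?G ?g (wprod S T)"
    proof (rule blockI)
      fix i j assume ij: "i \<in> wprod S T" "j \<in> wprod S T" "i \<noteq> j"
      then obtain s1 t1 s2 t2 where st: "i = s1 @ t1" "j = s2 @ t2" "s1 \<in> S" "s2 \<in> S" "t1 \<in> T" "t2 \<in> T"
        unfolding wprod_def by blast
      have "G s1 \<inter> G s2 = {} \<or> H t1 \<inter> H t2 = {}" using ij st b'(8) c'(8) by (metis)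
      then have "wprod (G s1) (H t1) \<inter> wprod (G s2) (H t2) = {}"
        by (intro wprod_disjoint[where p=q]) (use lenG st in auto)
      then show "?G i \<inter> ?G j = {}" using st len by simp
    next
      fix i assume "i \<in> wprod S T"
      then obtain s1 t1 where st: "i = s1 @ t1" "s1 \<in> S" "t1 \<in> T" unfolding wprod_def by blast
      then show "finite (?G i)" "?g i \<in> Arr C" "Dom C (?g i) = ?w i" "Cod C (?g i) = sumo ?w' (?G i)"
        using len b' c' G by auto
    qed (use fS T in auto)
    then show ?thesis
      using Y.phi_blk[OF bn, where w="?w'" and H="?G" and h="?g"] by (simp add: nu_def U)
  qed
  finally show ?thesis .
qed

end

section \<open>The product of Laurent families\<close>

locale rigid_laplaza = laplaza C a l r s m lm rm dl dr nl nr
  for C :: "('o, 'm) rig_cat" (structure) and a l r s m lm rm dl dr nl nr +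
  assumes rigid: "hom C \<zero> \<zero> = {Id C \<zero>}"
begin

abbreviation null :: "'o \<Rightarrow> bool" where "null x \<equiv> isomorphic C x \<zero>"

lemma null_Obj: "null x ==> x \<in> Obj C"
  by (auto elim!: isomorphicE)

lemma null_zero [simp]: "null \<zero>"
  by (rule isomorphic_refl) simp

lemma null_arrow_unique:
  assumes "null x" "null y" "f \<in> Arr C" "g \<in> Arr C" "Dom C f = x" "Dom C g = x" "Cod C f = y" "Cod C g = y"
  shows "f = g"
proof -
  obtain z where z: "z \<in> Arr C" "Dom C z = x" "Cod C z = \<zero>" "invertible C z" using assms(1) by (rule isomorphicE)
  obtain z' where z': "z' \<in> Arr C" "Dom C z' = y" "Cod C z' = \<zero>" "invertible C z'" using assms(2) by (rule isomorphicE)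
  have id: "h = Id C \<zero>" if "h \<in> Arr C" "Dom C h = \<zero>" "Cod C h = \<zero>" for h
  proof -
    have "h \<in> hom C \<zero> \<zero>" using that by (simp add: hom_iff)
    then show ?thesis unfolding rigid by simp
  qed
  have "z' \<cdot> (f \<cdot> arr_inv z) = z' \<cdot> (g \<cdot> arr_inv z)"
    using id[of "z' \<cdot> (f \<cdot> arr_inv z)"] id[of "z' \<cdot> (g \<cdot> arr_inv z)"] z z' assms by simp
  then have "f \<cdot> arr_inv z = g \<cdot> arr_inv z"
    by (rule cancel_left) (use z z' assms in auto)
  then show ?thesis
    by (rule cancel_right) (use z z' assms in auto)
qed

text \<open>The choice is immaterial: by \<open>null_arrow_unique\<close> a null object has only one
  arrow to zero.\<close>

definition to0 :: "'o \<Rightarrow> 'm" where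
  "to0 x = (SOME z. z \<in> Arr C \<and> Dom C z = x \<and> Cod C z = \<zero> \<and> invertible C z)"

lemma to0_Arr:
  assumes "null x"
  shows "to0 x \<in> Arr C" "Dom C (to0 x) = x" "Cod C (to0 x) = \<zero>" "invertible C (to0 x)"
proof -
  have "\<exists>z. z \<in> Arr C \<and> Dom C z = x \<and> Cod C z = \<zero> \<and> invertible C z"
    using assms by (auto elim!: isomorphicE)
  from someI_ex[OF this] show "to0 x \<in> Arr C" "Dom C (to0 x) = x" "Cod C (to0 x) = \<zero>" "invertible C (to0 x)"
    by (simp_all add: to0_def)
qed

lemma null_tens:
  assumes "x \<in> Obj C" "y \<in> Obj C" "null x \<or> null y"
  shows "null (x \<otimes> y)"
  using assms(3)
proof
  assume "null x"
  note z = to0_Arr[OF this]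
  have "invertible C (nl y \<cdot> (to0 x \<boxtimes> Id C y))" using z assms by simp
  from isomorphicI[OF _ this] show ?thesis using z assms by simp
next
  assume "null y"
  note z = to0_Arr[OF this]
  have "invertible C (nr x \<cdot> (Id C x \<boxtimes> to0 y))" using z assms by simp
  from isomorphicI[OF _ this] show ?thesis using z assms by simp
qed

lemma isomorphic_null: "f \<in> Arr C ==> invertible C f ==> null (Cod C f) ==> null (Dom C f)"
  using isomorphicI isomorphic_trans by blast

definition diag :: "('i::linorder \<Rightarrow> 'o) \<Rightarrow> ('i \<Rightarrow> 'o) \<Rightarrow> ('i \<Rightarrow> 'm) \<Rightarrow> 'i set \<Rightarrow> 'm" where
  "diag u v g S = phi u v (\<lambda>k. {k}) (\<lambda>k. unit v k \<cdot> g k) S"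

lemma diag_block:
  assumes "finite S" "\<And>i. u i \<in> Obj C" "\<And>i. v i \<in> Obj C" "\<And>k. k \<in> S ==> g k \<in> Arr C \<and> Dom C (g k) = u k \<and> Cod C (g k) = v k"
  shows "sblock u v (\<lambda>k. {k}) (\<lambda>k. unit v k \<cdot> g k) S"
  by (rule blockI) (use assms in auto)

lemma diag_Arr:
  assumes "finite S" "\<And>i. u i \<in> Obj C" "\<And>i. v i \<in> Obj C" "\<And>k. k \<in> S ==> g k \<in> Arr C \<and> Dom C (g k) = u k \<and> Cod C (g k) = v k"
  shows "diag u v g S \<in> Arr C" "Dom C (diag u v g S) = sumo u S" "Cod C (diag u v g S) = sumo v S"
    "(\<And>k. k \<in> S ==> invertible C (g k)) ==> invertible C (diag u v g S)"
  using phi_Arr[OF diag_block[of S u v g, OF assms]] assms by (auto simp: diag_def)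

text \<open>The summands outside \<open>J\<close> are discarded; they have to be null.\<close>

definition drop_null :: "('i::linorder \<Rightarrow> 'o) \<Rightarrow> 'i set \<Rightarrow> 'i set \<Rightarrow> 'm" where
  "drop_null X L J = phi X X (\<lambda>k. if k \<in> J then {k} else {}) (\<lambda>k. if k \<in> J then unit X k else to0 (X k)) L"

lemma drop_block:
  assumes "finite L" "\<And>i. X i \<in> Obj C" "\<And>k. k \<in> L - J ==> null (X k)"
  shows "sblock X X (\<lambda>k. if k \<in> J then {k} else {}) (\<lambda>k. if k \<in> J then unit X k else to0 (X k)) L"
  by (rule blockI) (use assms to0_Arr in auto)

lemma drop_Arr:
  assumes "finite L" "\<And>i. X i \<in> Obj C" "J \<subseteq> L" "\<And>k. k \<in> L - J ==> null (X k)"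
  shows "drop_null X L J \<in> Arr C" "Dom C (drop_null X L J) = sumo X L" "Cod C (drop_null X L J) = sumo X J"
    "invertible C (drop_null X L J)"
proof -
  have "(\<Union>k\<in>L. if k \<in> J then {k} else {}) = J" using assms(3) by (auto split: if_splits)
  then show "drop_null X L J \<in> Arr C" "Dom C (drop_null X L J) = sumo X L" "Cod C (drop_null X L J) = sumo X J"
    "invertible C (drop_null X L J)"
    using phi_Arr[OF drop_block[of L X J, OF assms(1,2,4)]] assms to0_Arr by (auto simp: drop_null_def)
qed

text \<open>Where a null summand is sent to the empty sum, the component is forced, being the only
  arrow from a null object to zero. So such summands can be discarded beforehand.\<close>

lemma phi_drop:
  assumes b: "sblock X v G g L" and J: "J \<subseteq> L" and n: "\<And>k. k \<in> L - J ==> null (X k) \<and> G k = {}"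
  shows "phi X v G g J \<cdot> drop_null X L J = phi X v G g L"
proof -
  note B = blockD[OF b]
  have U: "(\<Union>k\<in>L. if k \<in> J then {k} else {}) = J" using J by (auto split: if_splits)
  have d: "sblock X X (\<lambda>k. if k \<in> J then {k} else {}) (\<lambda>k. if k \<in> J then unit X k else to0 (X k)) L"
    by (rule drop_block) (use B n in auto)
  have bJ: "sblock X v G g J" by (rule block_subset[OF b J])
  have "phi X v G g J \<cdot> drop_null X L J = phi X v (\<lambda>k. \<Union>(G ` (if k \<in> J then {k} else {})))
      (\<lambda>k. phi X v G g (if k \<in> J then {k} else {}) \<cdot> (if k \<in> J then unit X k else to0 (X k))) L"
    using phi_phi[OF d, of v G g] bJ by (simp only: U drop_null_def)
  also have "\<dots> = phi X v G g L"
  proof (rule blk_cong)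
    fix k assume k: "k \<in> L"
    show "\<Union>(G ` (if k \<in> J then {k} else {})) = G k" using n[of k] k by auto
    show "phi X v G g (if k \<in> J then {k} else {}) \<cdot> (if k \<in> J then unit X k else to0 (X k)) = g k"
    proof (cases "k \<in> J")
      case True
      have "sblock X v G g {k}" by (rule block_subset[OF b]) (use k in auto)
      from phi_single[OF this] show ?thesis using True by simp
    next
      case False
      then have k': "null (X k)" "G k = {}" using n k by auto
      have "to0 (X k) = g k"
        by (rule null_arrow_unique[OF k'(1) null_zero]) (use B k k' to0_Arr[OF k'(1)] in auto)
      then show ?thesis using False to0_Arr[OF k'(1)] by simp
    qed
  qed (use B in auto)
  finally show ?thesis .
qed

lemma drop_drop:
  assumes "finite L'" "\<And>i. X i \<in> Obj C" "J \<subseteq> L" "L \<subseteq> L'" "\<And>k. k \<in> L' - J ==> null (X k)"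
  shows "drop_null X L J \<cdot> drop_null X L' L = drop_null X L' J"
  unfolding drop_null_def[of X L J] drop_null_def[of X L' J]
  by (rule phi_drop[OF drop_block]) (use assms in auto)

lemma drop_self:
  assumes "finite L" "\<And>i. X i \<in> Obj C"
  shows "drop_null X L L = Id C (sumo X L)"
proof -
  have "drop_null X L L = phi X X (\<lambda>k. {k}) (unit X) L"
    unfolding drop_null_def by (rule blk_cong) (use assms in auto)
  then show ?thesis using phi_id[of X L] assms by simp
qed

text \<open>Inside \<open>J\<close> both composites have the component \<open>g k\<close>; outside
  \<open>J\<close> both are arrows from null objects to zero and therefore equal.\<close>

lemma drop_diag:
  assumes L: "finite L" "J \<subseteq> L" and X: "\<And>i. X i \<in> Obj C" and Y: "\<And>i. Y i \<in> Obj C"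
    and n: "\<And>k. k \<in> L - J ==> null (X k) \<and> null (Y k)"
    and g: "\<And>k. k \<in> L ==> g k \<in> Arr C \<and> Dom C (g k) = X k \<and> Cod C (g k) = Y k"
  shows "drop_null Y L J \<cdot> diag X Y g L = diag X Y g J \<cdot> drop_null X L J"
proof -
  let ?G = "\<lambda>k. if k \<in> J then {k} else {}" and ?g = "\<lambda>k. if k \<in> J then unit Y k \<cdot> g k else to0 (X k)"
  have b: "sblock X Y ?G ?g L"
    by (rule blockI) (use L X Y g n to0_Arr in auto)
  have "diag X Y g J \<cdot> drop_null X L J = phi X Y ?G ?g J \<cdot> drop_null X L J"
  proof -
    have "diag X Y g J = phi X Y ?G ?g J"
      unfolding diag_def by (rule blk_cong) (use L finite_subset in auto)
    then show ?thesis by simp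
  qed
  also have "\<dots> = phi X Y ?G ?g L"
    by (rule phi_drop[OF b]) (use L n in auto)
  finally have r: "diag X Y g J \<cdot> drop_null X L J = phi X Y ?G ?g L" .
  have d: "sblock X Y (\<lambda>k. {k}) (\<lambda>k. unit Y k \<cdot> g k) L"
    by (rule diag_block) (use L X Y g in auto)
  have dd: "sblock Y Y ?G (\<lambda>k. if k \<in> J then unit Y k else to0 (Y k)) L"
    by (rule drop_block) (use L Y n in auto)
  have "drop_null Y L J \<cdot> diag X Y g L = phi X Y (\<lambda>k. \<Union>(?G ` {k})) (\<lambda>k. phi Y Y ?G (\<lambda>k. if k \<in> J then unit Y k else to0 (Y k)) {k} \<cdot> (unit Y k \<cdot> g k)) L"
    using phi_phi[OF d, of Y ?G "\<lambda>k. if k \<in> J then unit Y k else to0 (Y k)"] dd by (simp add: drop_null_def diag_def)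
  also have "\<dots> = phi X Y ?G ?g L"
  proof (rule blk_cong)
    fix k assume k: "k \<in> L"
    have bk: "sblock Y Y ?G (\<lambda>k. if k \<in> J then unit Y k else to0 (Y k)) {k}" by (rule block_subset[OF dd]) (use k in auto)
    have "phi Y Y ?G (\<lambda>k. if k \<in> J then unit Y k else to0 (Y k)) {k} \<cdot> (unit Y k \<cdot> g k) = (if k \<in> J then unit Y k else to0 (Y k)) \<cdot> g k"
      by (rule phi_unit_comp[OF bk]) (use g k in auto)
    also have "\<dots> = ?g k"
    proof (cases "k \<in> J")
      case False
      then have "null (X k)" "null (Y k)" using n k by auto
      then have "to0 (Y k) \<cdot> g k = to0 (X k)"
        by (intro null_arrow_unique[of "X k" \<zero>]) (use g k to0_Arr in auto)
      then show ?thesis using False by simp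
    qed simp
    finally show "phi Y Y ?G (\<lambda>k. if k \<in> J then unit Y k else to0 (Y k)) {k} \<cdot> (unit Y k \<cdot> g k) = ?g k" .
  qed (use L in auto)
  finally show ?thesis using r by simp
qed

definition cterm :: "(int \<Rightarrow> 'o) \<Rightarrow> (int \<Rightarrow> 'o) \<Rightarrow> int \<Rightarrow> int \<Rightarrow> 'o" where
  "cterm f g n k = f k \<otimes> g (n - k)"

definition cset :: "(int \<Rightarrow> 'o) \<Rightarrow> (int \<Rightarrow> 'o) \<Rightarrow> int \<Rightarrow> int set" where
  "cset f g n = {k. \<not> null (f k) \<and> \<not> null (g (n - k))}"

lemma cauchy_prod_eq: "cauchy_prod C f g n = sumo (cterm f g n) (cset f g n)"
proof -
  have "foldr (osum C) (map (cterm f g n) ks) \<zero> = suml (cterm f g n) ks" for ks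
    by (induction ks) auto
  then show ?thesis
    by (simp add: cauchy_prod_def big_osum_def sumo_def cauchy_indices_def cset_def cterm_def[abs_def])
qed

lemma laurent_objsD:
  assumes "f \<in> laurent_objs C"
  shows "f n \<in> Obj C" "\<exists>k. \<forall>n<k. null (f n)"
  using assms by (auto simp: laurent_objs_def)

lemma laurent_objsI:
  assumes "\<And>n. f n \<in> Obj C" "\<And>n. n < k ==> null (f n)"
  shows "f \<in> laurent_objs C"
proof -
  have "\<exists>k\<le>0. \<forall>n<k. null (f n)"
    by (rule exI[of _ "min k 0"]) (use assms in auto)
  then show ?thesis using assms by (auto simp: laurent_objs_def)
qed

lemma finite_cset:
  assumes "f \<in> laurent_objs C" "g \<in> laurent_objs C"
  shows "finite (cset f g n)"
proof -
  obtain i j where "\<forall>n<i. null (f n)" "\<forall>n<j. null (g n)" using assms laurent_objsD(2) by meson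
  then have "cset f g n \<subseteq> {i..n - j}" by (force simp: cset_def)
  then show ?thesis using finite_subset by blast
qed

lemma cterm_Obj [simp]: "(\<And>n. f n \<in> Obj C) ==> (\<And>n. g n \<in> Obj C) ==> cterm f g n k \<in> Obj C"
  by (simp add: cterm_def)

text \<open>The pairs omitted from the Cauchy product give null terms, which is why
  \<open>drop_null\<close> can compare sums over different index sets.\<close>

lemma cterm_null: "(\<And>n. f n \<in> Obj C) ==> (\<And>n. g n \<in> Obj C) ==> k \<notin> cset f g n ==> null (cterm f g n k)"
  unfolding cterm_def by (rule null_tens) (auto simp: cset_def)

lemma cauchy_prod_laurent:
  assumes "f \<in> laurent_objs C" "g \<in> laurent_objs C"
  shows "cauchy_prod C f g \<in> laurent_objs C"
proof -
  obtain i j where ij: "\<forall>n<i. null (f n)" "\<forall>n<j. null (g n)" using assms laurent_objsD(2) by meson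
  have "cset f g n = {}" if "n < i + j" for n
    unfolding cset_def
  proof (intro Collect_empty_eq[THEN iffD2] allI notI)
    fix k assume "\<not> null (f k) \<and> \<not> null (g (n - k))"
    then have "i \<le> k" "j \<le> n - k" using ij by force+
    then show False using that by simp
  qed
  then show ?thesis
    using assms laurent_objsD(1) by (intro laurent_objsI[of _ "i + j"]) (auto simp: cauchy_prod_eq)
qed

text \<open>Source and target have different index sets in general. The termwise sum of arrows is
  formed over their union \<open>L\<close>: null terms are added to the source beforehand and
  dropped from the target afterwards.\<close>

definition ctimes :: "(int \<Rightarrow> 'm) \<times> (int \<Rightarrow> 'm) \<Rightarrow> int \<Rightarrow> 'm" where
  "ctimes = (\<lambda>(\<phi>, \<psi>) n.
     let f = (\<lambda>k. Dom C (\<phi> k)); f' = (\<lambda>k. Cod C (\<phi> k)); g = (\<lambda>k. Dom C (\<psi> k)); g' = (\<lambda>k. Cod C (\<psi> k));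
         L = cset f g n \<union> cset f' g' n
     in drop_null (cterm f' g' n) L (cset f' g' n) \<cdot>
        (diag (cterm f g n) (cterm f' g' n) (\<lambda>k. \<phi> k \<boxtimes> \<psi> (n - k)) L \<cdot>
         arr_inv (drop_null (cterm f g n) L (cset f g n))))"

definition larr :: "(int \<Rightarrow> 'm) \<Rightarrow> (int \<Rightarrow> 'o) \<Rightarrow> (int \<Rightarrow> 'o) \<Rightarrow> bool" where
  "larr \<phi> f g \<longleftrightarrow> f \<in> laurent_objs C \<and> g \<in> laurent_objs C \<and> (\<forall>n. \<phi> n \<in> Arr C \<and> Dom C (\<phi> n) = f n \<and> Cod C (\<phi> n) = g n)"

lemma larrD:
  assumes "larr \<phi> f g"
  shows "f \<in> laurent_objs C" "g \<in> laurent_objs C" "\<phi> n \<in> Arr C" "Dom C (\<phi> n) = f n" "Cod C (\<phi> n) = g n"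
    "f n \<in> Obj C" "g n \<in> Obj C"
  using assms laurent_objsD(1) by (auto simp: larr_def)

text \<open>The freedom in \<open>L\<close> allows a comparison with presentations, whose index sets
  may be larger. Surplus terms are dropped in two stages by \<open>drop_drop\<close>, and
  \<open>drop_diag\<close> moves the first stage past the diagonal map.\<close>

lemma ctimes_eq:
  assumes \<phi>: "larr \<phi> f f'" and \<psi>: "larr \<psi> g g'" and L: "finite L" "cset f g n \<subseteq> L" "cset f' g' n \<subseteq> L"
  shows "ctimes (\<phi>, \<psi>) n = drop_null (cterm f' g' n) L (cset f' g' n) \<cdot>
        (diag (cterm f g n) (cterm f' g' n) (\<lambda>k. \<phi> k \<boxtimes> \<psi> (n - k)) L \<cdot>
         arr_inv (drop_null (cterm f g n) L (cset f g n)))"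
proof -
  note [simp] = larrD(3-7)[OF \<phi>] larrD(3-7)[OF \<psi>]
  let ?X = "cterm f g n" and ?Y = "cterm f' g' n" and ?J = "cset f g n" and ?J' = "cset f' g' n" and ?g = "\<lambda>k. \<phi> k \<boxtimes> \<psi> (n - k)"
  let ?L = "?J \<union> ?J'"
  have fin: "finite ?J" "finite ?J'" by (rule finite_cset[OF larrD(1)[OF \<phi>] larrD(1)[OF \<psi>]], rule finite_cset[OF larrD(2)[OF \<phi>] larrD(2)[OF \<psi>]])
  have nX: "null (?X k)" if "k \<notin> ?J" for k by (rule cterm_null) (use that in auto)
  have nY: "null (?Y k)" if "k \<notin> ?J'" for k by (rule cterm_null) (use that in auto)
  have g: "?g k \<in> Arr C \<and> Dom C (?g k) = ?X k \<and> Cod C (?g k) = ?Y k" for k by (simp add: cterm_def)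
  have A1 [simp]: "diag ?X ?Y ?g L \<in> Arr C" "Dom C (diag ?X ?Y ?g L) = sumo ?X L" "Cod C (diag ?X ?Y ?g L) = sumo ?Y L"
    by (rule diag_Arr; use L g in simp)+
  have A2 [simp]: "diag ?X ?Y ?g ?L \<in> Arr C" "Dom C (diag ?X ?Y ?g ?L) = sumo ?X ?L" "Cod C (diag ?X ?Y ?g ?L) = sumo ?Y ?L"
    by (rule diag_Arr; use fin g in simp)+
  have A3 [simp]: "drop_null ?X L ?J \<in> Arr C" "Dom C (drop_null ?X L ?J) = sumo ?X L" "Cod C (drop_null ?X L ?J) = sumo ?X ?J" "invertible C (drop_null ?X L ?J)"
    by (rule drop_Arr; use L nX in simp)+
  have A4 [simp]: "drop_null ?X ?L ?J \<in> Arr C" "Dom C (drop_null ?X ?L ?J) = sumo ?X ?L" "Cod C (drop_null ?X ?L ?J) = sumo ?X ?J" "invertible C (drop_null ?X ?L ?J)"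
    by (rule drop_Arr; use fin nX in simp)+
  have A5 [simp]: "drop_null ?X L ?L \<in> Arr C" "Dom C (drop_null ?X L ?L) = sumo ?X L" "Cod C (drop_null ?X L ?L) = sumo ?X ?L"
    by (rule drop_Arr; use L nX in simp)+
  have A6 [simp]: "drop_null ?Y ?L ?J' \<in> Arr C" "Dom C (drop_null ?Y ?L ?J') = sumo ?Y ?L" "Cod C (drop_null ?Y ?L ?J') = sumo ?Y ?J'"
    by (rule drop_Arr; use fin nY in simp)+
  have A7 [simp]: "drop_null ?Y L ?L \<in> Arr C" "Dom C (drop_null ?Y L ?L) = sumo ?Y L" "Cod C (drop_null ?Y L ?L) = sumo ?Y ?L"
    by (rule drop_Arr; use L nY in simp)+
  have A8 [simp]: "drop_null ?Y L ?J' \<in> Arr C" "Dom C (drop_null ?Y L ?J') = sumo ?Y L" "Cod C (drop_null ?Y L ?J') = sumo ?Y ?J'"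
    by (rule drop_Arr; use L nY in simp)+
  have t: "ctimes (\<phi>, \<psi>) n = drop_null ?Y ?L ?J' \<cdot> (diag ?X ?Y ?g ?L \<cdot> arr_inv (drop_null ?X ?L ?J))"
    by (simp add: ctimes_def Let_def)
  have d1: "drop_null ?X ?L ?J \<cdot> drop_null ?X L ?L = drop_null ?X L ?J"
    by (rule drop_drop) (use L nX in auto)
  have d2: "drop_null ?Y ?L ?J' \<cdot> drop_null ?Y L ?L = drop_null ?Y L ?J'"
    by (rule drop_drop) (use L nY in auto)
  have d3: "drop_null ?Y L ?L \<cdot> diag ?X ?Y ?g L = diag ?X ?Y ?g ?L \<cdot> drop_null ?X L ?L"
    by (rule drop_diag) (use L nX nY g in auto)
  have "ctimes (\<phi>, \<psi>) n \<cdot> drop_null ?X L ?J = drop_null ?Y ?L ?J' \<cdot> (diag ?X ?Y ?g ?L \<cdot> (arr_inv (drop_null ?X ?L ?J) \<cdot> (drop_null ?X ?L ?J \<cdot> drop_null ?X L ?L)))"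
    unfolding t d1 by (simp add: comp_assoc)
  also have "\<dots> = drop_null ?Y ?L ?J' \<cdot> (drop_null ?Y L ?L \<cdot> diag ?X ?Y ?g L)"
    unfolding d3 by simp
  also have "\<dots> = drop_null ?Y L ?J' \<cdot> diag ?X ?Y ?g L"
    unfolding d2[symmetric] by (simp add: comp_assoc)
  finally have e: "ctimes (\<phi>, \<psi>) n \<cdot> drop_null ?X L ?J = drop_null ?Y L ?J' \<cdot> diag ?X ?Y ?g L" .
  have [simp]: "ctimes (\<phi>, \<psi>) n \<in> Arr C" "Dom C (ctimes (\<phi>, \<psi>) n) = sumo ?X ?J"
    by (simp_all add: t)
  show ?thesis
    by (rule cancel_right[where f="drop_null ?X L ?J"]) (simp_all add: e comp_assoc)
qed

lemma ctimes_Arr: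
  assumes \<phi>: "larr \<phi> f f'" and \<psi>: "larr \<psi> g g'"
  shows "ctimes (\<phi>, \<psi>) n \<in> Arr C" "Dom C (ctimes (\<phi>, \<psi>) n) = cauchy_prod C f g n" "Cod C (ctimes (\<phi>, \<psi>) n) = cauchy_prod C f' g' n"
proof -
  note [simp] = larrD(3-7)[OF \<phi>] larrD(3-7)[OF \<psi>]
  let ?X = "cterm f g n" and ?Y = "cterm f' g' n" and ?J = "cset f g n" and ?J' = "cset f' g' n" and ?g = "\<lambda>k. \<phi> k \<boxtimes> \<psi> (n - k)"
  let ?L = "?J \<union> ?J'"
  have fin: "finite ?J" "finite ?J'" by (rule finite_cset[OF larrD(1)[OF \<phi>] larrD(1)[OF \<psi>]], rule finite_cset[OF larrD(2)[OF \<phi>] larrD(2)[OF \<psi>]])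
  have nX: "null (?X k)" if "k \<notin> ?J" for k by (rule cterm_null) (use that in auto)
  have nY: "null (?Y k)" if "k \<notin> ?J'" for k by (rule cterm_null) (use that in auto)
  have g: "?g k \<in> Arr C \<and> Dom C (?g k) = ?X k \<and> Cod C (?g k) = ?Y k" for k by (simp add: cterm_def)
  have A2 [simp]: "diag ?X ?Y ?g ?L \<in> Arr C" "Dom C (diag ?X ?Y ?g ?L) = sumo ?X ?L" "Cod C (diag ?X ?Y ?g ?L) = sumo ?Y ?L"
    by (rule diag_Arr; use fin g in simp)+
  have A4 [simp]: "drop_null ?X ?L ?J \<in> Arr C" "Dom C (drop_null ?X ?L ?J) = sumo ?X ?L" "Cod C (drop_null ?X ?L ?J) = sumo ?X ?J" "invertible C (drop_null ?X ?L ?J)"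
    by (rule drop_Arr; use fin nX in simp)+
  have A6 [simp]: "drop_null ?Y ?L ?J' \<in> Arr C" "Dom C (drop_null ?Y ?L ?J') = sumo ?Y ?L" "Cod C (drop_null ?Y ?L ?J') = sumo ?Y ?J'"
    by (rule drop_Arr; use fin nY in simp)+
  show "ctimes (\<phi>, \<psi>) n \<in> Arr C" "Dom C (ctimes (\<phi>, \<psi>) n) = cauchy_prod C f g n" "Cod C (ctimes (\<phi>, \<psi>) n) = cauchy_prod C f' g' n"
    by (simp_all add: ctimes_def Let_def cauchy_prod_eq)
qed

text \<open>If the index sets agree, nothing is added or dropped, and \<open>phi_diagonal\<close>
  identifies what remains with the plain sum of arrows.\<close>

lemma ctimes_cauchy: "cauchy_arrow_map C ctimes"
  unfolding cauchy_arrow_map_def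
proof (intro ballI allI impI)
  fix \<phi> \<psi> n
  assume \<phi>: "\<phi> \<in> laurent_arrs C" and \<psi>: "\<psi> \<in> laurent_arrs C"
  let ?f = "\<lambda>k. Dom C (\<phi> k)" and ?f' = "\<lambda>k. Cod C (\<phi> k)" and ?g = "\<lambda>k. Dom C (\<psi> k)" and ?g' = "\<lambda>k. Cod C (\<psi> k)"
  let ?J = "cset ?f ?g n"
  assume eq: "cauchy_indices C ?f ?g n = cauchy_indices C ?f' ?g' n"
  have l: "larr \<phi> ?f ?f'" "larr \<psi> ?g ?g'" using \<phi> \<psi> by (auto simp: larr_def laurent_arrs_def)
  have fin: "finite ?J" "finite (cset ?f' ?g' n)"
    by (rule finite_cset[OF larrD(1)[OF l(1)] larrD(1)[OF l(2)]], rule finite_cset[OF larrD(2)[OF l(1)] larrD(2)[OF l(2)]])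
  \<comment> \<open>The hypothesis compares lists. Finiteness is needed to return to the sets, since
    \<open>sorted_list_of_set\<close> is empty on every infinite set.\<close>
  have J: "cset ?f' ?g' n = ?J"
  proof -
    have "sorted_list_of_set ?J = sorted_list_of_set (cset ?f' ?g' n)"
      using eq by (simp add: cauchy_indices_def cset_def)
    then have "set (sorted_list_of_set ?J) = set (sorted_list_of_set (cset ?f' ?g' n))" by simp
    then show ?thesis using fin by simp
  qed
  note [simp] = larrD(3)[OF l(1)] larrD(3)[OF l(2)]
  let ?h = "\<lambda>k. \<phi> k \<boxtimes> \<psi> (n - k)"
  have d: "drop_null (cterm ?f ?g n) ?J ?J = Id C (sumo (cterm ?f ?g n) ?J)"
    "drop_null (cterm ?f' ?g' n) ?J ?J = Id C (sumo (cterm ?f' ?g' n) ?J)"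
    by (rule drop_self; use fin in simp)+
  have A [simp]: "diag (cterm ?f ?g n) (cterm ?f' ?g' n) ?h ?J \<in> Arr C"
    "Dom C (diag (cterm ?f ?g n) (cterm ?f' ?g' n) ?h ?J) = sumo (cterm ?f ?g n) ?J"
    "Cod C (diag (cterm ?f ?g n) (cterm ?f' ?g' n) ?h ?J) = sumo (cterm ?f' ?g' n) ?J"
    by (rule diag_Arr; use fin in \<open>simp add: cterm_def\<close>)+
  have "arr_inv (Id C (sumo (cterm ?f ?g n) ?J)) = Id C (sumo (cterm ?f ?g n) ?J)"
    by (rule inverse_unique) auto
  then have "ctimes (\<phi>, \<psi>) n = diag (cterm ?f ?g n) (cterm ?f' ?g' n) ?h ?J"
    by (simp add: ctimes_def Let_def J d)
  also have "\<dots> = foldr (\<lambda>k X. ?h k \<boxplus> X) (sorted_list_of_set ?J) (Id C \<zero>)"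
    unfolding diag_def by (rule phi_diagonal) (use fin in \<open>auto simp: cterm_def\<close>)
  also have "\<dots> = big_asum C (map ?h (sorted_list_of_set ?J))"
    by (simp add: big_asum_def foldr_map comp_def)
  finally show "ctimes (\<phi>, \<psi>) n = big_asum C (map ?h (cauchy_indices C ?f ?g n))"
    by (simp add: cauchy_indices_def cset_def)
qed

end

section \<open>Presentations\<close>

text \<open>A presentation writes every member of a family as a sum of objects indexed by words, all of
  the same length. Each letter carries a degree and a colour; the colour keeps the words of different factors and
  summands apart.\<close>

type_synonym word = "(nat \<times> int) list"

definition deg :: "word \<Rightarrow> int" where
  "deg w = sum_list (map snd w)"

lemma deg_simps [simp]: "deg [] = 0" "deg [(c, n)] = n" "deg (v @ w) = deg v + deg w"
  by (simp_all add: deg_def)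

record ('o, 'm) presentation =
  plen :: nat
  pidx :: "word set"
  pob :: "word \<Rightarrow> 'o"
  par :: "int \<Rightarrow> 'm"

definition grade :: "('o, 'm) presentation \<Rightarrow> int \<Rightarrow> word set" where
  "grade X n = {w \<in> pidx X. deg w = n}"

lemma grade_iff: "w \<in> grade X n \<longleftrightarrow> w \<in> pidx X \<and> deg w = n"
  by (simp add: grade_def)

lemma grade_disjoint: "k \<noteq> n ==> grade X k \<inter> grade Y n = {}"
  by (auto simp: grade_def)

context rigid_laplaza
begin

text \<open>\<open>par X n\<close> is an isomorphism from the coefficient \<open>x n\<close> to the
  sum of all summands of degree \<open>n\<close>, null ones included. The lower bound on the degrees
  makes the relevant index sets of a product finite.\<close>

definition pres :: "('o, 'm) presentation \<Rightarrow> (int \<Rightarrow> 'o) \<Rightarrow> bool" where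
  "pres X x \<longleftrightarrow> (\<forall>w\<in>pidx X. length w = plen X) \<and> (\<exists>k. \<forall>w\<in>pidx X. k \<le> deg w) \<and> (\<forall>n. finite (grade X n)) \<and>
    (\<forall>w. pob X w \<in> Obj C) \<and>
    (\<forall>n. par X n \<in> Arr C \<and> Dom C (par X n) = x n \<and> Cod C (par X n) = sumo (pob X) (grade X n) \<and> invertible C (par X n))"

lemma presD:
  assumes "pres X x"
  shows "w \<in> pidx X ==> length w = plen X" "\<exists>k. \<forall>w\<in>pidx X. k \<le> deg w" "finite (grade X n)" "pob X w \<in> Obj C"
    "par X n \<in> Arr C" "Dom C (par X n) = x n" "Cod C (par X n) = sumo (pob X) (grade X n)" "invertible C (par X n)"
    "words (plen X) (grade X n)"
  using assms by (auto simp: pres_def grade_def words_def)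

lemma presI:
  assumes "\<And>w. w \<in> pidx X ==> length w = plen X" "\<And>w. w \<in> pidx X ==> k \<le> deg w" "\<And>n. finite (grade X n)" "\<And>w. pob X w \<in> Obj C"
    "\<And>n. par X n \<in> Arr C" "\<And>n. Dom C (par X n) = x n" "\<And>n. Cod C (par X n) = sumo (pob X) (grade X n)" "\<And>n. invertible C (par X n)"
  shows "pres X x"
  using assms unfolding pres_def by blast

lemma pres_null: "pres X x ==> grade X n = {} ==> null (x n)"
  using isomorphic_null[of "par X n"] presD(5-8)[of X x n] by simp

lemma grade_bounded: "pres X x ==> \<exists>k. \<forall>n<k. grade X n = {}"
proof -
  assume "pres X x"
  then obtain k where k: "\<forall>w\<in>pidx X. k \<le> deg w" using presD(2) by blast
  have "grade X n = {}" if "n < k" for n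
    unfolding grade_def using k that by force
  then show ?thesis by blast
qed

lemma pres_laurent: "pres X x ==> x \<in> laurent_objs C"
proof -
  assume X: "pres X x"
  then obtain k where k: "\<forall>n<k. grade X n = {}" using grade_bounded by blast
  show ?thesis
  proof (rule laurent_objsI[of _ k])
    show "x n \<in> Obj C" for n using presD(5,6)[OF X, of n] Dom_Cod_Obj(1)[of "par X n"] by simp
    show "null (x n)" if "n < k" for n using pres_null[OF X] k that by blast
  qed
qed

lemma presO: "pres X x ==> x n \<in> Obj C"
  using pres_laurent laurent_objsD by blast

text \<open>In \<open>rep \<phi> X Y G g\<close> the arrow \<open>g w\<close> sends the summand \<open>w\<close> of \<open>X\<close> into the sum of the summands \<open>G w\<close> of \<open>Y\<close>;
  in \<open>drep \<phi> X Y g\<close> below, \<open>\<phi>\<close> is diagonal. A diagonal arrow is determined by its components, so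
  that equations between composites of structure maps reduce to equations in \<open>C\<close>.\<close>

definition rep :: "(int \<Rightarrow> 'm) \<Rightarrow> ('o, 'm) presentation \<Rightarrow> ('o, 'm) presentation \<Rightarrow> (word \<Rightarrow> word set) \<Rightarrow> (word \<Rightarrow> 'm) \<Rightarrow> bool" where
  "rep \<phi> X Y G g \<longleftrightarrow> pidx Y = \<Union>(G ` pidx X) \<and>
    (\<forall>w\<in>pidx X. finite (G w) \<and> G w \<subseteq> {v. deg v = deg w} \<and> g w \<in> Arr C \<and> Dom C (g w) = pob X w \<and> Cod C (g w) = sumo (pob Y) (G w)) \<and>
    (\<forall>w\<in>pidx X. \<forall>v\<in>pidx X. w \<noteq> v \<longrightarrow> G w \<inter> G v = {}) \<and>
    (\<forall>n. \<phi> n \<in> Arr C \<and> Dom C (\<phi> n) = Dom C (par X n) \<and> Cod C (\<phi> n) = Dom C (par Y n) \<and>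
      par Y n \<cdot> \<phi> n = phi (pob X) (pob Y) G g (grade X n) \<cdot> par X n)"

lemma repD:
  assumes "rep \<phi> X Y G g"
  shows "pidx Y = \<Union>(G ` pidx X)" "w \<in> pidx X ==> finite (G w)" "w \<in> pidx X ==> v \<in> G w ==> deg v = deg w"
    "w \<in> pidx X ==> g w \<in> Arr C" "w \<in> pidx X ==> Dom C (g w) = pob X w" "w \<in> pidx X ==> Cod C (g w) = sumo (pob Y) (G w)"
    "w \<in> pidx X ==> v \<in> pidx X ==> w \<noteq> v ==> G w \<inter> G v = {}"
    "\<phi> n \<in> Arr C" "Dom C (\<phi> n) = Dom C (par X n)" "Cod C (\<phi> n) = Dom C (par Y n)"
    "par Y n \<cdot> \<phi> n = phi (pob X) (pob Y) G g (grade X n) \<cdot> par X n"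
proof -
  note r = assms[unfolded rep_def]
  note r1 = r[THEN conjunct1] and r2 = r[THEN conjunct2, THEN conjunct1, rule_format]
    and r3 = r[THEN conjunct2, THEN conjunct2, THEN conjunct1, rule_format]
    and r4 = r[THEN conjunct2, THEN conjunct2, THEN conjunct2, rule_format]
  show "pidx Y = \<Union>(G ` pidx X)" by (fact r1)
  show "w \<in> pidx X ==> v \<in> G w ==> deg v = deg w" using r2[of w] by blast
  show "w \<in> pidx X ==> finite (G w)" "w \<in> pidx X ==> g w \<in> Arr C" "w \<in> pidx X ==> Dom C (g w) = pob X w" "w \<in> pidx X ==> Cod C (g w) = sumo (pob Y) (G w)"
    using r2 by simp_all
  show "w \<in> pidx X ==> v \<in> pidx X ==> w \<noteq> v ==> G w \<inter> G v = {}" by (rule r3)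
  show "\<phi> n \<in> Arr C" "Dom C (\<phi> n) = Dom C (par X n)" "Cod C (\<phi> n) = Dom C (par Y n)"
    "par Y n \<cdot> \<phi> n = phi (pob X) (pob Y) G g (grade X n) \<cdot> par X n"
    using r4[of n] by simp_all
qed

lemma repI:
  assumes "pidx Y = \<Union>(G ` pidx X)" "\<And>w. w \<in> pidx X ==> finite (G w)" "\<And>w v. w \<in> pidx X ==> v \<in> G w ==> deg v = deg w"
    "\<And>w. w \<in> pidx X ==> g w \<in> Arr C" "\<And>w. w \<in> pidx X ==> Dom C (g w) = pob X w" "\<And>w. w \<in> pidx X ==> Cod C (g w) = sumo (pob Y) (G w)"
    "\<And>w v. w \<in> pidx X ==> v \<in> pidx X ==> w \<noteq> v ==> G w \<inter> G v = {}"
    "\<And>n. \<phi> n \<in> Arr C" "\<And>n. Dom C (\<phi> n) = Dom C (par X n)" "\<And>n. Cod C (\<phi> n) = Dom C (par Y n)"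
    "\<And>n. par Y n \<cdot> \<phi> n = phi (pob X) (pob Y) G g (grade X n) \<cdot> par X n"
  shows "rep \<phi> X Y G g"
  unfolding rep_def by (intro conjI ballI allI impI subsetI CollectI) (rule assms; assumption)+

lemma rep_grade:
  assumes "rep \<phi> X Y G g"
  shows "\<Union>(G ` grade X n) = grade Y n"
proof -
  have "v \<in> grade Y n" if "w \<in> grade X n" "v \<in> G w" for v w
    using repD(1,3)[OF assms] that by (auto simp: grade_iff)
  moreover have "\<exists>w. w \<in> grade X n \<and> v \<in> G w" if "v \<in> grade Y n" for v
    using repD(1,3)[OF assms] that by (auto simp: grade_iff)
  ultimately show ?thesis by blast
qed

lemma rep_block:
  assumes "pres X x" "pres Y y" "rep \<phi> X Y G g"
  shows "sblock (pob X) (pob Y) G g (grade X n)"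
  by (rule blockI) (use presD(3,4)[OF assms(1)] presD(4)[OF assms(2)] repD(2,4-7)[OF assms(3)] in \<open>auto simp: grade_iff\<close>)

lemma rep_Arr:
  assumes "pres X x" "pres Y y" "rep \<phi> X Y G g"
  shows "\<phi> n \<in> Arr C" "Dom C (\<phi> n) = x n" "Cod C (\<phi> n) = y n"
  using repD(8-10)[OF assms(3)] presD(6)[OF assms(1)] presD(6)[OF assms(2)] by auto

lemma rep_larr: "pres X x ==> pres Y y ==> rep \<phi> X Y G g ==> larr \<phi> x y"
  using rep_Arr[of X x Y y \<phi> G g] pres_laurent[of X x] pres_laurent[of Y y] by (simp add: larr_def)

lemma rep_unique:
  assumes X: "pres X x" and Y: "pres Y y" and r: "rep \<phi> X Y G g" "rep \<psi> X Y G' g'"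
    and eq: "\<And>w. w \<in> pidx X ==> G w = G' w \<and> g w = g' w"
  shows "\<phi> = \<psi>"
proof
  fix n
  have "phi (pob X) (pob Y) G g (grade X n) = phi (pob X) (pob Y) G' g' (grade X n)"
    by (rule blk_cong) (use presD(3)[OF X] repD(2)[OF r(1)] eq in \<open>auto simp: grade_iff\<close>)
  then have "par Y n \<cdot> \<phi> n = par Y n \<cdot> \<psi> n"
    using repD(11)[OF r(1), of n] repD(11)[OF r(2), of n] by simp
  then show "\<phi> n = \<psi> n"
    by (rule cancel_left) (use presD(5-8)[OF Y] rep_Arr[OF X Y r(1)] rep_Arr[OF X Y r(2)] in auto)
qed

lemma rep_cong:
  assumes X: "pres X x" and r: "rep \<phi> X Y G g" and eq: "\<And>w. w \<in> pidx X ==> G w = G' w \<and> g w = g' w"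
  shows "rep \<phi> X Y G' g'"
proof -
  have "phi (pob X) (pob Y) G g (grade X n) = phi (pob X) (pob Y) G' g' (grade X n)" for n
    by (rule blk_cong) (use presD(3)[OF X] repD(2)[OF r] eq in \<open>auto simp: grade_iff\<close>)
  moreover have "\<Union>(G ` pidx X) = \<Union>(G' ` pidx X)" using eq by auto
  ultimately show ?thesis using r eq unfolding rep_def by simp
qed

lemma rep_comp:
  assumes X: "pres X x" and Y: "pres Y y" and Z: "pres Z z" and r: "rep \<phi> X Y G g" and q: "rep \<psi> Y Z H h"
  shows "rep (\<lambda>n. \<psi> n \<cdot> \<phi> n) X Z (\<lambda>w. \<Union>(H ` G w)) (\<lambda>w. phi (pob Y) (pob Z) H h (G w) \<cdot> g w)"
proof (rule repI)
  have sub: "G w \<subseteq> grade Y (deg w)" if "w \<in> pidx X" for w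
    using repD(1,3)[OF r] that by (auto simp: grade_iff)
  have b: "sblock (pob Y) (pob Z) H h (G w)" if "w \<in> pidx X" for w
    by (rule block_subset[OF rep_block[OF Y Z q] sub[OF that]])
  have subY: "v \<in> pidx Y" if "w \<in> pidx X" "v \<in> G w" for v w
    using repD(1)[OF r] that by auto
  show "pidx Z = \<Union>((\<lambda>w. \<Union>(H ` G w)) ` pidx X)"
    using repD(1)[OF r] repD(1)[OF q] by auto
  fix w assume w: "w \<in> pidx X"
  show "finite (\<Union>(H ` G w))"
    by (intro finite_UN_I) (use repD(2)[OF r w] repD(2)[OF q subY[OF w]] in auto)
  show "phi (pob Y) (pob Z) H h (G w) \<cdot> g w \<in> Arr C" "Dom C (phi (pob Y) (pob Z) H h (G w) \<cdot> g w) = pob X w"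
    "Cod C (phi (pob Y) (pob Z) H h (G w) \<cdot> g w) = sumo (pob Z) (\<Union>(H ` G w))"
    using phi_Arr(1-3)[OF b[OF w]] repD(4-6)[OF r w] by auto
  show "deg v = deg w" if "v \<in> \<Union>(H ` G w)" for v
  proof -
    from that obtain i where i: "i \<in> G w" "v \<in> H i" by auto
    show ?thesis using repD(3)[OF r w i(1)] repD(3)[OF q subY[OF w i(1)] i(2)] by simp
  qed
  fix v assume v: "v \<in> pidx X" "w \<noteq> v"
  have "H i \<inter> H j = {}" if "i \<in> G w" "j \<in> G v" for i j
    using repD(7)[OF q subY[OF w that(1)] subY[OF v(1) that(2)]] repD(7)[OF r w v(1,2)] that by auto
  then show "\<Union>(H ` G w) \<inter> \<Union>(H ` G v) = {}" by blast
next
  fix n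
  note A = rep_Arr[OF X Y r, of n] rep_Arr[OF Y Z q, of n] presD(5-8)[OF X, of n] presD(5-8)[OF Y, of n] presD(5-8)[OF Z, of n]
  note pb = rep_block[OF X Y r, of n] rep_block[OF Y Z q, of n]
  note pA = phi_Arr(1-3)[OF pb(1)] phi_Arr(1-3)[OF pb(2)]
  show "\<psi> n \<cdot> \<phi> n \<in> Arr C" "Dom C (\<psi> n \<cdot> \<phi> n) = Dom C (par X n)" "Cod C (\<psi> n \<cdot> \<phi> n) = Dom C (par Z n)"
    using A by auto
  have "par Z n \<cdot> (\<psi> n \<cdot> \<phi> n) = (par Z n \<cdot> \<psi> n) \<cdot> \<phi> n"
    using A by (simp add: comp_assoc)
  also have "\<dots> = phi (pob Y) (pob Z) H h (grade Y n) \<cdot> (par Y n \<cdot> \<phi> n)"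
    unfolding repD(11)[OF q] using A pA by (simp add: comp_assoc)
  also have "\<dots> = (phi (pob Y) (pob Z) H h (grade Y n) \<cdot> phi (pob X) (pob Y) G g (grade X n)) \<cdot> par X n"
    unfolding repD(11)[OF r] using A pA by (simp add: comp_assoc rep_grade[OF r])
  also have "phi (pob Y) (pob Z) H h (grade Y n) \<cdot> phi (pob X) (pob Y) G g (grade X n)
    = phi (pob X) (pob Z) (\<lambda>w. \<Union>(H ` G w)) (\<lambda>w. phi (pob Y) (pob Z) H h (G w) \<cdot> g w) (grade X n)"
    using phi_phi[OF pb(1), of "pob Z" H h] pb(2) by (simp add: rep_grade[OF r])
  finally show "par Z n \<cdot> (\<psi> n \<cdot> \<phi> n) = phi (pob X) (pob Z) (\<lambda>w. \<Union>(H ` G w)) (\<lambda>w. phi (pob Y) (pob Z) H h (G w) \<cdot> g w) (grade X n) \<cdot> par X n" .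
qed

text \<open>The family presented by itself, with one letter of colour \<open>c\<close> for each
  degree in \<open>B\<close>. Outside \<open>B\<close> the coefficient is presented by the empty
  sum, so it has to be null there.\<close>

definition leaf :: "nat \<Rightarrow> int set \<Rightarrow> (int \<Rightarrow> 'o) \<Rightarrow> ('o, 'm) presentation" where
  "leaf c B x = \<lparr>plen = 1, pidx = (\<lambda>n. [(c, n)]) ` B, pob = (\<lambda>w. x (snd (hd w))),
     par = (\<lambda>n. if n \<in> B then unit (\<lambda>w. x (snd (hd w))) [(c, n)] else to0 (x n))\<rparr>"

lemma leaf_simps [simp]:
  "plen (leaf c B x) = 1" "pidx (leaf c B x) = (\<lambda>n. [(c, n)]) ` B" "pob (leaf c B x) w = x (snd (hd w))"
  "grade (leaf c B x) n = (if n \<in> B then {[(c, n)]} else {})"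
  by (auto simp: leaf_def grade_def)

definition supp :: "(int \<Rightarrow> 'o) \<Rightarrow> int set" where
  "supp x = {n. \<not> null (x n)}"

text \<open>\<open>B\<close> may exceed the support: the two ends of an arrow have different
  supports and need a common \<open>B\<close> in order to be related diagonally.\<close>

definition leafy :: "int set \<Rightarrow> (int \<Rightarrow> 'o) \<Rightarrow> bool" where
  "leafy B x \<longleftrightarrow> x \<in> laurent_objs C \<and> (\<exists>k. \<forall>n\<in>B. k \<le> n) \<and> supp x \<subseteq> B"

lemma pres_leaf:
  assumes "leafy B x"
  shows "pres (leaf c B x) x"
proof -
  obtain k where k: "\<forall>n\<in>B. k \<le> n" using assms by (auto simp: leafy_def)
  have x: "x n \<in> Obj C" for n using assms laurent_objsD(1) by (auto simp: leafy_def)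
  have n: "null (x n)" if "n \<notin> B" for n using assms that by (auto simp: leafy_def supp_def)
  have b: "pob (leaf c B x) = (\<lambda>w. x (snd (hd w)))" by (simp add: leaf_def)
  show ?thesis
    by (rule presI[of _ k]) (use x n k to0_Arr[OF n] in \<open>auto simp: b, auto simp: leaf_def\<close>)
qed

lemma leafy_supp: "x \<in> laurent_objs C ==> leafy (supp x) x"
  unfolding leafy_def supp_def by (auto dest!: laurent_objsD(2)) (meson not_less)

lemma leafy_union:
  assumes "leafy B x" "\<exists>k. \<forall>n\<in>B'. k \<le> n"
  shows "leafy (B \<union> B') x"
proof -
  obtain k k' where "\<forall>n\<in>B. k \<le> n" "\<forall>n\<in>B'. k' \<le> n" using assms by (auto simp: leafy_def)
  then have "\<forall>n\<in>B \<union> B'. min k k' \<le> n" by (auto simp: min_def)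
  then show ?thesis using assms by (auto simp: leafy_def)
qed

definition drep :: "(int \<Rightarrow> 'm) \<Rightarrow> ('o, 'm) presentation \<Rightarrow> ('o, 'm) presentation \<Rightarrow> (word \<Rightarrow> 'm) \<Rightarrow> bool" where
  "drep \<phi> X Y g \<longleftrightarrow> rep \<phi> X Y (\<lambda>w. {w}) (\<lambda>w. unit (pob Y) w \<cdot> g w) \<and>
     (\<forall>w\<in>pidx X. g w \<in> Arr C \<and> Dom C (g w) = pob X w \<and> Cod C (g w) = pob Y w)"

lemma drepD:
  assumes "drep \<phi> X Y g"
  shows "rep \<phi> X Y (\<lambda>w. {w}) (\<lambda>w. unit (pob Y) w \<cdot> g w)" "w \<in> pidx X ==> g w \<in> Arr C"
    "w \<in> pidx X ==> Dom C (g w) = pob X w" "w \<in> pidx X ==> Cod C (g w) = pob Y w" "pidx Y = pidx X"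
  using assms repD(1) by (auto simp: drep_def)

lemma drepI:
  assumes Y: "pres Y y" and "pidx Y = pidx X"
    and g: "\<And>w. w \<in> pidx X ==> g w \<in> Arr C" "\<And>w. w \<in> pidx X ==> Dom C (g w) = pob X w" "\<And>w. w \<in> pidx X ==> Cod C (g w) = pob Y w"
    and \<phi>: "\<And>n. \<phi> n \<in> Arr C" "\<And>n. Dom C (\<phi> n) = Dom C (par X n)" "\<And>n. Cod C (\<phi> n) = Dom C (par Y n)"
    "\<And>n. par Y n \<cdot> \<phi> n = phi (pob X) (pob Y) (\<lambda>w. {w}) (\<lambda>w. unit (pob Y) w \<cdot> g w) (grade X n) \<cdot> par X n"
  shows "drep \<phi> X Y g"
  unfolding drep_def
proof
  show "rep \<phi> X Y (\<lambda>w. {w}) (\<lambda>w. unit (pob Y) w \<cdot> g w)"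
    by (rule repI) (use assms presD(4)[OF Y] in auto)
qed (use g in auto)

lemma drep_cong: "pres X x ==> drep \<phi> X Y g ==> (\<And>w. w \<in> pidx X ==> g w = g' w) ==> drep \<phi> X Y g'"
  unfolding drep_def using rep_cong[of X x \<phi> Y "\<lambda>w. {w}" "\<lambda>w. unit (pob Y) w \<cdot> g w" "\<lambda>w. {w}" "\<lambda>w. unit (pob Y) w \<cdot> g' w"]
  by auto

lemma drep_unique:
  assumes "pres X x" "pres Y y" "drep \<phi> X Y g" "drep \<psi> X Y g'" "\<And>w. w \<in> pidx X ==> g w = g' w"
  shows "\<phi> = \<psi>"
  by (rule rep_unique[OF assms(1,2) drepD(1)[OF assms(3)] drepD(1)[OF assms(4)]]) (use assms(5) in auto)

lemma drep_comp:
  assumes X: "pres X x" and Y: "pres Y y" and Z: "pres Z z" and r: "drep \<phi> X Y g" and q: "drep \<psi> Y Z h"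
  shows "drep (\<lambda>n. \<psi> n \<cdot> \<phi> n) X Z (\<lambda>w. h w \<cdot> g w)"
  unfolding drep_def
proof
  have i: "pidx Y = pidx X" using drepD(5)[OF r] .
  show "rep (\<lambda>n. \<psi> n \<cdot> \<phi> n) X Z (\<lambda>w. {w}) (\<lambda>w. unit (pob Z) w \<cdot> (h w \<cdot> g w))"
  proof (rule rep_cong[OF X rep_comp[OF X Y Z drepD(1)[OF r] drepD(1)[OF q]]])
    fix w assume w: "w \<in> pidx X"
    have b: "sblock (pob Y) (pob Z) (\<lambda>w. {w}) (\<lambda>w. unit (pob Z) w \<cdot> h w) {w}"
      by (rule block_subset[OF rep_block[OF Y Z drepD(1)[OF q], of "deg w"]]) (use w i in \<open>auto simp: grade_iff\<close>)
    have "phi (pob Y) (pob Z) (\<lambda>w. {w}) (\<lambda>w. unit (pob Z) w \<cdot> h w) {w} \<cdot> (unit (pob Y) w \<cdot> g w) = (unit (pob Z) w \<cdot> h w) \<cdot> g w"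
      by (rule phi_unit_comp[OF b]) (use w drepD(2-4)[OF r] in auto)
    then show "\<Union>((\<lambda>w. {w}) ` {w}) = {w} \<and> phi (pob Y) (pob Z) (\<lambda>w. {w}) (\<lambda>w. unit (pob Z) w \<cdot> h w) {w} \<cdot> (unit (pob Y) w \<cdot> g w)
        = unit (pob Z) w \<cdot> (h w \<cdot> g w)"
      using w i drepD(2-4)[OF r] drepD(2-4)[OF q] presD(4)[OF Z] by (simp add: comp_assoc)
  qed
qed (use drepD[OF r] drepD[OF q] in auto)

lemma drep_id:
  assumes X: "pres X x"
  shows "drep (\<lambda>n. Id C (x n)) X X (\<lambda>w. Id C (pob X w))"
proof (rule drepI[OF X])
  fix n
  have "phi (pob X) (pob X) (\<lambda>w. {w}) (\<lambda>w. unit (pob X) w \<cdot> Id C (pob X w)) (grade X n) = phi (pob X) (pob X) (\<lambda>w. {w}) (unit (pob X)) (grade X n)"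
    by (rule blk_cong) (use presD(3,4)[OF X] in auto)
  then show "par X n \<cdot> Id C (x n) = phi (pob X) (pob X) (\<lambda>w. {w}) (\<lambda>w. unit (pob X) w \<cdot> Id C (pob X w)) (grade X n) \<cdot> par X n"
    using phi_id[of "pob X" "grade X n"] presD(3-8)[OF X] by simp
qed (use presD[OF X] presO[OF X] in auto)

text \<open>The criterion for the structure maps of \<open>\<oplus>\<close>, which only regroup
  summands and hence have identity components.\<close>

lemma drep_trivial:
  assumes X: "pres X x" and Y: "pres Y y" and i: "pidx Y = pidx X" and o: "\<And>w. w \<in> pidx X ==> pob Y w = pob X w"
    and \<phi>: "\<And>n. \<phi> n \<in> Arr C" "\<And>n. Dom C (\<phi> n) = x n" "\<And>n. Cod C (\<phi> n) = y n"
    "\<And>n. par Y n \<cdot> \<phi> n = par X n"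
  shows "drep \<phi> X Y (\<lambda>w. Id C (pob X w))"
proof (rule drepI[OF Y i])
  fix n
  have g: "grade Y n = grade X n" by (simp add: grade_def i)
  have "phi (pob X) (pob Y) (\<lambda>w. {w}) (\<lambda>w. unit (pob Y) w \<cdot> Id C (pob X w)) (grade X n) = phi (pob Y) (pob Y) (\<lambda>w. {w}) (unit (pob Y)) (grade X n)"
    by (rule blk_cong) (use presD(3,4)[OF X] presD(4)[OF Y] o in \<open>auto simp: grade_iff\<close>)
  also have "\<dots> = Id C (sumo (pob Y) (grade X n))" by (rule phi_id) (use presD(3)[OF X] presD(4)[OF Y] in auto)
  finally show "par Y n \<cdot> \<phi> n = phi (pob X) (pob Y) (\<lambda>w. {w}) (\<lambda>w. unit (pob Y) w \<cdot> Id C (pob X w)) (grade X n) \<cdot> par X n"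
    using presD(3-8)[OF X] \<phi> sumo_cong[OF presD(3)[OF X], of n "pob Y" "pob X"] o by (simp add: grade_iff)
qed (use presD[OF X] presD[OF Y] \<phi> o in auto)

lemma drep_leaf:
  assumes \<phi>: "larr \<phi> x y" and x: "leafy B x" and y: "leafy B y"
  shows "drep \<phi> (leaf c B x) (leaf c B y) (\<lambda>w. \<phi> (snd (hd w)))"
proof (rule drepI[OF pres_leaf[OF y]])
  note A [simp] = larrD(3-7)[OF \<phi>]
  have px: "pob (leaf c B x) = (\<lambda>w. x (snd (hd w)))" and py: "pob (leaf c B y) = (\<lambda>w. y (snd (hd w)))" by (simp_all add: leaf_def)
  fix n
  show "Dom C (\<phi> n) = Dom C (par (leaf c B x) n)" "Cod C (\<phi> n) = Dom C (par (leaf c B y) n)"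
    using presD(6)[OF pres_leaf[OF x]] presD(6)[OF pres_leaf[OF y]] by auto
  show "par (leaf c B y) n \<cdot> \<phi> n = phi (pob (leaf c B x)) (pob (leaf c B y)) (\<lambda>w. {w}) (\<lambda>w. unit (pob (leaf c B y)) w \<cdot> \<phi> (snd (hd w))) (grade (leaf c B x) n) \<cdot> par (leaf c B x) n"
  proof (cases "n \<in> B")
    case True
    let ?g = "\<lambda>w. unit (\<lambda>w. y (snd (hd w))) w \<cdot> \<phi> (snd (hd w))"
    have "sblock (\<lambda>w. x (snd (hd w))) (\<lambda>w. y (snd (hd w))) (\<lambda>w. {w}) ?g {[(c, n)]}"
      by (rule blockI) auto
    from phi_single[OF this] show ?thesis using True by (simp add: px py) (simp add: leaf_def)
  next
    case False
    then have n: "null (x n)" "null (y n)" using x y by (auto simp: leafy_def supp_def)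
    have "to0 (y n) \<cdot> \<phi> n = to0 (x n)"
      by (rule null_arrow_unique[OF n(1) null_zero]) (use to0_Arr[OF n(1)] to0_Arr[OF n(2)] in auto)
    then show ?thesis using False to0_Arr[OF n(1)] by (simp add: px py) (simp add: leaf_def)
  qed
qed (use larrD[OF \<phi>] in auto)

text \<open>Every presentation refines a leaf with enough degrees: the only summand of degree
  \<open>n\<close> of the leaf is split by \<open>par X n\<close> itself.\<close>

lemma rep_leaf:
  assumes X: "pres X x" and B: "leafy B x" "\<And>w. w \<in> pidx X ==> deg w \<in> B"
  shows "rep (\<lambda>n. Id C (x n)) (leaf c B x) X (\<lambda>w. grade X (deg w)) (\<lambda>w. par X (deg w))"
proof (rule repI)
  have px: "pob (leaf c B x) = (\<lambda>w. x (snd (hd w)))" by (simp add: leaf_def)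
  show "pidx X = \<Union>((\<lambda>w. grade X (deg w)) ` pidx (leaf c B x))"
    using B(2) by (auto simp: grade_iff)
  fix n
  note A = presD(5-8)[OF X, of n] presO[OF X]
  show "Dom C (Id C (x n)) = Dom C (par (leaf c B x) n)" "Cod C (Id C (x n)) = Dom C (par X n)"
    using presD(6)[OF pres_leaf[OF B(1)]] A by auto
  show "par X n \<cdot> Id C (x n) = phi (pob (leaf c B x)) (pob X) (\<lambda>w. grade X (deg w)) (\<lambda>w. par X (deg w)) (grade (leaf c B x) n) \<cdot> par (leaf c B x) n"
  proof (cases "n \<in> B")
    case True
    have "sblock (\<lambda>w. x (snd (hd w))) (pob X) (\<lambda>w. grade X (deg w)) (\<lambda>w. par X (deg w)) {[(c, n)]}"
      by (rule blockI) (use presD(3-8)[OF X] presO[OF X] in auto)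
    from phi_single[OF this] show ?thesis using True A by (simp add: px) (simp add: leaf_def)
  next
    case False
    then have n: "null (x n)" "grade X n = {}" using B by (auto simp: leafy_def supp_def grade_def)
    have "par X n = to0 (x n)"
      by (rule null_arrow_unique[OF n(1) null_zero]) (use to0_Arr[OF n(1)] A n(2) in auto)
    then show ?thesis using False to0_Arr[OF n(1)] A by (simp add: px) (simp add: leaf_def)
  qed
qed (use presD[OF X] presO[OF X] grade_disjoint in \<open>auto simp: grade_iff\<close>)

definition bound :: "('o, 'm) presentation \<Rightarrow> (int \<Rightarrow> 'o) \<Rightarrow> int set" where
  "bound X x = supp x \<union> deg ` pidx X"

lemma leafy_bound: "pres X x ==> leafy (bound X x) x"
  unfolding bound_def by (rule leafy_union[OF leafy_supp[OF pres_laurent]]) (use presD(2)[of X x] in auto)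

end

section \<open>Sums and products of presentations\<close>

context rigid_laplaza
begin

definition pzero :: "nat \<Rightarrow> ('o, 'm) presentation" where
  "pzero p = \<lparr>plen = p, pidx = {}, pob = (\<lambda>w. \<zero>), par = (\<lambda>n. Id C \<zero>)\<rparr>"

definition pone :: "('o, 'm) presentation" where
  "pone = \<lparr>plen = 0, pidx = {[]}, pob = (\<lambda>w. \<one>), par = (\<lambda>n. if n = 0 then unit (\<lambda>w::word. \<one>) [] else Id C \<zero>)\<rparr>"

lemma pzero_simps [simp]:
  "plen (pzero p) = p" "pidx (pzero p) = {}" "grade (pzero p) n = {}" "par (pzero p) n = Id C \<zero>" "pob (pzero p) w = \<zero>"
  by (simp_all add: pzero_def grade_def)

lemma pone_simps [simp]:
  "plen pone = 0" "pidx pone = {[]}" "grade pone n = (if n = 0 then {[]} else {})" "pob pone w = \<one>"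
  "par pone n = (if n = 0 then unit (pob pone) [] else Id C \<zero>)"
  by (auto simp: pone_def grade_def)

lemma pres_pzero: "pres (pzero p) (\<lambda>n. \<zero>)"
  by (rule presI) auto

lemma pres_pone: "pres pone (\<lambda>n. if n = 0 then \<one> else \<zero>)"
  by (rule presI[of _ 0]) auto

text \<open>The case distinction is harmless, since sums are formed of \<open>separate\<close>
  presentations, where no word belongs to both.\<close>

definition pplus :: "('o, 'm) presentation \<Rightarrow> ('o, 'm) presentation \<Rightarrow> ('o, 'm) presentation" where
  "pplus X Y = (let u = (\<lambda>w. if w \<in> pidx X then pob X w else pob Y w) in
     \<lparr>plen = plen X, pidx = pidx X \<union> pidx Y, pob = u,
      par = (\<lambda>n. mu u (grade X n) (grade Y n) \<cdot> (par X n \<boxplus> par Y n))\<rparr>)"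

lemma pplus_simps [simp]:
  "plen (pplus X Y) = plen X" "pidx (pplus X Y) = pidx X \<union> pidx Y"
  "grade (pplus X Y) n = grade X n \<union> grade Y n"
  by (auto simp: pplus_def grade_def Let_def)

lemma pob_pplus: "pob (pplus X Y) w = (if w \<in> pidx X then pob X w else pob Y w)"
  by (simp add: pplus_def Let_def)

lemma par_pplus: "par (pplus X Y) n = mu (pob (pplus X Y)) (grade X n) (grade Y n) \<cdot> (par X n \<boxplus> par Y n)"
  by (simp add: pplus_def Let_def)

definition separate :: "('o, 'm) presentation \<Rightarrow> ('o, 'm) presentation \<Rightarrow> bool" where
  "separate X Y \<longleftrightarrow> plen X = plen Y \<and> pidx X \<inter> pidx Y = {}"

lemma sumo_pplus:
  assumes "pres X x" "pres Y y" "separate X Y"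
  shows "sumo (pob (pplus X Y)) (grade X n) = sumo (pob X) (grade X n)"
    "sumo (pob (pplus X Y)) (grade Y n) = sumo (pob Y) (grade Y n)"
  using assms presD(3)
  by (auto intro!: sumo_cong simp: pob_pplus grade_iff separate_def)

lemma pres_pplus:
  assumes X: "pres X x" and Y: "pres Y y" and s: "separate X Y"
  shows "pres (pplus X Y) (\<lambda>n. x n \<oplus> y n)"
proof -
  obtain i j where "\<forall>w\<in>pidx X. i \<le> deg w" "\<forall>w\<in>pidx Y. j \<le> deg w" using presD(2)[OF X] presD(2)[OF Y] by blast
  then have b: "\<forall>w\<in>pidx X \<union> pidx Y. min i j \<le> deg w" by (auto simp: min_le_iff_disj)
  have o: "pob (pplus X Y) w \<in> Obj C" for w using presD(4)[OF X] presD(4)[OF Y] by (simp add: pob_pplus)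
  have d: "grade X n \<inter> grade Y n = {}" for n using s by (auto simp: separate_def grade_iff)
  show ?thesis
    by (rule presI[of _ "min i j"])
      (use b o d s presD(1)[OF X] presD(1)[OF Y] presD(3,5-8)[OF X] presD(3,5-8)[OF Y] sumo_pplus[OF X Y s] in
        \<open>auto simp: par_pplus separate_def\<close>)
qed

lemma rep_pplus:
  assumes X: "pres X x" and X': "pres X' x'" and Y: "pres Y y" and Y': "pres Y' y'"
    and s: "separate X Y" and s': "separate X' Y'"
    and r: "rep \<phi> X X' G g" and q: "rep \<psi> Y Y' H h"
  shows "rep (\<lambda>n. \<phi> n \<boxplus> \<psi> n) (pplus X Y) (pplus X' Y')
    (\<lambda>w. if w \<in> pidx X then G w else H w) (\<lambda>w. if w \<in> pidx X then g w else h w)"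
    (is "rep _ _ _ ?G ?g")
proof (rule repI)
  have sep: "pidx X \<inter> pidx Y = {}" "pidx X' \<inter> pidx Y' = {}" using s s' by (auto simp: separate_def)
  have subX: "G w \<subseteq> pidx X'" if "w \<in> pidx X" for w using repD(1)[OF r] that by auto
  have subY: "H w \<subseteq> pidx Y'" if "w \<in> pidx Y" for w using repD(1)[OF q] that by auto
  show "pidx (pplus X' Y') = \<Union>(?G ` pidx (pplus X Y))"
  proof -
    have "\<Union>(?G ` pidx X) = pidx X'" using repD(1)[OF r] by simp
    moreover have "\<Union>(?G ` pidx Y) = \<Union>(H ` pidx Y)" using sep by (intro SUP_cong) auto
    ultimately show ?thesis using repD(1)[OF q] by (simp only: pplus_simps UN_Un)
  qed
  let ?u = "pob (pplus X Y)" and ?u' = "pob (pplus X' Y')"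
  have suX: "sumo ?u' (G w) = sumo (pob X') (G w)" if "w \<in> pidx X" for w
    by (rule sumo_cong) (use repD(2)[OF r that] subX[OF that] in \<open>auto simp: pob_pplus\<close>)
  have suY: "sumo ?u' (H w) = sumo (pob Y') (H w)" if "w \<in> pidx Y" for w
    by (rule sumo_cong) (use repD(2)[OF q that] subY[OF that] sep in \<open>auto simp: pob_pplus\<close>)
  fix w assume "w \<in> pidx (pplus X Y)"
  then have w: "w \<in> pidx X \<or> w \<in> pidx Y \<and> w \<notin> pidx X" using sep by auto
  show "finite (?G w)" using w repD(2)[OF r] repD(2)[OF q] by auto
  show "deg v = deg w" if "v \<in> ?G w" for v
    using w that repD(3)[OF r, of w v] repD(3)[OF q, of w v] by (auto split: if_splits)
  show "?g w \<in> Arr C" "Dom C (?g w) = ?u w" "Cod C (?g w) = sumo ?u' (?G w)"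
    using w repD(4-6)[OF r, of w] repD(4-6)[OF q, of w] suX suY by (auto simp: pob_pplus)
  fix v assume "v \<in> pidx (pplus X Y)" and wv: "w \<noteq> v"
  then have v: "v \<in> pidx X \<or> v \<in> pidx Y \<and> v \<notin> pidx X" using sep by auto
  have c: "G w \<inter> H v = {}" "H v \<inter> G w = {}" if "w \<in> pidx X" "v \<in> pidx Y" for w v
    using subX[OF that(1)] subY[OF that(2)] sep by blast+
  show "?G w \<inter> ?G v = {}"
    by (cases "w \<in> pidx X"; cases "v \<in> pidx X"; use v w wv c repD(7)[OF r, of w v] repD(7)[OF q, of w v] in simp)
next
  fix n
  have sep: "pidx X \<inter> pidx Y = {}" "pidx X' \<inter> pidx Y' = {}" using s s' by (auto simp: separate_def)
  have d: "grade X n \<inter> grade Y n = {}" "grade X' n \<inter> grade Y' n = {}" using sep by (auto simp: grade_iff)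
  let ?u = "pob (pplus X Y)" and ?u' = "pob (pplus X' Y')"
  note PX = presD(3-8)[OF X] and PX' = presD(3-8)[OF X'] and PY = presD(3-8)[OF Y] and PY' = presD(3-8)[OF Y']
  note PP = presD(4-8)[OF pres_pplus[OF X Y s]] presD(4-8)[OF pres_pplus[OF X' Y' s']]
  note A = rep_Arr[OF X X' r] rep_Arr[OF Y Y' q]
  show "\<phi> n \<boxplus> \<psi> n \<in> Arr C" "Dom C (\<phi> n \<boxplus> \<psi> n) = Dom C (par (pplus X Y) n)" "Cod C (\<phi> n \<boxplus> \<psi> n) = Dom C (par (pplus X' Y') n)"
    using A PP by auto
  have sub: "G w \<subseteq> pidx X'" "finite (G w)" if "w \<in> grade X n" for w using repD(1,2)[OF r] that by (auto simp: grade_iff)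
  have subY: "H w \<subseteq> pidx Y'" "finite (H w)" if "w \<in> grade Y n" for w using repD(1,2)[OF q] that by (auto simp: grade_iff)
  have bX: "sblock (pob X) (pob X') G g (grade X n)" by (rule rep_block[OF X X' r])
  have bY: "sblock (pob Y) (pob Y') H h (grade Y n)" by (rule rep_block[OF Y Y' q])
  have pX: "phi (pob X) (pob X') G g (grade X n) = phi ?u ?u' ?G ?g (grade X n)"
    by (rule blk_cong) (use PX(1) sub in \<open>auto simp: pob_pplus grade_iff\<close>)
  have pY: "phi (pob Y) (pob Y') H h (grade Y n) = phi ?u ?u' ?G ?g (grade Y n)"
  proof (rule blk_cong)
    fix k assume k: "k \<in> grade Y n"
    then have k': "k \<notin> pidx X" using sep by (auto simp: grade_iff)
    show "pob Y k = ?u k" "H k = ?G k" "h k = ?g k" using k' by (auto simp: pob_pplus)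
    show "finite (H k)" using subY(2)[OF k] .
    show "pob Y' j = ?u' j" if "j \<in> H k" for j using subY(1)[OF k] sep that by (auto simp: pob_pplus)
  qed (use PY(1) in auto)
  note phA = phi_Arr(1-3)[OF bX, unfolded pX] phi_Arr(1-3)[OF bY, unfolded pY]
  have b: "sblock ?u ?u' ?G ?g (grade X n \<union> grade Y n)"
  proof (rule blockI)
    fix k assume "k \<in> grade X n \<union> grade Y n"
    then have k: "k \<in> grade X n \<and> k \<in> pidx X \<or> k \<in> grade Y n \<and> k \<in> pidx Y \<and> k \<notin> pidx X" using sep by (auto simp: grade_iff)
    have suX: "sumo ?u' (G k) = sumo (pob X') (G k)" if "k \<in> grade X n"
      by (rule sumo_cong) (use sub[OF that] in \<open>auto simp: pob_pplus\<close>)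
    have suY: "sumo ?u' (H k) = sumo (pob Y') (H k)" if "k \<in> grade Y n"
      by (rule sumo_cong) (use subY[OF that] sep in \<open>auto simp: pob_pplus\<close>)
    show "finite (?G k)" "?g k \<in> Arr C" "Dom C (?g k) = ?u k" "Cod C (?g k) = sumo ?u' (?G k)"
      using k sub(2) subY(2) suX suY blockD(5-7)[OF bX, of k] blockD(5-7)[OF bY, of k] by (auto simp: pob_pplus)
    fix v assume "v \<in> grade X n \<union> grade Y n" and kv: "k \<noteq> v"
    then have v: "v \<in> grade X n \<and> v \<in> pidx X \<or> v \<in> grade Y n \<and> v \<in> pidx Y \<and> v \<notin> pidx X" using sep by (auto simp: grade_iff)
    have c: "G w \<inter> H v = {}" "H v \<inter> G w = {}" if "w \<in> grade X n" "v \<in> grade Y n" for w v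
      using sub(1)[OF that(1)] subY(1)[OF that(2)] sep by blast+
    show "?G k \<inter> ?G v = {}"
      by (cases "k \<in> pidx X"; cases "v \<in> pidx X"; use v k kv c blockD(8)[OF bX, of k v] blockD(8)[OF bY, of k v] in simp)
  qed (use PX(1) PY(1) PP in auto)
  have UX: "\<Union>(?G ` grade X n) = grade X' n"
  proof -
    have "\<Union>(?G ` grade X n) = \<Union>(G ` grade X n)" by (intro SUP_cong) (auto simp: grade_iff)
    then show ?thesis using rep_grade[OF r] by simp
  qed
  have UY: "\<Union>(?G ` grade Y n) = grade Y' n"
  proof -
    have "\<Union>(?G ` grade Y n) = \<Union>(H ` grade Y n)" using sep by (intro SUP_cong) (auto simp: grade_iff)
    then show ?thesis using rep_grade[OF q] by simp
  qed
  have "par (pplus X' Y') n \<cdot> (\<phi> n \<boxplus> \<psi> n) = mu ?u' (grade X' n) (grade Y' n) \<cdot> ((par X' n \<cdot> \<phi> n) \<boxplus> (par Y' n \<cdot> \<psi> n))"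
    using A PX' PY' PP d sumo_pplus[OF X' Y' s'] by (simp add: par_pplus comp_assoc interchange)
  also have "\<dots> = mu ?u' (grade X' n) (grade Y' n) \<cdot> ((phi ?u ?u' ?G ?g (grade X n) \<boxplus> phi ?u ?u' ?G ?g (grade Y n)) \<cdot> (par X n \<boxplus> par Y n))"
    unfolding repD(11)[OF r] repD(11)[OF q] pX pY using PX PY phA sumo_pplus[OF X Y s] by (simp add: interchange)
  also have "\<dots> = (mu ?u' (grade X' n) (grade Y' n) \<cdot> (phi ?u ?u' ?G ?g (grade X n) \<boxplus> phi ?u ?u' ?G ?g (grade Y n))) \<cdot> (par X n \<boxplus> par Y n)"
    using PX PY PX' PY' PP phA d sumo_pplus[OF X Y s] sumo_pplus[OF X' Y' s'] rep_grade[OF r, of n] rep_grade[OF q, of n]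
    by (simp add: comp_assoc)
  also have "mu ?u' (grade X' n) (grade Y' n) \<cdot> (phi ?u ?u' ?G ?g (grade X n) \<boxplus> phi ?u ?u' ?G ?g (grade Y n))
    = phi ?u ?u' ?G ?g (grade X n \<union> grade Y n) \<cdot> mu ?u (grade X n) (grade Y n)"
    using phi_mu[OF b d(1)] unfolding UX UY by (rule sym)
  also have "(phi ?u ?u' ?G ?g (grade X n \<union> grade Y n) \<cdot> mu ?u (grade X n) (grade Y n)) \<cdot> (par X n \<boxplus> par Y n)
    = phi ?u ?u' ?G ?g (grade (pplus X Y) n) \<cdot> par (pplus X Y) n"
    unfolding par_pplus pplus_simps
    by (rule comp_assoc) (use PX PY PP phi_Arr(1,2)[OF b] d sumo_pplus[OF X Y s] in simp_all)
  finally show "par (pplus X' Y') n \<cdot> (\<phi> n \<boxplus> \<psi> n) = phi ?u ?u' ?G ?g (grade (pplus X Y) n) \<cdot> par (pplus X Y) n" .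
qed

lemma drep_pplus:
  assumes X: "pres X x" and X': "pres X' x'" and Y: "pres Y y" and Y': "pres Y' y'"
    and s: "separate X Y" and s': "separate X' Y'" and r: "drep \<phi> X X' g" and q: "drep \<psi> Y Y' h"
  shows "drep (\<lambda>n. \<phi> n \<boxplus> \<psi> n) (pplus X Y) (pplus X' Y') (\<lambda>w. if w \<in> pidx X then g w else h w)"
  unfolding drep_def
proof
  show "rep (\<lambda>n. \<phi> n \<boxplus> \<psi> n) (pplus X Y) (pplus X' Y') (\<lambda>w. {w}) (\<lambda>w. unit (pob (pplus X' Y')) w \<cdot> (if w \<in> pidx X then g w else h w))"
  proof (rule rep_cong[OF pres_pplus[OF X Y s] rep_pplus[OF X X' Y Y' s s' drepD(1)[OF r] drepD(1)[OF q]]])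
    fix w
    show "(if w \<in> pidx X then {w} else {w}) = {w} \<and> (if w \<in> pidx X then unit (pob X') w \<cdot> g w else unit (pob Y') w \<cdot> h w) =
      unit (pob (pplus X' Y')) w \<cdot> (if w \<in> pidx X then g w else h w)"
      using drepD(5)[OF r] by (auto simp: unit_def pob_pplus)
  qed
qed (use drepD(2-5)[OF r] drepD(2-5)[OF q] s in \<open>auto simp: pob_pplus separate_def\<close>)

text \<open>Recovers the family from its presentation, so that \<open>ptimes\<close> can be defined
  without the families as further arguments.\<close>

definition fam :: "('o, 'm) presentation \<Rightarrow> int \<Rightarrow> 'o" where
  "fam X n = Dom C (par X n)"

lemma fam_eq: "pres X x ==> fam X = x"
  using presD(6) by (auto simp: fam_def)

definition pgam :: "('o, 'm) presentation \<Rightarrow> ('o, 'm) presentation \<Rightarrow> int \<Rightarrow> int \<Rightarrow> 'm" where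
  "pgam X Y n k = nu (plen X) (pob X) (pob Y) (grade X k) (grade Y (n - k)) \<cdot> (par X k \<boxtimes> par Y (n - k))"

definition pflat :: "('o, 'm) presentation \<Rightarrow> ('o, 'm) presentation \<Rightarrow> int \<Rightarrow> int set \<Rightarrow> 'm" where
  "pflat X Y n L = phi (cterm (fam X) (fam Y) n) (tens (plen X) (pob X) (pob Y))
     (\<lambda>k. wprod (grade X k) (grade Y (n - k))) (pgam X Y n) L"

definition pset :: "('o, 'm) presentation \<Rightarrow> ('o, 'm) presentation \<Rightarrow> int \<Rightarrow> int set" where
  "pset X Y n = {k. grade X k \<noteq> {} \<and> grade Y (n - k) \<noteq> {}}"

text \<open>A coefficient of the product is a sum over \<open>cset\<close>. It is enlarged to
  \<open>pset\<close>, the degrees in which both presentations have words, and each term is expanded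
  by \<open>pgam\<close>. The enlargement is necessary because words may label null
  summands.\<close>

definition ptimes :: "('o, 'm) presentation \<Rightarrow> ('o, 'm) presentation \<Rightarrow> ('o, 'm) presentation" where
  "ptimes X Y = \<lparr>plen = plen X + plen Y, pidx = wprod (pidx X) (pidx Y), pob = tens (plen X) (pob X) (pob Y),
     par = (\<lambda>n. pflat X Y n (pset X Y n) \<cdot>
       arr_inv (drop_null (cterm (fam X) (fam Y) n) (pset X Y n) (cset (fam X) (fam Y) n)))\<rparr>"

lemma ptimes_simps [simp]:
  "plen (ptimes X Y) = plen X + plen Y" "pidx (ptimes X Y) = wprod (pidx X) (pidx Y)"
  "pob (ptimes X Y) = tens (plen X) (pob X) (pob Y)"
  by (simp_all add: ptimes_def)

lemma finite_pset:
  assumes "pres X x" "pres Y y"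
  shows "finite (pset X Y n)"
proof -
  obtain i j where ij: "\<forall>n<i. grade X n = {}" "\<forall>n<j. grade Y n = {}" using grade_bounded assms by meson
  have "pset X Y n \<subseteq> {i..n - j}"
  proof
    fix k assume "k \<in> pset X Y n"
    then have "\<not> k < i" "\<not> n - k < j" using ij by (auto simp: pset_def)
    then show "k \<in> {i..n - j}" by simp
  qed
  then show ?thesis using finite_subset by blast
qed

lemma grade_ptimes:
  assumes "pset X Y n \<subseteq> L"
  shows "(\<Union>k\<in>L. wprod (grade X k) (grade Y (n - k))) = grade (ptimes X Y) n"
proof
  show "(\<Union>k\<in>L. wprod (grade X k) (grade Y (n - k))) \<subseteq> grade (ptimes X Y) n"
    by (fastforce simp: wprod_def grade_iff)
  show "grade (ptimes X Y) n \<subseteq> (\<Union>k\<in>L. wprod (grade X k) (grade Y (n - k)))"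
  proof
    fix w assume "w \<in> grade (ptimes X Y) n"
    then obtain v t where w: "w = v @ t" "v \<in> pidx X" "t \<in> pidx Y" "deg v + deg t = n"
      by (auto simp: wprod_def grade_iff)
    then have "v \<in> grade X (deg v)" "t \<in> grade Y (n - deg v)" by (auto simp: grade_iff)
    then have "deg v \<in> pset X Y n" "w \<in> wprod (grade X (deg v)) (grade Y (n - deg v))"
      using w by (auto simp: pset_def wprod_def)
    then show "w \<in> (\<Union>k\<in>L. wprod (grade X k) (grade Y (n - k)))" using assms by auto
  qed
qed

lemma pgam_Arr:
  assumes X: "pres X x" and Y: "pres Y y"
  shows "pgam X Y n k \<in> Arr C" "Dom C (pgam X Y n k) = cterm x y n k"
    "Cod C (pgam X Y n k) = sumo (tens (plen X) (pob X) (pob Y)) (wprod (grade X k) (grade Y (n - k)))"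
    "invertible C (pgam X Y n k)"
  using presD(3-9)[OF X] presD(3-9)[OF Y] by (auto simp: pgam_def cterm_def)

lemma pflat_block:
  assumes X: "pres X x" and Y: "pres Y y" and L: "finite L"
  shows "sblock (cterm x y n) (tens (plen X) (pob X) (pob Y)) (\<lambda>k. wprod (grade X k) (grade Y (n - k))) (pgam X Y n) L"
proof (rule blockI)
  fix k m assume "k \<noteq> (m :: int)"
  then show "wprod (grade X k) (grade Y (n - k)) \<inter> wprod (grade X m) (grade Y (n - m)) = {}"
    by (intro wprod_disjoint[where p="plen X"]) (use presD(1)[OF X] grade_disjoint[of k m X X] in \<open>auto simp: grade_iff\<close>)
qed (use L pgam_Arr[OF X Y] presO[OF X] presO[OF Y] presD(3,4)[OF X] presD(3,4)[OF Y] in auto)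

lemma cset_pset: "pres X x ==> pres Y y ==> cset x y n \<subseteq> pset X Y n"
  using pres_null[of X x] pres_null[of Y y] by (auto simp: cset_def pset_def)

text \<open>Surplus degrees contribute null terms with an empty set of words, so
  \<open>phi_drop\<close> removes them. Two products can thereby be expanded over one common index
  set.\<close>

lemma par_ptimes:
  assumes X: "pres X x" and Y: "pres Y y" and L: "finite L" "pset X Y n \<subseteq> L"
  shows "par (ptimes X Y) n = pflat X Y n L \<cdot> arr_inv (drop_null (cterm x y n) L (cset x y n))"
proof -
  note [simp] = presO[OF X] presO[OF Y]
  let ?X = "cterm x y n" and ?J = "cset x y n" and ?K = "pset X Y n"
  note f = fam_eq[OF X] fam_eq[OF Y]
  have fK: "finite ?K" by (rule finite_pset[OF X Y])
  have JK: "?J \<subseteq> ?K" by (rule cset_pset[OF X Y])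
  have nX: "null (?X k)" if "k \<notin> ?J" for k by (rule cterm_null) (use that in auto)
  have A1 [simp]: "drop_null ?X L ?J \<in> Arr C" "Dom C (drop_null ?X L ?J) = sumo ?X L" "Cod C (drop_null ?X L ?J) = sumo ?X ?J" "invertible C (drop_null ?X L ?J)"
    by (rule drop_Arr; use L JK nX in auto)+
  have A2 [simp]: "drop_null ?X ?K ?J \<in> Arr C" "Dom C (drop_null ?X ?K ?J) = sumo ?X ?K" "Cod C (drop_null ?X ?K ?J) = sumo ?X ?J" "invertible C (drop_null ?X ?K ?J)"
    by (rule drop_Arr; use fK JK nX in auto)+
  have A3 [simp]: "drop_null ?X L ?K \<in> Arr C" "Dom C (drop_null ?X L ?K) = sumo ?X L" "Cod C (drop_null ?X L ?K) = sumo ?X ?K"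
    by (rule drop_Arr; use L JK nX in auto)+
  have A4 [simp]: "pflat X Y n M \<in> Arr C" "Dom C (pflat X Y n M) = sumo ?X M" if "finite M" for M
    using phi_Arr(1,2)[OF pflat_block[OF X Y that]] by (simp_all add: pflat_def f)
  have d: "drop_null ?X ?K ?J \<cdot> drop_null ?X L ?K = drop_null ?X L ?J"
    by (rule drop_drop) (use L JK nX in auto)
  have p: "pflat X Y n ?K \<cdot> drop_null ?X L ?K = pflat X Y n L"
    unfolding pflat_def f
  proof (rule phi_drop[OF pflat_block[OF X Y L(1)] L(2)])
    fix k assume "k \<in> L - ?K"
    then have "k \<notin> ?J" "grade X k = {} \<or> grade Y (n - k) = {}" using JK by (auto simp: pset_def)
    then show "null (?X k) \<and> wprod (grade X k) (grade Y (n - k)) = {}" using nX by auto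
  qed
  have e: "par (ptimes X Y) n = pflat X Y n ?K \<cdot> arr_inv (drop_null ?X ?K ?J)"
    by (simp add: ptimes_def f)
  have "par (ptimes X Y) n \<cdot> drop_null ?X L ?J = pflat X Y n L"
    unfolding e d[symmetric] using fK p by (simp add: comp_assoc)
  then show ?thesis
    by (rule cancel_right[where f="drop_null ?X L ?J", OF trans]) (use L fK e in \<open>simp_all add: comp_assoc\<close>)
qed

lemma pres_ptimes:
  assumes X: "pres X x" and Y: "pres Y y"
  shows "pres (ptimes X Y) (cauchy_prod C x y)"
proof -
  obtain i j where ij: "\<forall>w\<in>pidx X. i \<le> deg w" "\<forall>w\<in>pidx Y. j \<le> deg w" using presD(2)[OF X] presD(2)[OF Y] by blast
  note [simp] = presO[OF X] presO[OF Y]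
  note f = fam_eq[OF X] fam_eq[OF Y]
  have fK: "finite (pset X Y n)" for n by (rule finite_pset[OF X Y])
  have fg: "finite (grade (ptimes X Y) n)" for n
    unfolding grade_ptimes[OF order_refl, symmetric] using fK presD(3)[OF X] presD(3)[OF Y] by auto
  have A2 [simp]: "drop_null (cterm x y n) (pset X Y n) (cset x y n) \<in> Arr C" "Dom C (drop_null (cterm x y n) (pset X Y n) (cset x y n)) = sumo (cterm x y n) (pset X Y n)"
     "Cod C (drop_null (cterm x y n) (pset X Y n) (cset x y n)) = sumo (cterm x y n) (cset x y n)" "invertible C (drop_null (cterm x y n) (pset X Y n) (cset x y n))" for n
    by (rule drop_Arr; use fK cset_pset[OF X Y] cterm_null[of x y] in auto)+
  have A4: "pflat X Y n (pset X Y n) \<in> Arr C" "Dom C (pflat X Y n (pset X Y n)) = sumo (cterm x y n) (pset X Y n)"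
    "Cod C (pflat X Y n (pset X Y n)) = sumo (tens (plen X) (pob X) (pob Y)) (grade (ptimes X Y) n)"
    "invertible C (pflat X Y n (pset X Y n))" for n
    using phi_Arr[OF pflat_block[OF X Y fK]] pgam_Arr(4)[OF X Y] grade_ptimes[of X Y n, OF order_refl]
    by (simp_all add: pflat_def f)
  have p: "par (ptimes X Y) n = pflat X Y n (pset X Y n) \<cdot> arr_inv (drop_null (cterm x y n) (pset X Y n) (cset x y n))" for n
    by (simp add: ptimes_def f)
  show ?thesis
  proof (rule presI[of _ "i + j"])
    show "length w = plen (ptimes X Y)" "i + j \<le> deg w" if "w \<in> pidx (ptimes X Y)" for w
    proof -
      from that obtain v t where w: "w = v @ t" "v \<in> pidx X" "t \<in> pidx Y" unfolding ptimes_simps wprod_def by blast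
      then have "i \<le> deg v" "j \<le> deg t" using ij by auto
      then show "length w = plen (ptimes X Y)" "i + j \<le> deg w"
        using w presD(1)[OF X w(2)] presD(1)[OF Y w(3)] by simp_all
    qed
    show "finite (grade (ptimes X Y) n)" for n by (rule fg)
  qed (use p A4 presD(4)[OF X] presD(4)[OF Y] in \<open>auto simp: cauchy_prod_eq\<close>)
qed

text \<open>Both products are expanded over a common set \<open>?L\<close> of degrees. There the
  claim holds term by term, by \<open>nu_phi\<close> and the equations that represent the two
  factors.\<close>

lemma rep_ptimes:
  assumes X: "pres X x" and X': "pres X' x'" and Y: "pres Y y" and Y': "pres Y' y'"
    and r: "rep \<phi> X X' G g" and q: "rep \<psi> Y Y' H h"
  shows "rep (ctimes (\<phi>, \<psi>)) (ptimes X Y) (ptimes X' Y')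
    (\<lambda>w. wprod (G (take (plen X) w)) (H (drop (plen X) w)))
    (\<lambda>w. nu (plen X') (pob X') (pob Y') (G (take (plen X) w)) (H (drop (plen X) w)) \<cdot>
       (g (take (plen X) w) \<boxtimes> h (drop (plen X) w)))"
    (is "rep _ _ _ ?G ?g")
proof (rule repI)
  note \<phi> = rep_larr[OF X X' r] and \<psi> = rep_larr[OF Y Y' q]
  have lenX: "v \<in> pidx X ==> length v = plen X" for v by (rule presD(1)[OF X])
  have Gw: "words (plen X') (G v)" if "v \<in> pidx X" for v
    using repD(1,2)[OF r] that presD(1)[OF X'] by (auto simp: words_def)
  have G [simp]: "?G (v @ t) = wprod (G v) (H t)" "?g (v @ t) = nu (plen X') (pob X') (pob Y') (G v) (H t) \<cdot> (g v \<boxtimes> h t)"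
    if "v \<in> pidx X" for v t using lenX[OF that] by simp_all
  show "pidx (ptimes X' Y') = \<Union>(?G ` pidx (ptimes X Y))"
  proof -
    have "\<Union>(?G ` wprod (pidx X) (pidx Y)) = (\<Union>v\<in>pidx X. \<Union>t\<in>pidx Y. ?G (v @ t))"
      by (auto simp: wprod_def)
    also have "\<dots> = (\<Union>v\<in>pidx X. \<Union>t\<in>pidx Y. wprod (G v) (H t))"
      by (intro SUP_cong refl) (simp add: lenX)
    also have "\<dots> = wprod (\<Union>(G ` pidx X)) (\<Union>(H ` pidx Y))"
      by (auto simp: wprod_def)
    finally show ?thesis using repD(1)[OF r] repD(1)[OF q] by simp
  qed
  fix w assume "w \<in> pidx (ptimes X Y)"
  then obtain v t where w: "w = v @ t" "v \<in> pidx X" "t \<in> pidx Y" unfolding ptimes_simps wprod_def by blast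
  note lv [simp] = lenX[OF w(2)]
  show "finite (?G w)" using w repD(2)[OF r w(2)] repD(2)[OF q w(3)] by simp
  show "deg b = deg w" if b: "b \<in> ?G w" for b
  proof -
    from b w obtain b1 b2 where "b = b1 @ b2" "b1 \<in> G v" "b2 \<in> H t" by (auto simp: wprod_def)
    then show ?thesis using repD(3)[OF r w(2)] repD(3)[OF q w(3)] w by simp
  qed
  show "?g w \<in> Arr C" "Dom C (?g w) = pob (ptimes X Y) w" "Cod C (?g w) = sumo (pob (ptimes X' Y')) (?G w)"
    using w Gw[OF w(2)] lenX[OF w(2)] repD(2,4-6)[OF r w(2)] repD(2,4-6)[OF q w(3)] presD(4)[OF X'] presD(4)[OF Y'] by auto
  fix w' assume "w' \<in> pidx (ptimes X Y)" and ne: "w \<noteq> w'"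
  then obtain v' t' where w': "w' = v' @ t'" "v' \<in> pidx X" "t' \<in> pidx Y" unfolding ptimes_simps wprod_def by blast
  have "G v \<inter> G v' = {} \<or> H t \<inter> H t' = {}"
    using ne w w' repD(7)[OF r w(2) w'(2)] repD(7)[OF q w(3) w'(3)] by auto
  then have "wprod (G v) (H t) \<inter> wprod (G v') (H t') = {}"
    by (intro wprod_disjoint[where p="plen X'"]) (use Gw[OF w(2)] Gw[OF w'(2)] in \<open>auto simp: words_def\<close>)
  then show "?G w \<inter> ?G w' = {}" using w w' lenX[OF w'(2)] by simp
next
  fix n
  note \<phi> = rep_larr[OF X X' r] and \<psi> = rep_larr[OF Y Y' q]
  note cA = ctimes_Arr[OF \<phi> \<psi>, of n]
  note PP = presD(5-8)[OF pres_ptimes[OF X Y], of n] presD(5-8)[OF pres_ptimes[OF X' Y'], of n]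
  show "ctimes (\<phi>, \<psi>) n \<in> Arr C" "Dom C (ctimes (\<phi>, \<psi>) n) = Dom C (par (ptimes X Y) n)" "Cod C (ctimes (\<phi>, \<psi>) n) = Dom C (par (ptimes X' Y') n)"
    using cA PP by auto
  note [simp] = presO[OF X] presO[OF Y] presO[OF X'] presO[OF Y'] larrD(3-5)[OF \<phi>] larrD(3-5)[OF \<psi>]
  note f = fam_eq[OF X] fam_eq[OF Y] fam_eq[OF X'] fam_eq[OF Y']
  let ?X = "cterm x y n" and ?Y = "cterm x' y' n" and ?J = "cset x y n" and ?J' = "cset x' y' n"
  let ?L = "pset X Y n \<union> pset X' Y' n"
  have fL: "finite ?L" using finite_pset[OF X Y] finite_pset[OF X' Y'] by simp
  have J: "?J \<subseteq> ?L" "?J' \<subseteq> ?L" using cset_pset[OF X Y] cset_pset[OF X' Y'] by blast+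
  let ?d = "\<lambda>k. \<phi> k \<boxtimes> \<psi> (n - k)"
  have gd: "?d k \<in> Arr C \<and> Dom C (?d k) = ?X k \<and> Cod C (?d k) = ?Y k" for k by (simp add: cterm_def)
  have nX: "null (?X k)" if "k \<notin> ?J" for k by (rule cterm_null) (use that in auto)
  have nY: "null (?Y k)" if "k \<notin> ?J'" for k by (rule cterm_null) (use that in auto)
  have A1 [simp]: "drop_null ?X ?L ?J \<in> Arr C" "Dom C (drop_null ?X ?L ?J) = sumo ?X ?L" "Cod C (drop_null ?X ?L ?J) = sumo ?X ?J" "invertible C (drop_null ?X ?L ?J)"
    by (rule drop_Arr; use fL J nX in auto)+
  have A2 [simp]: "drop_null ?Y ?L ?J' \<in> Arr C" "Dom C (drop_null ?Y ?L ?J') = sumo ?Y ?L" "Cod C (drop_null ?Y ?L ?J') = sumo ?Y ?J'" "invertible C (drop_null ?Y ?L ?J')"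
    by (rule drop_Arr; use fL J nY in auto)+
  have A3 [simp]: "diag ?X ?Y ?d ?L \<in> Arr C" "Dom C (diag ?X ?Y ?d ?L) = sumo ?X ?L" "Cod C (diag ?X ?Y ?d ?L) = sumo ?Y ?L"
    by (rule diag_Arr; use fL gd in simp)+
  let ?w = "tens (plen X) (pob X) (pob Y)" and ?w' = "tens (plen X') (pob X') (pob Y')"
  note bX = pflat_block[OF X Y fL, of n] and bY = pflat_block[OF X' Y' fL, of n]
  have A4 [simp]: "pflat X Y n ?L \<in> Arr C" "Dom C (pflat X Y n ?L) = sumo ?X ?L" "Cod C (pflat X Y n ?L) = sumo ?w (grade (ptimes X Y) n)"
    using phi_Arr(1-3)[OF bX] grade_ptimes[of X Y n ?L] by (simp_all add: pflat_def f)
  have A5 [simp]: "pflat X' Y' n ?L \<in> Arr C" "Dom C (pflat X' Y' n ?L) = sumo ?Y ?L"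
    using phi_Arr(1-3)[OF bY] by (simp_all add: pflat_def f)
  note pX = presD(3-9)[OF X] and pX' = presD(3-9)[OF X'] and pY = presD(3-9)[OF Y] and pY' = presD(3-9)[OF Y']
  have lenX: "v \<in> pidx X ==> length v = plen X" for v by (rule presD(1)[OF X])
  have Gw: "words (plen X') (G v)" if "v \<in> pidx X" for v
    using repD(1,2)[OF r] that presD(1)[OF X'] by (auto simp: words_def)
  \<comment> \<open>\<open>left\<close> and \<open>right\<close> turn the two ways around the
    naturality square into one and the same block map over \<open>?L\<close>, with component
    \<open>pgam X' Y' n k\<close> after \<open>?d k\<close>.\<close>
  have left: "pflat X' Y' n ?L \<cdot> diag ?X ?Y ?d ?L = phi ?X ?w' (\<lambda>k. wprod (grade X' k) (grade Y' (n - k))) (\<lambda>k. pgam X' Y' n k \<cdot> ?d k) ?L"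
  proof -
    have bd: "sblock ?X ?Y (\<lambda>k. {k}) (\<lambda>k. unit ?Y k \<cdot> ?d k) ?L" by (rule diag_block) (use fL gd in auto)
    have "pflat X' Y' n ?L \<cdot> diag ?X ?Y ?d ?L = phi ?X ?w' (\<lambda>k. \<Union>((\<lambda>k. wprod (grade X' k) (grade Y' (n - k))) ` {k}))
      (\<lambda>k. phi ?Y ?w' (\<lambda>k. wprod (grade X' k) (grade Y' (n - k))) (pgam X' Y' n) {k} \<cdot> (unit ?Y k \<cdot> ?d k)) ?L"
      unfolding pflat_def diag_def f using phi_phi[OF bd, where w="?w'" and H="\<lambda>k. wprod (grade X' k) (grade Y' (n - k))" and h="pgam X' Y' n"] bY
      by (simp only: UN_single)
    also have "\<dots> = phi ?X ?w' (\<lambda>k. wprod (grade X' k) (grade Y' (n - k))) (\<lambda>k. pgam X' Y' n k \<cdot> ?d k) ?L"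
    proof (rule blk_cong)
      fix k assume k: "k \<in> ?L"
      have "sblock ?Y ?w' (\<lambda>k. wprod (grade X' k) (grade Y' (n - k))) (pgam X' Y' n) {k}" by (rule block_subset[OF bY]) (use k in auto)
      then show "phi ?Y ?w' (\<lambda>k. wprod (grade X' k) (grade Y' (n - k))) (pgam X' Y' n) {k} \<cdot> (unit ?Y k \<cdot> ?d k) = pgam X' Y' n k \<cdot> ?d k"
        by (rule phi_unit_comp) (use gd in auto)
    qed (use fL pX' pY' in auto)
    finally show ?thesis .
  qed
  have b: "sblock ?w ?w' ?G ?g (grade (ptimes X Y) n)"
  proof (rule blockI)
    show "finite (grade (ptimes X Y) n)" using presD(3)[OF pres_ptimes[OF X Y]] .
    fix w assume "w \<in> grade (ptimes X Y) n"
    then obtain v t where w: "w = v @ t" "v \<in> pidx X" "t \<in> pidx Y" unfolding grade_iff ptimes_simps wprod_def by blast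
    show "finite (?G w)" "?g w \<in> Arr C" "Dom C (?g w) = ?w w" "Cod C (?g w) = sumo ?w' (?G w)"
      using w Gw[OF w(2)] lenX[OF w(2)] repD(2,4-6)[OF r w(2)] repD(2,4-6)[OF q w(3)] pX' pY' by auto
    fix z assume "z \<in> grade (ptimes X Y) n" and ne: "w \<noteq> z"
    then obtain v' t' where w': "z = v' @ t'" "v' \<in> pidx X" "t' \<in> pidx Y" unfolding grade_iff ptimes_simps wprod_def by blast
    have "G v \<inter> G v' = {} \<or> H t \<inter> H t' = {}"
      using ne w w' repD(7)[OF r w(2) w'(2)] repD(7)[OF q w(3) w'(3)] by auto
    then have "wprod (G v) (H t) \<inter> wprod (G v') (H t') = {}"
      by (intro wprod_disjoint[where p="plen X'"]) (use Gw[OF w(2)] Gw[OF w'(2)] in \<open>auto simp: words_def\<close>)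
    then show "?G w \<inter> ?G z = {}" using w w' lenX by simp
  qed (use pX pY pX' pY' in auto)
  have U: "(\<Union>k\<in>?L. wprod (grade X k) (grade Y (n - k))) = grade (ptimes X Y) n"
    by (rule grade_ptimes) auto
  have right: "phi ?w ?w' ?G ?g (grade (ptimes X Y) n) \<cdot> pflat X Y n ?L
    = phi ?X ?w' (\<lambda>k. wprod (grade X' k) (grade Y' (n - k))) (\<lambda>k. pgam X' Y' n k \<cdot> ?d k) ?L"
  proof -
    have "phi ?w ?w' ?G ?g (grade (ptimes X Y) n) \<cdot> pflat X Y n ?L
      = phi ?X ?w' (\<lambda>k. \<Union>(?G ` wprod (grade X k) (grade Y (n - k)))) (\<lambda>k. phi ?w ?w' ?G ?g (wprod (grade X k) (grade Y (n - k))) \<cdot> pgam X Y n k) ?L"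
      unfolding pflat_def f using phi_phi[OF bX, where w="?w'" and H="?G" and h="?g"] b by (simp only: U)
    also have "\<dots> = phi ?X ?w' (\<lambda>k. wprod (grade X' k) (grade Y' (n - k))) (\<lambda>k. pgam X' Y' n k \<cdot> ?d k) ?L"
    proof (rule blk_cong)
      fix k assume k: "k \<in> ?L"
      have UG: "\<Union>(?G ` wprod (grade X k) (grade Y (n - k))) = wprod (grade X' k) (grade Y' (n - k))"
      proof -
        have "\<Union>(?G ` wprod (grade X k) (grade Y (n - k))) = (\<Union>v\<in>grade X k. \<Union>t\<in>grade Y (n - k). ?G (v @ t))"
          by (auto simp: wprod_def)
        also have "\<dots> = (\<Union>v\<in>grade X k. \<Union>t\<in>grade Y (n - k). wprod (G v) (H t))"
          by (intro SUP_cong refl) (simp add: lenX grade_iff)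
        also have "\<dots> = wprod (\<Union>(G ` grade X k)) (\<Union>(H ` grade Y (n - k)))"
          by (auto simp: wprod_def)
        finally show ?thesis using rep_grade[OF r] rep_grade[OF q] by simp
      qed
      then show "\<Union>(?G ` wprod (grade X k) (grade Y (n - k))) = wprod (grade X' k) (grade Y' (n - k))" .
      show "finite (\<Union>(?G ` wprod (grade X k) (grade Y (n - k))))" unfolding UG using pX' pY' by simp
      note bG = rep_block[OF X X' r, of k] and bH = rep_block[OF Y Y' q, of "n - k"]
      have np: "nu (plen X') (pob X') (pob Y') (grade X' k) (grade Y' (n - k)) \<cdot> (phi (pob X) (pob X') G g (grade X k) \<boxtimes> phi (pob Y) (pob Y') H h (grade Y (n - k)))
        = phi ?w ?w' ?G ?g (wprod (grade X k) (grade Y (n - k))) \<cdot> nu (plen X) (pob X) (pob Y) (grade X k) (grade Y (n - k))"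
        using nu_phi[OF pX(7)[of k] pY(1)[of "n - k"] bG bH, of "plen X'"] Gw rep_grade[OF r, of k] rep_grade[OF q, of "n - k"] by (simp add: grade_iff)
      have bk: "sblock ?w ?w' ?G ?g (wprod (grade X k) (grade Y (n - k)))"
        by (rule block_subset[OF b]) (use U k in blast)
      note bA = phi_Arr(1-3)[OF bk] phi_Arr(1-3)[OF bG] phi_Arr(1-3)[OF bH]
      have "phi ?w ?w' ?G ?g (wprod (grade X k) (grade Y (n - k))) \<cdot> pgam X Y n k
        = (phi ?w ?w' ?G ?g (wprod (grade X k) (grade Y (n - k))) \<cdot> nu (plen X) (pob X) (pob Y) (grade X k) (grade Y (n - k))) \<cdot> (par X k \<boxtimes> par Y (n - k))"
        using bA pX pY by (simp add: pgam_def comp_assoc)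
      also have "\<dots> = nu (plen X') (pob X') (pob Y') (grade X' k) (grade Y' (n - k)) \<cdot> ((phi (pob X) (pob X') G g (grade X k) \<cdot> par X k) \<boxtimes> (phi (pob Y) (pob Y') H h (grade Y (n - k)) \<cdot> par Y (n - k)))"
        unfolding np[symmetric] using bA pX pY pX' pY' rep_grade[OF r, of k] rep_grade[OF q, of "n - k"] by (simp add: comp_assoc times.interchange)
      also have "\<dots> = pgam X' Y' n k \<cdot> ?d k"
        unfolding repD(11)[OF r, symmetric] repD(11)[OF q, symmetric] using pX' pY' by (simp add: pgam_def comp_assoc times.interchange)
      finally show "phi ?w ?w' ?G ?g (wprod (grade X k) (grade Y (n - k))) \<cdot> pgam X Y n k = pgam X' Y' n k \<cdot> ?d k" .
    qed (use fL in auto)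
    finally show ?thesis .
  qed
  have "par (ptimes X' Y') n \<cdot> ctimes (\<phi>, \<psi>) n = pflat X' Y' n ?L \<cdot> (arr_inv (drop_null ?Y ?L ?J') \<cdot> (drop_null ?Y ?L ?J' \<cdot> (diag ?X ?Y ?d ?L \<cdot> arr_inv (drop_null ?X ?L ?J))))"
    unfolding par_ptimes[OF X' Y' fL Un_upper2] ctimes_eq[OF \<phi> \<psi> fL J] by (simp add: comp_assoc)
  also have "\<dots> = (pflat X' Y' n ?L \<cdot> diag ?X ?Y ?d ?L) \<cdot> arr_inv (drop_null ?X ?L ?J)"
    by (simp add: comp_assoc)
  also have "\<dots> = (phi ?w ?w' ?G ?g (grade (ptimes X Y) n) \<cdot> pflat X Y n ?L) \<cdot> arr_inv (drop_null ?X ?L ?J)"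
    unfolding left right ..
  also have "\<dots> = phi ?w ?w' ?G ?g (grade (ptimes X Y) n) \<cdot> par (ptimes X Y) n"
    unfolding par_ptimes[OF X Y fL Un_upper1] using phi_Arr(1-3)[OF b] by (simp add: comp_assoc)
  finally show "par (ptimes X' Y') n \<cdot> ctimes (\<phi>, \<psi>) n = phi (pob (ptimes X Y)) (pob (ptimes X' Y')) ?G ?g (grade (ptimes X Y) n) \<cdot> par (ptimes X Y) n"
    by simp
qed

text \<open>The distribution of two single words is again a single word by
  \<open>nu_single_single\<close>, so products of diagonal arrows are diagonal.\<close>

lemma drep_ptimes:
  assumes X: "pres X x" and X': "pres X' x'" and Y: "pres Y y" and Y': "pres Y' y'"
    and p: "plen X' = plen X" and r: "drep \<phi> X X' g" and q: "drep \<psi> Y Y' h"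
  shows "drep (ctimes (\<phi>, \<psi>)) (ptimes X Y) (ptimes X' Y') (\<lambda>w. g (take (plen X) w) \<boxtimes> h (drop (plen X) w))"
  unfolding drep_def
proof
  have i: "pidx X' = pidx X" "pidx Y' = pidx Y" using drepD(5)[OF r] drepD(5)[OF q] by auto
  show "rep (ctimes (\<phi>, \<psi>)) (ptimes X Y) (ptimes X' Y') (\<lambda>w. {w}) (\<lambda>w. unit (pob (ptimes X' Y')) w \<cdot> (g (take (plen X) w) \<boxtimes> h (drop (plen X) w)))"
  proof (rule rep_cong[OF pres_ptimes[OF X Y] rep_ptimes[OF X X' Y Y' drepD(1)[OF r] drepD(1)[OF q]]])
    fix w assume "w \<in> pidx (ptimes X Y)"
    then obtain v t where w: "w = v @ t" "v \<in> pidx X" "t \<in> pidx Y" unfolding ptimes_simps wprod_def by blast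
    have l: "length v = plen X" by (rule presD(1)[OF X w(2)])
    note g = drepD(2-4)[OF r w(2)] and h = drepD(2-4)[OF q w(3)] and o = presD(4)[OF X'] presD(4)[OF Y']
    have "nu (plen X') (pob X') (pob Y') {v} {t} \<cdot> ((unit (pob X') v \<cdot> g v) \<boxtimes> (unit (pob Y') t \<cdot> h t))
      = (nu (plen X') (pob X') (pob Y') {v} {t} \<cdot> (unit (pob X') v \<boxtimes> unit (pob Y') t)) \<cdot> (g v \<boxtimes> h t)"
      using g h o l p by (simp add: comp_assoc times.interchange)
    also have "\<dots> = unit (pob (ptimes X' Y')) w \<cdot> (g v \<boxtimes> h t)"
      using nu_single_single[of "pob X'" "pob Y'" v "plen X'" t] o l p w by simp
    finally show "wprod {take (plen X) w} {drop (plen X) w} = {w} \<and>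
      nu (plen X') (pob X') (pob Y') {take (plen X) w} {drop (plen X) w} \<cdot> ((unit (pob X') (take (plen X) w) \<cdot> g (take (plen X) w)) \<boxtimes> (unit (pob Y') (drop (plen X) w) \<cdot> h (drop (plen X) w)))
      = unit (pob (ptimes X' Y')) w \<cdot> (g (take (plen X) w) \<boxtimes> h (drop (plen X) w))"
      using w l by simp
  qed
  show "\<forall>w\<in>pidx (ptimes X Y). g (take (plen X) w) \<boxtimes> h (drop (plen X) w) \<in> Arr C \<and>
      Dom C (g (take (plen X) w) \<boxtimes> h (drop (plen X) w)) = pob (ptimes X Y) w \<and> Cod C (g (take (plen X) w) \<boxtimes> h (drop (plen X) w)) = pob (ptimes X' Y') w"
  proof
    fix w assume "w \<in> pidx (ptimes X Y)"
    then obtain v t where w: "w = v @ t" "v \<in> pidx X" "t \<in> pidx Y" unfolding ptimes_simps wprod_def by blast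
    have l: "length v = plen X" by (rule presD(1)[OF X w(2)])
    show "g (take (plen X) w) \<boxtimes> h (drop (plen X) w) \<in> Arr C \<and>
      Dom C (g (take (plen X) w) \<boxtimes> h (drop (plen X) w)) = pob (ptimes X Y) w \<and> Cod C (g (take (plen X) w) \<boxtimes> h (drop (plen X) w)) = pob (ptimes X' Y') w"
      using w l p drepD(2-4)[OF r w(2)] drepD(2-4)[OF q w(3)] by simp
  qed
qed

end

section \<open>The structure maps of the Laurent category\<close>

context laplaza
begin

lemma lam_cong:
  assumes "finite T" "\<And>t. t \<in> T ==> v t = v' t" "\<And>t. t \<in> T ==> w (s' @ t) = w' (s' @ t)"
  shows "lam x v w s' T = lam x v' w' s' T"
  unfolding lam_def by (rule blk_cong) (use assms in \<open>auto simp: unit_def\<close>)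

lemma nu_cong:
  assumes S: "words p S" and T: "finite T" and "\<And>k. k \<in> S ==> u k = u' k" "\<And>t. t \<in> T ==> v t = v' t"
  shows "nu p u v S T = nu p u' v' S T"
proof -
  have e: "sumo v T = sumo v' T" by (rule sumo_cong) (use assms in auto)
  show ?thesis unfolding nu_def e
  proof (rule blk_cong)
    fix k assume k: "k \<in> S"
    then have l: "length k = p" using S by (auto simp: words_def)
    show "tens p u v j = tens p u' v' j" if "j \<in> (@) k ` T" for j using that assms k l by auto
    have "lam (u k) v (tens p u v) k T = lam (u k) v' (tens p u' v') k T"
      by (rule lam_cong) (use assms k l in auto)
    then show "lam (u k) v (tens p u v) k T = lam (u' k) v' (tens p u' v') k T" using assms(3)[OF k] by simp
  qed (use assms words_finite in auto)
qed

lemma phi_trivial: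
  assumes "finite S" "\<And>i. u i \<in> Obj C" "\<And>i. v i \<in> Obj C" "\<And>k. k \<in> S ==> v k = u k"
  shows "phi u v (\<lambda>k. {k}) (\<lambda>k. unit v k \<cdot> Id C (u k)) S = Id C (sumo u S)"
proof -
  have "phi u v (\<lambda>k. {k}) (\<lambda>k. unit v k \<cdot> Id C (u k)) S = phi u u (\<lambda>k. {k}) (unit u) S"
    by (rule blk_cong) (use assms in \<open>auto simp: unit_def\<close>)
  then show ?thesis using phi_id[of u S] assms by simp
qed

end

context rigid_laplaza
begin

text \<open>Source and target are refined by the same blocks, and \<open>compat\<close> matches the
  components before and after refinement. One direction composes with the refinement of the target;
  the other cancels it, which is why its components \<open>g'\<close> have to be invertible.\<close>

lemma transfer:
  assumes X0: "pres X0 x" and X: "pres X x" and Y0: "pres Y0 y" and Y: "pres Y y"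
    and r: "rep (\<lambda>n. Id C (x n)) X0 X G g" and q: "rep (\<lambda>n. Id C (y n)) Y0 Y G' g'"
    and G: "\<And>w. w \<in> pidx X0 ==> G' w = G w"
    and i: "\<And>w. w \<in> pidx X0 ==> invertible C (g' w)"
    and i0: "pidx Y0 = pidx X0"
    and c0: "\<And>w. w \<in> pidx X0 ==> c0 w \<in> Arr C" "\<And>w. w \<in> pidx X0 ==> Dom C (c0 w) = pob X0 w" "\<And>w. w \<in> pidx X0 ==> Cod C (c0 w) = pob Y0 w"
    and c: "\<And>w. w \<in> pidx X ==> c w \<in> Arr C" "\<And>w. w \<in> pidx X ==> Dom C (c w) = pob X w" "\<And>w. w \<in> pidx X ==> Cod C (c w) = pob Y w"
    and compat: "\<And>w. w \<in> pidx X0 ==> phi (pob X) (pob Y) (\<lambda>w. {w}) (\<lambda>w. unit (pob Y) w \<cdot> c w) (G w) \<cdot> g w = g' w \<cdot> c0 w"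
  shows "drep t X0 Y0 c0 \<longleftrightarrow> drep t X Y c"
proof -
  have iX: "pidx Y = pidx X"
    using repD(1)[OF r] repD(1)[OF q] i0 G by simp
  note P = presD(3-8)[OF X0] presD(3-8)[OF X] presD(3-8)[OF Y0] presD(3-8)[OF Y]
  have g0: "grade Y0 n = grade X0 n" and g1: "grade Y n = grade X n" for n using i0 iX by (simp_all add: grade_def)
  have bc0: "sblock (pob X0) (pob Y0) (\<lambda>w. {w}) (\<lambda>w. unit (pob Y0) w \<cdot> c0 w) (grade X0 n)" for n
    by (rule blockI) (use P c0 in \<open>auto simp: grade_iff\<close>)
  have bc: "sblock (pob X) (pob Y) (\<lambda>w. {w}) (\<lambda>w. unit (pob Y) w \<cdot> c w) (grade X n)" for n
    by (rule blockI) (use P c in \<open>auto simp: grade_iff\<close>)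
  note bg = rep_block[OF X0 X r] and bg' = rep_block[OF Y0 Y q]
  note A = phi_Arr(1-3)[OF bc0] phi_Arr(1-3)[OF bc] phi_Arr(1-3)[OF bg] phi_Arr(1-3)[OF bg']
  have pX: "par X n = phi (pob X0) (pob X) G g (grade X0 n) \<cdot> par X0 n" for n
    using repD(11)[OF r, of n] P by simp
  have pY: "par Y n = phi (pob Y0) (pob Y) G' g' (grade Y0 n) \<cdot> par Y0 n" for n
    using repD(11)[OF q, of n] P by simp
  have U: "(\<Union>w\<in>grade X0 n. {w}) = grade Y0 n" "(\<Union>w\<in>grade X n. {w}) = grade X n" for n using g0 by auto
  let ?d = "\<lambda>n. phi (pob X0) (pob Y0) (\<lambda>w. {w}) (\<lambda>w. unit (pob Y0) w \<cdot> c0 w) (grade X0 n)"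
  let ?c = "\<lambda>n. phi (pob X) (pob Y) (\<lambda>w. {w}) (\<lambda>w. unit (pob Y) w \<cdot> c w) (grade X n)"
  let ?g = "\<lambda>n. phi (pob X0) (pob X) G g (grade X0 n)" and ?g' = "\<lambda>n. phi (pob Y0) (pob Y) G' g' (grade Y0 n)"
  have key: "?c n \<cdot> ?g n = ?g' n \<cdot> ?d n" for n
  proof -
    have "?c n \<cdot> ?g n = phi (pob X0) (pob Y) (\<lambda>w. \<Union>w\<in>G w. {w}) (\<lambda>w. phi (pob X) (pob Y) (\<lambda>w. {w}) (\<lambda>w. unit (pob Y) w \<cdot> c w) (G w) \<cdot> g w) (grade X0 n)"
      using phi_phi[OF bg, where w="pob Y" and H="\<lambda>w. {w}" and h="\<lambda>w. unit (pob Y) w \<cdot> c w"] bc by (simp only: rep_grade[OF r])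
    also have "\<dots> = phi (pob X0) (pob Y) (\<lambda>w. \<Union>(G' ` {w})) (\<lambda>w. phi (pob Y0) (pob Y) G' g' {w} \<cdot> (unit (pob Y0) w \<cdot> c0 w)) (grade X0 n)"
    proof (rule blk_cong)
      fix w assume "w \<in> grade X0 n"
      then have w: "w \<in> pidx X0" "w \<in> grade Y0 n" using g0 by (auto simp: grade_iff)
      show "(\<Union>w\<in>G w. {w}) = \<Union>(G' ` {w})" using G[OF w(1)] by simp
      have bw: "sblock (pob Y0) (pob Y) G' g' {w}" by (rule block_subset[OF bg']) (use w(2) in auto)
      show "phi (pob X) (pob Y) (\<lambda>w. {w}) (\<lambda>w. unit (pob Y) w \<cdot> c w) (G w) \<cdot> g w = phi (pob Y0) (pob Y) G' g' {w} \<cdot> (unit (pob Y0) w \<cdot> c0 w)"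
        using compat[OF w(1)] phi_unit_comp[OF bw c0(1,3)[OF w(1)]] by simp
      show "finite (\<Union>w\<in>G w. {w})" using repD(2)[OF r w(1)] by simp
    qed (use P in auto)
    also have "\<dots> = ?g' n \<cdot> ?d n"
      using phi_phi[OF bc0, where w="pob Y" and H=G' and h=g'] bg' by (simp only: U)
    finally show ?thesis .
  qed
  have i': "invertible C (?g' n)" for n
    by (rule phi_Arr(4)[OF bg']) (use i i0 in \<open>auto simp: grade_iff\<close>)
  have gA: "?g n \<in> Arr C" "Dom C (?g n) = sumo (pob X0) (grade X0 n)" "Cod C (?g n) = sumo (pob X) (grade X n)"
    "?g' n \<in> Arr C" "Dom C (?g' n) = sumo (pob Y0) (grade Y0 n)"
    "?d n \<in> Arr C" "Dom C (?d n) = sumo (pob X0) (grade X0 n)" "Cod C (?d n) = sumo (pob Y0) (grade Y0 n)"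
    "?c n \<in> Arr C" "Dom C (?c n) = sumo (pob X) (grade X n)" for n
    using phi_Arr(1-3)[OF bg, of n] phi_Arr(1-3)[OF bg', of n] phi_Arr(1-3)[OF bc0, of n] phi_Arr(1-3)[OF bc, of n]
    by (simp_all only: rep_grade[OF r] U)
  have main: "par Y0 n \<cdot> t n = ?d n \<cdot> par X0 n \<longleftrightarrow> par Y n \<cdot> t n = ?c n \<cdot> par X n"
    if t: "t n \<in> Arr C" "Dom C (t n) = x n" "Cod C (t n) = y n" for n
  proof -
    have "par Y n \<cdot> t n = ?g' n \<cdot> (par Y0 n \<cdot> t n)" unfolding pY using t gA P by (simp add: comp_assoc)
    moreover have "?c n \<cdot> par X n = ?g' n \<cdot> (?d n \<cdot> par X0 n)"
    proof -
      have "?c n \<cdot> par X n = (?c n \<cdot> ?g n) \<cdot> par X0 n" unfolding pX using gA P by (simp add: comp_assoc)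
      also have "\<dots> = ?g' n \<cdot> (?d n \<cdot> par X0 n)" unfolding key using gA P by (simp add: comp_assoc)
      finally show ?thesis .
    qed
    moreover have "?g' n \<cdot> (par Y0 n \<cdot> t n) = ?g' n \<cdot> (?d n \<cdot> par X0 n) \<longleftrightarrow> par Y0 n \<cdot> t n = ?d n \<cdot> par X0 n"
      using cancel_left[of "?g' n" "par Y0 n \<cdot> t n" "?d n \<cdot> par X0 n"] gA i' P t by auto
    ultimately show ?thesis by auto
  qed
  show ?thesis
  proof
    assume d: "drep t X0 Y0 c0"
    note dA = rep_Arr[OF X0 Y0 drepD(1)[OF d]]
    show "drep t X Y c"
      by (rule drepI[OF Y iX]) (use c dA P main[THEN iffD1, OF dA repD(11)[OF drepD(1)[OF d]]] in auto)
  next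
    assume d: "drep t X Y c"
    note dA = rep_Arr[OF X Y drepD(1)[OF d]]
    show "drep t X0 Y0 c0"
      by (rule drepI[OF Y0 i0]) (use c0 dA P main[THEN iffD2, OF dA repD(11)[OF drepD(1)[OF d]]] in auto)
  qed
qed

text \<open>\<open>X\<close> refines \<open>X0\<close>: each summand of \<open>X0\<close> is split into summands of \<open>X\<close>. Any two presentations
  of a family are related through a common \<open>leaf\<close>.\<close>

definition refd :: "('o, 'm) presentation \<Rightarrow> ('o, 'm) presentation \<Rightarrow> (int \<Rightarrow> 'o) \<Rightarrow> (word \<Rightarrow> word set) \<Rightarrow> (word \<Rightarrow> 'm) \<Rightarrow> bool" where
  "refd X0 X x G g \<longleftrightarrow> pres X0 x \<and> pres X x \<and> rep (\<lambda>n. Id C (x n)) X0 X G g \<and> (\<forall>w\<in>pidx X0. invertible C (g w))"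

lemma refdD:
  assumes "refd X0 X x G g"
  shows "pres X0 x" "pres X x" "rep (\<lambda>n. Id C (x n)) X0 X G g" "w \<in> pidx X0 ==> invertible C (g w)"
  using assms by (auto simp: refd_def)

lemma refd_words:
  assumes r: "refd X0 X x G g" and w: "w \<in> pidx X0"
  shows "words (plen X) (G w)"
proof -
  have "G w \<subseteq> pidx X" using repD(1)[OF refdD(3)[OF r]] w by auto
  then show ?thesis using repD(2)[OF refdD(3)[OF r] w] presD(1)[OF refdD(2)[OF r]] by (auto simp: words_def)
qed

lemma refd_leaf:
  assumes X: "pres X x" and B: "leafy B x" "\<And>w. w \<in> pidx X ==> deg w \<in> B"
  shows "refd (leaf c B x) X x (\<lambda>w. grade X (deg w)) (\<lambda>w. par X (deg w))"
  unfolding refd_def using pres_leaf[OF B(1)] X rep_leaf[OF X B] presD(8)[OF X] by blast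

lemma refd_self: "pres X x ==> refd X X x (\<lambda>w. {w}) (\<lambda>w. unit (pob X) w \<cdot> Id C (pob X w))"
  unfolding refd_def using drepD(1)[OF drep_id[of X x]] presD(4)[of X x] by auto

text \<open>The leaf over \<open>bound V v\<close> is refined both by the leaf over the support and
  by the given presentation, so a property stable under refinement in both directions passes from
  one to the other. \<open>S\<close> carries the disjointness that sums require; the colours 0, 1, 2
  provide it for leaves.\<close>

lemma extend3:
  assumes x: "x \<in> laurent_objs C" and y: "y \<in> laurent_objs C" and z: "z \<in> laurent_objs C"
    and base: "Q (leaf 0 (supp x) x) (leaf 1 (supp y) y) (leaf 2 (supp z) z)"
    and tr: "\<And>X0 X Y0 Y Z0 Z G g H h K k. refd X0 X x G g ==> refd Y0 Y y H h ==> refd Z0 Z z K k ==>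
       S X0 Y0 Z0 ==> S X Y Z ==> Q X0 Y0 Z0 \<longleftrightarrow> Q X Y Z"
    and S: "\<And>A B D. S (leaf 0 A x) (leaf 1 B y) (leaf 2 D z)"
    and X: "pres X x" and Y: "pres Y y" and Z: "pres Z z" and SX: "S X Y Z"
  shows "Q X Y Z"
proof -
  have up: "refd (leaf c (bound V v) v) V v (\<lambda>w. grade V (deg w)) (\<lambda>w. par V (deg w))"
    and lo: "refd (leaf c (bound V v) v) (leaf c (supp v) v) v (\<lambda>w. grade (leaf c (supp v) v) (deg w)) (\<lambda>w. par (leaf c (supp v) v) (deg w))"
    if "pres V v" for V v c
  proof -
    show "refd (leaf c (bound V v) v) V v (\<lambda>w. grade V (deg w)) (\<lambda>w. par V (deg w))"
      by (rule refd_leaf[OF that leafy_bound[OF that]]) (auto simp: bound_def)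
    show "refd (leaf c (bound V v) v) (leaf c (supp v) v) v (\<lambda>w. grade (leaf c (supp v) v) (deg w)) (\<lambda>w. par (leaf c (supp v) v) (deg w))"
      by (rule refd_leaf[OF pres_leaf[OF leafy_supp[OF pres_laurent[OF that]]] leafy_bound[OF that]]) (auto simp: bound_def)
  qed
  have "Q (leaf 0 (bound X x) x) (leaf 1 (bound Y y) y) (leaf 2 (bound Z z) z)"
    using tr[OF lo[OF X] lo[OF Y] lo[OF Z] S S] base by simp
  then show ?thesis
    using tr[OF up[OF X] up[OF Y] up[OF Z] S SX] by simp
qed

text \<open>The block map with components \<open>c\<close>, transported along the parametrizations
  of its two ends. It is the arrow that is diagonal with these components.\<close>

definition conn :: "('o, 'm) presentation \<Rightarrow> ('o, 'm) presentation \<Rightarrow> (word \<Rightarrow> 'm) \<Rightarrow> int \<Rightarrow> 'm" where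
  "conn P Q c n = arr_inv (par Q n) \<cdot> (phi (pob P) (pob Q) (\<lambda>w. {w}) (\<lambda>w. unit (pob Q) w \<cdot> c w) (grade P n) \<cdot> par P n)"

lemma conn:
  assumes P: "pres P f" and Q: "pres Q g" and i: "pidx Q = pidx P"
    and c: "\<And>w. w \<in> pidx P ==> c w \<in> Arr C" "\<And>w. w \<in> pidx P ==> Dom C (c w) = pob P w" "\<And>w. w \<in> pidx P ==> Cod C (c w) = pob Q w"
      "\<And>w. w \<in> pidx P ==> invertible C (c w)"
  shows "drep (conn P Q c) P Q c" "invertible C (conn P Q c n)"
proof -
  note A = presD(3-8)[OF P] presD(3-8)[OF Q]
  have g: "grade Q n = grade P n" for n using i by (simp add: grade_def)
  have b: "sblock (pob P) (pob Q) (\<lambda>w. {w}) (\<lambda>w. unit (pob Q) w \<cdot> c w) (grade P n)" for n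
    by (rule blockI) (use A c in \<open>auto simp: grade_iff\<close>)
  let ?p = "\<lambda>n. phi (pob P) (pob Q) (\<lambda>w. {w}) (\<lambda>w. unit (pob Q) w \<cdot> c w) (grade P n)"
  have pA [simp]: "?p n \<in> Arr C" "Dom C (?p n) = sumo (pob P) (grade P n)" "Cod C (?p n) = sumo (pob Q) (grade Q n)" "invertible C (?p n)" for n
    using phi_Arr[OF b, of n] c A by (simp_all only: UN_single g) (auto simp: grade_iff)
  show "drep (conn P Q c) P Q c"
    by (rule drepI[OF Q i]) (use A c in \<open>auto simp: conn_def\<close>)
  show "invertible C (conn P Q c n)" using A by (simp add: conn_def)
qed

lemma drep_larr: "pres X x ==> pres Y y ==> drep \<phi> X Y g ==> larr \<phi> x y"
  using rep_larr drepD(1) by blast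

lemma larr_id: "x \<in> laurent_objs C ==> larr (\<lambda>n. Id C (x n)) x x"
  using laurent_objsD(1) by (auto simp: larr_def)

lemma larr_comp: "larr \<phi> x y ==> larr \<psi> y z ==> larr (\<lambda>n. \<psi> n \<cdot> \<phi> n) x z"
  by (auto simp: larr_def)

lemma leafy_common:
  assumes "x \<in> laurent_objs C" "y \<in> laurent_objs C" "z \<in> laurent_objs C"
  obtains B where "leafy B x" "leafy B y" "leafy B z"
proof -
  have b: "\<exists>k. \<forall>n\<in>supp v. k \<le> n" if "v \<in> laurent_objs C" for v using leafy_supp[OF that] by (auto simp: leafy_def)
  obtain i j k where "\<forall>n\<in>supp x. i \<le> n" "\<forall>n\<in>supp y. j \<le> n" "\<forall>n\<in>supp z. k \<le> n" using b assms by meson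
  then have "\<forall>n\<in>supp x \<union> supp y \<union> supp z. min i (min j k) \<le> n" by (auto simp: min_le_iff_disj)
  then show ?thesis using assms by (intro that[of "supp x \<union> supp y \<union> supp z"]) (auto simp: leafy_def)
qed

text \<open>Both sides are diagonal on one presentation with identity components, so
  \<open>drep_unique\<close> applies.\<close>

lemma ctimes_id:
  assumes x: "x \<in> laurent_objs C" and y: "y \<in> laurent_objs C"
  shows "ctimes (\<lambda>n. Id C (x n), \<lambda>n. Id C (y n)) = (\<lambda>n. Id C (cauchy_prod C x y n))"
proof -
  let ?X = "leaf 0 (supp x) x" and ?Y = "leaf 0 (supp y) y"
  have X: "pres ?X x" and Y: "pres ?Y y" using x y by (auto intro: pres_leaf leafy_supp)
  note XY = pres_ptimes[OF X Y]
  show ?thesis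
    by (rule drep_unique[OF XY XY drep_ptimes[OF X X Y Y refl drep_id[OF X] drep_id[OF Y]] drep_id[OF XY]])
      (use presD(4)[OF X] presD(4)[OF Y] in \<open>auto simp: tens_def simp del: leaf_simps\<close>)
qed

text \<open>Source, middle object and target get leaves over one common set of degrees. All arrows
  are then diagonal over the same words, and the claim is the interchange law in
  \<open>C\<close>.\<close>

lemma ctimes_comp:
  assumes "larr \<phi> x y" "larr \<phi>' y z" "larr \<psi> x' y'" "larr \<psi>' y' z'"
  shows "ctimes (\<lambda>n. \<phi>' n \<cdot> \<phi> n, \<lambda>n. \<psi>' n \<cdot> \<psi> n) = (\<lambda>n. ctimes (\<phi>', \<psi>') n \<cdot> ctimes (\<phi>, \<psi>) n)"
proof -
  obtain B where B: "leafy B x" "leafy B y" "leafy B z" using leafy_common larrD(1,2) assms by metis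
  obtain B' where B': "leafy B' x'" "leafy B' y'" "leafy B' z'" using leafy_common larrD(1,2) assms by metis
  note X = pres_leaf[OF B(1), of 0] pres_leaf[OF B(2), of 0] pres_leaf[OF B(3), of 0]
  note X' = pres_leaf[OF B'(1), of 0] pres_leaf[OF B'(2), of 0] pres_leaf[OF B'(3), of 0]
  note d1 = drep_leaf[OF assms(1) B(1,2), of 0] and d2 = drep_leaf[OF assms(2) B(2,3), of 0]
    and e1 = drep_leaf[OF assms(3) B'(1,2), of 0] and e2 = drep_leaf[OF assms(4) B'(2,3), of 0]
  show ?thesis
  proof (rule drep_unique[OF pres_ptimes[OF X(1) X'(1)] pres_ptimes[OF X(3) X'(3)]])
    show "drep (ctimes (\<lambda>n. \<phi>' n \<cdot> \<phi> n, \<lambda>n. \<psi>' n \<cdot> \<psi> n)) (ptimes (leaf 0 B x) (leaf 0 B' x')) (ptimes (leaf 0 B z) (leaf 0 B' z'))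
      (\<lambda>w. (\<phi>' (snd (hd (take 1 w))) \<cdot> \<phi> (snd (hd (take 1 w)))) \<boxtimes> (\<psi>' (snd (hd (drop 1 w))) \<cdot> \<psi> (snd (hd (drop 1 w)))))"
      using drep_ptimes[OF X(1) X(3) X'(1) X'(3) _ drep_comp[OF X d1 d2] drep_comp[OF X' e1 e2]] by simp
    show "drep (\<lambda>n. ctimes (\<phi>', \<psi>') n \<cdot> ctimes (\<phi>, \<psi>) n) (ptimes (leaf 0 B x) (leaf 0 B' x')) (ptimes (leaf 0 B z) (leaf 0 B' z'))
      (\<lambda>w. (\<phi>' (snd (hd (take 1 w))) \<boxtimes> \<psi>' (snd (hd (drop 1 w)))) \<cdot> (\<phi> (snd (hd (take 1 w))) \<boxtimes> \<psi> (snd (hd (drop 1 w)))))"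
      using drep_comp[OF pres_ptimes[OF X(1) X'(1)] pres_ptimes[OF X(2) X'(2)] pres_ptimes[OF X(3) X'(3)]
        drep_ptimes[OF X(1,2) X'(1,2) _ d1 e1] drep_ptimes[OF X(2,3) X'(2,3) _ d2 e2]] by simp
    show "(\<phi>' (snd (hd (take 1 w))) \<cdot> \<phi> (snd (hd (take 1 w)))) \<boxtimes> (\<psi>' (snd (hd (drop 1 w))) \<cdot> \<psi> (snd (hd (drop 1 w)))) =
      (\<phi>' (snd (hd (take 1 w))) \<boxtimes> \<psi>' (snd (hd (drop 1 w)))) \<cdot> (\<phi> (snd (hd (take 1 w))) \<boxtimes> \<psi> (snd (hd (drop 1 w))))" for w
      using larrD(3-5)[OF assms(1)] larrD(3-5)[OF assms(2)] larrD(3-5)[OF assms(3)] larrD(3-5)[OF assms(4)]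
      by (simp add: times.interchange)
  qed
qed

text \<open>A refinement represents an identity arrow, so this is \<open>rep_ptimes\<close> for two
  identities, whose product is again an identity by \<open>ctimes_id\<close>.\<close>

lemma refd_ptimes:
  assumes r: "refd X0 X x G g" and q: "refd Y0 Y y H h"
  shows "refd (ptimes X0 Y0) (ptimes X Y) (cauchy_prod C x y)
    (\<lambda>w. wprod (G (take (plen X0) w)) (H (drop (plen X0) w)))
    (\<lambda>w. nu (plen X) (pob X) (pob Y) (G (take (plen X0) w)) (H (drop (plen X0) w)) \<cdot>
       (g (take (plen X0) w) \<boxtimes> h (drop (plen X0) w)))"
  unfolding refd_def
proof (intro conjI ballI)
  note R = refdD[OF r] and Q = refdD[OF q]
  show "pres (ptimes X0 Y0) (cauchy_prod C x y)" "pres (ptimes X Y) (cauchy_prod C x y)"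
    using pres_ptimes R Q by blast+
  show "rep (\<lambda>n. Id C (cauchy_prod C x y n)) (ptimes X0 Y0) (ptimes X Y)
    (\<lambda>w. wprod (G (take (plen X0) w)) (H (drop (plen X0) w)))
    (\<lambda>w. nu (plen X) (pob X) (pob Y) (G (take (plen X0) w)) (H (drop (plen X0) w)) \<cdot>
       (g (take (plen X0) w) \<boxtimes> h (drop (plen X0) w)))"
    using rep_ptimes[OF R(1,2) Q(1,2) R(3) Q(3)] ctimes_id[OF pres_laurent[OF R(1)] pres_laurent[OF Q(1)]] by simp
  fix w assume "w \<in> pidx (ptimes X0 Y0)"
  then obtain v t where w: "w = v @ t" "v \<in> pidx X0" "t \<in> pidx Y0" unfolding ptimes_simps wprod_def by blast
  have "words (plen X) (G v)" by (rule refd_words[OF r w(2)])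
  then show "invertible C (nu (plen X) (pob X) (pob Y) (G (take (plen X0) w)) (H (drop (plen X0) w)) \<cdot> (g (take (plen X0) w) \<boxtimes> h (drop (plen X0) w)))"
    using w presD(1)[OF R(1) w(2)] repD(2,4-6)[OF R(3) w(2)] repD(2,4-6)[OF Q(3) w(3)] R(4)[OF w(2)] Q(4)[OF w(3)] presD(4)[OF R(2)] presD(4)[OF Q(2)]
    by simp
qed

lemma refd_pplus:
  assumes r: "refd X0 X x G g" and q: "refd Y0 Y y H h" and s: "separate X0 Y0" "separate X Y"
  shows "refd (pplus X0 Y0) (pplus X Y) (\<lambda>n. x n \<oplus> y n)
    (\<lambda>w. if w \<in> pidx X0 then G w else H w) (\<lambda>w. if w \<in> pidx X0 then g w else h w)"
  unfolding refd_def
proof (intro conjI ballI)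
  note R = refdD[OF r] and Q = refdD[OF q]
  show "pres (pplus X0 Y0) (\<lambda>n. x n \<oplus> y n)" "pres (pplus X Y) (\<lambda>n. x n \<oplus> y n)"
    using pres_pplus R Q s by blast+
  show "rep (\<lambda>n. Id C (x n \<oplus> y n)) (pplus X0 Y0) (pplus X Y)
    (\<lambda>w. if w \<in> pidx X0 then G w else H w) (\<lambda>w. if w \<in> pidx X0 then g w else h w)"
    using rep_pplus[OF R(1,2) Q(1,2) s R(3) Q(3)] presO[OF R(1)] presO[OF Q(1)] by simp
qed (use refdD[OF r] refdD[OF q] in auto)

lemma separate_leaf: "c \<noteq> d ==> separate (leaf c A x) (leaf d B y)"
  by (auto simp: separate_def)

definition comp_m :: "('o, 'm) presentation \<Rightarrow> ('o, 'm) presentation \<Rightarrow> ('o, 'm) presentation \<Rightarrow> word \<Rightarrow> 'm" where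
  "comp_m X Y Z w = m (pob X (take (plen X) w), pob Y (take (plen Y) (drop (plen X) w)), pob Z (drop (plen X + plen Y) w))"

lemma comp_m_append [simp]:
  "length v = plen X ==> length t = plen Y ==> comp_m X Y Z (v @ t @ b) = m (pob X v, pob Y t, pob Z b)"
  by (simp add: comp_m_def)

text \<open>The presentations by supports serve only to fix the arrow; \<open>drep_mL\<close> shows
  that it is diagonal with components \<open>m\<close> on every presentation.\<close>

definition mL :: "(int \<Rightarrow> 'o) \<times> (int \<Rightarrow> 'o) \<times> (int \<Rightarrow> 'o) \<Rightarrow> int \<Rightarrow> 'm" where
  "mL = (\<lambda>(x, y, z). let X = leaf 0 (supp x) x; Y = leaf 1 (supp y) y; Z = leaf 2 (supp z) z in
     conn (ptimes (ptimes X Y) Z) (ptimes X (ptimes Y Z)) (comp_m X Y Z))"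

lemma wprod3E:
  assumes "w \<in> wprod (wprod S T) R" obtains v t b where "w = v @ t @ b" "v \<in> S" "t \<in> T" "b \<in> R"
  using assms unfolding wprod_def by force

lemma comp_m_props:
  assumes X: "pres X x" and Y: "pres Y y" and Z: "pres Z z" and w: "w \<in> pidx (ptimes (ptimes X Y) Z)"
  shows "comp_m X Y Z w \<in> Arr C" "Dom C (comp_m X Y Z w) = pob (ptimes (ptimes X Y) Z) w"
    "Cod C (comp_m X Y Z w) = pob (ptimes X (ptimes Y Z)) w" "invertible C (comp_m X Y Z w)"
proof -
  obtain v t b where w: "w = v @ t @ b" "v \<in> pidx X" "t \<in> pidx Y" "b \<in> pidx Z" using w by (auto elim: wprod3E)
  have l: "length v = plen X" "length t = plen Y" using presD(1)[OF X] presD(1)[OF Y] w by auto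
  have "tens (plen X + plen Y) (tens (plen X) (pob X) (pob Y)) (pob Z) ((v @ t) @ b) = (pob X v \<otimes> pob Y t) \<otimes> pob Z b"
    using l by (subst tens_append) auto
  then show "comp_m X Y Z w \<in> Arr C" "Dom C (comp_m X Y Z w) = pob (ptimes (ptimes X Y) Z) w"
    "Cod C (comp_m X Y Z w) = pob (ptimes X (ptimes Y Z)) w" "invertible C (comp_m X Y Z w)"
    using w l presD(4)[OF X] presD(4)[OF Y] presD(4)[OF Z] by simp_all
qed

text \<open>The compatibility demanded by \<open>transfer\<close> is \<open>nu_assoc\<close>,
  combined with naturality of \<open>m\<close> in the refining arrows.\<close>

lemma mL_transfer:
  assumes r: "refd X0 X x G g" and q: "refd Y0 Y y H h" and k: "refd Z0 Z z K k"
  shows "drep t (ptimes (ptimes X0 Y0) Z0) (ptimes X0 (ptimes Y0 Z0)) (comp_m X0 Y0 Z0)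
    \<longleftrightarrow> drep t (ptimes (ptimes X Y) Z) (ptimes X (ptimes Y Z)) (comp_m X Y Z)"
proof -
  note R = refdD[OF r] and Q = refdD[OF q] and K = refdD[OF k]
  note A = refd_ptimes[OF refd_ptimes[OF r q] k] and B = refd_ptimes[OF r refd_ptimes[OF q k]]
  show ?thesis
  proof (rule transfer[OF refdD(1-2)[OF A] refdD(1-2)[OF B] refdD(3)[OF A] refdD(3)[OF B]], goal_cases)
    \<comment> \<open>The refinements of both bracketings have the same blocks because concatenation
      is associative.\<close>
    case (1 w)
    then obtain v t b where w: "w = v @ t @ b" "length v = plen X0" "length t = plen Y0"
      using presD(1)[OF R(1)] presD(1)[OF Q(1)] by (auto elim!: wprod3E)
    then show ?case by (simp add: wprod_assoc)
  next
    case (2 w)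
    then show ?case by (intro refdD(4)[OF B]) (simp add: wprod_assoc)
  next
    case (10 w)
    then obtain v t b where w: "w = v @ t @ b" "v \<in> pidx X0" "t \<in> pidx Y0" "b \<in> pidx Z0" by (auto elim: wprod3E)
    have l: "length v = plen X0" "length t = plen Y0" using presD(1)[OF R(1)] presD(1)[OF Q(1)] w by auto
    have G: "words (plen X) (G v)" and H: "words (plen Y) (H t)" and Kf: "finite (K b)"
      using refd_words[OF r w(2)] refd_words[OF q w(3)] repD(2)[OF K(3) w(4)] by auto
    note o = presD(4)[OF R(2)] presD(4)[OF Q(2)] presD(4)[OF K(2)]
    note gv = repD(4-6)[OF R(3) w(2)] and ht = repD(4-6)[OF Q(3) w(3)] and kb = repD(4-6)[OF K(3) w(4)]
    let ?p = "plen X" and ?q = "plen Y" and ?u = "pob X" and ?v = "pob Y" and ?z = "pob Z"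
    let ?n1 = "nu ?q ?v ?z (H t) (K b)" and ?n2 = "nu ?p ?u ?v (G v) (H t)"
    let ?P = "phi (tens (?p + ?q) (tens ?p ?u ?v) ?z) (tens ?p ?u (tens ?q ?v ?z)) (\<lambda>w. {w}) (\<lambda>w. unit (tens ?p ?u (tens ?q ?v ?z)) w \<cdot> comp_m X Y Z w) (wprod (wprod (G v) (H t)) (K b))"
    have bP: "sblock (tens (?p + ?q) (tens ?p ?u ?v) ?z) (tens ?p ?u (tens ?q ?v ?z)) (\<lambda>w. {w}) (\<lambda>w. unit (tens ?p ?u (tens ?q ?v ?z)) w \<cdot> comp_m X Y Z w) (wprod (wprod (G v) (H t)) (K b))"
    proof -
      have "wprod (wprod (G v) (H t)) (K b) \<subseteq> pidx (ptimes (ptimes X Y) Z)"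
        using repD(1)[OF R(3)] repD(1)[OF Q(3)] repD(1)[OF K(3)] w by (force simp: wprod_def)
      then show ?thesis
        by (intro blockI) (use comp_m_props[OF R(2) Q(2) K(2)] G H Kf o in \<open>auto simp: words_finite subset_iff\<close>)
    qed
    note PA = phi_Arr(1-3)[OF bP]
    have c: "?P \<cdot> (nu (?p + ?q) (tens ?p ?u ?v) ?z (wprod (G v) (H t)) (K b) \<cdot> (?n2 \<boxtimes> Id C (sumo ?z (K b))))
      = nu ?p ?u (tens ?q ?v ?z) (G v) (wprod (H t) (K b)) \<cdot> ((Id C (sumo ?u (G v)) \<boxtimes> ?n1) \<cdot> m (sumo ?u (G v), sumo ?v (H t), sumo ?z (K b)))"
      by (rule nu_assoc[symmetric, OF o G H Kf]) (use G H in \<open>auto simp: words_def\<close>)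
    have "?P \<cdot> (nu (?p + ?q) (tens ?p ?u ?v) ?z (wprod (G v) (H t)) (K b) \<cdot> ((?n2 \<cdot> (g v \<boxtimes> h t)) \<boxtimes> k b))
      = (?P \<cdot> (nu (?p + ?q) (tens ?p ?u ?v) ?z (wprod (G v) (H t)) (K b) \<cdot> (?n2 \<boxtimes> Id C (sumo ?z (K b))))) \<cdot> ((g v \<boxtimes> h t) \<boxtimes> k b)"
      using PA gv ht kb o G H Kf words_wprod[OF G H] by (simp add: comp_assoc times.interchange words_finite)
    also have "\<dots> = nu ?p ?u (tens ?q ?v ?z) (G v) (wprod (H t) (K b)) \<cdot> ((Id C (sumo ?u (G v)) \<boxtimes> ?n1) \<cdot> (m (sumo ?u (G v), sumo ?v (H t), sumo ?z (K b)) \<cdot> ((g v \<boxtimes> h t) \<boxtimes> k b)))"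
      unfolding c using gv ht kb o G H Kf by (simp add: comp_assoc words_finite)
    also have "\<dots> = (nu ?p ?u (tens ?q ?v ?z) (G v) (wprod (H t) (K b)) \<cdot> (g v \<boxtimes> (?n1 \<cdot> (h t \<boxtimes> k b)))) \<cdot> m (pob X0 v, pob Y0 t, pob Z0 b)"
      using gv ht kb o G H Kf presD(4)[OF R(1)] presD(4)[OF Q(1)] presD(4)[OF K(1)]
      by (simp add: comp_assoc times.a_nat times.merge words_finite)
    finally show ?case
      using w l by simp
  qed (use comp_m_props[OF R(1) Q(1) K(1)] comp_m_props[OF R(2) Q(2) K(2)] in \<open>auto simp: wprod_assoc\<close>)
qed

lemma drep_mL:
  assumes X: "pres X x" and Y: "pres Y y" and Z: "pres Z z"
  shows "drep (mL (x, y, z)) (ptimes (ptimes X Y) Z) (ptimes X (ptimes Y Z)) (comp_m X Y Z)"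
proof (rule extend3[where S="\<lambda>X Y Z. True" and x=x and y=y and z=z, OF _ _ _ _ mL_transfer])
  let ?X = "leaf 0 (supp x) x" and ?Y = "leaf 1 (supp y) y" and ?Z = "leaf 2 (supp z) z"
  have l: "pres ?X x" "pres ?Y y" "pres ?Z z" using assms by (auto intro: pres_leaf leafy_supp pres_laurent)
  show "drep (mL (x, y, z)) (ptimes (ptimes ?X ?Y) ?Z) (ptimes ?X (ptimes ?Y ?Z)) (comp_m ?X ?Y ?Z)"
    unfolding mL_def Let_def prod.case
    by (rule conn(1)[OF pres_ptimes[OF pres_ptimes[OF l(1,2)] l(3)] pres_ptimes[OF l(1) pres_ptimes[OF l(2,3)]]])
      (use comp_m_props[OF l] in \<open>auto simp: wprod_assoc simp del: leaf_simps\<close>)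
qed (use assms pres_laurent in auto)

lemma mL_invertible:
  assumes "x \<in> laurent_objs C" "y \<in> laurent_objs C" "z \<in> laurent_objs C"
  shows "invertible C (mL (x, y, z) n)"
proof -
  let ?X = "leaf 0 (supp x) x" and ?Y = "leaf 1 (supp y) y" and ?Z = "leaf 2 (supp z) z"
  have l: "pres ?X x" "pres ?Y y" "pres ?Z z" using assms by (auto intro: pres_leaf leafy_supp pres_laurent)
  show ?thesis
    unfolding mL_def Let_def prod.case
    by (rule conn(2)[OF pres_ptimes[OF pres_ptimes[OF l(1,2)] l(3)] pres_ptimes[OF l(1) pres_ptimes[OF l(2,3)]]])
      (use comp_m_props[OF l] in \<open>auto simp: wprod_assoc simp del: leaf_simps\<close>)
qed

end

section \<open>Unitors and distributors of the product\<close>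

context rigid_laplaza
begin

lemma extend1:
  assumes x: "x \<in> laurent_objs C"
    and base: "Q (leaf 0 (supp x) x)"
    and tr: "\<And>X0 X G g. refd X0 X x G g ==> Q X0 \<longleftrightarrow> Q X"
    and X: "pres X x"
  shows "Q X"
proof -
  have z: "(\<lambda>n. \<zero>) \<in> laurent_objs C" by (rule pres_laurent[OF pres_pzero])
  show ?thesis
    by (rule extend3[where Q="\<lambda>X Y Z. Q X" and S="\<lambda>X Y Z. True", OF x z z base _ _ X pres_pzero pres_pzero])
      (use tr in blast)+
qed

text \<open>Both sides have the same summands and the same refining arrows, so the compatibility in
  \<open>transfer\<close> reduces to \<open>phi_trivial\<close>.\<close>

lemma transfer_trivial:
  assumes A: "refd X0 X x G g" and B: "refd Y0 Y y G' g'"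
    and i: "pidx Y0 = pidx X0" "pidx Y = pidx X"
    and o: "\<And>w. w \<in> pidx X0 ==> pob Y0 w = pob X0 w" "\<And>w. w \<in> pidx X ==> pob Y w = pob X w"
    and e: "\<And>w. w \<in> pidx X0 ==> G' w = G w" "\<And>w. w \<in> pidx X0 ==> g' w = g w"
  shows "drep t X0 Y0 (\<lambda>w. Id C (pob X0 w)) \<longleftrightarrow> drep t X Y (\<lambda>w. Id C (pob X w))"
proof (rule transfer[OF refdD(1,2)[OF A] refdD(1,2)[OF B] refdD(3)[OF A] refdD(3)[OF B] e(1)])
  fix w assume w: "w \<in> pidx X0"
  have G: "finite (G w)" "G w \<subseteq> pidx X" using repD(1,2)[OF refdD(3)[OF A]] w by auto
  have "phi (pob X) (pob Y) (\<lambda>w. {w}) (\<lambda>w. unit (pob Y) w \<cdot> Id C (pob X w)) (G w) = Id C (sumo (pob X) (G w))"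
    by (rule phi_trivial) (use G o presD(4)[OF refdD(2)[OF A]] presD(4)[OF refdD(2)[OF B]] in auto)
  then show "phi (pob X) (pob Y) (\<lambda>w. {w}) (\<lambda>w. unit (pob Y) w \<cdot> Id C (pob X w)) (G w) \<cdot> g w = g' w \<cdot> Id C (pob X0 w)"
    using e(2)[OF w] repD(4-6)[OF refdD(3)[OF A] w] by simp
qed (use i o refdD(4)[OF B] presD(4)[OF refdD(1)[OF A]] presD(4)[OF refdD(2)[OF A]] in auto)

abbreviation oneL :: "int \<Rightarrow> 'o" where "oneL \<equiv> (\<lambda>n. if n = 0 then \<one> else \<zero>)"
abbreviation zeroL :: "int \<Rightarrow> 'o" where "zeroL \<equiv> (\<lambda>n. \<zero>)"

text \<open>The empty word is the only index of \<open>pone\<close>, so multiplication by it leaves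
  the set of words unchanged and the unitor can be diagonal.\<close>

definition lmL :: "(int \<Rightarrow> 'o) \<Rightarrow> int \<Rightarrow> 'm" where
  "lmL x = (let X = leaf 0 (supp x) x in conn (ptimes pone X) X (\<lambda>w. lm (pob X w)))"

definition rmL :: "(int \<Rightarrow> 'o) \<Rightarrow> int \<Rightarrow> 'm" where
  "rmL x = (let X = leaf 0 (supp x) x in conn (ptimes X pone) X (\<lambda>w. rm (pob X w)))"

lemma wprod_Nil [simp]: "wprod S {[]} = S"
  by (auto simp: wprod_def)

lemma pidx_ptimes_pone: "pidx (ptimes pone X) = pidx X" "pidx (ptimes X pone) = pidx X"
  by simp_all

lemma pob_ptimes_pone:
  "pob (ptimes pone X) w = \<one> \<otimes> pob X w"
  "pres X x ==> w \<in> pidx X ==> pob (ptimes X pone) w = pob X w \<otimes> \<one>"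
  using presD(1)[of X x w] by (simp_all add: tens_def)

lemma lmL_transfer:
  assumes r: "refd X0 X x G g"
  shows "drep t (ptimes pone X0) X0 (\<lambda>w. lm (pob X0 w)) \<longleftrightarrow> drep t (ptimes pone X) X (\<lambda>w. lm (pob X w))"
proof -
  note R = refdD[OF r]
  note A = refd_ptimes[OF refd_self[OF pres_pone] r]
  show ?thesis
  proof (rule transfer[OF refdD(1,2)[OF A] R(1,2) refdD(3)[OF A] R(3)], goal_cases)
    case (1 w) show ?case by simp
  next
    case (10 w)
    then have w: "w \<in> pidx X0" by simp
    note o = presD(4)[OF R(2)] and gw = repD(2,4-6)[OF R(3) w]
    let ?P = "phi (tens 0 (pob pone) (pob X)) (pob X) (\<lambda>w. {w}) (\<lambda>w. unit (pob X) w \<cdot> lm (pob X w)) (G w)"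
    let ?n = "nu 0 (pob pone) (pob X) {[]} (G w)"
    have b: "sblock (tens 0 (pob pone) (pob X)) (pob X) (\<lambda>w. {w}) (\<lambda>w. unit (pob X) w \<cdot> lm (pob X w)) (G w)"
      by (rule blockI) (use gw o in \<open>auto simp: tens_def\<close>)
    note PA = phi_Arr(1-3)[OF b]
    have e: "?P \<cdot> (?n \<cdot> (unit (pob pone) [] \<boxtimes> Id C (sumo (pob X) (G w)))) = lm (sumo (pob X) (G w))"
      by (rule nu_unit_left) (use gw o in auto)
    have "?P \<cdot> (?n \<cdot> (unit (pob pone) [] \<boxtimes> g w)) = (?P \<cdot> (?n \<cdot> (unit (pob pone) [] \<boxtimes> Id C (sumo (pob X) (G w))))) \<cdot> (Id C \<one> \<boxtimes> g w)"
      using PA gw o by (simp add: comp_assoc times.interchange)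
    also have "\<dots> = g w \<cdot> lm (pob X0 w)"
      unfolding e using gw o by (simp add: times.l_nat)
    finally show ?case
      by simp
  qed (use R(4) presD(4)[OF R(1)] presD(4)[OF R(2)] in \<open>auto simp: pob_ptimes_pone pidx_ptimes_pone simp del: ptimes_simps\<close>)
qed

lemma rmL_transfer:
  assumes r: "refd X0 X x G g"
  shows "drep t (ptimes X0 pone) X0 (\<lambda>w. rm (pob X0 w)) \<longleftrightarrow> drep t (ptimes X pone) X (\<lambda>w. rm (pob X w))"
proof -
  note R = refdD[OF r]
  note A = refd_ptimes[OF r refd_self[OF pres_pone]]
  show ?thesis
  proof (rule transfer[OF refdD(1,2)[OF A] R(1,2) refdD(3)[OF A] R(3)], goal_cases)
    case (1 w) then show ?case using presD(1)[OF R(1)] by simp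
  next
    case (10 w)
    then have w: "w \<in> pidx X0" by simp
    have l: "length w = plen X0" by (rule presD(1)[OF R(1) w])
    have G: "words (plen X) (G w)" by (rule refd_words[OF r w])
    have Gs: "k \<in> pidx X" if "k \<in> G w" for k using repD(1)[OF R(3)] w that by auto
    note o = presD(4)[OF R(2)] and gw = repD(2,4-6)[OF R(3) w]
    let ?P = "phi (tens (plen X) (pob X) (pob pone)) (pob X) (\<lambda>w. {w}) (\<lambda>w. unit (pob X) w \<cdot> rm (pob X w)) (G w)"
    let ?n = "nu (plen X) (pob X) (pob pone) (G w) {[]}"
    have b: "sblock (tens (plen X) (pob X) (pob pone)) (pob X) (\<lambda>w. {w}) (\<lambda>w. unit (pob X) w \<cdot> rm (pob X w)) (G w)"
      by (rule blockI) (use gw o presD(1)[OF R(2) Gs] in \<open>auto simp: tens_def\<close>)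
    note PA = phi_Arr(1-3)[OF b]
    have e: "?P \<cdot> (?n \<cdot> (Id C (sumo (pob X) (G w)) \<boxtimes> unit (pob pone) [])) = rm (sumo (pob X) (G w))"
      by (rule nu_unit_right) (use gw o G in auto)
    have "?P \<cdot> (?n \<cdot> (g w \<boxtimes> unit (pob pone) [])) = (?P \<cdot> (?n \<cdot> (Id C (sumo (pob X) (G w)) \<boxtimes> unit (pob pone) []))) \<cdot> (g w \<boxtimes> Id C \<one>)"
      using PA gw o G by (simp add: comp_assoc times.interchange)
    also have "\<dots> = g w \<cdot> rm (pob X0 w)"
      unfolding e using gw o by (simp add: times.r_nat)
    finally show ?case
      using l by simp
  qed (use R(4) presD(4)[OF R(1)] presD(4)[OF R(2)] pob_ptimes_pone(2)[OF R(1)] pob_ptimes_pone(2)[OF R(2)] in \<open>auto simp: pidx_ptimes_pone simp del: ptimes_simps\<close>)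
qed

lemma lmL:
  assumes "x \<in> laurent_objs C"
  shows "pres X x ==> drep (lmL x) (ptimes pone X) X (\<lambda>w. lm (pob X w))" "invertible C (lmL x n)"
proof -
  let ?X = "leaf 0 (supp x) x"
  have l: "pres ?X x" using assms by (auto intro: pres_leaf leafy_supp)
  have c: "drep (lmL x) (ptimes pone ?X) ?X (\<lambda>w. lm (pob ?X w))" "invertible C (lmL x n)" for n
    unfolding lmL_def Let_def
    by (rule conn[OF pres_ptimes[OF pres_pone l] l];
      use presD(4)[OF l] in \<open>auto simp: pob_ptimes_pone pidx_ptimes_pone simp del: leaf_simps ptimes_simps\<close>)+
  show "invertible C (lmL x n)" by (rule c)
  show "drep (lmL x) (ptimes pone X) X (\<lambda>w. lm (pob X w))" if "pres X x"
    by (rule extend1[where Q="\<lambda>X. drep (lmL x) (ptimes pone X) X (\<lambda>w. lm (pob X w))", OF assms c(1) lmL_transfer that])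
qed

lemma rmL:
  assumes "x \<in> laurent_objs C"
  shows "pres X x ==> drep (rmL x) (ptimes X pone) X (\<lambda>w. rm (pob X w))" "invertible C (rmL x n)"
proof -
  let ?X = "leaf 0 (supp x) x"
  have l: "pres ?X x" using assms by (auto intro: pres_leaf leafy_supp)
  have c: "drep (rmL x) (ptimes ?X pone) ?X (\<lambda>w. rm (pob ?X w))" "invertible C (rmL x n)" for n
    unfolding rmL_def Let_def
    by (rule conn[OF pres_ptimes[OF l pres_pone] l];
      use presD(4)[OF l] pob_ptimes_pone(2)[OF l] in \<open>auto simp: pidx_ptimes_pone simp del: leaf_simps ptimes_simps\<close>)+
  show "invertible C (rmL x n)" by (rule c)
  show "drep (rmL x) (ptimes X pone) X (\<lambda>w. rm (pob X w))" if "pres X x"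
    by (rule extend1[where Q="\<lambda>X. drep (rmL x) (ptimes X pone) X (\<lambda>w. rm (pob X w))", OF assms c(1) rmL_transfer that])
qed

lemma append_in_wprod:
  assumes "\<And>v. v \<in> S ==> length v = p" "length b = p"
  shows "b @ t \<in> wprod S T \<longleftrightarrow> b \<in> S \<and> t \<in> T"
proof
  assume "b @ t \<in> wprod S T"
  then obtain v t' where v: "b @ t = v @ t'" "v \<in> S" "t' \<in> T" unfolding wprod_def by blast
  then show "b \<in> S \<and> t \<in> T" using assms(1)[OF v(2)] assms(2) by simp
qed (auto simp: wprod_def)

lemma separate_ptimes:
  assumes "pres X x" "separate Y Z"
  shows "separate (ptimes X Y) (ptimes X Z)"
  using assms presD(1)[OF assms(1)] wprod_disjoint[of "pidx X" "pidx X" "plen X" "pidx Y" "pidx Z"]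
  by (auto simp: separate_def)

lemma separate_ptimes_right:
  assumes "pres X x" "pres Y y" "separate X Y"
  shows "separate (ptimes X Z) (ptimes Y Z)"
  using assms presD(1)[OF assms(1)] presD(1)[OF assms(2)] wprod_disjoint[of "pidx X" "pidx Y" "plen X" "pidx Z" "pidx Z"]
  by (auto simp: separate_def)

lemma wprod_Un: "wprod S (T \<union> T') = wprod S T \<union> wprod S T'" "wprod (S \<union> S') T = wprod S T \<union> wprod S' T"
  by (auto simp: wprod_def)

lemma pob_left:
  assumes X: "pres X x" and w: "w \<in> pidx (ptimes X (pplus Y Z))" and s: "separate Y Z"
  shows "pob (pplus (ptimes X Y) (ptimes X Z)) w = pob (ptimes X (pplus Y Z)) w"
proof -
  from w obtain v t where w: "w = v @ t" "v \<in> pidx X" "t \<in> pidx Y \<union> pidx Z" unfolding ptimes_simps pplus_simps wprod_def by blast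
  have l: "length v = plen X" by (rule presD(1)[OF X w(2)])
  have "w \<in> wprod (pidx X) (pidx Y) \<longleftrightarrow> t \<in> pidx Y"
    using append_in_wprod[of "pidx X" "plen X" v t "pidx Y"] presD(1)[OF X] l w by simp
  then show ?thesis using w l by (simp add: pob_pplus)
qed

lemma pob_right:
  assumes X: "pres X x" and Y: "pres Y y" and w: "w \<in> pidx (ptimes (pplus X Y) Z)" and s: "separate X Y"
  shows "pob (pplus (ptimes X Z) (ptimes Y Z)) w = pob (ptimes (pplus X Y) Z) w"
proof -
  from w obtain v t where w: "w = v @ t" "v \<in> pidx X \<union> pidx Y" "t \<in> pidx Z" unfolding ptimes_simps pplus_simps wprod_def by blast
  have p: "plen Y = plen X" using s by (simp add: separate_def)
  have l: "length v = plen X" using presD(1)[OF X] presD(1)[OF Y] w(2) p by auto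
  have "w \<in> wprod (pidx X) (pidx Z) \<longleftrightarrow> v \<in> pidx X"
    using append_in_wprod[of "pidx X" "plen X" v t "pidx Z"] presD(1)[OF X] l w by simp
  then show ?thesis using w l p by (simp add: pob_pplus)
qed

text \<open>Expanded into words, both sides of the distributive law are the same sum. So the
  components are identities, and the distributors of \<open>C\<close> are hidden in the
  parametrizations \<open>par\<close>.\<close>

definition dlL :: "(int \<Rightarrow> 'o) \<times> (int \<Rightarrow> 'o) \<times> (int \<Rightarrow> 'o) \<Rightarrow> int \<Rightarrow> 'm" where
  "dlL = (\<lambda>(x, y, z). let X = leaf 0 (supp x) x; Y = leaf 1 (supp y) y; Z = leaf 2 (supp z) z in
     conn (ptimes X (pplus Y Z)) (pplus (ptimes X Y) (ptimes X Z)) (\<lambda>w. Id C (pob (ptimes X (pplus Y Z)) w)))"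

definition drL :: "(int \<Rightarrow> 'o) \<times> (int \<Rightarrow> 'o) \<times> (int \<Rightarrow> 'o) \<Rightarrow> int \<Rightarrow> 'm" where
  "drL = (\<lambda>(x, y, z). let X = leaf 0 (supp x) x; Y = leaf 1 (supp y) y; Z = leaf 2 (supp z) z in
     conn (ptimes (pplus X Y) Z) (pplus (ptimes X Z) (ptimes Y Z)) (\<lambda>w. Id C (pob (ptimes (pplus X Y) Z) w)))"

lemma dlL_transfer:
  assumes r: "refd X0 X x G g" and q: "refd Y0 Y y H h" and k: "refd Z0 Z z K k"
    and s: "separate Y0 Z0" "separate Y Z"
  shows "drep t (ptimes X0 (pplus Y0 Z0)) (pplus (ptimes X0 Y0) (ptimes X0 Z0)) (\<lambda>w. Id C (pob (ptimes X0 (pplus Y0 Z0)) w))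
    \<longleftrightarrow> drep t (ptimes X (pplus Y Z)) (pplus (ptimes X Y) (ptimes X Z)) (\<lambda>w. Id C (pob (ptimes X (pplus Y Z)) w))"
proof -
  note R = refdD[OF r] and Q = refdD[OF q] and K = refdD[OF k]
  note A = refd_ptimes[OF r refd_pplus[OF q k s]]
    and B = refd_pplus[OF refd_ptimes[OF r q] refd_ptimes[OF r k] separate_ptimes[OF R(1) s(1)] separate_ptimes[OF R(2) s(2)]]
  \<comment> \<open>The case distinction of the sum may be made before or after the product, because
    a concatenated word shows from which summand its last part comes.\<close>
  have e: "(if w \<in> pidx (ptimes X0 Y0) then wprod (G (take (plen X0) w)) (H (drop (plen X0) w)) else wprod (G (take (plen X0) w)) (K (drop (plen X0) w)))
     = wprod (G (take (plen X0) w)) (if drop (plen X0) w \<in> pidx Y0 then H (drop (plen X0) w) else K (drop (plen X0) w)) \<and>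
     (if w \<in> pidx (ptimes X0 Y0) then nu (plen X) (pob X) (pob Y) (G (take (plen X0) w)) (H (drop (plen X0) w)) \<cdot> (g (take (plen X0) w) \<boxtimes> h (drop (plen X0) w))
      else nu (plen X) (pob X) (pob Z) (G (take (plen X0) w)) (K (drop (plen X0) w)) \<cdot> (g (take (plen X0) w) \<boxtimes> k (drop (plen X0) w)))
     = nu (plen X) (pob X) (pob (pplus Y Z)) (G (take (plen X0) w)) (if drop (plen X0) w \<in> pidx Y0 then H (drop (plen X0) w) else K (drop (plen X0) w)) \<cdot>
       (g (take (plen X0) w) \<boxtimes> (if drop (plen X0) w \<in> pidx Y0 then h (drop (plen X0) w) else k (drop (plen X0) w)))"
    if W: "w \<in> pidx (ptimes X0 (pplus Y0 Z0))" for w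
  proof -
    from W obtain v t where w: "w = v @ t" "v \<in> pidx X0" "t \<in> pidx Y0 \<union> pidx Z0" unfolding ptimes_simps pplus_simps wprod_def by blast
    have l: "length v = plen X0" by (rule presD(1)[OF R(1) w(2)])
    have m: "w \<in> pidx (ptimes X0 Y0) \<longleftrightarrow> t \<in> pidx Y0"
      using append_in_wprod[of "pidx X0" "plen X0" v t "pidx Y0"] presD(1)[OF R(1)] l w by simp
    have Gv: "words (plen X) (G v)" by (rule refd_words[OF r w(2)])
    show ?thesis
    proof (cases "t \<in> pidx Y0")
      case True
      have "nu (plen X) (pob X) (pob Y) (G v) (H t) = nu (plen X) (pob X) (pob (pplus Y Z)) (G v) (H t)"
        by (rule nu_cong[OF Gv]) (use repD(1,2)[OF Q(3)] True in \<open>auto simp: pob_pplus\<close>)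
      then show ?thesis using True w l m by simp
    next
      case False
      then have t: "t \<in> pidx Z0" using w by auto
      have "nu (plen X) (pob X) (pob Z) (G v) (K t) = nu (plen X) (pob X) (pob (pplus Y Z)) (G v) (K t)"
        by (rule nu_cong[OF Gv]) (use repD(1,2)[OF K(3)] t s(2) in \<open>auto simp: pob_pplus separate_def\<close>)
      then show ?thesis using False w l m by simp
    qed
  qed
  show ?thesis
    by (rule transfer_trivial[OF A B])
      (use e pob_left[OF R(1) _ s(1)] pob_left[OF R(2) _ s(2)] in \<open>simp_all only: pplus_simps ptimes_simps wprod_Un\<close>)
qed

lemma drL_transfer:
  assumes r: "refd X0 X x G g" and q: "refd Y0 Y y H h" and k: "refd Z0 Z z K k"
    and s: "separate X0 Y0" "separate X Y"
  shows "drep t (ptimes (pplus X0 Y0) Z0) (pplus (ptimes X0 Z0) (ptimes Y0 Z0)) (\<lambda>w. Id C (pob (ptimes (pplus X0 Y0) Z0) w))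
    \<longleftrightarrow> drep t (ptimes (pplus X Y) Z) (pplus (ptimes X Z) (ptimes Y Z)) (\<lambda>w. Id C (pob (ptimes (pplus X Y) Z) w))"
proof -
  note R = refdD[OF r] and Q = refdD[OF q] and K = refdD[OF k]
  have p0: "plen Y0 = plen X0" "plen Y = plen X" using s by (auto simp: separate_def)
  note A = refd_ptimes[OF refd_pplus[OF r q s] k]
    and B = refd_pplus[OF refd_ptimes[OF r k] refd_ptimes[OF q k] separate_ptimes_right[OF R(1) Q(1) s(1)] separate_ptimes_right[OF R(2) Q(2) s(2)], unfolded p0]
  have e: "(if w \<in> pidx (ptimes X0 Z0) then wprod (G (take (plen X0) w)) (K (drop (plen X0) w)) else wprod (H (take (plen X0) w)) (K (drop (plen X0) w)))
     = wprod (if take (plen X0) w \<in> pidx X0 then G (take (plen X0) w) else H (take (plen X0) w)) (K (drop (plen X0) w)) \<and>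
     (if w \<in> pidx (ptimes X0 Z0) then nu (plen X) (pob X) (pob Z) (G (take (plen X0) w)) (K (drop (plen X0) w)) \<cdot> (g (take (plen X0) w) \<boxtimes> k (drop (plen X0) w))
      else nu (plen X) (pob Y) (pob Z) (H (take (plen X0) w)) (K (drop (plen X0) w)) \<cdot> (h (take (plen X0) w) \<boxtimes> k (drop (plen X0) w)))
     = nu (plen X) (pob (pplus X Y)) (pob Z) (if take (plen X0) w \<in> pidx X0 then G (take (plen X0) w) else H (take (plen X0) w)) (K (drop (plen X0) w)) \<cdot>
       ((if take (plen X0) w \<in> pidx X0 then g (take (plen X0) w) else h (take (plen X0) w)) \<boxtimes> k (drop (plen X0) w))"
    if W: "w \<in> pidx (ptimes (pplus X0 Y0) Z0)" for w
  proof -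
    from W obtain v t where w: "w = v @ t" "v \<in> pidx X0 \<union> pidx Y0" "t \<in> pidx Z0" unfolding ptimes_simps pplus_simps wprod_def by blast
    have l: "length v = plen X0" using presD(1)[OF R(1)] presD(1)[OF Q(1)] w(2) p0 by auto
    have m: "w \<in> pidx (ptimes X0 Z0) \<longleftrightarrow> v \<in> pidx X0"
      using append_in_wprod[of "pidx X0" "plen X0" v t "pidx Z0"] presD(1)[OF R(1)] l w by simp
    have Kf: "finite (K t)" using repD(2)[OF K(3) w(3)] .
    show ?thesis
    proof (cases "v \<in> pidx X0")
      case True
      have "nu (plen X) (pob X) (pob Z) (G v) (K t) = nu (plen X) (pob (pplus X Y)) (pob Z) (G v) (K t)"
        by (rule nu_cong[OF refd_words[OF r True] Kf]) (use repD(1)[OF R(3)] True in \<open>auto simp: pob_pplus\<close>)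
      then show ?thesis using True w l m by simp
    next
      case False
      then have v: "v \<in> pidx Y0" using w by auto
      have Hv: "words (plen X) (H v)" using refd_words[OF q v] p0 by simp
      have "nu (plen X) (pob Y) (pob Z) (H v) (K t) = nu (plen X) (pob (pplus X Y)) (pob Z) (H v) (K t)"
        by (rule nu_cong[OF Hv Kf]) (use repD(1)[OF Q(3)] v s(2) in \<open>auto simp: pob_pplus separate_def\<close>)
      then show ?thesis using False w l m by simp
    qed
  qed
  show ?thesis
    by (rule transfer_trivial[OF A B])
      (use e pob_right[OF R(1) Q(1) _ s(1)] pob_right[OF R(2) Q(2) _ s(2)] in \<open>simp_all only: pplus_simps ptimes_simps wprod_Un\<close>)
qed

lemma dlL:
  assumes x: "x \<in> laurent_objs C" and y: "y \<in> laurent_objs C" and z: "z \<in> laurent_objs C"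
  shows "pres X x ==> pres Y y ==> pres Z z ==> separate Y Z ==>
      drep (dlL (x, y, z)) (ptimes X (pplus Y Z)) (pplus (ptimes X Y) (ptimes X Z)) (\<lambda>w. Id C (pob (ptimes X (pplus Y Z)) w))"
    "invertible C (dlL (x, y, z) n)"
proof -
  let ?X = "leaf 0 (supp x) x" and ?Y = "leaf 1 (supp y) y" and ?Z = "leaf 2 (supp z) z"
  have l: "pres ?X x" "pres ?Y y" "pres ?Z z" using assms by (auto intro: pres_leaf leafy_supp)
  have s: "separate ?Y ?Z" by (rule separate_leaf) simp
  note P = pres_ptimes[OF l(1) pres_pplus[OF l(2,3) s]] and Q = pres_pplus[OF pres_ptimes[OF l(1,2)] pres_ptimes[OF l(1,3)] separate_ptimes[OF l(1) s]]
  have c: "drep (dlL (x, y, z)) (ptimes ?X (pplus ?Y ?Z)) (pplus (ptimes ?X ?Y) (ptimes ?X ?Z)) (\<lambda>w. Id C (pob (ptimes ?X (pplus ?Y ?Z)) w))"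
    "invertible C (dlL (x, y, z) n)" for n
    unfolding dlL_def Let_def prod.case
    by (rule conn[OF P Q]; use presD(4)[OF P] pob_left[OF l(1) _ s] in \<open>simp add: wprod_Un del: leaf_simps\<close>)+
  show "invertible C (dlL (x, y, z) n)" by (rule c)
  show "drep (dlL (x, y, z)) (ptimes X (pplus Y Z)) (pplus (ptimes X Y) (ptimes X Z)) (\<lambda>w. Id C (pob (ptimes X (pplus Y Z)) w))"
    if "pres X x" "pres Y y" "pres Z z" "separate Y Z"
    by (rule extend3[where S="\<lambda>X Y Z. separate Y Z" and x=x and y=y and z=z and
        Q="\<lambda>X Y Z. drep (dlL (x, y, z)) (ptimes X (pplus Y Z)) (pplus (ptimes X Y) (ptimes X Z)) (\<lambda>w. Id C (pob (ptimes X (pplus Y Z)) w))", OF assms c(1) dlL_transfer _ that])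
      (auto intro: separate_leaf)
qed

lemma drL:
  assumes x: "x \<in> laurent_objs C" and y: "y \<in> laurent_objs C" and z: "z \<in> laurent_objs C"
  shows "pres X x ==> pres Y y ==> pres Z z ==> separate X Y ==>
      drep (drL (x, y, z)) (ptimes (pplus X Y) Z) (pplus (ptimes X Z) (ptimes Y Z)) (\<lambda>w. Id C (pob (ptimes (pplus X Y) Z) w))"
    "invertible C (drL (x, y, z) n)"
proof -
  let ?X = "leaf 0 (supp x) x" and ?Y = "leaf 1 (supp y) y" and ?Z = "leaf 2 (supp z) z"
  have l: "pres ?X x" "pres ?Y y" "pres ?Z z" using assms by (auto intro: pres_leaf leafy_supp)
  have s: "separate ?X ?Y" by (rule separate_leaf) simp
  note P = pres_ptimes[OF pres_pplus[OF l(1,2) s] l(3)] and Q = pres_pplus[OF pres_ptimes[OF l(1,3)] pres_ptimes[OF l(2,3)] separate_ptimes_right[OF l(1,2) s]]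
  have c: "drep (drL (x, y, z)) (ptimes (pplus ?X ?Y) ?Z) (pplus (ptimes ?X ?Z) (ptimes ?Y ?Z)) (\<lambda>w. Id C (pob (ptimes (pplus ?X ?Y) ?Z) w))"
    "invertible C (drL (x, y, z) n)" for n
    unfolding drL_def Let_def prod.case
    by (rule conn[OF P Q]; use presD(4)[OF P] pob_right[OF l(1,2) _ s] in \<open>simp add: wprod_Un del: leaf_simps\<close>)+
  show "invertible C (drL (x, y, z) n)" by (rule c)
  show "drep (drL (x, y, z)) (ptimes (pplus X Y) Z) (pplus (ptimes X Z) (ptimes Y Z)) (\<lambda>w. Id C (pob (ptimes (pplus X Y) Z) w))"
    if "pres X x" "pres Y y" "pres Z z" "separate X Y"
    by (rule extend3[where S="\<lambda>X Y Z. separate X Y" and x=x and y=y and z=z and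
        Q="\<lambda>X Y Z. drep (drL (x, y, z)) (ptimes (pplus X Y) Z) (pplus (ptimes X Z) (ptimes Y Z)) (\<lambda>w. Id C (pob (ptimes (pplus X Y) Z) w))", OF assms c(1) drL_transfer _ that])
      (auto intro: separate_leaf)
qed

end

section \<open>The Laurent category\<close>

context rigid_laplaza
begin

abbreviation L :: "(int \<Rightarrow> 'o, int \<Rightarrow> 'm) rig_cat" where "L \<equiv> laurent C ctimes"

lemma L_simps [simp]:
  "Obj L = laurent_objs C" "Arr L = laurent_arrs C" "Dom L \<phi> = (\<lambda>n. Dom C (\<phi> n))" "Cod L \<phi> = (\<lambda>n. Cod C (\<phi> n))"
  "Id L x = (\<lambda>n. Id C (x n))" "Comp L \<psi> \<phi> = (\<lambda>n. \<psi> n \<cdot> \<phi> n)"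
  "x \<oplus>\<^bsub>L\<^esub> y = (\<lambda>n. x n \<oplus> y n)" "\<phi> \<boxplus>\<^bsub>L\<^esub> \<psi> = (\<lambda>n. \<phi> n \<boxplus> \<psi> n)"
  "x \<otimes>\<^bsub>L\<^esub> y = cauchy_prod C x y" "\<phi> \<boxtimes>\<^bsub>L\<^esub> \<psi> = ctimes (\<phi>, \<psi>)"
  "\<zero>\<^bsub>L\<^esub> = zeroL" "\<one>\<^bsub>L\<^esub> = oneL"
  by (simp_all add: laurent_def)

lemma laurent_arrs_iff: "\<phi> \<in> laurent_arrs C \<longleftrightarrow> larr \<phi> (\<lambda>n. Dom C (\<phi> n)) (\<lambda>n. Cod C (\<phi> n))"
  by (auto simp: laurent_arrs_def larr_def)

lemma hom_L: "\<phi> \<in> hom L x y \<longleftrightarrow> larr \<phi> x y"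
  by (auto simp: hom_def larr_def laurent_arrs_def)

lemma larr_laurent: "larr \<phi> x y ==> \<phi> \<in> laurent_arrs C \<and> (\<lambda>n. Dom C (\<phi> n)) = x \<and> (\<lambda>n. Cod C (\<phi> n)) = y"
  by (auto simp: larr_def laurent_arrs_def)

lemma category_L: "category L"
  by unfold_locales
    (auto simp: hom_L laurent_arrs_def intro: larr_id larr_comp, auto simp: larr_def comp_assoc)

lemma invertible_L:
  assumes "larr \<phi> x y" "\<And>n. invertible C (\<phi> n)"
  shows "invertible L \<phi>"
proof -
  have "larr (\<lambda>n. arr_inv (\<phi> n)) y x" using assms by (auto simp: larr_def)
  then show ?thesis
    unfolding invertible_def using assms larrD[OF assms(1)] larr_laurent[OF assms(1)]
    by (intro bexI[of _ "\<lambda>n. arr_inv (\<phi> n)"]) (auto simp: hom_L)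
qed

lemma laurent_plus:
  assumes "x \<in> laurent_objs C" "y \<in> laurent_objs C"
  shows "(\<lambda>n. x n \<oplus> y n) \<in> laurent_objs C"
  using pres_laurent[OF pres_pplus[OF pres_leaf[OF leafy_supp[OF assms(1)]] pres_leaf[OF leafy_supp[OF assms(2)]] separate_leaf[of 0 1]]]
  by simp

lemma larr_plus: "larr \<phi> x y ==> larr \<psi> x' y' ==> larr (\<lambda>n. \<phi> n \<boxplus> \<psi> n) (\<lambda>n. x n \<oplus> x' n) (\<lambda>n. y n \<oplus> y' n)"
  using laurent_plus by (auto simp: larr_def)

lemma larr_times: "larr \<phi> x y ==> larr \<psi> x' y' ==> larr (ctimes (\<phi>, \<psi>)) (cauchy_prod C x x') (cauchy_prod C y y')"
  using cauchy_prod_laurent ctimes_Arr[of \<phi> x y \<psi> x' y'] by (auto simp: larr_def)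

lemma zeroL_laurent: "zeroL \<in> laurent_objs C" and oneL_laurent: "oneL \<in> laurent_objs C"
  using pres_laurent[OF pres_pzero] pres_laurent[OF pres_pone] by auto

lemma is_functor_L:
  assumes "\<And>x. x \<in> Obj D ==> F x \<in> laurent_objs C"
    "\<And>\<phi>. \<phi> \<in> Arr D ==> larr (F' \<phi>) (F (Dom D \<phi>)) (F (Cod D \<phi>))"
    "\<And>x. x \<in> Obj D ==> F' (Id D x) = (\<lambda>n. Id C (F x n))"
    "\<And>\<phi> \<psi>. \<phi> \<in> Arr D ==> \<psi> \<in> Arr D ==> Cod D \<phi> = Dom D \<psi> ==> F' (Comp D \<psi> \<phi>) = (\<lambda>n. F' \<psi> n \<cdot> F' \<phi> n)"
  shows "is_functor D L (Ftor F F')"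
  using assms by (auto simp: is_functor_def hom_L)

lemma functor_plus_L: "is_functor (pow2 L) L (Plus L)"
proof -
  have e: "Plus L = Ftor (\<lambda>(x, y) n. x n \<oplus> y n) (\<lambda>(\<phi>, \<psi>) n. \<phi> n \<boxplus> \<psi> n)" by (simp add: laurent_def)
  show ?thesis
    unfolding e
    by (rule is_functor_L)
      (auto simp: laurent_plus laurent_objsD laurent_arrs_iff intro!: larr_plus, auto simp: larr_def interchange fun_eq_iff)
qed

lemma functor_times_L: "is_functor (pow2 L) L (Times L)"
proof -
  have e: "Times L = Ftor (\<lambda>(x, y). cauchy_prod C x y) ctimes" by (simp add: laurent_def)
  show ?thesis
    unfolding e
  proof (rule is_functor_L)
    fix \<phi> \<psi> assume "\<phi> \<in> Arr (pow2 L)" "\<psi> \<in> Arr (pow2 L)" "Cod (pow2 L) \<phi> = Dom (pow2 L) \<psi>"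
    then show "ctimes (Comp (pow2 L) \<psi> \<phi>) = (\<lambda>n. ctimes \<psi> n \<cdot> ctimes \<phi> n)"
      by (cases \<phi>; cases \<psi>) (auto simp: laurent_arrs_iff ctimes_comp)
  qed (auto simp: cauchy_prod_laurent ctimes_id laurent_arrs_iff intro!: larr_times)
qed

lemma natural_L:
  assumes "\<And>x. x \<in> Obj D ==> larr (t x) (F x) (G x) \<and> (\<forall>n. invertible C (t x n))"
    "\<And>\<phi>. \<phi> \<in> Arr D ==> (\<lambda>n. t (Cod D \<phi>) n \<cdot> F' \<phi> n) = (\<lambda>n. G' \<phi> n \<cdot> t (Dom D \<phi>) n)"
  shows "natural_iso D L (Ftor F F') (Ftor G G') t"
  unfolding natural_iso_def using assms by (auto simp: hom_L intro: invertible_L)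

lemma natural1_L:
  assumes "\<And>x. x \<in> laurent_objs C ==> larr (t x) (F x) (G x) \<and> (\<forall>n. invertible C (t x n))"
    "\<And>\<phi> x y. larr \<phi> x y ==> (\<lambda>n. t y n \<cdot> F' \<phi> n) = (\<lambda>n. G' \<phi> n \<cdot> t x n)"
  shows "natural_iso L L (Ftor F F') (Ftor G G') t"
  by (rule natural_L) (use assms in \<open>auto simp: laurent_arrs_iff\<close>)

lemma natural2_L:
  assumes "\<And>x y. x \<in> laurent_objs C ==> y \<in> laurent_objs C ==>
      larr (t (x, y)) (F (x, y)) (G (x, y)) \<and> (\<forall>n. invertible C (t (x, y) n))"
    "\<And>\<phi> \<psi> x x' y y'. larr \<phi> x x' ==> larr \<psi> y y' ==> (\<lambda>n. t (x', y') n \<cdot> F' (\<phi>, \<psi>) n) = (\<lambda>n. G' (\<phi>, \<psi>) n \<cdot> t (x, y) n)"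
  shows "natural_iso (pow2 L) L (Ftor F F') (Ftor G G') t"
  by (rule natural_L) (use assms in \<open>auto simp: laurent_arrs_iff\<close>)

lemma natural3_L:
  assumes "\<And>x y z. x \<in> laurent_objs C ==> y \<in> laurent_objs C ==> z \<in> laurent_objs C ==>
      larr (t (x, y, z)) (F (x, y, z)) (G (x, y, z)) \<and> (\<forall>n. invertible C (t (x, y, z) n))"
    "\<And>\<phi> \<psi> \<chi> x x' y y' z z'. larr \<phi> x x' ==> larr \<psi> y y' ==> larr \<chi> z z' ==>
      (\<lambda>n. t (x', y', z') n \<cdot> F' (\<phi>, \<psi>, \<chi>) n) = (\<lambda>n. G' (\<phi>, \<psi>, \<chi>) n \<cdot> t (x, y, z) n)"
  shows "natural_iso (pow3 L) L (Ftor F F') (Ftor G G') t"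
  by (rule natural_L) (use assms in \<open>auto simp: laurent_arrs_iff\<close>)

text \<open>Bundles \<open>drep\<close> with the presentations of both ends, so that the components
  of a composite of structure maps are obtained by nesting rules.\<close>

definition rarr where
  "rarr \<phi> X x Y y g \<longleftrightarrow> pres X x \<and> pres Y y \<and> drep \<phi> X Y g"

lemma rarr_unique:
  "rarr \<phi> X x Y y g ==> rarr \<psi> X x Y y h ==> (\<And>w. w \<in> pidx X ==> g w = h w) ==> \<phi> = \<psi>"
  unfolding rarr_def using drep_unique by blast

lemma rarr_larr: "rarr \<phi> X x Y y g ==> larr \<phi> x y"
  unfolding rarr_def using drep_larr by blast

lemma rarr_comp: "rarr \<phi> X x Y y g ==> rarr \<psi> Y y Z z h ==> rarr (\<lambda>n. \<psi> n \<cdot> \<phi> n) X x Z z (\<lambda>w. h w \<cdot> g w)"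
  unfolding rarr_def using drep_comp by blast

lemma rarr_id: "pres X x ==> rarr (\<lambda>n. Id C (x n)) X x X x (\<lambda>w. Id C (pob X w))"
  unfolding rarr_def using drep_id by blast

lemma rarr_times: "rarr \<phi> X x X' x' g ==> rarr \<psi> Y y Y' y' h ==> plen X' = plen X ==>
    rarr (ctimes (\<phi>, \<psi>)) (ptimes X Y) (cauchy_prod C x y) (ptimes X' Y') (cauchy_prod C x' y')
      (\<lambda>w. g (take (plen X) w) \<boxtimes> h (drop (plen X) w))"
  unfolding rarr_def by (intro conjI pres_ptimes drep_ptimes[of X x X' x' Y y Y' y']) auto

lemma rarr_plus: "rarr \<phi> X x X' x' g ==> rarr \<psi> Y y Y' y' h ==> separate X Y ==> separate X' Y' ==>
    rarr (\<lambda>n. \<phi> n \<boxplus> \<psi> n) (pplus X Y) (\<lambda>n. x n \<oplus> y n) (pplus X' Y') (\<lambda>n. x' n \<oplus> y' n)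
      (\<lambda>w. if w \<in> pidx X then g w else h w)"
  unfolding rarr_def by (intro conjI pres_pplus drep_pplus[of X x X' x' Y y Y' y']) auto

lemma rarr_leaf: "larr \<phi> x y ==> leafy B x ==> leafy B y ==> rarr \<phi> (leaf c B x) x (leaf c B y) y (\<lambda>w. \<phi> (snd (hd w)))"
  unfolding rarr_def using pres_leaf drep_leaf by blast

lemma rarr_m: "pres X x ==> pres Y y ==> pres Z z ==>
    rarr (mL (x, y, z)) (ptimes (ptimes X Y) Z) (cauchy_prod C (cauchy_prod C x y) z)
      (ptimes X (ptimes Y Z)) (cauchy_prod C x (cauchy_prod C y z)) (comp_m X Y Z)"
  unfolding rarr_def by (intro conjI pres_ptimes drep_mL)

lemma rarr_lm: "pres X x ==> rarr (lmL x) (ptimes pone X) (cauchy_prod C oneL x) X x (\<lambda>w. lm (pob X w))"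
  and rarr_rm: "pres X x ==> rarr (rmL x) (ptimes X pone) (cauchy_prod C x oneL) X x (\<lambda>w. rm (pob X w))"
  unfolding rarr_def by (intro conjI pres_ptimes pres_pone lmL(1) rmL(1) pres_laurent; assumption)+

lemma rarr_dl: "pres X x ==> pres Y y ==> pres Z z ==> separate Y Z ==>
    rarr (dlL (x, y, z)) (ptimes X (pplus Y Z)) (cauchy_prod C x (\<lambda>n. y n \<oplus> z n))
      (pplus (ptimes X Y) (ptimes X Z)) (\<lambda>n. cauchy_prod C x y n \<oplus> cauchy_prod C x z n) (\<lambda>w. Id C (pob (ptimes X (pplus Y Z)) w))"
  unfolding rarr_def
  by (intro conjI pres_ptimes pres_pplus dlL(1) separate_ptimes pres_laurent[of X x] pres_laurent[of Y y] pres_laurent[of Z z]; assumption)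

lemma rarr_dr: "pres X x ==> pres Y y ==> pres Z z ==> separate X Y ==>
    rarr (drL (x, y, z)) (ptimes (pplus X Y) Z) (cauchy_prod C (\<lambda>n. x n \<oplus> y n) z)
      (pplus (ptimes X Z) (ptimes Y Z)) (\<lambda>n. cauchy_prod C x z n \<oplus> cauchy_prod C y z n) (\<lambda>w. Id C (pob (ptimes (pplus X Y) Z) w))"
  unfolding rarr_def
  by (intro conjI pres_ptimes pres_pplus drL(1) separate_ptimes_right[of X x Y y] pres_laurent[of X x] pres_laurent[of Y y] pres_laurent[of Z z]; assumption)

text \<open>Both sides are empty sums, so the equation compares arrows between null objects and any
  components are admissible.\<close>

lemma rarr_zero:
  assumes X: "pres X zeroL" and Y: "pres Y zeroL" and i: "pidx X = {}" "pidx Y = {}"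
  shows "rarr (\<lambda>n. Id C \<zero>) X zeroL Y zeroL g"
proof -
  have "grade X n = {}" "grade Y n = {}" for n using i by (simp_all add: grade_def)
  then have "par Y n \<cdot> Id C \<zero> = phi (pob X) (pob Y) (\<lambda>w. {w}) (\<lambda>w. unit (pob Y) w \<cdot> g w) {} \<cdot> par X n" for n
    by (intro null_arrow_unique[of \<zero> \<zero>]) (use presD(5-8)[OF X, of n] presD(5-8)[OF Y, of n] in auto)
  then show ?thesis
    unfolding rarr_def using X Y i presD[OF X] presD[OF Y]
    by (auto intro!: drepI[OF Y] simp: grade_def)
qed

text \<open>Both bracketings have the same words, and \<open>mu_assoc\<close> is the statement that
  the associator becomes the identity on them. For the symmetry below, \<open>mu_sym\<close> plays
  this part.\<close>

lemma rarr_a: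
  assumes X: "pres X x" and Y: "pres Y y" and Z: "pres Z z" and s: "separate X Y" "separate X Z" "separate Y Z"
  shows "rarr (\<lambda>n. a (x n, y n, z n)) (pplus (pplus X Y) Z) (\<lambda>n. (x n \<oplus> y n) \<oplus> z n) (pplus X (pplus Y Z)) (\<lambda>n. x n \<oplus> (y n \<oplus> z n))
    (\<lambda>w. Id C (pob (pplus (pplus X Y) Z) w))"
proof -
  have s': "separate (pplus X Y) Z" "separate X (pplus Y Z)" using s by (auto simp: separate_def)
  note P = pres_pplus[OF pres_pplus[OF X Y s(1)] Z s'(1)] and Q = pres_pplus[OF X pres_pplus[OF Y Z s(3)] s'(2)]
  let ?u = "pob (pplus (pplus X Y) Z)"
  have d: "grade X n \<inter> grade Y n = {}" "grade X n \<inter> grade Z n = {}" "grade Y n \<inter> grade Z n = {}"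
    "(grade X n \<union> grade Y n) \<inter> grade Z n = {}" "grade X n \<inter> (grade Y n \<union> grade Z n) = {}" for n
    using s by (auto simp: separate_def grade_iff)
  have u: "?u = pob (pplus X (pplus Y Z))" by (auto simp: pob_pplus)
  have c: "mu (pob (pplus X Y)) (grade X n) (grade Y n) = mu ?u (grade X n) (grade Y n)"
    "mu (pob (pplus Y Z)) (grade Y n) (grade Z n) = mu ?u (grade Y n) (grade Z n)"
    "sumo (pob X) (grade X n) = sumo ?u (grade X n)" "sumo (pob Y) (grade Y n) = sumo ?u (grade Y n)" "sumo (pob Z) (grade Z n) = sumo ?u (grade Z n)" for n
    using s presD(3)[OF X] presD(3)[OF Y] presD(3)[OF Z]
    by (auto intro!: mu_cong sumo_cong simp: pob_pplus separate_def grade_iff)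
  note A = presD(3-8)[OF X] presD(3-8)[OF Y] presD(3-8)[OF Z] presO[OF X] presO[OF Y] presO[OF Z] presD(4)[OF P]
  have "drep (\<lambda>n. a (x n, y n, z n)) (pplus (pplus X Y) Z) (pplus X (pplus Y Z)) (\<lambda>w. Id C (?u w))"
  proof (rule drep_trivial[OF P Q])
    fix n
    have "par (pplus (pplus X Y) Z) n = (mu ?u (grade X n \<union> grade Y n) (grade Z n) \<cdot> (mu ?u (grade X n) (grade Y n) \<boxplus> Id C (sumo ?u (grade Z n)))) \<cdot> ((par X n \<boxplus> par Y n) \<boxplus> par Z n)"
      unfolding par_pplus pplus_simps c using A d by (simp add: comp_assoc interchange c)
    also have "\<dots> = (mu ?u (grade X n) (grade Y n \<union> grade Z n) \<cdot> (Id C (sumo ?u (grade X n)) \<boxplus> mu ?u (grade Y n) (grade Z n))) \<cdot> (a (sumo ?u (grade X n), sumo ?u (grade Y n), sumo ?u (grade Z n)) \<cdot> ((par X n \<boxplus> par Y n) \<boxplus> par Z n))"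
      using mu_assoc[of ?u "grade X n" "grade Y n" "grade Z n"] A d by (simp add: comp_assoc c)
    also have "\<dots> = par (pplus X (pplus Y Z)) n \<cdot> a (x n, y n, z n)"
      unfolding par_pplus pplus_simps c u[symmetric] using A d by (simp add: comp_assoc interchange merge a_nat c)
    finally show "par (pplus X (pplus Y Z)) n \<cdot> a (x n, y n, z n) = par (pplus (pplus X Y) Z) n" ..
  qed (use A u in auto)
  then show ?thesis using P Q by (simp add: rarr_def)
qed

lemma rarr_s:
  assumes X: "pres X x" and Y: "pres Y y" and s: "separate X Y"
  shows "rarr (\<lambda>n. s (x n, y n)) (pplus X Y) (\<lambda>n. x n \<oplus> y n) (pplus Y X) (\<lambda>n. y n \<oplus> x n) (\<lambda>w. Id C (pob (pplus X Y) w))"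
proof -
  have s': "separate Y X" using s by (auto simp: separate_def)
  note P = pres_pplus[OF X Y s] and Q = pres_pplus[OF Y X s']
  let ?u = "pob (pplus X Y)"
  have d: "grade X n \<inter> grade Y n = {}" for n using s by (auto simp: separate_def grade_iff)
  have c: "mu (pob (pplus Y X)) (grade Y n) (grade X n) = mu ?u (grade Y n) (grade X n)"
    "sumo (pob X) (grade X n) = sumo ?u (grade X n)" "sumo (pob Y) (grade Y n) = sumo ?u (grade Y n)" for n
    using s presD(3)[OF X] presD(3)[OF Y] by (auto intro!: mu_cong sumo_cong simp: pob_pplus separate_def grade_iff)
  note A = presD(3-8)[OF X] presD(3-8)[OF Y] presO[OF X] presO[OF Y] presD(4)[OF P]
  have "drep (\<lambda>n. s (x n, y n)) (pplus X Y) (pplus Y X) (\<lambda>w. Id C (?u w))"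
  proof (rule drep_trivial[OF P Q])
    fix n
    have "par (pplus Y X) n \<cdot> s (x n, y n) = mu ?u (grade Y n) (grade X n) \<cdot> (s (sumo ?u (grade X n), sumo ?u (grade Y n)) \<cdot> (par X n \<boxplus> par Y n))"
      unfolding par_pplus c using A d by (simp add: comp_assoc s_nat c Int_commute)
    also have "\<dots> = (mu ?u (grade Y n) (grade X n) \<cdot> s (sumo ?u (grade X n), sumo ?u (grade Y n))) \<cdot> (par X n \<boxplus> par Y n)"
      using A d by (simp add: comp_assoc c Int_commute)
    also have "\<dots> = par (pplus X Y) n" using mu_sym[of ?u "grade X n" "grade Y n"] A d by (simp add: par_pplus)
    finally show "par (pplus Y X) n \<cdot> s (x n, y n) = par (pplus X Y) n" .
  qed (use A s in \<open>auto simp: pob_pplus separate_def\<close>)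
  then show ?thesis using P Q by (simp add: rarr_def)
qed

lemma rarr_l: "pres X x ==> plen X = p ==>
    rarr (\<lambda>n. l (x n)) (pplus (pzero p) X) (\<lambda>n. \<zero> \<oplus> x n) X x (\<lambda>w. Id C (pob X w))"
  and rarr_r: "pres X x ==> plen X = p ==>
    rarr (\<lambda>n. r (x n)) (pplus X (pzero p)) (\<lambda>n. x n \<oplus> \<zero>) X x (\<lambda>w. Id C (pob X w))"
proof -
  assume X: "pres X x" and p: "plen X = p"
  have s: "separate (pzero p) X" "separate X (pzero p)" using p by (auto simp: separate_def)
  note P = pres_pplus[OF pres_pzero X s(1)] and Q = pres_pplus[OF X pres_pzero s(2)]
  have u: "pob (pplus (pzero p) X) = pob X" by (auto simp: pob_pplus)
  have c: "mu (pob (pplus X (pzero p))) (grade X n) {} = mu (pob X) (grade X n) {}" for n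
    by (rule mu_cong) (use presD(3)[OF X] in \<open>auto simp: pob_pplus grade_iff\<close>)
  note A = presD(3-8)[OF X] presO[OF X]
  have "drep (\<lambda>n. l (x n)) (pplus (pzero p) X) X (\<lambda>w. Id C (pob (pplus (pzero p) X) w))"
    by (rule drep_trivial[OF P X]) (use A l_nat in \<open>auto simp: u par_pplus\<close>)
  then show "rarr (\<lambda>n. l (x n)) (pplus (pzero p) X) (\<lambda>n. \<zero> \<oplus> x n) X x (\<lambda>w. Id C (pob X w))"
    using X P by (simp add: rarr_def u)
  have "drep (\<lambda>n. r (x n)) (pplus X (pzero p)) X (\<lambda>w. Id C (pob (pplus X (pzero p)) w))"
    by (rule drep_trivial[OF Q X]) (use A r_nat in \<open>auto simp: c par_pplus pob_pplus\<close>)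
  then show "rarr (\<lambda>n. r (x n)) (pplus X (pzero p)) (\<lambda>n. x n \<oplus> \<zero>) X x (\<lambda>w. Id C (pob X w))"
    using X Q drep_cong[OF Q] by (auto simp: rarr_def pob_pplus)
qed

end

section \<open>The two monoidal structures of the Laurent category\<close>

context rigid_laplaza
begin

lemma wprod_leaf: "w \<in> wprod ((\<lambda>n. [(c, n)]) ` B) T \<longleftrightarrow> (\<exists>n\<in>B. \<exists>t\<in>T. w = (c, n) # t)"
  by (auto simp: wprod_def)

lemmas word_simps = wprod_leaf wprod_assoc wprod_Un separate_def tens_def comp_m_def pob_pplus

lemma cauchy_prod_zero [simp]: "cauchy_prod C zeroL x = zeroL" "cauchy_prod C x zeroL = zeroL"
  by (auto simp: cauchy_prod_eq cset_def)

lemma leaf_pres: "x \<in> laurent_objs C ==> pres (leaf c (supp x) x) x"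
  by (rule pres_leaf[OF leafy_supp])

text \<open>The colour stays open, because one arrow can be used in several positions with different
  colours.\<close>

definition common where
  "common \<phi> x y B \<longleftrightarrow> leafy B x \<and> leafy B y \<and> (\<forall>c. rarr \<phi> (leaf c B x) x (leaf c B y) y (\<lambda>w. \<phi> (snd (hd w))))"

lemma commonD:
  assumes "common \<phi> x y B"
  shows "leafy B x" "leafy B y" "rarr \<phi> (leaf c B x) x (leaf c B y) y (\<lambda>w. \<phi> (snd (hd w)))"
  using assms by (auto simp: common_def)

lemma larr_leaf: "larr \<phi> x y ==> \<exists>B. common \<phi> x y B"
  unfolding common_def using leafy_common[of x y y] rarr_leaf larrD(1,2) by metis

text \<open>Replaces an empty presentation, such as a product with \<open>pzero\<close>, by
  \<open>pzero\<close> itself, to which the unit laws of \<open>\<oplus>\<close> apply.\<close>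

lemma rarr_null:
  assumes "pres X x" "x = zeroL" "pidx X = {}"
  shows "rarr (\<lambda>n. Id C \<zero>) X x (pzero p) zeroL (\<lambda>w. Id C \<zero>)"
  unfolding assms(2) by (rule rarr_zero[OF _ pres_pzero]) (use assms in simp_all)

lemma null_larr: "larr \<phi> zeroL zeroL ==> larr \<psi> zeroL zeroL ==> \<phi> = \<psi>"
  using null_arrow_unique[of \<zero> \<zero>] by (auto simp: larr_def)

lemma larr_null: "larr (\<lambda>n. Id C \<zero>) zeroL zeroL"
  using zeroL_laurent by (auto simp: larr_def)

lemma larr_structure:
  assumes "x \<in> laurent_objs C" "y \<in> laurent_objs C" "z \<in> laurent_objs C"
  shows "larr (mL (x, y, z)) (cauchy_prod C (cauchy_prod C x y) z) (cauchy_prod C x (cauchy_prod C y z))"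
    "larr (lmL x) (cauchy_prod C oneL x) x" "larr (rmL x) (cauchy_prod C x oneL) x"
    "larr (dlL (x, y, z)) (cauchy_prod C x (\<lambda>n. y n \<oplus> z n)) (\<lambda>n. cauchy_prod C x y n \<oplus> cauchy_prod C x z n)"
    "larr (drL (x, y, z)) (cauchy_prod C (\<lambda>n. x n \<oplus> y n) z) (\<lambda>n. cauchy_prod C x z n \<oplus> cauchy_prod C y z n)"
proof -
  note X = leaf_pres[OF assms(1), of 0] and Y = leaf_pres[OF assms(2), of 1] and Z = leaf_pres[OF assms(3), of 2]
  show "larr (mL (x, y, z)) (cauchy_prod C (cauchy_prod C x y) z) (cauchy_prod C x (cauchy_prod C y z))"
    by (rule rarr_larr[OF rarr_m[OF X Y Z]])
  show "larr (lmL x) (cauchy_prod C oneL x) x" "larr (rmL x) (cauchy_prod C x oneL) x"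
    by (rule rarr_larr[OF rarr_lm[OF X]], rule rarr_larr[OF rarr_rm[OF X]])
  show "larr (dlL (x, y, z)) (cauchy_prod C x (\<lambda>n. y n \<oplus> z n)) (\<lambda>n. cauchy_prod C x y n \<oplus> cauchy_prod C x z n)"
    by (rule rarr_larr[OF rarr_dl[OF X Y Z separate_leaf]]) simp
  show "larr (drL (x, y, z)) (cauchy_prod C (\<lambda>n. x n \<oplus> y n) z) (\<lambda>n. cauchy_prod C x z n \<oplus> cauchy_prod C y z n)"
    by (rule rarr_larr[OF rarr_dr[OF X Y Z separate_leaf]]) simp
qed

abbreviation aL where "aL \<equiv> (\<lambda>(x, y, z) n. a (x n, y n, z n))"
abbreviation lL where "lL \<equiv> (\<lambda>x n. l (x n))"
abbreviation rL where "rL \<equiv> (\<lambda>x n. r (x n))"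
abbreviation sL where "sL \<equiv> (\<lambda>(x, y) n. s (x n, y n))"
abbreviation nL where "nL \<equiv> (\<lambda>x n. Id C \<zero>)"

text \<open>Every law equates arrows that are diagonal on the same presentation by leaves, so
  \<open>rarr_unique\<close> reduces it to the corresponding law of \<open>C\<close> for the
  components.\<close>

lemma monoidal_times_L: "monoidal L (Times L) \<one>\<^bsub>L\<^esub> mL lmL rmL"
proof (intro monoidal.intro monoidal_axioms.intro category_L functor_times_L, goal_cases)
  case 1 show ?case using oneL_laurent by simp
next
  case 2
  show ?case
  proof (rule natural3_L, goal_cases)
    case o: (2 \<phi> \<psi> \<chi> x x' y y' z z')
    note \<phi> = o(1) and \<psi> = o(2) and \<chi> = o(3)
    obtain A where "common \<phi> x x' A" using larr_leaf[OF \<phi>] by blast note A = commonD[OF this]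
    obtain B where "common \<psi> y y' B" using larr_leaf[OF \<psi>] by blast note B = commonD[OF this]
    obtain D where "common \<chi> z z' D" using larr_leaf[OF \<chi>] by blast note D = commonD[OF this]
    note P = A(3)[of 0] B(3)[of 1] D(3)[of 2]
    show ?case
      unfolding L_simps prod.case
      by (rule rarr_unique[OF rarr_comp[OF rarr_times[OF rarr_times[OF P(1,2)] P(3)] rarr_m[OF pres_leaf[OF A(2)] pres_leaf[OF B(2)] pres_leaf[OF D(2)]]]
          rarr_comp[OF rarr_m[OF pres_leaf[OF A(1)] pres_leaf[OF B(1)] pres_leaf[OF D(1)]] rarr_times[OF P(1) rarr_times[OF P(2,3)]]]])
        (use larrD(3-5)[OF \<phi>] larrD(3-5)[OF \<psi>] larrD(3-5)[OF \<chi>] in \<open>auto simp: word_simps times.a_nat\<close>)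
  qed (use mL_invertible larr_structure in auto)
next
  case 3
  show ?case
  proof (rule natural1_L, goal_cases)
    case \<phi>: (2 \<phi> x x')
    obtain A where "common \<phi> x x' A" using larr_leaf[OF \<phi>] by blast note A = commonD[OF this]
    show ?case
      unfolding L_simps
      by (rule rarr_unique[OF rarr_comp[OF rarr_times[OF rarr_id[OF pres_pone] A(3)[of 0]] rarr_lm[OF pres_leaf[OF A(2)]]]
          rarr_comp[OF rarr_lm[OF pres_leaf[OF A(1)]] A(3)[of 0]]])
        (use larrD(3-5)[OF \<phi>] in \<open>auto simp: times.l_nat\<close>)
  qed (use lmL larr_structure in auto)
next
  case 4
  show ?case
  proof (rule natural1_L, goal_cases)
    case \<phi>: (2 \<phi> x x')
    obtain A where "common \<phi> x x' A" using larr_leaf[OF \<phi>] by blast note A = commonD[OF this]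
    show ?case
      unfolding L_simps
      by (rule rarr_unique[OF rarr_comp[OF rarr_times[OF A(3)[of 0] rarr_id[OF pres_pone]] rarr_rm[OF pres_leaf[OF A(2)]]]
          rarr_comp[OF rarr_rm[OF pres_leaf[OF A(1)]] A(3)[of 0]]])
        (use larrD(3-5)[OF \<phi>] in \<open>auto simp: times.r_nat\<close>)
  qed (use rmL larr_structure in auto)
next
  case (5 x y z w)
  note o = 5[unfolded L_simps]
  note X = leaf_pres[OF o(1), of 0] and Y = leaf_pres[OF o(2), of 1] and Z = leaf_pres[OF o(3), of 2] and W = leaf_pres[OF o(4), of 3]
  show ?case
    unfolding L_simps
    by (rule rarr_unique[OF rarr_comp[OF rarr_m[OF pres_ptimes[OF X Y] Z W] rarr_m[OF X Y pres_ptimes[OF Z W]]]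
        rarr_comp[OF rarr_comp[OF rarr_times[OF rarr_m[OF X Y Z] rarr_id[OF W]] rarr_m[OF X pres_ptimes[OF Y Z] W]] rarr_times[OF rarr_id[OF X] rarr_m[OF Y Z W]]]])
      (use o[THEN laurent_objsD(1)] in \<open>auto simp: word_simps times.pentagon comp_assoc\<close>)
next
  case (6 x y)
  note o = 6[unfolded L_simps]
  note X = leaf_pres[OF o(1), of 0] and Y = leaf_pres[OF o(2), of 1]
  show ?case
    unfolding L_simps
    by (rule rarr_unique[OF rarr_comp[OF rarr_m[OF X pres_pone Y] rarr_times[OF rarr_id[OF X] rarr_lm[OF Y]]] rarr_times[OF rarr_rm[OF X] rarr_id[OF Y]]])
      (use o[THEN laurent_objsD(1)] in \<open>auto simp: word_simps times.triangle\<close>)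
qed

lemma symmetric_monoidal_L: "symmetric_monoidal L (Plus L) \<zero>\<^bsub>L\<^esub> aL lL rL sL"
proof (intro symmetric_monoidal.intro symmetric_monoidal_axioms.intro monoidal.intro monoidal_axioms.intro category_L functor_plus_L, goal_cases)
  case 1 show ?case using zeroL_laurent by simp
next
  case 2 show ?case
    by (rule natural3_L) (auto simp: larr_def laurent_plus laurent_objsD a_nat)
next
  case 3 show ?case
    by (rule natural1_L) (auto simp: larr_def laurent_plus zeroL_laurent laurent_objsD l_nat)
next
  case 4 show ?case
    by (rule natural1_L) (auto simp: larr_def laurent_plus zeroL_laurent laurent_objsD r_nat)
next
  case (5 x y z w) then show ?case using laurent_objsD(1) pentagon by (simp add: comp_assoc)
next
  case (6 x y) then show ?case using laurent_objsD(1) triangle by simp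
next
  case 7 show ?case
    by (rule natural2_L) (auto simp: larr_def laurent_plus laurent_objsD s_nat)
next
  case (8 x y) then show ?case using laurent_objsD(1) by simp
next
  case (9 x y z) then show ?case using laurent_objsD(1) hexagon by (simp add: comp_assoc)
qed

end

section \<open>Distributivity and Laplaza's conditions\<close>

context rigid_laplaza
begin

lemma rarr_cong: "rarr \<phi> X x Y y g ==> (\<And>w. w \<in> pidx X ==> g w = h w) ==> rarr \<phi> X x Y y h"
  unfolding rarr_def using drep_cong by blast

text \<open>The structure maps of \<open>\<oplus>\<close> and the distributors have identity
  components. Composites, sums and products of such arrows are of the same kind, so conditions among
  them only require matching words and summands.\<close>

abbreviation "triv \<phi> X x Y y \<equiv> rarr \<phi> X x Y y (\<lambda>w. Id C (pob X w))"

lemma triv_comp: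
  assumes "triv \<phi> X x Y y" "triv \<psi> Y y Z z"
  shows "triv (\<lambda>n. \<psi> n \<cdot> \<phi> n) X x Z z"
proof (rule rarr_cong[OF rarr_comp[OF assms]])
  fix w assume w: "w \<in> pidx X"
  have X: "pres X x" and d: "drep \<phi> X Y (\<lambda>w. Id C (pob X w))" using assms(1) by (auto simp: rarr_def)
  have "pob Y w = pob X w" using drepD(4)[OF d w] presD(4)[OF X, of w] by simp
  then show "Id C (pob Y w) \<cdot> Id C (pob X w) = Id C (pob X w)" using presD(4)[OF X, of w] by simp
qed

lemma triv_plus:
  assumes "triv \<phi> X x X' x'" "triv \<psi> Y y Y' y'" "separate X Y" "separate X' Y'"
  shows "triv (\<lambda>n. \<phi> n \<boxplus> \<psi> n) (pplus X Y) (\<lambda>n. x n \<oplus> y n) (pplus X' Y') (\<lambda>n. x' n \<oplus> y' n)"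
  by (rule rarr_cong[OF rarr_plus[OF assms]]) (simp add: pob_pplus)

lemma triv_times:
  assumes "triv \<phi> X x X' x'" "triv \<psi> Y y Y' y'" "plen X' = plen X"
  shows "triv (ctimes (\<phi>, \<psi>)) (ptimes X Y) (cauchy_prod C x y) (ptimes X' Y') (cauchy_prod C x' y')"
proof (rule rarr_cong[OF rarr_times[OF assms]])
  have "pob X v \<in> Obj C" "pob Y v \<in> Obj C" for v using assms(1,2) presD(4) by (auto simp: rarr_def)
  then show "Id C (pob X (take (plen X) w)) \<boxtimes> Id C (pob Y (drop (plen X) w)) = Id C (pob (ptimes X Y) w)" for w
    by (simp add: tens_def)
qed

lemma ball_neq: "(\<forall>i\<in>B. j \<noteq> i) \<longleftrightarrow> j \<notin> B"
  by blast

lemma distributive_data_L: "distributive_data L aL lL rL sL mL lmL rmL dlL drL"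
proof (intro distributive_data.intro distributive_data_axioms.intro category_L symmetric_monoidal_L monoidal_times_L, goal_cases)
  case 1
  show ?case
  proof (rule natural3_L, goal_cases)
    case o: (2 \<phi> \<psi> \<chi> x x' y y' z z')
    note \<phi> = o(1) and \<psi> = o(2) and \<chi> = o(3)
    obtain A where "common \<phi> x x' A" using larr_leaf[OF \<phi>] by blast note A = commonD[OF this]
    obtain B where "common \<psi> y y' B" using larr_leaf[OF \<psi>] by blast note B = commonD[OF this]
    obtain D where "common \<chi> z z' D" using larr_leaf[OF \<chi>] by blast note D = commonD[OF this]
    note P = A(3)[of 0] B(3)[of 1] D(3)[of 2]
    show ?case
      unfolding L_simps prod.case
      by (rule rarr_unique[OF rarr_comp[OF rarr_times[OF P(1) rarr_plus[OF P(2,3)]] rarr_dl[OF pres_leaf[OF A(2)] pres_leaf[OF B(2)] pres_leaf[OF D(2)]]]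
          rarr_comp[OF rarr_dl[OF pres_leaf[OF A(1)] pres_leaf[OF B(1)] pres_leaf[OF D(1)]] rarr_plus[OF rarr_times[OF P(1,2)] rarr_times[OF P(1,3)]]]])
        (use larrD(3-5)[OF \<phi>] larrD(3-5)[OF \<psi>] larrD(3-5)[OF \<chi>] in \<open>auto simp: word_simps\<close>)
  qed (use dlL larr_structure in auto)
next
  case 2
  show ?case
  proof (rule natural3_L, goal_cases)
    case o: (2 \<phi> \<psi> \<chi> x x' y y' z z')
    note \<phi> = o(1) and \<psi> = o(2) and \<chi> = o(3)
    obtain A where "common \<phi> x x' A" using larr_leaf[OF \<phi>] by blast note A = commonD[OF this]
    obtain B where "common \<psi> y y' B" using larr_leaf[OF \<psi>] by blast note B = commonD[OF this]
    obtain D where "common \<chi> z z' D" using larr_leaf[OF \<chi>] by blast note D = commonD[OF this]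
    note P = A(3)[of 0] B(3)[of 1] D(3)[of 2]
    show ?case
      unfolding L_simps prod.case
      by (rule rarr_unique[OF rarr_comp[OF rarr_times[OF rarr_plus[OF P(1,2)] P(3)] rarr_dr[OF pres_leaf[OF A(2)] pres_leaf[OF B(2)] pres_leaf[OF D(2)]]]
          rarr_comp[OF rarr_dr[OF pres_leaf[OF A(1)] pres_leaf[OF B(1)] pres_leaf[OF D(1)]] rarr_plus[OF rarr_times[OF P(1,3)] rarr_times[OF P(2,3)]]]])
        (use larrD(3-5)[OF \<phi>] larrD(3-5)[OF \<psi>] larrD(3-5)[OF \<chi>] in \<open>auto simp: word_simps\<close>)
  qed (use drL larr_structure in auto)
qed

lemma ctimes_null:
  "larr \<phi> x y ==> larr \<psi> zeroL zeroL ==> ctimes (\<phi>, \<psi>) = (\<lambda>n. Id C \<zero>)"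
  "larr \<phi> x y ==> larr \<psi> zeroL zeroL ==> ctimes (\<psi>, \<phi>) = (\<lambda>n. Id C \<zero>)"
  using null_larr[OF _ larr_null] larr_times[of \<phi> x y \<psi> zeroL zeroL] larr_times[of \<psi> zeroL zeroL \<phi> x y] by auto

text \<open>In I, III, IV, V and IX all components are identities; in VI, VII, VIII, XXIII and XXIV
  both sides have the same component \<open>m\<close>, \<open>lm\<close> or \<open>rm\<close>; XIX
  to XXII again have identity components. The conditions X to XVIII compare arrows between zero
  families. The absorptions \<open>nL\<close> are identities, because an empty index set makes a
  product with the zero family literally zero.\<close>

lemma laplaza_L: "laplaza L aL lL rL sL mL lmL rmL dlL drL nL nL"
proof (intro laplaza.intro laplaza_axioms.intro distributive_data_L, goal_cases)
  case 1 show ?case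
    by (rule natural1_L) (use ctimes_null larr_null in auto)
next
  case 2 show ?case
    by (rule natural1_L) (use ctimes_null larr_null in auto)
next
  case (3 x y z)
  note o = 3[unfolded L_simps]
  note X = leaf_pres[OF o(1), of 0] and Y = leaf_pres[OF o(2), of 1] and Z = leaf_pres[OF o(3), of 2]
  show ?case
    unfolding L_simps prod.case
    by (rule rarr_unique[OF triv_comp[OF rarr_dl[OF X Y Z] rarr_s[OF pres_ptimes[OF X Y] pres_ptimes[OF X Z]]]
        triv_comp[OF triv_times[OF rarr_id[OF X] rarr_s[OF Y Z]] rarr_dl[OF X Z Y]]])
      (auto simp: word_simps)
next
  case (4 x y z)
  note o = 4[unfolded L_simps]
  note X = leaf_pres[OF o(1), of 0] and Y = leaf_pres[OF o(2), of 1] and Z = leaf_pres[OF o(3), of 2]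
  show ?case
    unfolding L_simps prod.case
    by (rule rarr_unique[OF triv_comp[OF rarr_dr[OF X Y Z] rarr_s[OF pres_ptimes[OF X Z] pres_ptimes[OF Y Z]]]
        triv_comp[OF triv_times[OF rarr_s[OF X Y] rarr_id[OF Z]] rarr_dr[OF Y X Z]]])
      (auto simp: word_simps)
next
  case (5 x y z w)
  note o = 5[unfolded L_simps]
  note X = leaf_pres[OF o(1), of 0] and Y = leaf_pres[OF o(2), of 1] and Z = leaf_pres[OF o(3), of 2] and W = leaf_pres[OF o(4), of 3]
  show ?case
    unfolding L_simps prod.case
    by (rule rarr_unique[OF triv_comp[OF triv_comp[OF rarr_dr[OF pres_pplus[OF X Y] Z W] triv_plus[OF rarr_dr[OF X Y W] rarr_id[OF pres_ptimes[OF Z W]]]]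
            rarr_a[OF pres_ptimes[OF X W] pres_ptimes[OF Y W] pres_ptimes[OF Z W]]]
        triv_comp[OF triv_comp[OF triv_times[OF rarr_a[OF X Y Z] rarr_id[OF W]] rarr_dr[OF X pres_pplus[OF Y Z] W]]
            triv_plus[OF rarr_id[OF pres_ptimes[OF X W]] rarr_dr[OF Y Z W]]]])
      (auto simp: word_simps)
next
  case (6 x y z w)
  note o = 6[unfolded L_simps]
  note X = leaf_pres[OF o(1), of 0] and Y = leaf_pres[OF o(2), of 1] and Z = leaf_pres[OF o(3), of 2] and W = leaf_pres[OF o(4), of 3]
  show ?case
    unfolding L_simps prod.case
    by (rule rarr_unique[OF triv_comp[OF triv_comp[OF rarr_dl[OF X pres_pplus[OF Y Z] W] triv_plus[OF rarr_dl[OF X Y Z] rarr_id[OF pres_ptimes[OF X W]]]]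
            rarr_a[OF pres_ptimes[OF X Y] pres_ptimes[OF X Z] pres_ptimes[OF X W]]]
        triv_comp[OF triv_comp[OF triv_times[OF rarr_id[OF X] rarr_a[OF Y Z W]] rarr_dl[OF X Y pres_pplus[OF Z W]]]
            triv_plus[OF rarr_id[OF pres_ptimes[OF X Y]] rarr_dl[OF X Z W]]]])
      (auto simp: word_simps)
next
  case (7 x y z w)
  note o = 7[unfolded L_simps]
  note X = leaf_pres[OF o(1), of 0] and Y = leaf_pres[OF o(2), of 1] and Z = leaf_pres[OF o(3), of 2] and W = leaf_pres[OF o(4), of 3]
  show ?case
    unfolding L_simps prod.case
    by (rule rarr_unique[OF rarr_comp[OF rarr_dl[OF pres_ptimes[OF X Y] Z W] rarr_plus[OF rarr_m[OF X Y Z] rarr_m[OF X Y W]]]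
        rarr_comp[OF rarr_comp[OF rarr_m[OF X Y pres_pplus[OF Z W]] rarr_times[OF rarr_id[OF X] rarr_dl[OF Y Z W]]]
            rarr_dl[OF X pres_ptimes[OF Y Z] pres_ptimes[OF Y W]]]])
      (use o[THEN laurent_objsD(1)] in \<open>auto simp: word_simps\<close>)
next
  case (8 x y z w)
  note o = 8[unfolded L_simps]
  note X = leaf_pres[OF o(1), of 0] and Y = leaf_pres[OF o(2), of 1] and Z = leaf_pres[OF o(3), of 2] and W = leaf_pres[OF o(4), of 3]
  show ?case
    unfolding L_simps prod.case
    by (rule rarr_unique[OF rarr_comp[OF rarr_m[OF pres_pplus[OF X Y] Z W] rarr_dr[OF X Y pres_ptimes[OF Z W]]]
        rarr_comp[OF rarr_comp[OF rarr_times[OF rarr_dr[OF X Y Z] rarr_id[OF W]] rarr_dr[OF pres_ptimes[OF X Z] pres_ptimes[OF Y Z] W]]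
            rarr_plus[OF rarr_m[OF X Z W] rarr_m[OF Y Z W]]]])
      (use o[THEN laurent_objsD(1)] in \<open>auto simp: word_simps ball_neq\<close>)
next
  case (9 x y z w)
  note o = 9[unfolded L_simps]
  note X = leaf_pres[OF o(1), of 0] and Y = leaf_pres[OF o(2), of 1] and Z = leaf_pres[OF o(3), of 2] and W = leaf_pres[OF o(4), of 3]
  show ?case
    unfolding L_simps prod.case
    by (rule rarr_unique[OF rarr_comp[OF rarr_comp[OF rarr_m[OF X pres_pplus[OF Y Z] W] rarr_times[OF rarr_id[OF X] rarr_dr[OF Y Z W]]]
            rarr_dl[OF X pres_ptimes[OF Y W] pres_ptimes[OF Z W]]]
        rarr_comp[OF rarr_comp[OF rarr_times[OF rarr_dl[OF X Y Z] rarr_id[OF W]] rarr_dr[OF pres_ptimes[OF X Y] pres_ptimes[OF X Z] W]]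
            rarr_plus[OF rarr_m[OF X Y W] rarr_m[OF X Z W]]]])
      (use o[THEN laurent_objsD(1)] in \<open>auto simp: word_simps\<close>)
next
  case (10 x y z w q p t swap)
  note o = 10[unfolded L_simps]
  note X = leaf_pres[OF o(1), of 0] and Y = leaf_pres[OF o(2), of 1] and Z = leaf_pres[OF o(3), of 2] and W = leaf_pres[OF o(4), of 3]
  note XZ = pres_ptimes[OF X Z] and Q = pres_ptimes[OF Y Z] and P = pres_ptimes[OF X W] and T = pres_ptimes[OF Y W]
  \<comment> \<open>The exchange of condition IX, assembled from its three factors together with the
    presentations of their ends.\<close>
  note swap = triv_comp[OF triv_comp[OF rarr_s[OF Q pres_pplus[OF P T]] rarr_a[OF P T Q]] triv_plus[OF rarr_id[OF P] rarr_s[OF T Q]]]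
  show ?case
    unfolding 10(5-8) L_simps prod.case
    by (rule rarr_unique[OF triv_comp[OF triv_comp[OF triv_comp[OF rarr_dl[OF pres_pplus[OF X Y] Z W] triv_plus[OF rarr_dr[OF X Y Z] rarr_dr[OF X Y W]]]
            rarr_a[OF XZ Q pres_pplus[OF P T]]] triv_plus[OF rarr_id[OF XZ] swap]]
        triv_comp[OF triv_comp[OF rarr_dr[OF X Y pres_pplus[OF Z W]] triv_plus[OF rarr_dl[OF X Z W] rarr_dl[OF Y Z W]]]
            rarr_a[OF XZ P pres_pplus[OF Q T]]]])
      (auto simp: word_simps)
next
  case (12 x y)
  note o = 12[unfolded L_simps]
  show ?case
    unfolding L_simps by (rule null_larr[OF _ larr_null]) (use larr_structure(4)[OF zeroL_laurent o] in \<open>auto simp: larr_def\<close>)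
next
  case (13 x y)
  note o = 13[unfolded L_simps]
  show ?case
    unfolding L_simps by (rule null_larr[OF _ larr_null]) (use larr_structure(5)[OF o zeroL_laurent] in \<open>auto simp: larr_def\<close>)
next
  case 14 show ?case using null_larr[OF larr_null] larr_structure(3)[OF zeroL_laurent zeroL_laurent zeroL_laurent] by simp
next
  case 15 show ?case using null_larr[OF larr_null] larr_structure(2)[OF zeroL_laurent zeroL_laurent zeroL_laurent] by simp
next
  case (16 x y)
  note o = 16[unfolded L_simps]
  have "mL (zeroL, x, y) = (\<lambda>n. Id C \<zero>)" using larr_structure(1)[OF zeroL_laurent o] by (intro null_larr[OF _ larr_null]) simp
  then show ?case using ctimes_null(2)[OF larr_id[OF o(2)] larr_null] by simp
next
  case (17 x y)
  note o = 17[unfolded L_simps]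
  have "mL (x, zeroL, y) = (\<lambda>n. Id C \<zero>)" using larr_structure(1)[OF o(1) zeroL_laurent o(2)] by (intro null_larr[OF _ larr_null]) simp
  then show ?case using ctimes_null(2)[OF larr_id[OF o(2)] larr_null] ctimes_null(1)[OF larr_id[OF o(1)] larr_null] by simp
next
  case (18 x y)
  note o = 18[unfolded L_simps]
  have "mL (x, y, zeroL) = (\<lambda>n. Id C \<zero>)" using larr_structure(1)[OF o zeroL_laurent] by (intro null_larr[OF _ larr_null]) simp
  then show ?case using ctimes_null(1)[OF larr_id[OF o(1)] larr_null] by simp
next
  case (19 x y)
  note o = 19[unfolded L_simps]
  \<comment> \<open>The zero summand is presented with word length 1, because
    \<open>separate\<close> demands the length of the leaf of \<open>y\<close>. After multiplication
    by \<open>x\<close> the length is 2.\<close>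
  note X = leaf_pres[OF o(1), of 0] and Y = leaf_pres[OF o(2), of 1] and Z = pres_pzero[of 1]
  show ?case
    unfolding L_simps prod.case
    by (rule rarr_unique[OF rarr_comp[OF rarr_comp[OF rarr_dl[OF X Z Y] rarr_plus[OF rarr_null[OF pres_ptimes[OF X Z] cauchy_prod_zero(2), of 2] rarr_id[OF pres_ptimes[OF X Y]]]]
            rarr_l[OF pres_ptimes[OF X Y], of 2]]
        rarr_times[OF rarr_id[OF X] rarr_l[OF Y, of 1]]])
      (use o[THEN laurent_objsD(1)] in \<open>auto simp: word_simps\<close>)
next
  case (20 x y)
  note o = 20[unfolded L_simps]
  note X = leaf_pres[OF o(1), of 0] and Y = leaf_pres[OF o(2), of 1] and Z = pres_pzero[of 1]
  show ?case
    unfolding L_simps prod.case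
    by (rule rarr_unique[OF rarr_comp[OF rarr_comp[OF rarr_dr[OF Z X Y] rarr_plus[OF rarr_null[OF pres_ptimes[OF Z Y] cauchy_prod_zero(1), of 2] rarr_id[OF pres_ptimes[OF X Y]]]]
            rarr_l[OF pres_ptimes[OF X Y], of 2]]
        rarr_times[OF rarr_l[OF X, of 1] rarr_id[OF Y]]])
      (use o[THEN laurent_objsD(1)] in \<open>auto simp: word_simps\<close>)
next
  case (21 x y)
  note o = 21[unfolded L_simps]
  note X = leaf_pres[OF o(1), of 0] and Y = leaf_pres[OF o(2), of 1] and Z = pres_pzero[of 1]
  show ?case
    unfolding L_simps prod.case
    by (rule rarr_unique[OF rarr_comp[OF rarr_comp[OF rarr_dl[OF X Y Z] rarr_plus[OF rarr_id[OF pres_ptimes[OF X Y]] rarr_null[OF pres_ptimes[OF X Z] cauchy_prod_zero(2), of 2]]]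
            rarr_r[OF pres_ptimes[OF X Y], of 2]]
        rarr_times[OF rarr_id[OF X] rarr_r[OF Y, of 1]]])
      (use o[THEN laurent_objsD(1)] in \<open>auto simp: word_simps\<close>)
next
  case (22 x y)
  note o = 22[unfolded L_simps]
  note X = leaf_pres[OF o(1), of 0] and Y = leaf_pres[OF o(2), of 1] and Z = pres_pzero[of 1]
  show ?case
    unfolding L_simps prod.case
    by (rule rarr_unique[OF rarr_comp[OF rarr_comp[OF rarr_dr[OF X Z Y] rarr_plus[OF rarr_id[OF pres_ptimes[OF X Y]] rarr_null[OF pres_ptimes[OF Z Y] cauchy_prod_zero(1), of 2]]]
            rarr_r[OF pres_ptimes[OF X Y], of 2]]
        rarr_times[OF rarr_r[OF X, of 1] rarr_id[OF Y]]])
      (use o[THEN laurent_objsD(1)] in \<open>auto simp: word_simps\<close>)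
next
  case (23 x y)
  note o = 23[unfolded L_simps]
  note X = leaf_pres[OF o(1), of 0] and Y = leaf_pres[OF o(2), of 1]
  show ?case
    unfolding L_simps prod.case
    by (rule rarr_unique[OF rarr_comp[OF rarr_dl[OF pres_pone X Y] rarr_plus[OF rarr_lm[OF X] rarr_lm[OF Y]]] rarr_lm[OF pres_pplus[OF X Y]]])
      (use o[THEN laurent_objsD(1)] in \<open>auto simp: word_simps\<close>)
next
  case (24 x y)
  note o = 24[unfolded L_simps]
  note X = leaf_pres[OF o(1), of 0] and Y = leaf_pres[OF o(2), of 1]
  show ?case
    unfolding L_simps prod.case
    by (rule rarr_unique[OF rarr_comp[OF rarr_dr[OF X Y pres_pone] rarr_plus[OF rarr_rm[OF X] rarr_rm[OF Y]]] rarr_rm[OF pres_pplus[OF X Y]]])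
      (use o[THEN laurent_objsD(1)] in \<open>auto simp: word_simps\<close>)
qed simp

lemma distributive_L: "distributive_category L"
  unfolding distributive_category_def using laplaza_L by blast

end

section \<open>Rota-Baxter functors from a splitting\<close>

context laplaza
begin

abbreviation C2 :: "('o \<times> 'o, 'm \<times> 'm) cat" where "C2 \<equiv> prod_cat C C"

text \<open>Natural isomorphism of functors in two variables, treated as a congruence for sums,
  products and composition. The Rota-Baxter isomorphism can then be derived by equational
  reasoning.\<close>

definition same :: "('o \<times> 'o, 'm \<times> 'm, 'o, 'm) ftor \<Rightarrow> ('o \<times> 'o, 'm \<times> 'm, 'o, 'm) ftor \<Rightarrow> bool" (infix \<open>\<simeq>\<close> 50) where
  "F \<simeq> G \<longleftrightarrow> is_functor C2 C F \<and> is_functor C2 C G \<and> naturally_isomorphic C2 C F G"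

definition fsum :: "('p, 'n, 'o, 'm) ftor \<Rightarrow> ('p, 'n, 'o, 'm) ftor \<Rightarrow> ('p, 'n, 'o, 'm) ftor" where
  "fsum F G = Ftor (\<lambda>x. obj_map F x \<oplus> obj_map G x) (\<lambda>f. arr_map F f \<boxplus> arr_map G f)"

definition ftimes :: "('p, 'n, 'o, 'm) ftor \<Rightarrow> ('p, 'n, 'o, 'm) ftor \<Rightarrow> ('p, 'n, 'o, 'm) ftor" where
  "ftimes F G = Ftor (\<lambda>x. obj_map F x \<otimes> obj_map G x) (\<lambda>f. arr_map F f \<boxtimes> arr_map G f)"

definition fcomp :: "('o, 'm, 'o, 'm) ftor \<Rightarrow> ('p, 'n, 'o, 'm) ftor \<Rightarrow> ('p, 'n, 'o, 'm) ftor" where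
  "fcomp P F = Ftor (\<lambda>x. obj_map P (obj_map F x)) (\<lambda>f. arr_map P (arr_map F f))"

lemmas ftor_defs = fsum_def ftimes_def fcomp_def

lemma functorD:
  assumes "is_functor D C F"
  shows "x \<in> Obj D ==> obj_map F x \<in> Obj C" "f \<in> Arr D ==> arr_map F f \<in> Arr C"
    "f \<in> Arr D ==> Dom C (arr_map F f) = obj_map F (Dom D f)" "f \<in> Arr D ==> Cod C (arr_map F f) = obj_map F (Cod D f)"
    "x \<in> Obj D ==> arr_map F (Id D x) = Id C (obj_map F x)"
    "f \<in> Arr D ==> g \<in> Arr D ==> Dom D g = Cod D f ==> arr_map F (Comp D g f) = arr_map F g \<cdot> arr_map F f"
  using is_functorD[OF assms] by (auto simp: hom_iff)

lemma functorI:
  assumes "\<And>x. x \<in> Obj D ==> obj_map F x \<in> Obj C" "\<And>f. f \<in> Arr D ==> arr_map F f \<in> Arr C"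
    "\<And>f. f \<in> Arr D ==> Dom C (arr_map F f) = obj_map F (Dom D f)" "\<And>f. f \<in> Arr D ==> Cod C (arr_map F f) = obj_map F (Cod D f)"
    "\<And>x. x \<in> Obj D ==> arr_map F (Id D x) = Id C (obj_map F x)"
    "\<And>f g. f \<in> Arr D ==> g \<in> Arr D ==> Dom D g = Cod D f ==> arr_map F (Comp D g f) = arr_map F g \<cdot> arr_map F f"
  shows "is_functor D C F"
  using assms by (auto simp: is_functor_def hom_iff)

lemma fsum_functor: "is_functor C2 C F ==> is_functor C2 C G ==> is_functor C2 C (fsum F G)"
  by (rule functorI) (use functorD[of C2 F] functorD[of C2 G] in \<open>auto simp: fsum_def interchange\<close>)

lemma ftimes_functor: "is_functor C2 C F ==> is_functor C2 C G ==> is_functor C2 C (ftimes F G)"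
  by (rule functorI) (use functorD[of C2 F] functorD[of C2 G] in \<open>auto simp: ftimes_def times.interchange\<close>)

lemma fcomp_functor: "is_functor C C P ==> is_functor C2 C F ==> is_functor C2 C (fcomp P F)"
  by (rule functorI) (use functorD[of C P] functorD[of C2 F] in \<open>auto simp: fcomp_def\<close>)

lemma functor_invertible:
  assumes P: "is_functor C C P" and f: "f \<in> Arr C" "invertible C f"
  shows "invertible C (arr_map P f)"
proof (rule invertibleI[where g="arr_map P (arr_inv f)"])
  note D = functorD[OF P]
  show "arr_map P (arr_inv f) \<cdot> arr_map P f = Id C (Dom C (arr_map P f))" "arr_map P f \<cdot> arr_map P (arr_inv f) = Id C (Cod C (arr_map P f))"
    using D(6)[of f "arr_inv f", symmetric] D(6)[of "arr_inv f" f, symmetric] D(3-5) f by simp_all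
qed (use functorD[OF P] f in auto)

lemma C2_Obj: "f \<in> Arr C2 ==> Dom C2 f \<in> Obj C2 \<and> Cod C2 f \<in> Obj C2"
  by auto

lemma sameI:
  assumes "is_functor C2 C F" "is_functor C2 C G"
    "\<And>x. x \<in> Obj C2 ==> t x \<in> Arr C \<and> Dom C (t x) = obj_map F x \<and> Cod C (t x) = obj_map G x \<and> invertible C (t x)"
    "\<And>f. f \<in> Arr C2 ==> t (Cod C2 f) \<cdot> arr_map F f = arr_map G f \<cdot> t (Dom C2 f)"
  shows "F \<simeq> G"
proof -
  have "natural_iso C2 C F G t" unfolding natural_iso_def using assms(3,4) by (simp add: hom_iff)
  then show ?thesis using assms(1,2) by (auto simp: same_def naturally_isomorphic_def)
qed

definition link where
  "link t F G \<longleftrightarrow> (\<forall>x\<in>Obj C2. t x \<in> Arr C \<and> Dom C (t x) = obj_map F x \<and> Cod C (t x) = obj_map G x \<and> invertible C (t x)) \<and>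
    (\<forall>f\<in>Arr C2. t (Cod C2 f) \<cdot> arr_map F f = arr_map G f \<cdot> t (Dom C2 f))"

lemma linkD:
  assumes "link t F G"
  shows "x \<in> Obj C2 ==> t x \<in> Arr C \<and> Dom C (t x) = obj_map F x \<and> Cod C (t x) = obj_map G x \<and> invertible C (t x)"
    "f \<in> Arr C2 ==> t (Cod C2 f) \<cdot> arr_map F f = arr_map G f \<cdot> t (Dom C2 f)"
  using assms unfolding link_def by blast+

lemma same_link: "F \<simeq> G ==> \<exists>t. link t F G"
  by (auto simp: same_def naturally_isomorphic_def natural_iso_def link_def hom_iff simp del: prod_cat_simps)

lemma same_functor: "F \<simeq> G ==> is_functor C2 C F" "F \<simeq> G ==> is_functor C2 C G"
  by (auto simp: same_def)

lemma same_refl: "is_functor C2 C F ==> F \<simeq> F"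
  by (rule sameI[where t="\<lambda>x. Id C (obj_map F x)"]) (use functorD[of C2 F] C2_Obj in auto)

lemma same_sym:
  assumes "F \<simeq> G"
  shows "G \<simeq> F"
proof -
  note F = same_functor[OF assms]
  obtain t where "link t F G" using same_link[OF assms] by blast
  note t = linkD[OF this]
  show ?thesis
  proof (rule sameI[OF F(2,1), where t="\<lambda>x. arr_inv (t x)"])
    fix f assume f: "f \<in> Arr C2"
    note o = C2_Obj[OF f]
    show "arr_inv (t (Cod C2 f)) \<cdot> arr_map G f = arr_map F f \<cdot> arr_inv (t (Dom C2 f))"
      by (rule inverse_natural[OF t(2)[OF f]])
        (use t(1)[of "Dom C2 f"] t(1)[of "Cod C2 f"] o functorD(2-4)[OF F(1) f] functorD(2-4)[OF F(2) f] in auto)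
  qed (use t in auto)
qed

lemma same_trans [trans]:
  assumes "F \<simeq> G" "G \<simeq> H"
  shows "F \<simeq> H"
proof -
  note F = same_functor[OF assms(1)] same_functor[OF assms(2)]
  obtain t where "link t F G" using same_link[OF assms(1)] by blast
  note t = linkD[OF this]
  obtain q where "link q G H" using same_link[OF assms(2)] by blast
  note q = linkD[OF this]
  show ?thesis
  proof (rule sameI[OF F(1,4), where t="\<lambda>x. q x \<cdot> t x"])
    fix f assume f: "f \<in> Arr C2"
    note A = t(1)[of "Dom C2 f"] t(1)[of "Cod C2 f"] q(1)[of "Dom C2 f"] q(1)[of "Cod C2 f"] C2_Obj[OF f]
      functorD(2-4)[OF F(1) f] functorD(2-4)[OF F(2) f] functorD(2-4)[OF F(4) f]
    have "(q (Cod C2 f) \<cdot> t (Cod C2 f)) \<cdot> arr_map F f = (q (Cod C2 f) \<cdot> arr_map G f) \<cdot> t (Dom C2 f)"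
      using A by (simp add: comp_assoc t(2)[OF f])
    also have "\<dots> = arr_map H f \<cdot> (q (Dom C2 f) \<cdot> t (Dom C2 f))"
      using A by (simp add: comp_assoc q(2)[OF f])
    finally show "(q (Cod C2 f) \<cdot> t (Cod C2 f)) \<cdot> arr_map F f = arr_map H f \<cdot> (q (Dom C2 f) \<cdot> t (Dom C2 f))" .
  qed (use t q in auto)
qed

lemma same_fsum:
  assumes "F \<simeq> G" "H \<simeq> K"
  shows "fsum F H \<simeq> fsum G K"
proof -
  note F = same_functor[OF assms(1)] same_functor[OF assms(2)]
  obtain t where "link t F G" using same_link[OF assms(1)] by blast
  note t = linkD[OF this]
  obtain q where "link q H K" using same_link[OF assms(2)] by blast
  note q = linkD[OF this]
  show ?thesis
  proof (rule sameI[OF fsum_functor[OF F(1,3)] fsum_functor[OF F(2,4)], where t="\<lambda>x. t x \<boxplus> q x"])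
    fix f assume f: "f \<in> Arr C2"
    show "(t (Cod C2 f) \<boxplus> q (Cod C2 f)) \<cdot> arr_map (fsum F H) f = arr_map (fsum G K) f \<cdot> (t (Dom C2 f) \<boxplus> q (Dom C2 f))"
      using t(1)[of "Dom C2 f"] t(1)[of "Cod C2 f"] q(1)[of "Dom C2 f"] q(1)[of "Cod C2 f"] C2_Obj[OF f]
        functorD(2-4)[OF F(1) f] functorD(2-4)[OF F(2) f] functorD(2-4)[OF F(3) f] functorD(2-4)[OF F(4) f]
      by (simp add: fsum_def interchange t(2)[OF f] q(2)[OF f])
  qed (use t q in \<open>auto simp: fsum_def\<close>)
qed

lemma same_ftimes:
  assumes "F \<simeq> G" "H \<simeq> K"
  shows "ftimes F H \<simeq> ftimes G K"
proof -
  note F = same_functor[OF assms(1)] same_functor[OF assms(2)]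
  obtain t where "link t F G" using same_link[OF assms(1)] by blast
  note t = linkD[OF this]
  obtain q where "link q H K" using same_link[OF assms(2)] by blast
  note q = linkD[OF this]
  show ?thesis
  proof (rule sameI[OF ftimes_functor[OF F(1,3)] ftimes_functor[OF F(2,4)], where t="\<lambda>x. t x \<boxtimes> q x"])
    fix f assume f: "f \<in> Arr C2"
    show "(t (Cod C2 f) \<boxtimes> q (Cod C2 f)) \<cdot> arr_map (ftimes F H) f = arr_map (ftimes G K) f \<cdot> (t (Dom C2 f) \<boxtimes> q (Dom C2 f))"
      using t(1)[of "Dom C2 f"] t(1)[of "Cod C2 f"] q(1)[of "Dom C2 f"] q(1)[of "Cod C2 f"] C2_Obj[OF f]
        functorD(2-4)[OF F(1) f] functorD(2-4)[OF F(2) f] functorD(2-4)[OF F(3) f] functorD(2-4)[OF F(4) f]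
      by (simp add: ftimes_def times.interchange t(2)[OF f] q(2)[OF f])
  qed (use t q in \<open>auto simp: ftimes_def\<close>)
qed

lemma same_fcomp:
  assumes P: "is_functor C C P" and "F \<simeq> G"
  shows "fcomp P F \<simeq> fcomp P G"
proof -
  note F = same_functor[OF assms(2)]
  obtain t where "link t F G" using same_link[OF assms(2)] by blast
  note t = linkD[OF this]
  show ?thesis
  proof (rule sameI[OF fcomp_functor[OF P F(1)] fcomp_functor[OF P F(2)], where t="\<lambda>x. arr_map P (t x)"])
    fix f assume f: "f \<in> Arr C2"
    show "arr_map P (t (Cod C2 f)) \<cdot> arr_map (fcomp P F) f = arr_map (fcomp P G) f \<cdot> arr_map P (t (Dom C2 f))"
      using t(1)[of "Dom C2 f"] t(1)[of "Cod C2 f"] C2_Obj[OF f] functorD(2-4)[OF F(1) f] functorD(2-4)[OF F(2) f]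
      by (simp add: fcomp_def functorD(6)[OF P, symmetric] t(2)[OF f])
  qed (use t functorD[OF P] functor_invertible[OF P] in \<open>auto simp: fcomp_def\<close>)
qed

lemma same_whisker:
  assumes "natural_iso C C P Q t" "is_functor C C P" "is_functor C C Q" "is_functor C2 C F"
  shows "fcomp P F \<simeq> fcomp Q F"
proof (rule sameI[OF fcomp_functor[OF assms(2,4)] fcomp_functor[OF assms(3,4)], where t="\<lambda>x. t (obj_map F x)"])
  fix f assume f: "f \<in> Arr C2"
  show "t (obj_map F (Cod C2 f)) \<cdot> arr_map (fcomp P F) f = arr_map (fcomp Q F) f \<cdot> t (obj_map F (Dom C2 f))"
    using natural_isoD(3)[OF assms(1), of "arr_map F f"] functorD(2-4)[OF assms(4) f] by (simp add: fcomp_def)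
qed (use natural_isoD(1,2)[OF assms(1)] functorD(1)[OF assms(4)] in \<open>auto simp: fcomp_def hom_iff\<close>)

lemma same_additive:
  assumes P: "is_functor C C P" "naturally_isomorphic C2 C
      (Ftor (\<lambda>(x, y). obj_map P (x \<oplus> y)) (\<lambda>(f, g). arr_map P (f \<boxplus> g)))
      (Ftor (\<lambda>(x, y). obj_map P x \<oplus> obj_map P y) (\<lambda>(f, g). arr_map P f \<boxplus> arr_map P g))"
    and F: "is_functor C2 C F" and G: "is_functor C2 C G"
  shows "fcomp P (fsum F G) \<simeq> fsum (fcomp P F) (fcomp P G)"
proof -
  obtain t where t: "natural_iso C2 C (Ftor (\<lambda>(x, y). obj_map P (x \<oplus> y)) (\<lambda>(f, g). arr_map P (f \<boxplus> g)))
      (Ftor (\<lambda>(x, y). obj_map P x \<oplus> obj_map P y) (\<lambda>(f, g). arr_map P f \<boxplus> arr_map P g)) t"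
    using P(2) by (auto simp: naturally_isomorphic_def)
  note T = natural_isoD[OF t]
  show ?thesis
  proof (rule sameI[where t="\<lambda>p. t (obj_map F p, obj_map G p)"])
    fix f assume f: "f \<in> Arr C2"
    show "t (obj_map F (Cod C2 f), obj_map G (Cod C2 f)) \<cdot> arr_map (fcomp P (fsum F G)) f =
        arr_map (fsum (fcomp P F) (fcomp P G)) f \<cdot> t (obj_map F (Dom C2 f), obj_map G (Dom C2 f))"
      using T(3)[of "(arr_map F f, arr_map G f)"] functorD(2-4)[OF F f] functorD(2-4)[OF G f] by (simp add: fcomp_def fsum_def)
  next
    fix x assume "x \<in> Obj C2"
    then show "t (obj_map F x, obj_map G x) \<in> Arr C \<and> Dom C (t (obj_map F x, obj_map G x)) = obj_map (fcomp P (fsum F G)) x \<and>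
        Cod C (t (obj_map F x, obj_map G x)) = obj_map (fsum (fcomp P F) (fcomp P G)) x \<and> invertible C (t (obj_map F x, obj_map G x))"
      using T(1,2)[of "(obj_map F x, obj_map G x)"] functorD(1)[OF F] functorD(1)[OF G] by (simp add: fcomp_def fsum_def hom_iff)
  qed (intro fcomp_functor fsum_functor P(1) F G)+
qed

lemma same_coherence:
  assumes F: "is_functor C2 C F" and G: "is_functor C2 C G" and H: "is_functor C2 C H"
  shows "ftimes F (fsum G H) \<simeq> fsum (ftimes F G) (ftimes F H)"
    "ftimes (fsum F G) H \<simeq> fsum (ftimes F H) (ftimes G H)"
    "fsum (fsum F G) H \<simeq> fsum F (fsum G H)"
    "fsum F G \<simeq> fsum G F"
    "fsum F (Ftor (\<lambda>x. \<zero>) (\<lambda>f. Id C \<zero>)) \<simeq> F"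
proof -
  note D = functorD(1-4)[OF F] functorD(1-4)[OF G] functorD(1-4)[OF H] C2_Obj
  have Z: "is_functor C2 C (Ftor (\<lambda>x. \<zero>) (\<lambda>f. Id C \<zero>))" by (rule functorI) auto
  show "ftimes F (fsum G H) \<simeq> fsum (ftimes F G) (ftimes F H)"
    by (rule sameI[where t="\<lambda>x. dl (obj_map F x, obj_map G x, obj_map H x)"], (intro fsum_functor ftimes_functor F G H)+)
      (use D in \<open>simp_all add: fsum_def ftimes_def dl_nat del: prod_cat_simps\<close>)
  show "ftimes (fsum F G) H \<simeq> fsum (ftimes F H) (ftimes G H)"
    by (rule sameI[where t="\<lambda>x. dr (obj_map F x, obj_map G x, obj_map H x)"], (intro fsum_functor ftimes_functor F G H)+)
      (use D in \<open>simp_all add: fsum_def ftimes_def dr_nat del: prod_cat_simps\<close>)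
  show "fsum (fsum F G) H \<simeq> fsum F (fsum G H)"
    by (rule sameI[where t="\<lambda>x. a (obj_map F x, obj_map G x, obj_map H x)"], (intro fsum_functor F G H)+)
      (use D in \<open>simp_all add: fsum_def a_nat del: prod_cat_simps\<close>)
  show "fsum F G \<simeq> fsum G F"
    by (rule sameI[where t="\<lambda>x. s (obj_map F x, obj_map G x)"], (intro fsum_functor F G)+)
      (use D in \<open>simp_all add: fsum_def s_nat del: prod_cat_simps\<close>)
  show "fsum F (Ftor (\<lambda>x. \<zero>) (\<lambda>f. Id C \<zero>)) \<simeq> F"
    by (rule sameI[where t="\<lambda>x. r (obj_map F x)"], (intro fsum_functor F Z)+)
      (use D in \<open>simp_all add: fsum_def r_nat del: prod_cat_simps\<close>)
qed

text \<open>Since \<open>x \<simeq> P x \<oplus> Q x\<close> and \<open>P (Q x \<otimes> Q y) \<simeq> 0\<close>, both sides are sums of \<open>P x \<otimes> P y\<close>,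
  \<open>P (P x \<otimes> Q y)\<close> and \<open>P (x \<otimes> P y)\<close>.\<close>

lemma rota_baxter_splitting:
  assumes P: "is_functor C C P" and Q: "is_functor C C Q"
    and add: "naturally_isomorphic C2 C
      (Ftor (\<lambda>(x, y). obj_map P (x \<oplus> y)) (\<lambda>(f, g). arr_map P (f \<boxplus> g)))
      (Ftor (\<lambda>(x, y). obj_map P x \<oplus> obj_map P y) (\<lambda>(f, g). arr_map P f \<boxplus> arr_map P g))"
    and split: "natural_iso C C (fsum P Q) id_ftor t"
    and PP: "naturally_isomorphic C2 C
      (Ftor (\<lambda>(x, y). obj_map P x \<otimes> obj_map P y) (\<lambda>(f, g). arr_map P f \<boxtimes> arr_map P g))
      (Ftor (\<lambda>(x, y). obj_map P (obj_map P x \<otimes> obj_map P y)) (\<lambda>(f, g). arr_map P (arr_map P f \<boxtimes> arr_map P g)))"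
    and QQ: "naturally_isomorphic C2 C
      (Ftor (\<lambda>(x, y). obj_map P (obj_map Q x \<otimes> obj_map Q y)) (\<lambda>(f, g). arr_map P (arr_map Q f \<boxtimes> arr_map Q g)))
      (Ftor (\<lambda>x. \<zero>) (\<lambda>f. Id C \<zero>))"
  shows "naturally_isomorphic C2 C
      (Ftor (\<lambda>(x, y). (obj_map P x \<otimes> obj_map P y) \<oplus> obj_map P (x \<otimes> y))
        (\<lambda>(f, g). (arr_map P f \<boxtimes> arr_map P g) \<boxplus> arr_map P (f \<boxtimes> g)))
      (Ftor (\<lambda>(x, y). obj_map P (obj_map P x \<otimes> y) \<oplus> obj_map P (x \<otimes> obj_map P y))
        (\<lambda>(f, g). arr_map P (arr_map P f \<boxtimes> g) \<boxplus> arr_map P (f \<boxtimes> arr_map P g)))"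
proof -
  let ?p = "fcomp P" and ?q = "fcomp Q" and ?X = "Ftor fst fst" and ?Y = "Ftor snd snd"
  have X: "is_functor C2 C ?X" and Y: "is_functor C2 C ?Y" by (rule functorI; auto)+
  note fs = fcomp_functor[OF P] fcomp_functor[OF Q] ftimes_functor fsum_functor X Y
  have PQ: "is_functor C C (fsum P Q)"
    by (rule functorI) (use functorD[OF P] functorD[OF Q] in \<open>auto simp: fsum_def interchange\<close>)
  have I: "is_functor C C id_ftor" by (rule functorI) auto
  have sp: "F \<simeq> fsum (?p F) (?q F)" if F: "is_functor C2 C F" for F
  proof -
    have "fcomp (fsum P Q) F \<simeq> fcomp id_ftor F" by (rule same_whisker[OF split PQ I F])
    moreover have "fcomp (fsum P Q) F = fsum (?p F) (?q F)" "fcomp id_ftor F = F"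
      by (simp_all add: fcomp_def fsum_def)
    ultimately show ?thesis using same_sym by simp
  qed
  have L: "?p (ftimes F G) \<simeq> fsum (?p (ftimes F (?p G))) (?p (ftimes F (?q G)))" if F: "is_functor C2 C F" and G: "is_functor C2 C G" for F G
  proof -
    have "ftimes F G \<simeq> ftimes F (fsum (?p G) (?q G))" by (rule same_ftimes[OF same_refl[OF F] sp[OF G]])
    also have "\<dots> \<simeq> fsum (ftimes F (?p G)) (ftimes F (?q G))" by (intro same_coherence fs F G)
    finally have "?p (ftimes F G) \<simeq> ?p (fsum (ftimes F (?p G)) (ftimes F (?q G)))" by (rule same_fcomp[OF P])
    also have "\<dots> \<simeq> fsum (?p (ftimes F (?p G))) (?p (ftimes F (?q G)))" by (intro same_additive[OF P add] fs F G)
    finally show ?thesis .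
  qed
  have R: "?p (ftimes F G) \<simeq> fsum (?p (ftimes (?p F) G)) (?p (ftimes (?q F) G))" if F: "is_functor C2 C F" and G: "is_functor C2 C G" for F G
  proof -
    have "ftimes F G \<simeq> ftimes (fsum (?p F) (?q F)) G" by (rule same_ftimes[OF sp[OF F] same_refl[OF G]])
    also have "\<dots> \<simeq> fsum (ftimes (?p F) G) (ftimes (?q F) G)" by (intro same_coherence fs F G)
    finally have "?p (ftimes F G) \<simeq> ?p (fsum (ftimes (?p F) G) (ftimes (?q F) G))" by (rule same_fcomp[OF P])
    also have "\<dots> \<simeq> fsum (?p (ftimes (?p F) G)) (?p (ftimes (?q F) G))" by (intro same_additive[OF P add] fs F G)
    finally show ?thesis .
  qed
  let ?A = "?p (ftimes (?p ?X) (?p ?Y))" and ?B = "?p (ftimes ?X (?p ?Y))" and ?M = "?p (ftimes (?p ?X) (?q ?Y))"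
  have fA: "is_functor C2 C ?A" "is_functor C2 C ?B" "is_functor C2 C ?M" by (intro fs)+
  have Z: "is_functor C2 C (Ftor (\<lambda>x. \<zero>) (\<lambda>f. Id C \<zero>))" by (rule functorI) auto
  have pp: "ftimes (?p ?X) (?p ?Y) \<simeq> ?A"
    unfolding same_def by (intro conjI fs) (use PP in \<open>simp add: ftor_defs case_prod_beta'\<close>)
  have qq: "?p (ftimes (?q ?X) (?q ?Y)) \<simeq> Ftor (\<lambda>x. \<zero>) (\<lambda>f. Id C \<zero>)"
    unfolding same_def by (intro conjI fs Z) (use QQ in \<open>simp add: ftor_defs case_prod_beta'\<close>)
  have M: "?p (ftimes ?X (?q ?Y)) \<simeq> ?M"
  proof -
    have "?p (ftimes ?X (?q ?Y)) \<simeq> fsum ?M (?p (ftimes (?q ?X) (?q ?Y)))" by (intro R fs)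
    also have "\<dots> \<simeq> fsum ?M (Ftor (\<lambda>x. \<zero>) (\<lambda>f. Id C \<zero>))" by (rule same_fsum[OF same_refl[OF fA(3)] qq])
    also have "\<dots> \<simeq> ?M" by (rule same_coherence(5)[OF fA(3) fA(3) fA(3)])
    finally show ?thesis .
  qed
  have B: "?p (ftimes ?X ?Y) \<simeq> fsum ?M ?B"
  proof -
    have "?p (ftimes ?X ?Y) \<simeq> fsum ?B (?p (ftimes ?X (?q ?Y)))" by (intro L fs)
    also have "\<dots> \<simeq> fsum ?B ?M" by (rule same_fsum[OF same_refl[OF fA(2)] M])
    also have "\<dots> \<simeq> fsum ?M ?B" by (rule same_coherence(4)[OF fA(2,3,3)])
    finally show ?thesis .
  qed
  have "fsum (ftimes (?p ?X) (?p ?Y)) (?p (ftimes ?X ?Y)) \<simeq> fsum ?A (fsum ?M ?B)" by (rule same_fsum[OF pp B])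
  also have "\<dots> \<simeq> fsum (fsum ?A ?M) ?B" by (rule same_sym[OF same_coherence(3)[OF fA(1,3,2)]])
  \<comment> \<open>\<open>?A\<close> and \<open>?M\<close> recombine to
    \<open>P (P x \<otimes> y)\<close>, since \<open>y\<close> splits into \<open>P y\<close> and
    \<open>Q y\<close>.\<close>
  also have "\<dots> \<simeq> fsum (?p (ftimes (?p ?X) ?Y)) ?B" by (intro same_fsum same_refl fA same_sym[OF L] fs)
  finally show ?thesis by (simp add: same_def ftor_defs case_prod_beta')
qed

end

section \<open>Truncation, negation and valuation\<close>

context rigid_laplaza
begin

definition nonnegative_part :: "(int \<Rightarrow> 'o, int \<Rightarrow> 'm, int \<Rightarrow> 'o, int \<Rightarrow> 'm) ftor" where
  "nonnegative_part = Ftor (\<lambda>x n. if n \<ge> 0 then x n else \<zero>) (\<lambda>\<phi> n. if n \<ge> 0 then \<phi> n else Id C \<zero>)"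

lemma part_simps [simp]:
  "obj_map (negative_part C) x = (\<lambda>n. if n \<ge> 0 then \<zero> else x n)"
  "arr_map (negative_part C) \<phi> = (\<lambda>n. if n \<ge> 0 then Id C \<zero> else \<phi> n)"
  "obj_map nonnegative_part x = (\<lambda>n. if n \<ge> 0 then x n else \<zero>)"
  "arr_map nonnegative_part \<phi> = (\<lambda>n. if n \<ge> 0 then \<phi> n else Id C \<zero>)"
  by (simp_all add: negative_part_def nonnegative_part_def)

lemma part_laurent:
  assumes "x \<in> laurent_objs C"
  shows "(\<lambda>n. if n \<ge> 0 then \<zero> else x n) \<in> laurent_objs C" "(\<lambda>n. if n \<ge> 0 then x n else \<zero>) \<in> laurent_objs C"
proof -
  obtain k where k: "\<forall>n<k. null (x n)" using laurent_objsD(2)[OF assms] by blast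
  show "(\<lambda>n. if n \<ge> 0 then \<zero> else x n) \<in> laurent_objs C"
    by (rule laurent_objsI[of _ k]) (use k laurent_objsD(1)[OF assms] in auto)
  show "(\<lambda>n. if n \<ge> 0 then x n else \<zero>) \<in> laurent_objs C"
    by (rule laurent_objsI[of _ 0]) (use laurent_objsD(1)[OF assms] in auto)
qed

lemma larr_part:
  assumes "larr \<phi> x y"
  shows "larr (\<lambda>n. if n \<ge> 0 then Id C \<zero> else \<phi> n) (\<lambda>n. if n \<ge> 0 then \<zero> else x n) (\<lambda>n. if n \<ge> 0 then \<zero> else y n)"
    "larr (\<lambda>n. if n \<ge> 0 then \<phi> n else Id C \<zero>) (\<lambda>n. if n \<ge> 0 then x n else \<zero>) (\<lambda>n. if n \<ge> 0 then y n else \<zero>)"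
  using assms part_laurent by (auto simp: larr_def)

lemma part_functor: "is_functor L L (negative_part C)" "is_functor L L nonnegative_part"
proof -
  show "is_functor L L (negative_part C)"
    unfolding negative_part_def
  proof (rule is_functor_L)
    fix \<phi> assume "\<phi> \<in> Arr L"
    then have "larr \<phi> (\<lambda>n. Dom C (\<phi> n)) (\<lambda>n. Cod C (\<phi> n))" by (simp add: laurent_arrs_iff)
    from larr_part(1)[OF this]
    show "larr (\<lambda>n. if 0 \<le> n then Id C \<zero> else \<phi> n) (\<lambda>n. if 0 \<le> n then \<zero> else Dom L \<phi> n) (\<lambda>n. if 0 \<le> n then \<zero> else Cod L \<phi> n)" unfolding L_simps .
  qed (use part_laurent in auto)
  show "is_functor L L nonnegative_part"
    unfolding nonnegative_part_def
  proof (rule is_functor_L)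
    fix \<phi> assume "\<phi> \<in> Arr L"
    then have "larr \<phi> (\<lambda>n. Dom C (\<phi> n)) (\<lambda>n. Cod C (\<phi> n))" by (simp add: laurent_arrs_iff)
    from larr_part(2)[OF this]
    show "larr (\<lambda>n. if 0 \<le> n then \<phi> n else Id C \<zero>) (\<lambda>n. if 0 \<le> n then Dom L \<phi> n else \<zero>) (\<lambda>n. if 0 \<le> n then Cod L \<phi> n else \<zero>)" unfolding L_simps .
  qed (use part_laurent in auto)
qed

lemma negative_part_plus: "naturally_isomorphic (pow2 L) L
    (Ftor (\<lambda>(x, y). obj_map (negative_part C) (x \<oplus>\<^bsub>L\<^esub> y)) (\<lambda>(f, g). arr_map (negative_part C) (f \<boxplus>\<^bsub>L\<^esub> g)))
    (Ftor (\<lambda>(x, y). obj_map (negative_part C) x \<oplus>\<^bsub>L\<^esub> obj_map (negative_part C) y)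
      (\<lambda>(f, g). arr_map (negative_part C) f \<boxplus>\<^bsub>L\<^esub> arr_map (negative_part C) g))"
  unfolding naturally_isomorphic_def
\<comment> \<open>In nonnegative degrees the left side is zero and the right side is
  \<open>\<zero> \<oplus> \<zero>\<close>, so the inverse of the unitor is needed there.\<close>
proof (rule exI[where x="\<lambda>(x, y) n. if n \<ge> 0 then arr_inv (l \<zero>) else Id C (x n \<oplus> y n)"], rule natural2_L, goal_cases)
  case o: (1 x y)
  show ?case
    using part_laurent(1)[OF laurent_plus[OF o]] laurent_plus[OF part_laurent(1)[OF o(1)] part_laurent(1)[OF o(2)]] laurent_objsD(1)[OF o(1)] laurent_objsD(1)[OF o(2)]
    by (auto simp: larr_def)
qed (auto simp: larr_def laurent_objsD)

text \<open>In each degree one of the two parts is zero and the corresponding unitor removes it: the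
  left one in nonnegative degrees, the right one in negative degrees.\<close>

lemma part_split: "natural_iso L L (laplaza.fsum L (negative_part C) nonnegative_part) id_ftor
    (\<lambda>x n. if n \<ge> 0 then l (x n) else r (x n))"
  unfolding laplaza.fsum_def[OF laplaza_L]
proof (rule natural1_L, goal_cases)
  case o: (1 x)
  show ?case
    using laurent_plus[OF part_laurent[OF o]] o laurent_objsD(1)[OF o] by (auto simp: larr_def)
qed (auto simp: larr_def laurent_objsD l_nat r_nat)

text \<open>Two negative degrees have a negative sum and two nonnegative degrees a nonnegative one,
  so the index sets are empty. The coefficients are then literally zero, and the two isomorphisms
  below can be taken to be identities.\<close>

lemma cauchy_prod_negative:
  "n \<ge> 0 ==> cauchy_prod C (\<lambda>n. if n \<ge> 0 then \<zero> else x n) (\<lambda>n. if n \<ge> 0 then \<zero> else y n) n = \<zero>"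
  "n < 0 ==> cauchy_prod C (\<lambda>n. if n \<ge> 0 then x n else \<zero>) (\<lambda>n. if n \<ge> 0 then y n else \<zero>) n = \<zero>"
proof -
  assume "n \<ge> 0"
  then have "cset (\<lambda>n. if n \<ge> 0 then \<zero> else x n) (\<lambda>n. if n \<ge> 0 then \<zero> else y n) n = {}" by (auto simp: cset_def)
  then show "cauchy_prod C (\<lambda>n. if n \<ge> 0 then \<zero> else x n) (\<lambda>n. if n \<ge> 0 then \<zero> else y n) n = \<zero>" by (simp add: cauchy_prod_eq)
next
  assume "n < 0"
  then have "cset (\<lambda>n. if n \<ge> 0 then x n else \<zero>) (\<lambda>n. if n \<ge> 0 then y n else \<zero>) n = {}" by (auto simp: cset_def)
  then show "cauchy_prod C (\<lambda>n. if n \<ge> 0 then x n else \<zero>) (\<lambda>n. if n \<ge> 0 then y n else \<zero>) n = \<zero>" by (simp add: cauchy_prod_eq)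
qed

lemma negative_part_times: "naturally_isomorphic (pow2 L) L
    (Ftor (\<lambda>(x, y). obj_map (negative_part C) x \<otimes>\<^bsub>L\<^esub> obj_map (negative_part C) y)
      (\<lambda>(f, g). arr_map (negative_part C) f \<boxtimes>\<^bsub>L\<^esub> arr_map (negative_part C) g))
    (Ftor (\<lambda>(x, y). obj_map (negative_part C) (obj_map (negative_part C) x \<otimes>\<^bsub>L\<^esub> obj_map (negative_part C) y))
      (\<lambda>(f, g). arr_map (negative_part C) (arr_map (negative_part C) f \<boxtimes>\<^bsub>L\<^esub> arr_map (negative_part C) g)))"
  unfolding naturally_isomorphic_def
proof (rule exI[where x="\<lambda>(x, y) n. Id C ((obj_map (negative_part C) x \<otimes>\<^bsub>L\<^esub> obj_map (negative_part C) y) n)"], rule natural2_L, goal_cases)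
  have e: "(\<lambda>n. if n \<ge> 0 then \<zero> else cauchy_prod C (\<lambda>n. if n \<ge> 0 then \<zero> else x n) (\<lambda>n. if n \<ge> 0 then \<zero> else y n) n) =
    cauchy_prod C (\<lambda>n. if n \<ge> 0 then \<zero> else x n) (\<lambda>n. if n \<ge> 0 then \<zero> else y n)" for x y
    using cauchy_prod_negative(1)[of _ x y] by (auto simp: fun_eq_iff)
  case o: (1 x y)
  note q = cauchy_prod_laurent[OF part_laurent(1)[OF o(1)] part_laurent(1)[OF o(2)]]
  show ?case
    using larr_id[OF q] laurent_objsD(1)[OF q] by (simp add: e)
next
  case o: (2 \<phi> \<psi> x x' y y')
  note \<phi> = o(1) and \<psi> = o(2)
  let ?p = "\<lambda>x n. if n \<ge> 0 then \<zero> else x n" and ?a = "\<lambda>\<phi> n. if n \<ge> 0 then Id C \<zero> else \<phi> n"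
  note T = larr_times[OF larr_part(1)[OF \<phi>] larr_part(1)[OF \<psi>]]
  have "ctimes (?a \<phi>, ?a \<psi>) n = Id C \<zero>" if "n \<ge> 0" for n
    by (rule null_arrow_unique[of \<zero> \<zero>]) (use larrD(3-5)[OF T, of n] cauchy_prod_negative(1)[OF that] in auto)
  then have e: "?a (ctimes (?a \<phi>, ?a \<psi>)) = ctimes (?a \<phi>, ?a \<psi>)" by (auto simp: fun_eq_iff)
  show ?case
    unfolding prod.case part_simps L_simps e using larrD(3-5)[OF T] by simp
qed

lemma nonnegative_part_times: "naturally_isomorphic (pow2 L) L
    (Ftor (\<lambda>(x, y). obj_map (negative_part C) (obj_map nonnegative_part x \<otimes>\<^bsub>L\<^esub> obj_map nonnegative_part y))
      (\<lambda>(f, g). arr_map (negative_part C) (arr_map nonnegative_part f \<boxtimes>\<^bsub>L\<^esub> arr_map nonnegative_part g)))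
    (Ftor (\<lambda>x. \<zero>\<^bsub>L\<^esub>) (\<lambda>f. Id L \<zero>\<^bsub>L\<^esub>))"
proof -
  have e: "(\<lambda>n. if n \<ge> 0 then \<zero> else cauchy_prod C (\<lambda>n. if n \<ge> 0 then x n else \<zero>) (\<lambda>n. if n \<ge> 0 then y n else \<zero>) n) = zeroL" for x y
    using cauchy_prod_negative(2)[of _ x y] by (auto simp: fun_eq_iff)
  have a: "(\<lambda>n. if n \<ge> 0 then Id C \<zero> else ctimes (\<lambda>n. if n \<ge> 0 then \<phi> n else Id C \<zero>, \<lambda>n. if n \<ge> 0 then \<psi> n else Id C \<zero>) n) = (\<lambda>n. Id C \<zero>)"
    if "larr \<phi> x x'" "larr \<psi> y y'" for \<phi> \<psi> x x' y y'
    using larr_part(1)[OF larr_times[OF larr_part(2)[OF that(1)] larr_part(2)[OF that(2)]]] null_larr[OF _ larr_null] by (simp add: e)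
  show ?thesis
    unfolding naturally_isomorphic_def
    by (rule exI[where x="\<lambda>(x, y) n. Id C \<zero>"], rule natural2_L) (use larr_null a in \<open>simp_all add: e\<close>)
qed

lemma isomorphic_ftor: "is_functor C C F ==> isomorphic C x y ==> isomorphic C (obj_map F x) (obj_map F y)"
  using functor_invertible[of F] functorD(2-4)[of C F] isomorphicI[of "arr_map F _"] by (auto elim!: isomorphicE) metis

text \<open>All structure is taken degree by degree. Since \<open>N\<close> of zero is null,
  \<open>N\<close> preserves null objects, and the families remain null in all sufficiently low
  degrees.\<close>

lemma negative_functor_L:
  assumes N: "negative_functor C N"
  shows "negative_functor L (laurent_neg N)"
proof -
  have F: "is_functor C C N" and N0: "null (obj_map N \<zero>)" using N by (auto simp: negative_functor_def)
  note D = functorD[OF F]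
  obtain t where t: "natural_iso (pow2 C) C (Ftor (\<lambda>(x, y). obj_map N (x \<oplus> y)) (\<lambda>(f, g). arr_map N (f \<boxplus> g)))
      (Ftor (\<lambda>(x, y). obj_map N x \<oplus> obj_map N y) (\<lambda>(f, g). arr_map N f \<boxplus> arr_map N g)) t"
    using N by (auto simp: negative_functor_def naturally_isomorphic_def)
  obtain q where q: "natural_iso C C (Ftor (\<lambda>x. obj_map N (obj_map N x)) (\<lambda>f. arr_map N (arr_map N f))) id_ftor q"
    using N by (auto simp: negative_functor_def naturally_isomorphic_def)
  have Nl: "(\<lambda>n. obj_map N (x n)) \<in> laurent_objs C" if x: "x \<in> laurent_objs C" for x
  proof -
    obtain k where k: "\<forall>n<k. null (x n)" using laurent_objsD(2)[OF x] by blast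
    show ?thesis
      by (rule laurent_objsI[of _ k]) (use k laurent_objsD(1)[OF x] D isomorphic_trans[OF isomorphic_ftor[OF F] N0] in auto)
  qed
  have Na: "larr (\<lambda>n. arr_map N (\<phi> n)) (\<lambda>n. obj_map N (x n)) (\<lambda>n. obj_map N (y n))" if "larr \<phi> x y" for \<phi> x y
    using that D Nl by (auto simp: larr_def)
  have fN: "is_functor L L (laurent_neg N)"
    unfolding laurent_neg_def
    by (rule is_functor_L) (auto simp: Nl laurent_objsD D laurent_arrs_iff intro!: Na, auto simp: larr_def fun_eq_iff D)
  have "isomorphic L (\<lambda>n. obj_map N \<zero>) zeroL"
  proof -
    have z: "larr (\<lambda>n. to0 (obj_map N \<zero>)) (\<lambda>n. obj_map N \<zero>) zeroL"
      using to0_Arr[OF N0] Nl[OF zeroL_laurent] zeroL_laurent by (auto simp: larr_def)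
    then show ?thesis using invertible_L[OF z] to0_Arr[OF N0] by (auto simp: isomorphic_def hom_L)
  qed
  moreover have "natural_iso (pow2 L) L
      (Ftor (\<lambda>(x, y). obj_map (laurent_neg N) (x \<oplus>\<^bsub>L\<^esub> y)) (\<lambda>(f, g). arr_map (laurent_neg N) (f \<boxplus>\<^bsub>L\<^esub> g)))
      (Ftor (\<lambda>(x, y). obj_map (laurent_neg N) x \<oplus>\<^bsub>L\<^esub> obj_map (laurent_neg N) y)
        (\<lambda>(f, g). arr_map (laurent_neg N) f \<boxplus>\<^bsub>L\<^esub> arr_map (laurent_neg N) g))
      (\<lambda>(x, y) n. t (x n, y n))"
  proof (rule natural2_L, goal_cases)
    case o: (1 x y)
    have "t (x n, y n) \<in> hom C (obj_map N (x n \<oplus> y n)) (obj_map N (x n) \<oplus> obj_map N (y n)) \<and> invertible C (t (x n, y n))" for n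
      using natural_isoD(1,2)[OF t, of "(x n, y n)"] laurent_objsD(1)[OF o(1)] laurent_objsD(1)[OF o(2)] by simp
    then show ?case
      using Nl[OF laurent_plus[OF o]] laurent_plus[OF Nl[OF o(1)] Nl[OF o(2)]] by (auto simp: larr_def laurent_neg_def hom_iff)
  next
    case o: (2 \<phi> \<psi> x x' y y')
    note A = larrD(3-5)[OF o(1)] larrD(3-5)[OF o(2)]
    show ?case
      using natural_isoD(3)[OF t, of "(\<phi> _, \<psi> _)"] A by (simp add: laurent_neg_def fun_eq_iff)
  qed
  moreover have "natural_iso L L
      (Ftor (\<lambda>x. obj_map (laurent_neg N) (obj_map (laurent_neg N) x)) (\<lambda>f. arr_map (laurent_neg N) (arr_map (laurent_neg N) f))) id_ftor
      (\<lambda>x n. q (x n))"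
  proof (rule natural1_L, goal_cases)
    case o: (1 x)
    show ?case
      using Nl[OF Nl[OF o]] o natural_isoD(1,2)[OF q laurent_objsD(1)[OF o]] by (auto simp: larr_def laurent_neg_def hom_iff)
  next
    case \<phi>: (2 \<phi> x y)
    note A = larrD(3-5)[OF \<phi>]
    show ?case
      using natural_isoD(3)[OF q A(1)] A by (simp add: laurent_neg_def fun_eq_iff)
  qed
  ultimately show ?thesis
    unfolding negative_functor_def naturally_isomorphic_def using fN by (auto simp: laurent_neg_def)
qed

lemma rota_baxter_L: "rota_baxter_category L None (negative_part C)"
  unfolding rota_baxter_category_def additive_def
  using distributive_L part_functor(1) negative_part_plus
    laplaza.rota_baxter_splitting[OF laplaza_L part_functor negative_part_plus part_split negative_part_times nonnegative_part_times]
  by simp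

lemma rota_baxter_negative_L:
  assumes N: "negative_functor C N"
  shows "rota_baxter_category L (Some (laurent_neg N)) (negative_part C)"
proof -
  have F: "is_functor C C N" and N0: "null (obj_map N \<zero>)" using N by (auto simp: negative_functor_def)
  note D = functorD[OF F] and z = to0_Arr[OF N0]
  have fN: "is_functor L L (laurent_neg N)" using negative_functor_L[OF N] by (simp add: negative_functor_def)
  \<comment> \<open>Truncating after negating gives zero in nonnegative degrees, negating after
    truncating gives \<open>N\<close> of zero; the isomorphism joins them by the inverse of
    \<open>to0\<close>. In negative degrees both agree.\<close>
  have "natural_iso L L
      (Ftor (\<lambda>x. obj_map (negative_part C) (obj_map (laurent_neg N) x)) (\<lambda>f. arr_map (negative_part C) (arr_map (laurent_neg N) f)))
      (Ftor (\<lambda>x. obj_map (laurent_neg N) (obj_map (negative_part C) x)) (\<lambda>f. arr_map (laurent_neg N) (arr_map (negative_part C) f)))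
      (\<lambda>x n. if n \<ge> 0 then arr_inv (to0 (obj_map N \<zero>)) else Id C (obj_map N (x n)))"
  proof (rule natural1_L, goal_cases)
    case o: (1 x)
    have "(\<lambda>n. obj_map N (if n \<ge> 0 then \<zero> else x n)) \<in> laurent_objs C" "(\<lambda>n. obj_map N (x n)) \<in> laurent_objs C"
      using is_functorD(1)[OF fN, of "\<lambda>n. if n \<ge> 0 then \<zero> else x n"] is_functorD(1)[OF fN, of x] part_laurent(1)[OF o] o
      by (simp_all add: laurent_neg_def)
    then show ?case
      using part_laurent(1) D z laurent_objsD(1)[OF o] by (auto simp: larr_def laurent_neg_def)
  next
    case \<phi>: (2 \<phi> x y)
    note A = larrD(3-7)[OF \<phi>]
    show ?case
      using D z A by (auto simp: laurent_neg_def fun_eq_iff)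
  qed
  then show ?thesis
    using rota_baxter_L negative_functor_L[OF N] unfolding rota_baxter_category_def additive_def naturally_isomorphic_def by auto
qed

text \<open>\<open>Abs_fls\<close> returns the given coefficients only if they vanish in all low
  degrees. They do, because the valuation is invariant under isomorphism and sends zero to
  0.\<close>

lemma laurent_val_nth:
  assumes "categorification C N v" "x \<in> laurent_objs C"
  shows "fls_nth (laurent_val v x) n = v (x n)"
proof -
  obtain k where "\<forall>n<k. null (x n)" using laurent_objsD(2)[OF assms(2)] by blast
  then have "\<exists>k. \<forall>n<k. v (x n) = 0"
    using assms(1) laurent_objsD(1)[OF assms(2)] unfolding categorification_def by (metis I_in)
  then show ?thesis unfolding laurent_val_def by (rule nth_Abs_fls_ex_lower_bound)
qed

text \<open>The sort adds the unit laws to \<open>ring\<close> without requiring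
  \<open>0 \<noteq> 1\<close>, so the zero ring is covered. Sums and negatives hold coefficientwise;
  only the product needs an argument.\<close>

lemma categorification_L:
  fixes v :: "'o \<Rightarrow> 'r::{ring, monoid_mult}"
  assumes c: "categorification C N v"
  shows "categorification L (laurent_neg N) (laurent_val v)"
proof -
  have N: "negative_functor C N" and F: "is_functor C C N" using c by (auto simp: categorification_def negative_functor_def)
  have v: "\<And>x y. isomorphic C x y ==> x \<in> Obj C ==> y \<in> Obj C ==> v x = v y" "\<And>x y. x \<in> Obj C ==> y \<in> Obj C ==> v (x \<oplus> y) = v x + v y"
    "\<And>x y. x \<in> Obj C ==> y \<in> Obj C ==> v (x \<otimes> y) = v x * v y" "v \<one> = 1" "v \<zero> = 0" "\<And>x. x \<in> Obj C ==> v (obj_map N x) = - v x"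
    using c by (auto simp: categorification_def)
  note nth = laurent_val_nth[OF c]
  have v0: "v x = 0" if "null x" for x using v(1)[OF that] v(5) null_Obj[OF that] by simp
  have vs: "v (sumo u S) = (\<Sum>k\<in>S. v (u k))" if "\<And>k. u k \<in> Obj C" "finite S" for u :: "int \<Rightarrow> 'o" and S
  proof -
    have "v (suml u ks) = sum_list (map (\<lambda>k. v (u k)) ks)" for ks by (induction ks) (use that v in auto)
    then show ?thesis using that by (simp add: sumo_def sum_list_distinct_conv_sum_set)
  qed
  have iso: "laurent_val v x = laurent_val v y" if i: "isomorphic L x y" and o: "x \<in> laurent_objs C" "y \<in> laurent_objs C" for x y
  proof -
    obtain \<phi> where \<phi>: "larr \<phi> x y" "invertible L \<phi>" using i by (auto simp: isomorphic_def hom_L)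
    obtain \<psi> where \<psi>: "larr \<psi> y x" "(\<lambda>n. \<psi> n \<cdot> \<phi> n) = (\<lambda>n. Id C (x n))" "(\<lambda>n. \<phi> n \<cdot> \<psi> n) = (\<lambda>n. Id C (y n))"
      using \<phi> larr_laurent[OF \<phi>(1)] larrD(4,5)[OF \<phi>(1)] by (auto simp: invertible_def hom_L)
    have "invertible C (\<phi> n)" for n
      by (rule invertibleI[of _ "\<psi> n"]) (use larrD(3-5)[OF \<phi>(1)] larrD(3-5)[OF \<psi>(1)] fun_cong[OF \<psi>(2)] fun_cong[OF \<psi>(3)] in auto)
    then have "isomorphic C (x n) (y n)" for n using isomorphicI[of "\<phi> n"] larrD(3-5)[OF \<phi>(1), of n] by simp
    then have "v (x n) = v (y n)" for n using v(1) o laurent_objsD(1) by blast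
    then show ?thesis by (simp add: laurent_val_def)
  qed
  have times: "laurent_val v (cauchy_prod C x y) = laurent_val v x * laurent_val v y" if o: "x \<in> laurent_objs C" "y \<in> laurent_objs C" for x y
  proof (rule fls_eqI)
    fix n
    note O = laurent_objsD(1)[OF o(1)] laurent_objsD(1)[OF o(2)]
    let ?f = "laurent_val v x" and ?g = "laurent_val v y"
    have "fls_nth (laurent_val v (cauchy_prod C x y)) n = (\<Sum>k\<in>cset x y n. v (x k \<otimes> y (n - k)))"
      using nth[OF cauchy_prod_laurent[OF o]] vs[of "cterm x y n" "cset x y n"] finite_cset[OF o] O by (simp add: cauchy_prod_eq) (simp add: cterm_def)
    also have "\<dots> = (\<Sum>i=fls_subdegree ?f..n - fls_subdegree ?g. fls_nth ?f i * fls_nth ?g (n - i))"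
    \<comment> \<open>One sum runs over the nonnull pairs, the other over the range given by the
      subdegrees. Neither set contains the other: a nonnull object may have value 0, and a
      coefficient inside the range may be null. On both differences the terms vanish.\<close>
    proof (rule sum.mono_neutral_cong)
      fix i assume i: "i \<in> cset x y n - {fls_subdegree ?f..n - fls_subdegree ?g}"
      then have "fls_nth ?f i = 0 \<or> fls_nth ?g (n - i) = 0" by (auto simp: not_le intro: fls_eq0_below_subdegree)
      then show "v (x i \<otimes> y (n - i)) = 0" using nth[OF o(1)] nth[OF o(2)] v(3) O by auto
    next
      fix i assume "i \<in> {fls_subdegree ?f..n - fls_subdegree ?g} - cset x y n"
      then have "null (x i) \<or> null (y (n - i))" by (auto simp: cset_def)
      then show "fls_nth ?f i * fls_nth ?g (n - i) = 0" using nth[OF o(1)] nth[OF o(2)] v0 by auto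
    qed (use finite_cset[OF o] nth[OF o(1)] nth[OF o(2)] v(3) O in auto)
    also have "\<dots> = fls_nth (?f * ?g) n" by (rule fls_times_nth(2)[symmetric])
    finally show "fls_nth (laurent_val v (cauchy_prod C x y)) n = fls_nth (?f * ?g) n" .
  qed
  have negL: "(\<lambda>n. obj_map N (x n)) \<in> laurent_objs C" if "x \<in> laurent_objs C" for x
    using is_functorD(1)[of L L "laurent_neg N" x] negative_functor_L[OF N] that by (simp add: negative_functor_def laurent_neg_def)
  show ?thesis
    unfolding categorification_def
    using distributive_L negative_functor_L[OF N] iso times nth[OF oneL_laurent] nth[OF zeroL_laurent] nth[OF laurent_plus] nth[OF negL] nth laurent_objsD(1) v
    by (auto simp: fls_eq_iff laurent_neg_def)
qed

end

text \<open>One arrow part, \<open>ctimes\<close>, is chosen before \<open>N\<close> and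
  \<open>v\<close> are given, so all the structures live on the same category.\<close>

theorem theorem2p2:
  fixes C :: "('o, 'm) rig_cat"
  assumes distributive: "distributive_category C"
    and zero_rigid: "hom C \<zero>\<^bsub>C\<^esub> \<zero>\<^bsub>C\<^esub> = {Id C \<zero>\<^bsub>C\<^esub>}"
  shows "\<exists>T. cauchy_arrow_map C T \<and>
    rota_baxter_category (laurent C T) None (negative_part C) \<and>
    (\<forall>N. negative_functor C N \<longrightarrow>
      rota_baxter_category (laurent C T) (Some (laurent_neg N)) (negative_part C)) \<and>
    (\<forall>N (v :: 'o \<Rightarrow> 'r::{ring, monoid_mult}). categorification C N v \<longrightarrow>
      categorification (laurent C T) (laurent_neg N) (laurent_val v))"
proof -
  obtain a l r s m lm rm dl dr nl nr where "laplaza C a l r s m lm rm dl dr nl nr"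
    using distributive unfolding distributive_category_def by blast
  then have R: "rigid_laplaza C a l r s m lm rm dl dr nl nr"
    using zero_rigid by (simp add: rigid_laplaza_def rigid_laplaza_axioms_def)
  show ?thesis
    using rigid_laplaza.ctimes_cauchy[OF R] rigid_laplaza.rota_baxter_L[OF R] rigid_laplaza.rota_baxter_negative_L[OF R]
      rigid_laplaza.categorification_L[OF R] by blast
qed

end
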